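(* Let $m_0$ be a Borel probability measure on $\mathcal G$ with bounded support and let the costs satisfy the standing assumptions listed in the context. Let $C>0$, let $\mu\in\mathcal P_{m_0}(\Gamma_C)$ be a relaxed equilibrium and let $(u,m)$ be the related mild solution. Then: 1. For all $0\le t\le\bar t\le T$ and $x\in\mathcal G$, $$u(x,t)=\inf_{y\in\Gamma_{t,\bar t}[x]}\Big\{u(y(\bar t),\bar t)+\int_t^{\bar t}L[m(\tau)](y(\tau),y'(\tau))\,d\tau\Big\}.$$ 2. $u$ is continuous in $\mathcal G\times[0,T)$; for all $x\in\mathcal G$, $t\mapsto u(x,t)$ is continuous on $[0,T]$, and $u(x,T)=G[m(T)](x)$. 3. $u$ is a viscosity solution in $\mathcal G\times(0,T)$ of $$-\partial_tu(x,t)+H_i(|x|,D_xu,t)=0\ \text{ if }x\in J_i\setminus\{0\},\qquad -\partial_tu(0,t)+H_0(D_xu,t)=0 .$$ If in addition $G_i[m']\in C^1(\mathbb R_+)$ for all $i\in\{1,\dots,N\}$ and $m'\in\mathcal P_1(\mathcal G)$, then: 4.a. $u$ is locally Lipschitz continuous in $\mathcal G\times[0,T)$; 4.b. if moreover $G[m']\in C(\mathcal G)$ for all $m'\in\mathcal P_1(\mathcal G)$, then $u$ is locally Lipschitz continuous in $\mathcal G\times[0,T]$.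
   Context: Junction: $N>1$ is an integer, $(e_i)$ is the canonical basis of $\mathbb R^N$, $\mathbb R_+=[0,\infty)$, $J_i=\mathbb R_+e_i$, $\mathcal G=\bigcup_{i=1}^N J_i\subset\mathbb R^N$, vertex $0$; $d(x,y)=|x-y|$ if $x,y$ lie in the same edge, $d(x,y)=|x|+|y|$ otherwise. Fix $T>0$, $p>1$. Trajectories: $\Gamma_t[x]$ is the set of $y\in C([t,T];\mathcal G)\cap W^{1,p}(t,T;\mathbb R^N)$ with $y(t)=x$; $\Gamma_{t,\bar t}[x]$ is the set of restrictions to $[t,\bar t]$ of elements of $\Gamma_t[x]$; $\Gamma[x]=\Gamma_0[x]$; $\bar y=|y|$. For $C>0$: $\Gamma_C[x]=\{y\in\Gamma[x]:\|y\|_{L^\infty(0,T)}\le C,\ \|y'\|_{L^p(0,T)}\le C\}$, $\Gamma_C=\bigcup_x\Gamma_C[x]$, with the topology of uniform convergence. Measures: $\mathcal P(X)$ is the set of Borel probability measures on $X$; $\mathcal P_1(\mathcal G)$ is the set of those on $\mathcal G$ with finite first moment, with the Kantorovich–Rubinstein distance $d_1$. For $\mu\in\mathcal P(\Gamma_C)$, $m^\mu(t)=e_t\sharp\mu$ with $e_t(y)=y(t)$. $\mathcal P_{m_0}(\Gamma_C)$ is the set of $\mu\in\mathcal P(\Gamma_C)$ with $e_0\sharp\mu=m_0$. Costs: $m\mapsto L_i[m]$ is continuous from $\mathcal P_1(\mathcal G)$ to $C^1(\mathbb R_+\times\mathbb R)$ (functions of $(x,a)$; $C^1$ convergence on compact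 sets), $G_i\in C_b(\mathcal P_1(\mathcal G);C_b(\mathbb R_+))$, $L_*,G_*\in C_b(\mathcal P_1(\mathcal G);\mathbb R)$, where $C_b$ denotes bounded continuous functions. Standing assumptions: (1) there is $C_0>0$ with $L_i[m](x,a)\ge C_0(|a|^p-1)$ and $L_*[m]\ge-C_0$ for all $i,m,x,a$; (2) for any $r>0$ there is a modulus $\omega_r$ with $|L_i[m_1](x,a)-L_i[m_2](x,a)|\le(1+|a|^p)\omega_r(d_1(m_1,m_2))$ for all $i$, $m_1,m_2\in\mathcal P_1(\mathcal G)$, $x\in[0,r]$, $a\in\mathbb R$; (3) for any $r>0$ there is $\tilde c(r)\ge0$ with $|\partial_xL_i[m](x,a)|\le\tilde c(r)(|a|^p+1)$ and $|\partial_aL_i[m](x,a)|\le\tilde c(r)(|a|^{p-1}+1)$ for all $i,m$, $x\in[0,r]$, $a\in\mathbb R$; (4) $a\mapsto L_i[m](x,a)$ is strictly convex for all $i$, $m$, $x\in\mathbb R_+$. $L_0[m]=\min\{L_*[m],\min_iL_i[m](0,0)\}$; $L[m](y(t),y'(t))=\sum_iL_i[m](\bar y(t),\bar y'(t))\mathbf 1_{y(t)\in J_i\setminus\{0\}}+L_0[m]\mathbf 1_{y(t)=0}$; $G[m](x)=\sum_iG_i[m](|x|)\mathbf 1_{x\in J_i\setminus\{0\}}+\min\{G_*[m],\min_iG_i[m](0)\}\mathbf 1_{x=0}$; $J_t^\mu(x;y)=\int_t^TL[m^\mu(\tau)](y(\tau),y'(\tau))\,d\tau+G[m^\mu(T)](y(T))$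 for $y\in\Gamma_t[x]$. Relaxed equilibrium: $\mu\in\mathcal P_{m_0}(\Gamma_C)$ such that every $y\in\operatorname{supp}(\mu)$ belongs, for some $x\in\operatorname{supp}(m_0)$, to $\{y\in\Gamma_C[x]:J_0^\mu(x;y)=\min_{\tilde y\in\Gamma[x]}J_0^\mu(x;\tilde y)\}$. The mild solution related to $\mu$ is $(u,m)$ with $m(t)=m^\mu(t)$, $u(x,t)=\inf_{y\in\Gamma_t[x]}J_t^\mu(x;y)$. Hamiltonians: for $x\in\mathbb R_+$, $q\in\mathbb R$, $P=(p_1,\dots,p_N)\in\mathbb R^N$: $H_i(x,q,t)=\sup_{\zeta\in\mathbb R}\{-q\zeta-L_i[m(t)](x,\zeta)\}$, $H_i^{\downarrow}(x,q,t)=\sup_{\zeta\ge0}\{-q\zeta-L_i[m(t)](x,\zeta)\}$, $H_0(P,t)=\max\big(-L_0[m(t)],\max_iH_i^{\downarrow}(0,p_i,t)\big)$. Viscosity solutions: $C^1(\mathcal G\times(0,T))$ is the set of continuous functions on $\mathcal G\times(0,T)$ whose restriction to each $J_i\times(0,T)$ is $C^1$; for such $\varphi$, $D_x\varphi(x,t)$ is the derivative of $\varphi|_{J_i}$ in the coordinate $|x|$ if $x\in J_i\setminus\{0\}$, and $D_x\varphi(0,t)\in\mathbb R^N$ is the vector of the $N$ one-sided derivatives at $0$ along $J_1,\dots,J_N$. $u\in C(\mathcal G\times(0,T))$ is a viscosity subsolution (resp. supersolution) if for every $\varphi\in C^1(\mathcal G\times(0,T))$ touching $u$ from above (resp. below)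 at $(x,t)$, one has $-\partial_t\varphi(x,t)+H_i(|x|,D_x\varphi(x,t),t)\le0$ (resp. $\ge0$) if $x\in J_i\setminus\{0\}$ and $-\partial_t\varphi(0,t)+H_0(D_x\varphi(0,t),t)\le0$ (resp. $\ge0$) if $x=0$; a viscosity solution is both. *)

theory Defs
  imports "HOL-Probability.Probability"
begin

section \<open>The junction\<close>

definition edge :: "'n::finite \<Rightarrow> (real ^ 'n) set" where
  "edge i = {s *\<^sub>R axis i 1 | s. 0 \<le> s}"

definition junction :: "(real ^ 'n::finite) set" where
  "junction = (\<Union>i. edge i)"

text \<open>Since \<open>norm (x - y) \<le> junction_dist x y \<le> sqrt 2 * norm (x - y)\<close> on the junction, the
  topology of \<open>junction_dist\<close> is the subspace topology of \<open>real ^ 'n\<close>; the latter is used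
  wherever only the topology matters.\<close>

definition junction_dist :: "real ^ 'n::finite \<Rightarrow> real ^ 'n \<Rightarrow> real" where
  "junction_dist x y =
     (if \<exists>i. x \<in> edge i \<and> y \<in> edge i then norm (x - y) else norm x + norm y)"


section \<open>Sobolev trajectories\<close>

definition test_function_on :: "real \<Rightarrow> real \<Rightarrow> (real \<Rightarrow> real) \<Rightarrow> bool" where
  "test_function_on a b \<phi> \<longleftrightarrow>
     \<phi> C1_differentiable_on UNIV \<and>
     compact (closure {s. \<phi> s \<noteq> 0}) \<and> closure {s. \<phi> s \<noteq> 0} \<subseteq> {a<..<b}"

definition locally_integrable_on ::
    "real \<Rightarrow> real \<Rightarrow> (real \<Rightarrow> 'a::{banach, second_countable_topology}) \<Rightarrow> bool" where
  "locally_integrable_on a b f \<longleftrightarrow>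
     (\<forall>c d. a < c \<and> d < b \<longrightarrow> set_integrable lborel {c..d} f)"

definition has_weak_derivative ::
    "real \<Rightarrow> real \<Rightarrow> (real \<Rightarrow> 'a::euclidean_space) \<Rightarrow> (real \<Rightarrow> 'a) \<Rightarrow> bool" where
  "has_weak_derivative a b f v \<longleftrightarrow>
     locally_integrable_on a b f \<and> locally_integrable_on a b v \<and>
     (\<forall>\<phi>. test_function_on a b \<phi> \<longrightarrow>
        (LINT s:{a<..<b}|lborel. deriv \<phi> s *\<^sub>R f s) =
        - (LINT s:{a<..<b}|lborel. \<phi> s *\<^sub>R v s))"

text \<open>A representative; weak derivatives are unique up to a null set of \<open>{a<..<b}\<close>, and
  everything below depends only on the almost-everywhere class.\<close>

definition weak_derivative :: "real \<Rightarrow> real \<Rightarrow> (real \<Rightarrow> 'a::euclidean_space) \<Rightarrow> real \<Rightarrow> 'a" where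
  "weak_derivative a b f = (SOME v. has_weak_derivative a b f v)"

definition Lp_function_on ::
    "real \<Rightarrow> real \<Rightarrow> real \<Rightarrow> (real \<Rightarrow> 'a::euclidean_space) \<Rightarrow> bool" where
  "Lp_function_on p a b f \<longleftrightarrow>
     set_borel_measurable lborel {a<..<b} f \<and>
     set_integrable lborel {a<..<b} (\<lambda>s. norm (f s) powr p)"

definition Lp_norm_on :: "real \<Rightarrow> real \<Rightarrow> real \<Rightarrow> (real \<Rightarrow> 'a::euclidean_space) \<Rightarrow> real" where
  "Lp_norm_on p a b f = (LINT s:{a<..<b}|lborel. norm (f s) powr p) powr (1 / p)"

definition sobolev_1p_on ::
    "real \<Rightarrow> real \<Rightarrow> real \<Rightarrow> (real \<Rightarrow> 'a::euclidean_space) \<Rightarrow> bool" where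
  "sobolev_1p_on p a b f \<longleftrightarrow>
     Lp_function_on p a b f \<and>
     (\<exists>v. Lp_function_on p a b v \<and> has_weak_derivative a b f v)"

text \<open>Trajectories are functions on \<open>{t..T}\<close>, represented as elements of the extensional
  function space, so that they are determined by their values on that interval.\<close>

definition trajectories :: "real \<Rightarrow> real \<Rightarrow> real \<Rightarrow> real ^ 'n::finite \<Rightarrow> (real \<Rightarrow> real ^ 'n) set" where
  "trajectories p T t x =
     {y \<in> {t..T} \<rightarrow>\<^sub>E junction. continuous_on {t..T} y \<and> sobolev_1p_on p t T y \<and> y t = x}"

definition trajectories_until ::
    "real \<Rightarrow> real \<Rightarrow> real \<Rightarrow> real \<Rightarrow> real ^ 'n::finite \<Rightarrow> (real \<Rightarrow> real ^ 'n) set" where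
  "trajectories_until p T t t' x = (\<lambda>y. restrict y {t..t'}) ` trajectories p T t x"

definition bounded_trajectories_from ::
    "real \<Rightarrow> real \<Rightarrow> real \<Rightarrow> real ^ 'n::finite \<Rightarrow> (real \<Rightarrow> real ^ 'n) set" where
  "bounded_trajectories_from p T C x =
     {y \<in> trajectories p T 0 x.
        (AE s\<in>{0<..<T} in lborel. norm (y s) \<le> C) \<and>
        Lp_norm_on p 0 T (weak_derivative 0 T y) \<le> C}"

definition bounded_trajectories :: "real \<Rightarrow> real \<Rightarrow> real \<Rightarrow> (real \<Rightarrow> real ^ 'n::finite) set" where
  "bounded_trajectories p T C = (\<Union>x\<in>junction. bounded_trajectories_from p T C x)"

definition trajectory_topology :: "real \<Rightarrow> real \<Rightarrow> real \<Rightarrow> (real \<Rightarrow> real ^ 'n::finite) topology" where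
  "trajectory_topology p T C =
     subtopology (mtopology_of (funspace {0..T} euclidean_metric)) (bounded_trajectories p T C)"


section \<open>Probability measures\<close>

definition borel_of :: "'a topology \<Rightarrow> 'a measure" where
  "borel_of X = sigma (topspace X) {U. openin X U}"

definition prob_measures :: "'a topology \<Rightarrow> 'a measure set" where
  "prob_measures X = {\<mu>. prob_space \<mu> \<and> sets \<mu> = sets (borel_of X)}"

definition measure_support :: "'a topology \<Rightarrow> 'a measure \<Rightarrow> 'a set" where
  "measure_support X \<mu> = {x \<in> topspace X. \<forall>U. openin X U \<and> x \<in> U \<longrightarrow> emeasure \<mu> U > 0}"

definition prob_measures_1 :: "(real ^ 'n::finite) measure set" where
  "prob_measures_1 =
     {m \<in> prob_measures (top_of_set junction). integrable m (\<lambda>x. junction_dist 0 x)}"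

definition couplings :: "'a measure \<Rightarrow> 'a measure \<Rightarrow> ('a \<times> 'a) measure set" where
  "couplings m m' =
     {\<gamma>. sets \<gamma> = sets (m \<Otimes>\<^sub>M m') \<and> distr \<gamma> m fst = m \<and> distr \<gamma> m' snd = m'}"

text \<open>The Kantorovich--Rubinstein (1-Wasserstein) distance.\<close>

definition KR_dist :: "(real ^ 'n::finite) measure \<Rightarrow> (real ^ 'n) measure \<Rightarrow> real" where
  "KR_dist m m' = (INF \<gamma>\<in>couplings m m'. \<integral>z. junction_dist (fst z) (snd z) \<partial>\<gamma>)"

text \<open>Neighbourhood filter in the metric space \<open>(prob_measures_1, KR_dist)\<close>.\<close>

definition KR_nhds :: "(real ^ 'n::finite) measure \<Rightarrow> (real ^ 'n) measure filter" where
  "KR_nhds m = (INF \<epsilon>\<in>{0<..}. principal {m' \<in> prob_measures_1. KR_dist m m' < \<epsilon>})"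

definition flow ::
    "(real \<Rightarrow> real ^ 'n::finite) measure \<Rightarrow> real \<Rightarrow> (real ^ 'n) measure" where
  "flow \<mu> t = distr \<mu> (borel_of (top_of_set junction)) (\<lambda>y. y t)"

definition prob_measures_starting ::
    "real \<Rightarrow> real \<Rightarrow> real \<Rightarrow> (real ^ 'n::finite) measure \<Rightarrow> (real \<Rightarrow> real ^ 'n) measure set" where
  "prob_measures_starting p T C m0 =
     {\<mu> \<in> prob_measures (trajectory_topology p T C). flow \<mu> 0 = m0}"


section \<open>Regularity notions\<close>

text \<open>Continuous differentiability up to the boundary, for sets such as half-lines, half-planes
  and half-strips. On these sets the derivative relative to the set is unique.\<close>

definition C1_on :: "'a::euclidean_space set \<Rightarrow> ('a \<Rightarrow> real) \<Rightarrow> bool" where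
  "C1_on S f \<longleftrightarrow>
     (\<exists>f'. (\<forall>z\<in>S. (f has_derivative blinfun_apply (f' z)) (at z within S)) \<and> continuous_on S f')"

text \<open>Partial derivatives of a function of \<open>(x, a)\<close> with \<open>0 \<le> x\<close>; the first is one-sided at \<open>0\<close>.\<close>

definition partial_x :: "(real \<Rightarrow> real \<Rightarrow> real) \<Rightarrow> real \<Rightarrow> real \<Rightarrow> real" where
  "partial_x f x a = vector_derivative (\<lambda>s. f s a) (at x within {0..})"

definition partial_a :: "(real \<Rightarrow> real \<Rightarrow> real) \<Rightarrow> real \<Rightarrow> real \<Rightarrow> real" where
  "partial_a f x a = deriv (\<lambda>b. f x b) a"

text \<open>Continuity of \<open>m \<mapsto> F m\<close> from \<open>prob_measures_1\<close> to the space of \<open>C\<^sup>1\<close> functions on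
  \<open>{0..} \<times> UNIV\<close> with local \<open>C\<^sup>1\<close> convergence.\<close>

definition continuous_into_C1 ::
    "((real ^ 'n::finite) measure \<Rightarrow> real \<Rightarrow> real \<Rightarrow> real) \<Rightarrow> bool" where
  "continuous_into_C1 F \<longleftrightarrow>
     (\<forall>m\<in>prob_measures_1.
        C1_on ({0..} \<times> UNIV) (\<lambda>(x, a). F m x a) \<and>
        (\<forall>K. compact K \<and> K \<subseteq> {0..} \<times> UNIV \<longrightarrow>
           uniform_limit K (\<lambda>m' (x, a). F m' x a) (\<lambda>(x, a). F m x a) (KR_nhds m) \<and>
           uniform_limit K (\<lambda>m' (x, a). partial_x (F m') x a)
             (\<lambda>(x, a). partial_x (F m) x a) (KR_nhds m) \<and>
           uniform_limit K (\<lambda>m' (x, a). partial_a (F m') x a)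
             (\<lambda>(x, a). partial_a (F m) x a) (KR_nhds m)))"

text \<open>Membership in \<open>C\<^sub>b (prob_measures_1; C\<^sub>b {0..})\<close> (uniform norm on the target).\<close>

definition Cb_into_Cb :: "((real ^ 'n::finite) measure \<Rightarrow> real \<Rightarrow> real) \<Rightarrow> bool" where
  "Cb_into_Cb F \<longleftrightarrow>
     (\<forall>m\<in>prob_measures_1. continuous_on {0..} (F m) \<and> uniform_limit {0..} F (F m) (KR_nhds m)) \<and>
     (\<exists>K. \<forall>m\<in>prob_measures_1. \<forall>x\<ge>0. \<bar>F m x\<bar> \<le> K)"

text \<open>Membership in \<open>C\<^sub>b (prob_measures_1; real)\<close>.\<close>

definition Cb_real :: "((real ^ 'n::finite) measure \<Rightarrow> real) \<Rightarrow> bool" where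
  "Cb_real f \<longleftrightarrow>
     (\<forall>m\<in>prob_measures_1. (f \<longlongrightarrow> f m) (KR_nhds m)) \<and>
     (\<exists>K. \<forall>m\<in>prob_measures_1. \<bar>f m\<bar> \<le> K)"

definition modulus_of_continuity :: "(real \<Rightarrow> real) \<Rightarrow> bool" where
  "modulus_of_continuity \<omega> \<longleftrightarrow> mono_on {0..} \<omega> \<and> \<omega> 0 = 0 \<and> (\<omega> \<longlongrightarrow> 0) (at_right 0)"

definition strictly_convex :: "(real \<Rightarrow> real) \<Rightarrow> bool" where
  "strictly_convex f \<longleftrightarrow>
     (\<forall>a b \<theta>. a \<noteq> b \<and> 0 < \<theta> \<and> \<theta> < 1 \<longrightarrow>
        f ((1 - \<theta>) * a + \<theta> * b) < (1 - \<theta>) * f a + \<theta> * f b)"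

definition locally_lipschitz_junction ::
    "real set \<Rightarrow> (real ^ 'n::finite \<Rightarrow> real \<Rightarrow> real) \<Rightarrow> bool" where
  "locally_lipschitz_junction I u \<longleftrightarrow>
     (\<forall>x\<in>junction. \<forall>t\<in>I. \<exists>r>0. \<exists>K. \<forall>y\<in>junction. \<forall>z\<in>junction. \<forall>s\<in>I. \<forall>s'\<in>I.
        junction_dist x y < r \<and> junction_dist x z < r \<and> \<bar>s - t\<bar> < r \<and> \<bar>s' - t\<bar> < r \<longrightarrow>
        \<bar>u y s - u z s'\<bar> \<le> K * (junction_dist y z + \<bar>s - s'\<bar>))"


section \<open>Costs, relaxed equilibria and mild solutions\<close>

type_synonym 'n running = "'n \<Rightarrow> (real ^ 'n) measure \<Rightarrow> real \<Rightarrow> real \<Rightarrow> real"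
type_synonym 'n terminal = "'n \<Rightarrow> (real ^ 'n) measure \<Rightarrow> real \<Rightarrow> real"
type_synonym 'n vertex_cost = "(real ^ 'n) measure \<Rightarrow> real"

definition vertex_running :: "'n::finite running \<Rightarrow> 'n vertex_cost \<Rightarrow> 'n vertex_cost" where
  "vertex_running L Ls m = min (Ls m) (Min (range (\<lambda>i. L i m 0 0)))"

text \<open>The last argument \<open>a\<close> stands for the derivative of \<open>norm y\<close> along the trajectory.\<close>

definition running_cost ::
    "'n::finite running \<Rightarrow> 'n vertex_cost \<Rightarrow> (real ^ 'n) measure \<Rightarrow> real ^ 'n \<Rightarrow> real \<Rightarrow> real" where
  "running_cost L Ls m x a =
     (\<Sum>i\<in>UNIV. L i m (norm x) a * indicator (edge i - {0}) x) +
     vertex_running L Ls m * indicator {0} x"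

definition terminal_cost ::
    "'n::finite terminal \<Rightarrow> 'n vertex_cost \<Rightarrow> (real ^ 'n) measure \<Rightarrow> real ^ 'n \<Rightarrow> real" where
  "terminal_cost G Gs m x =
     (\<Sum>i\<in>UNIV. G i m (norm x) * indicator (edge i - {0}) x) +
     min (Gs m) (Min (range (\<lambda>i. G i m 0))) * indicator {0} x"

definition integrated_cost ::
    "'n::finite running \<Rightarrow> 'n vertex_cost \<Rightarrow> (real \<Rightarrow> (real ^ 'n) measure) \<Rightarrow>
     real \<Rightarrow> real \<Rightarrow> (real \<Rightarrow> real ^ 'n) \<Rightarrow> real" where
  "integrated_cost L Ls m t t' y =
     (LINT \<tau>:{t..t'}|lborel.
        running_cost L Ls (m \<tau>) (y \<tau>) (weak_derivative t t' (\<lambda>s. norm (y s)) \<tau>))"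

definition total_cost ::
    "'n::finite running \<Rightarrow> 'n vertex_cost \<Rightarrow> 'n terminal \<Rightarrow> 'n vertex_cost \<Rightarrow> real \<Rightarrow>
     (real \<Rightarrow> (real ^ 'n) measure) \<Rightarrow> real \<Rightarrow> (real \<Rightarrow> real ^ 'n) \<Rightarrow> real" where
  "total_cost L Ls G Gs T m t y =
     integrated_cost L Ls m t T y + terminal_cost G Gs (m T) (y T)"

definition optimal_bounded_trajectories ::
    "'n::finite running \<Rightarrow> 'n vertex_cost \<Rightarrow> 'n terminal \<Rightarrow> 'n vertex_cost \<Rightarrow>
     real \<Rightarrow> real \<Rightarrow> real \<Rightarrow> (real \<Rightarrow> real ^ 'n) measure \<Rightarrow> real ^ 'n \<Rightarrow> (real \<Rightarrow> real ^ 'n) set" where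
  "optimal_bounded_trajectories L Ls G Gs p T C \<mu> x =
     {y \<in> bounded_trajectories_from p T C x.
        is_arg_min (total_cost L Ls G Gs T (flow \<mu>) 0) (\<lambda>z. z \<in> trajectories p T 0 x) y}"

definition relaxed_equilibrium ::
    "'n::finite running \<Rightarrow> 'n vertex_cost \<Rightarrow> 'n terminal \<Rightarrow> 'n vertex_cost \<Rightarrow>
     real \<Rightarrow> real \<Rightarrow> real \<Rightarrow> (real ^ 'n) measure \<Rightarrow> (real \<Rightarrow> real ^ 'n) measure \<Rightarrow> bool" where
  "relaxed_equilibrium L Ls G Gs p T C m0 \<mu> \<longleftrightarrow>
     \<mu> \<in> prob_measures_starting p T C m0 \<and>
     measure_support (trajectory_topology p T C) \<mu> \<subseteq>
       (\<Union>x\<in>measure_support (top_of_set junction) m0.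
          optimal_bounded_trajectories L Ls G Gs p T C \<mu> x)"

text \<open>Under the standing assumptions all the costs below are finite and bounded from below, so that
  the infimum in the reals is the genuine one.\<close>

definition mild_solution ::
    "'n::finite running \<Rightarrow> 'n vertex_cost \<Rightarrow> 'n terminal \<Rightarrow> 'n vertex_cost \<Rightarrow> real \<Rightarrow> real \<Rightarrow>
     (real \<Rightarrow> real ^ 'n) measure \<Rightarrow> (real ^ 'n \<Rightarrow> real \<Rightarrow> real) \<Rightarrow> (real \<Rightarrow> (real ^ 'n) measure) \<Rightarrow>
     bool" where
  "mild_solution L Ls G Gs p T \<mu> u m \<longleftrightarrow>
     (\<forall>t\<in>{0..T}. m t = flow \<mu> t) \<and>
     (\<forall>x\<in>junction. \<forall>t\<in>{0..T}.
        u x t = (INF y\<in>trajectories p T t x. total_cost L Ls G Gs T (flow \<mu>) t y))"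


section \<open>Hamiltonians and viscosity solutions\<close>

definition hamiltonian ::
    "'n::finite running \<Rightarrow> (real \<Rightarrow> (real ^ 'n) measure) \<Rightarrow> 'n \<Rightarrow> real \<Rightarrow> real \<Rightarrow> real \<Rightarrow> real" where
  "hamiltonian L m i x q t = (SUP \<zeta>. - q * \<zeta> - L i (m t) x \<zeta>)"

definition hamiltonian_down ::
    "'n::finite running \<Rightarrow> (real \<Rightarrow> (real ^ 'n) measure) \<Rightarrow> 'n \<Rightarrow> real \<Rightarrow> real \<Rightarrow> real \<Rightarrow> real" where
  "hamiltonian_down L m i x q t = (SUP \<zeta>\<in>{0..}. - q * \<zeta> - L i (m t) x \<zeta>)"

definition vertex_hamiltonian ::
    "'n::finite running \<Rightarrow> 'n vertex_cost \<Rightarrow> (real \<Rightarrow> (real ^ 'n) measure) \<Rightarrow>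
     real ^ 'n \<Rightarrow> real \<Rightarrow> real" where
  "vertex_hamiltonian L Ls m P t =
     max (- vertex_running L Ls (m t)) (Max (range (\<lambda>i. hamiltonian_down L m i 0 (P $ i) t)))"

definition C1_junction :: "real \<Rightarrow> (real ^ 'n::finite \<Rightarrow> real \<Rightarrow> real) \<Rightarrow> bool" where
  "C1_junction T \<phi> \<longleftrightarrow>
     continuous_on (junction \<times> {0<..<T}) (\<lambda>(x, t). \<phi> x t) \<and>
     (\<forall>i. C1_on ({0..} \<times> {0<..<T}) (\<lambda>(s, t). \<phi> (s *\<^sub>R axis i 1) t))"

definition edge_derivative ::
    "(real ^ 'n::finite \<Rightarrow> real \<Rightarrow> real) \<Rightarrow> 'n \<Rightarrow> real \<Rightarrow> real \<Rightarrow> real" where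
  "edge_derivative \<phi> i s t = vector_derivative (\<lambda>r. \<phi> (r *\<^sub>R axis i 1) t) (at s within {0..})"

definition vertex_gradient :: "(real ^ 'n::finite \<Rightarrow> real \<Rightarrow> real) \<Rightarrow> real \<Rightarrow> real ^ 'n" where
  "vertex_gradient \<phi> t = (\<chi> i. edge_derivative \<phi> i 0 t)"

definition touches_from_above ::
    "real \<Rightarrow> (real ^ 'n::finite \<Rightarrow> real \<Rightarrow> real) \<Rightarrow> (real ^ 'n \<Rightarrow> real \<Rightarrow> real) \<Rightarrow>
     real ^ 'n \<Rightarrow> real \<Rightarrow> bool" where
  "touches_from_above T \<phi> u x t \<longleftrightarrow>
     \<phi> x t = u x t \<and>
     (\<forall>\<^sub>F (y, s) in at (x, t) within junction \<times> {0<..<T}. u y s \<le> \<phi> y s)"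

definition touches_from_below ::
    "real \<Rightarrow> (real ^ 'n::finite \<Rightarrow> real \<Rightarrow> real) \<Rightarrow> (real ^ 'n \<Rightarrow> real \<Rightarrow> real) \<Rightarrow>
     real ^ 'n \<Rightarrow> real \<Rightarrow> bool" where
  "touches_from_below T \<phi> u x t \<longleftrightarrow>
     \<phi> x t = u x t \<and>
     (\<forall>\<^sub>F (y, s) in at (x, t) within junction \<times> {0<..<T}. \<phi> y s \<le> u y s)"

definition viscosity_subsolution ::
    "real \<Rightarrow> ('n::finite \<Rightarrow> real \<Rightarrow> real \<Rightarrow> real \<Rightarrow> real) \<Rightarrow> (real ^ 'n \<Rightarrow> real \<Rightarrow> real) \<Rightarrow>
     (real ^ 'n \<Rightarrow> real \<Rightarrow> real) \<Rightarrow> bool" where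
  "viscosity_subsolution T H H0 u \<longleftrightarrow>
     continuous_on (junction \<times> {0<..<T}) (\<lambda>(x, t). u x t) \<and>
     (\<forall>\<phi> x t. C1_junction T \<phi> \<and> x \<in> junction \<and> t \<in> {0<..<T} \<and> touches_from_above T \<phi> u x t \<longrightarrow>
        (\<forall>i. x \<in> edge i - {0} \<longrightarrow>
           - deriv (\<phi> x) t + H i (norm x) (edge_derivative \<phi> i (norm x) t) t \<le> 0) \<and>
        (x = 0 \<longrightarrow> - deriv (\<phi> 0) t + H0 (vertex_gradient \<phi> t) t \<le> 0))"

definition viscosity_supersolution ::
    "real \<Rightarrow> ('n::finite \<Rightarrow> real \<Rightarrow> real \<Rightarrow> real \<Rightarrow> real) \<Rightarrow> (real ^ 'n \<Rightarrow> real \<Rightarrow> real) \<Rightarrow>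
     (real ^ 'n \<Rightarrow> real \<Rightarrow> real) \<Rightarrow> bool" where
  "viscosity_supersolution T H H0 u \<longleftrightarrow>
     continuous_on (junction \<times> {0<..<T}) (\<lambda>(x, t). u x t) \<and>
     (\<forall>\<phi> x t. C1_junction T \<phi> \<and> x \<in> junction \<and> t \<in> {0<..<T} \<and> touches_from_below T \<phi> u x t \<longrightarrow>
        (\<forall>i. x \<in> edge i - {0} \<longrightarrow>
           - deriv (\<phi> x) t + H i (norm x) (edge_derivative \<phi> i (norm x) t) t \<ge> 0) \<and>
        (x = 0 \<longrightarrow> - deriv (\<phi> 0) t + H0 (vertex_gradient \<phi> t) t \<ge> 0))"

definition viscosity_solution ::
    "real \<Rightarrow> ('n::finite \<Rightarrow> real \<Rightarrow> real \<Rightarrow> real \<Rightarrow> real) \<Rightarrow> (real ^ 'n \<Rightarrow> real \<Rightarrow> real) \<Rightarrow>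
     (real ^ 'n \<Rightarrow> real \<Rightarrow> real) \<Rightarrow> bool" where
  "viscosity_solution T H H0 u \<longleftrightarrow>
     viscosity_subsolution T H H0 u \<and> viscosity_supersolution T H H0 u"

end

theory Submission
  imports Defs
begin

text \<open>The flow of measures is uniformly continuous in the Kantorovich--Rubinstein distance, so
  inserting it into the costs leaves a time-dependent optimal control problem with value function
  \<open>u\<close>, for which dynamic programming follows by concatenating paths. Everything else rests on one estimate: a path which is
  \<open>\<epsilon>\<close>-optimal from \<open>(x, t)\<close>, with \<open>x\<close> in a bounded set, satisfies
  \<open>d(x, y(t + h)) \<le> V (h + \<epsilon>)\<close> for a constant \<open>V\<close>. A path violating it gains, by the
  superlinear growth of the running cost, from being replaced near its start by a straight line or by
  a slower approach to the same trajectory, and the gain exceeds the error coming from the dependence of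
  the cost on the position. This replaces existence and Lipschitz regularity of minimisers (no Euler--Lagrange
  equation is needed): following a near-optimal path for a time \<open>h\<close> and inserting or removing a unit
  speed displacement gives the local Lipschitz bound for \<open>u\<close> away from the final time, and up to it
  when the terminal cost is locally Lipschitz. The viscosity inequalities are then the infinitesimal form of
  dynamic programming; at the vertex the net displacement of a path along each edge is nonnegative,
  which is why only outgoing velocities enter the Hamiltonian there.\<close>

section \<open>Absolutely continuous functions\<close>

text \<open>Two places resist a direct argument. At the vertex, a path cannot be translated along an
  edge once it passes through \<open>0\<close>; the displacement estimate is therefore first proved
  for paths that start at the vertex or avoid it before the time considered, and an arbitrary path
  is cut at its first visit. At the final time, the terminal cost may be only lower semicontinuous;
  the displacement estimate takes as input a mean speed bound for the remaining piece up to
  \<open>T\<close>, which comes from the energy bound when \<open>T\<close> is kept at a distance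
  and from a Lipschitz constant of the terminal cost otherwise. Each comparison also carries an
  additive error \<open>e\<close> that does not shrink with the time interval; hence the side
  conditions \<open>e \<le> h\<close> and \<open>e \<le> norm (y t)\<close>, under which it is
  absorbed. Paths are encoded by one scalar radial velocity vanishing at the vertex: every
  coordinate is the primitive of that velocity restricted to where the coordinate is positive.
  Restriction and concatenation then need no Sobolev theory, and weak derivatives matter only when
  trajectories are matched with such paths.\<close>

text \<open>Bounds of this kind add up over adjacent intervals, so Bolzano's bisection principle
  turns the local estimates into
  \<open>\<bar>\<Psi> b - \<Psi> a\<bar> \<le> e * (V b - V a)\<close>, and \<open>e\<close> is
  arbitrary. In the application \<open>V\<close> is the variation of a path, and no
  differentiability of \<open>\<Psi>\<close> is involved.\<close>

lemma eq_if_locally_small_increments: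
  fixes \<Psi> V :: "real \<Rightarrow> real"
  assumes "a \<le> b"
    and loc: "\<And>x e. a \<le> x \<Longrightarrow> x \<le> b \<Longrightarrow> 0 < e \<Longrightarrow>
      \<exists>d>0. \<forall>s s'. a \<le> s \<and> s \<le> x \<and> x \<le> s' \<and> s' \<le> b \<and> s' - s < d \<longrightarrow> \<bar>\<Psi> s' - \<Psi> s\<bar> \<le> e * (V s' - V s)"
  shows "\<Psi> b = \<Psi> a"
proof -
  have *: "\<bar>\<Psi> b - \<Psi> a\<bar> \<le> e * (V b - V a)" if "0 < e" for e
  proof -
    have "a \<le> a \<and> b \<le> b \<longrightarrow> \<bar>\<Psi> b - \<Psi> a\<bar> \<le> e * (V b - V a)"
      using assms(1)
    proof (rule Bolzano[where P = "\<lambda>s s'. a \<le> s \<and> s' \<le> b \<longrightarrow> \<bar>\<Psi> s' - \<Psi> s\<bar> \<le> e * (V s' - V s)"])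
      fix r s q assume "a \<le> r \<and> s \<le> b \<longrightarrow> \<bar>\<Psi> s - \<Psi> r\<bar> \<le> e * (V s - V r)"
        "a \<le> s \<and> q \<le> b \<longrightarrow> \<bar>\<Psi> q - \<Psi> s\<bar> \<le> e * (V q - V s)" "r \<le> s" "s \<le> q"
      then show "a \<le> r \<and> q \<le> b \<longrightarrow> \<bar>\<Psi> q - \<Psi> r\<bar> \<le> e * (V q - V r)"
        by (auto simp: algebra_simps)
    next
      fix x assume "a \<le> x" "x \<le> b"
      from loc[OF this that] show "\<exists>d>0. \<forall>s s'. s \<le> x \<and> x \<le> s' \<and> s' - s < d \<longrightarrow>
          a \<le> s \<and> s' \<le> b \<longrightarrow> \<bar>\<Psi> s' - \<Psi> s\<bar> \<le> e * (V s' - V s)"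
        by blast
    qed
    then show ?thesis by simp
  qed
  have "\<bar>\<Psi> b - \<Psi> a\<bar> \<le> 0"
  proof (rule field_le_epsilon)
    fix e :: real assume "0 < e"
    have "\<bar>\<Psi> b - \<Psi> a\<bar> \<le> e / (\<bar>V b - V a\<bar> + 1) * (V b - V a)"
      by (rule *) (use \<open>0 < e\<close> in simp)
    also have "\<dots> \<le> e / (\<bar>V b - V a\<bar> + 1) * (\<bar>V b - V a\<bar> + 1)"
      using \<open>0 < e\<close> by (intro mult_left_mono) auto
    also have "\<dots> = 0 + e" by simp
    finally show "\<bar>\<Psi> b - \<Psi> a\<bar> \<le> 0 + e" .
  qed
  then show ?thesis by simp
qed

text \<open>Near a point \<open>x\<close> the mean value theorem writes an increment of
  \<open>F (f s)\<close> as \<open>F' \<xi>\<close> times the integral of \<open>v\<close>, and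
  \<open>F' \<xi>\<close> differs from \<open>F' (f \<sigma>)\<close> by at most \<open>e\<close>.
  The discrepancy is at most \<open>e\<close> times the integral of \<open>\<bar>v\<bar>\<close>,
  which is the situation of \<open>eq_if_locally_small_increments\<close>.\<close>

lemma chain_rule_indefinite_integral:
  fixes f v F F' :: "real \<Rightarrow> real"
  assumes "a \<le> b" and v: "v absolutely_integrable_on {a..b}"
    and f: "\<And>s. s \<in> {a..b} \<Longrightarrow> f s = f a + integral {a..s} v"
    and F: "\<And>x. (F has_real_derivative F' x) (at x)" and F': "continuous_on UNIV F'"
  shows "(\<lambda>s. F' (f s) * v s) absolutely_integrable_on {a..b}"
    and "integral {a..b} (\<lambda>s. F' (f s) * v s) = F (f b) - F (f a)"
proof -
  have vi: "v integrable_on {a..b}" and avi: "(\<lambda>s. \<bar>v s\<bar>) integrable_on {a..b}"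
    using v by (auto simp: absolutely_integrable_on_def)
  have fc: "continuous_on {a..b} f"
  proof -
    have "continuous_on {a..b} (\<lambda>s. f a + integral {a..s} v)"
      by (intro continuous_intros indefinite_integral_continuous_1 vi)
    then show ?thesis
      by (rule continuous_on_eq) (simp add: f[symmetric])
  qed
  have F'fc: "continuous_on {a..b} (\<lambda>s. F' (f s))"
    by (rule continuous_on_compose2[OF F' fc]) auto
  show ai: "(\<lambda>s. F' (f s) * v s) absolutely_integrable_on {a..b}"
  proof (rule absolutely_integrable_bounded_measurable_product_real[OF _ _ _ v])
    show "(\<lambda>s. F' (f s)) \<in> borel_measurable (lebesgue_on {a..b})"
      by (rule continuous_imp_measurable_on_sets_lebesgue[OF F'fc]) auto
    show "bounded ((\<lambda>s. F' (f s)) ` {a..b})"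
      by (intro compact_imp_bounded compact_continuous_image F'fc) auto
  qed auto
  have gi: "(\<lambda>s. F' (f s) * v s) integrable_on {a..b}"
    using ai by (auto simp: absolutely_integrable_on_def)
  have sub: "g integrable_on {s..s'}" if "g integrable_on {a..b}" "a \<le> s" "s' \<le> b"
    for g :: "real \<Rightarrow> real" and s s'
    using that by (auto intro: integrable_subinterval_real)
  have diff: "integral {a..s'} g - integral {a..s} g = integral {s..s'} g"
    if "g integrable_on {a..b}" "a \<le> s" "s \<le> s'" "s' \<le> b" for g :: "real \<Rightarrow> real" and s s'
    using Henstock_Kurzweil_Integration.integral_combine[of a s s' g] that sub[of g a s'] by auto
  define \<Psi> where "\<Psi> s = F (f s) - integral {a..s} (\<lambda>s. F' (f s) * v s)" for s
  define V where "V s = integral {a..s} (\<lambda>s. \<bar>v s\<bar>)" for s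
  have "\<Psi> b = \<Psi> a"
  proof (rule eq_if_locally_small_increments[OF \<open>a \<le> b\<close>, where V = V])
    fix x e :: real assume x: "a \<le> x" "x \<le> b" and e: "0 < e"
    have "isCont F' (f x)" using F' by (simp add: continuous_on_eq_continuous_at)
    then obtain \<eta> where \<eta>: "\<eta> > 0" "\<And>z. \<bar>z - f x\<bar> < \<eta> \<Longrightarrow> \<bar>F' z - F' (f x)\<bar> < e/2"
      using e unfolding continuous_at_eps_delta by (metis half_gt_zero dist_real_def)
    obtain d where d: "d > 0" "\<And>s. s \<in> {a..b} \<Longrightarrow> \<bar>s - x\<bar> < d \<Longrightarrow> \<bar>f s - f x\<bar> < \<eta>"
      using fc x \<eta>(1) unfolding continuous_on_iff by (metis atLeastAtMost_iff dist_real_def)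
    have "\<bar>\<Psi> s' - \<Psi> s\<bar> \<le> e * (V s' - V s)"
      if s: "a \<le> s" "s \<le> x" "x \<le> s'" "s' \<le> b" "s' - s < d" for s s'
    proof -
      have near: "\<bar>f \<sigma> - f x\<bar> < \<eta>" if "\<sigma> \<in> {s..s'}" for \<sigma>
        using d(2)[of \<sigma>] that s by auto
      \<comment> \<open>A point between \<open>f s\<close> and \<open>f s'\<close> is as close to
        \<open>f x\<close> as these two values are; when they coincide, the common value itself
        serves.\<close>
      obtain \<xi> where \<xi>: "\<bar>\<xi> - f x\<bar> < \<eta>" "F (f s') - F (f s) = (f s' - f s) * F' \<xi>"
      proof -
        consider "f s < f s'" | "f s > f s'" | "f s = f s'" by linarith
        then show ?thesis
        proof cases
          case 1
          from MVT2[OF 1, of F F'] F obtain z where "f s < z" "z < f s'" "F (f s') - F (f s) = (f s' - f s) * F' z"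
            by blast
          then show ?thesis using that[of z] near[of s] near[of s'] s by auto
        next
          case 2
          from MVT2[OF 2, of F F'] F obtain z where "f s' < z" "z < f s" "F (f s) - F (f s') = (f s - f s') * F' z"
            by blast
          then show ?thesis using that[of z] near[of s] near[of s'] s by (auto simp: algebra_simps)
        next
          case 3 then show ?thesis using that[of "f s"] near[of s] s by auto
        qed
      qed
      have [simp]: "s \<le> s'" using s by simp
      have fd: "f s' - f s = integral {s..s'} v"
        using f[of s] f[of s'] s diff[OF vi, of s s'] by auto
      have "\<Psi> s' - \<Psi> s = F' \<xi> * integral {s..s'} v - integral {s..s'} (\<lambda>s. F' (f s) * v s)"
        using \<xi>(2) fd diff[OF gi, of s s'] s by (auto simp: \<Psi>_def algebra_simps)
      also have "\<dots> = integral {s..s'} (\<lambda>\<sigma>. F' \<xi> * v \<sigma> - F' (f \<sigma>) * v \<sigma>)"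
        using sub[OF vi, of s s'] sub[OF gi, of s s'] s by (subst integral_diff) (auto intro: integrable_on_mult_right)
      finally have "\<bar>\<Psi> s' - \<Psi> s\<bar> = norm (integral {s..s'} (\<lambda>\<sigma>. F' \<xi> * v \<sigma> - F' (f \<sigma>) * v \<sigma>))" by simp
      also have "\<dots> \<le> integral {s..s'} (\<lambda>\<sigma>. e * \<bar>v \<sigma>\<bar>)"
      proof (rule Henstock_Kurzweil_Integration.integral_norm_bound_integral)
        show "(\<lambda>\<sigma>. F' \<xi> * v \<sigma> - F' (f \<sigma>) * v \<sigma>) integrable_on {s..s'}"
          using sub[OF vi, of s s'] sub[OF gi, of s s'] s by (intro integrable_diff integrable_on_mult_right) auto
        show "(\<lambda>\<sigma>. e * \<bar>v \<sigma>\<bar>) integrable_on {s..s'}"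
          using sub[OF avi, of s s'] s by (intro integrable_on_mult_right) auto
        fix \<sigma> assume \<sigma>: "\<sigma> \<in> {s..s'}"
        have "\<bar>F' \<xi> - F' (f \<sigma>)\<bar> \<le> e" using \<eta>(2)[OF \<xi>(1)] \<eta>(2)[OF near[OF \<sigma>]] by linarith
        then show "norm (F' \<xi> * v \<sigma> - F' (f \<sigma>) * v \<sigma>) \<le> e * \<bar>v \<sigma>\<bar>"
          by (simp add: left_diff_distrib[symmetric] abs_mult mult_right_mono)
      qed
      also have "\<dots> = e * (V s' - V s)"
        using diff[OF avi, of s s'] s by (simp add: V_def)
      finally show ?thesis .
    qed
    then show "\<exists>d>0. \<forall>s s'. a \<le> s \<and> s \<le> x \<and> x \<le> s' \<and> s' \<le> b \<and> s' - s < d \<longrightarrow> \<bar>\<Psi> s' - \<Psi> s\<bar> \<le> e * (V s' - V s)"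
      using d(1) by blast
  qed
  then show "integral {a..b} (\<lambda>s. F' (f s) * v s) = F (f b) - F (f a)"
    by (simp add: \<Psi>_def)
qed

text \<open>The velocity of a nonnegative absolutely continuous function does not contribute on its zero
  set: apply the chain rule to the smooth approximations \<open>sqrt (x\<^sup>2 + \<epsilon>\<^sup>2)\<close> of \<open>x\<close>.\<close>

lemma integral_velocity_positive_part:
  fixes f v :: "real \<Rightarrow> real"
  assumes "a \<le> b" and v: "v absolutely_integrable_on {a..b}"
    and f: "\<And>s. s \<in> {a..b} \<Longrightarrow> f s = f a + integral {a..s} v"
    and pos: "\<And>s. s \<in> {a..b} \<Longrightarrow> 0 \<le> f s"
  shows "((\<lambda>s. if f s > 0 then v s else 0) has_integral (f b - f a)) {a..b}"
proof -
  define e where "e n = inverse (real (Suc n))" for n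
  have e: "e n > 0" "e \<longlonglongrightarrow> 0" for n
    unfolding e_def by (simp, rule LIMSEQ_inverse_real_of_nat)
  have pos': "0 < x\<^sup>2 + (e n)\<^sup>2" for x n
    using e(1)[of n] by (simp add: add_nonneg_pos)
  define F where "F n x = sqrt (x\<^sup>2 + (e n)\<^sup>2)" for n x
  define F' where "F' n x = x / sqrt (x\<^sup>2 + (e n)\<^sup>2)" for n x
  have der: "(F n has_real_derivative F' n x) (at x)" for n x
    unfolding F_def[abs_def] F'_def using pos'[of x n]
    by (auto intro!: derivative_eq_intros simp: field_simps)
  have cont: "continuous_on UNIV (F' n)" for n
    unfolding F'_def[abs_def] using pos'[of _ n]
    by (intro continuous_intros) (auto simp: real_sqrt_eq_zero_cancel_iff less_imp_neq[symmetric])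
  note ch = chain_rule_indefinite_integral[OF \<open>a \<le> b\<close> v f der cont]
  have bnd: "\<bar>F' n x\<bar> \<le> 1" for n x
  proof -
    have "\<bar>x\<bar> \<le> sqrt (x\<^sup>2 + (e n)\<^sup>2)" by (rule real_le_rsqrt) simp
    moreover have "0 < sqrt (x\<^sup>2 + (e n)\<^sup>2)" using pos' by simp
    ultimately show ?thesis by (simp add: F'_def abs_divide divide_le_eq_1)
  qed
  \<comment> \<open>Every \<open>F' n\<close> vanishes at \<open>0\<close>, whereas for
    \<open>x > 0\<close> the derivatives tend to \<open>1\<close>: in the limit the velocity is
    removed exactly on the zero set of \<open>f\<close>.\<close>
  have lim: "(\<lambda>n. F' n x) \<longlonglongrightarrow> (if x > 0 then 1 else 0)" if "x \<ge> 0" for x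
  proof (cases "x = 0")
    case True then show ?thesis by (simp add: F'_def)
  next
    case False
    have "(\<lambda>n. F' n x) \<longlonglongrightarrow> x / sqrt (x\<^sup>2 + 0\<^sup>2)"
      unfolding F'_def using False by (intro tendsto_intros e(2)) auto
    then show ?thesis using False that by simp
  qed
  have avi: "(\<lambda>s. \<bar>v s\<bar>) integrable_on {a..b}"
    using v by (auto simp: absolutely_integrable_on_def)
  have fi: "(\<lambda>s. F' n (f s) * v s) integrable_on {a..b}" for n
    using ch(1)[of n] by (auto simp: absolutely_integrable_on_def)
  have nb: "norm (F' n (f s) * v s) \<le> \<bar>v s\<bar>" for n s
    using mult_right_mono[OF bnd[of n "f s"], of "\<bar>v s\<bar>"] by (simp add: abs_mult)
  have pw: "\<forall>s\<in>{a..b}. (\<lambda>n. F' n (f s) * v s) \<longlonglongrightarrow> (if f s > 0 then v s else 0)"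
  proof
    fix s assume "s \<in> {a..b}"
    from tendsto_mult[OF lim[OF pos[OF this]] tendsto_const[of "v s"]]
    show "(\<lambda>n. F' n (f s) * v s) \<longlonglongrightarrow> (if f s > 0 then v s else 0)" by (auto split: if_splits)
  qed
  note dc = dominated_convergence[of "\<lambda>n s. F' n (f s) * v s" "{a..b}" "\<lambda>s. \<bar>v s\<bar>" "\<lambda>s. if f s > 0 then v s else 0"]
  have 1: "(\<lambda>s. if f s > 0 then v s else 0) integrable_on {a..b}"
    by (rule dc(1)[OF fi avi]) (use nb pw in auto)
  have 2: "(\<lambda>n. integral {a..b} (\<lambda>s. F' n (f s) * v s)) \<longlonglongrightarrow> integral {a..b} (\<lambda>s. if f s > 0 then v s else 0)"
    by (rule dc(2)[OF fi avi]) (use nb pw in auto)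
  have "(\<lambda>n. F n (f b) - F n (f a)) \<longlonglongrightarrow> sqrt ((f b)\<^sup>2 + 0\<^sup>2) - sqrt ((f a)\<^sup>2 + 0\<^sup>2)"
    unfolding F_def by (intro tendsto_intros e(2))
  then have "(\<lambda>n. F n (f b) - F n (f a)) \<longlonglongrightarrow> f b - f a"
    using pos[of a] pos[of b] \<open>a \<le> b\<close> by simp
  then have "integral {a..b} (\<lambda>s. if f s > 0 then v s else 0) = f b - f a"
    using 2 ch(2) LIMSEQ_unique by auto
  then show ?thesis using 1 by (auto simp: has_integral_integrable_integral)
qed

text \<open>Polarisation: the chain rule for \<open>x\<^sup>2 / 2\<close> is applied to
  \<open>f + g\<close>, \<open>f\<close> and \<open>g\<close>, and the results are
  subtracted.\<close>

lemma integration_by_parts_indefinite_integral: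
  fixes f v g w :: "real \<Rightarrow> real"
  assumes "a \<le> b" and v: "v absolutely_integrable_on {a..b}" and w: "w absolutely_integrable_on {a..b}"
    and f: "\<And>s. s \<in> {a..b} \<Longrightarrow> f s = f a + integral {a..s} v"
    and g: "\<And>s. s \<in> {a..b} \<Longrightarrow> g s = g a + integral {a..s} w"
  shows "((\<lambda>s. f s * w s + g s * v s) has_integral (f b * g b - f a * g a)) {a..b}"
proof -
  have sum: "(\<lambda>s. v s + w s) absolutely_integrable_on {a..b}" using v w by simp
  have fg: "f s + g s = (f a + g a) + integral {a..s} (\<lambda>s. v s + w s)" if s: "s \<in> {a..b}" for s
  proof -
    have "integral {a..s} (\<lambda>s. v s + w s) = integral {a..s} v + integral {a..s} w"
      using v w s by (intro Henstock_Kurzweil_Integration.integral_add)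
        (auto simp: absolutely_integrable_on_def intro: integrable_subinterval_real)
    then show ?thesis using f[OF s] g[OF s] by simp
  qed
  have sq: "((\<lambda>x::real. x\<^sup>2 / 2) has_real_derivative x) (at x)" for x
    by (auto intro!: derivative_eq_intros)
  have c: "continuous_on UNIV (\<lambda>x::real. x)" by (rule continuous_on_id)
  have hi: "((\<lambda>s. h s * u s) has_integral ((h b)\<^sup>2 / 2 - (h a)\<^sup>2 / 2)) {a..b}"
    if "u absolutely_integrable_on {a..b}" "\<And>s. s \<in> {a..b} \<Longrightarrow> h s = h a + integral {a..s} u" for h u :: "real \<Rightarrow> real"
    using chain_rule_indefinite_integral[OF \<open>a \<le> b\<close> that sq c]
    by (auto simp: has_integral_integrable_integral absolutely_integrable_on_def)
  have "((\<lambda>s. (f s + g s) * (v s + w s) - f s * v s - g s * w s) has_integral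
      ((f b + g b)\<^sup>2 / 2 - (f a + g a)\<^sup>2 / 2) - ((f b)\<^sup>2 / 2 - (f a)\<^sup>2 / 2) - ((g b)\<^sup>2 / 2 - (g a)\<^sup>2 / 2)) {a..b}"
    by (rule has_integral_diff[OF has_integral_diff[OF hi[OF sum, of "\<lambda>s. f s + g s", OF fg] hi[OF v f]] hi[OF w g]])
  then show ?thesis
    by (simp add: algebra_simps power2_eq_square add_divide_distrib)
qed

text \<open>Lebesgue differentiation, applied to the extension of \<open>w\<close> by zero: off a
  negligible set the integrand is the limit of right difference quotients of its primitive.\<close>

lemma AE_zero_if_indefinite_integral_zero:
  fixes w :: "real \<Rightarrow> real"
  assumes w: "w integrable_on {a..b}" and z: "\<And>s. s \<in> {a..b} \<Longrightarrow> integral {a..s} w = 0"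
  shows "AE s in lebesgue. s \<in> {a..b} \<longrightarrow> w s = 0"
proof -
  define g where "g s = (if s \<in> {a..b} then w s else 0)" for s
  have "g integrable_on cbox c d" for c d
    using integrable_altD(1)[OF w, of c d] by (simp add: g_def[abs_def])
  from integrable_ccontinuous_explicit[OF this] obtain N where N: "negligible N"
    "\<And>x e. x \<notin> N \<Longrightarrow> 0 < e \<Longrightarrow> \<exists>d>0. \<forall>h. 0 < h \<and> h < d \<longrightarrow> norm (integral {x..x + h} g / h - g x) < e"
    by (auto simp: divide_inverse mult.commute) 
  \<comment> \<open>The endpoint \<open>b\<close> joins the null set because a right difference
    quotient at \<open>b\<close> would leave the interval.\<close>
  have "w x = 0" if x: "x \<notin> insert b N" "x \<in> {a..b}" for x
  proof (rule ccontr)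
    assume "w x \<noteq> 0"
    then obtain d where d: "d > 0" "\<And>h. 0 < h \<and> h < d \<Longrightarrow> \<bar>integral {x..x + h} g / h - w x\<bar> < \<bar>w x\<bar>"
      using N(2)[of x "\<bar>w x\<bar>"] x by (auto simp: g_def)
    define h where "h = min (d/2) (b - x)"
    have h: "0 < h" "h < d" "x + h \<le> b" using d(1) x by (auto simp: h_def)
    have "integral {x..x + h} g = integral {x..x + h} w"
      by (rule integral_cong) (use x h in \<open>auto simp: g_def\<close>)
    also have "\<dots> = integral {a..x+h} w - integral {a..x} w"
    proof -
      have "w integrable_on {a..x+h}" using w by (rule integrable_subinterval_real) (use x h in auto)
      from Henstock_Kurzweil_Integration.integral_combine[OF _ _ this, of x] show ?thesis using x h by auto
    qed
    also have "\<dots> = 0" using z x h by simp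
    finally show False using d(2)[of h] h by simp
  qed
  then have "\<forall>x. x \<notin> insert b N \<longrightarrow> x \<in> {a..b} \<longrightarrow> w x = 0" by blast
  moreover have "insert b N \<in> null_sets lebesgue"
    using N(1) by (simp add: negligible_iff_null_sets[symmetric])
  ultimately show ?thesis
    by (intro AE_I'[of "insert b N"]) blast+
qed

section \<open>Weak derivatives\<close>

lemma test_functionE:
  assumes \<phi>: "test_function_on a b \<phi>" and "a < b"
  obtains c d where "a < c" "c < d" "d < b" "\<And>s. (\<phi> has_real_derivative deriv \<phi> s) (at s)"
    "continuous_on UNIV (deriv \<phi>)" "continuous_on UNIV \<phi>"
    "\<And>s. s \<notin> {c..d} \<Longrightarrow> \<phi> s = 0" "\<And>s. s \<notin> {c..d} \<Longrightarrow> deriv \<phi> s = 0"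
proof -
  define K where "K = closure {s. \<phi> s \<noteq> 0}"
  have K: "compact K" "K \<subseteq> {a<..<b}" using \<phi> by (auto simp: test_function_on_def K_def)
  obtain c d where cd: "a < c" "c < d" "d < b" "K \<subseteq> {c..d}"
  proof (cases "K = {}")
    case True
    then show ?thesis using that[of "(2*a+b)/3" "(a+2*b)/3"] \<open>a < b\<close> by simp
  next
    case False
    obtain l where l: "l \<in> K" "\<And>x. x \<in> K \<Longrightarrow> l \<le> x" using compact_attains_inf[OF K(1) False] by auto
    obtain u where u: "u \<in> K" "\<And>x. x \<in> K \<Longrightarrow> x \<le> u" using compact_attains_sup[OF K(1) False] by auto
    have "a < l" "u < b" "l \<le> u" using l u K(2) by auto
    then show ?thesis using that[of "(a+l)/2" "(u+b)/2"] l u by force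
  qed
  have df: "\<And>s. \<phi> differentiable at s"
    and cd': "continuous_on UNIV (\<lambda>x. vector_derivative \<phi> (at x))"
    using \<phi> by (auto simp: test_function_on_def C1_differentiable_on_eq)
  have der: "(\<phi> has_real_derivative deriv \<phi> s) (at s)" for s
    using df[of s] by (metis DERIV_deriv_iff_real_differentiable)
  then have "vector_derivative \<phi> (at s) = deriv \<phi> s" for s
    by (simp add: has_real_derivative_iff_has_vector_derivative vector_derivative_at)
  then have cder: "continuous_on UNIV (deriv \<phi>)" using cd' by simp
  have z: "\<phi> s = 0" if "s \<notin> {c..d}" for s
    using that cd(4) closure_subset[of "{s. \<phi> s \<noteq> 0}"] by (auto simp: K_def)
  have "deriv \<phi> s = 0" if "s \<notin> {c..d}" for s
  proof -
    have "((\<lambda>_. 0) has_real_derivative deriv \<phi> s) (at s)"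
      by (rule has_field_derivative_transform_within_open[OF der, where S = "- {c..d}"]) (use that z in auto)
    then show ?thesis using DERIV_const[of 0] DERIV_unique by blast
  qed
  moreover have "continuous_on UNIV \<phi>"
    using der by (meson DERIV_isCont continuous_at_imp_continuous_on)
  ultimately show ?thesis using that[of c d] cd der cder z by blast
qed

text \<open>Weakly differentiable functions are only locally integrable, so an integral over the
  open interval makes sense only through the cutoff \<open>\<psi>\<close>, which confines it to a
  compact subinterval.\<close>

lemma set_integral_locally_integrable_times_compactly_supported:
  fixes f :: "real \<Rightarrow> 'a::{banach, second_countable_topology}" and \<psi> :: "real \<Rightarrow> real"
  assumes f: "locally_integrable_on a b f" and cd: "a < c" "d < b"
    and \<psi>: "continuous_on UNIV \<psi>" "\<And>s. s \<notin> {c..d} \<Longrightarrow> \<psi> s = 0"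
  shows "set_integrable lborel {c..d} (\<lambda>s. \<psi> s *\<^sub>R f s)"
    and "set_integrable lborel {a<..<b} (\<lambda>s. \<psi> s *\<^sub>R f s)"
    and "(LINT s:{a<..<b}|lborel. \<psi> s *\<^sub>R f s) = (LINT s:{c..d}|lborel. \<psi> s *\<^sub>R f s)"
proof -
  have fi: "integrable lborel (\<lambda>s. indicator {c..d} s *\<^sub>R f s)"
    using f cd by (auto simp: locally_integrable_on_def set_integrable_def)
  obtain B where B: "\<And>s. s \<in> {c..d} \<Longrightarrow> \<bar>\<psi> s\<bar> \<le> B"
  proof -
    have "compact (\<psi> ` {c..d})"
      by (intro compact_continuous_image continuous_on_subset[OF \<psi>(1)]) auto
    then obtain B where "\<forall>s\<in>{c..d}. \<bar>\<psi> s\<bar> \<le> B" by (auto dest!: compact_imp_bounded simp: bounded_iff)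
    then show ?thesis using that[of B] by blast
  qed
  have [measurable]: "\<psi> \<in> borel_measurable borel"
    using \<psi>(1) by (rule borel_measurable_continuous_onI)
  have [measurable]: "(\<lambda>s. indicator {c..d} s *\<^sub>R f s) \<in> borel_measurable lborel"
    using fi by (rule borel_measurable_integrable)
  have eq: "indicator {c..d} s *\<^sub>R (\<psi> s *\<^sub>R f s) = \<psi> s *\<^sub>R (indicator {c..d} s *\<^sub>R f s)" for s
    by (simp add: mult.commute)
  have eq2: "indicator {a<..<b} s *\<^sub>R (\<psi> s *\<^sub>R f s) = indicator {c..d} s *\<^sub>R (\<psi> s *\<^sub>R f s)" for s
    using \<psi>(2)[of s] cd by (auto simp: indicator_def)
  show 1: "set_integrable lborel {c..d} (\<lambda>s. \<psi> s *\<^sub>R f s)"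
    unfolding set_integrable_def eq
  proof (rule Bochner_Integration.integrable_bound[of _ "\<lambda>s. B *\<^sub>R norm (indicator {c..d} s *\<^sub>R f s)"])
    show "integrable lborel (\<lambda>s. B *\<^sub>R norm (indicator {c..d} s *\<^sub>R f s))"
      unfolding real_scaleR_def by (intro integrable_mult_right integrable_norm fi)
    show "AE s in lborel. norm (\<psi> s *\<^sub>R indicator {c..d} s *\<^sub>R f s) \<le> norm (B *\<^sub>R norm (indicator {c..d} s *\<^sub>R f s))"
    proof (rule AE_I2)
      fix s show "norm (\<psi> s *\<^sub>R indicator {c..d} s *\<^sub>R f s) \<le> norm (B *\<^sub>R norm (indicator {c..d} s *\<^sub>R f s))"
        using B[of s] by (cases "s \<in> {c..d}") (auto simp: abs_mult mult_right_mono)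
    qed
  qed measurable
  show "set_integrable lborel {a<..<b} (\<lambda>s. \<psi> s *\<^sub>R f s)"
    using 1 unfolding set_integrable_def eq2 .
  show "(LINT s:{a<..<b}|lborel. \<psi> s *\<^sub>R f s) = (LINT s:{c..d}|lborel. \<psi> s *\<^sub>R f s)"
    unfolding set_lebesgue_integral_def eq2 ..
qed

text \<open>A coordinate is a bounded linear functional and commutes with the integrals against test
  functions, which exist by compact support.\<close>

lemma has_weak_derivative_component:
  fixes f v :: "real \<Rightarrow> real ^ 'n::finite"
  assumes "has_weak_derivative a b f v" and "a < b"
  shows "has_weak_derivative a b (\<lambda>s. f s $ i) (\<lambda>s. v s $ i)"
proof -
  have comp: "locally_integrable_on a b (\<lambda>s. g s $ i)" if "locally_integrable_on a b g" for g :: "real \<Rightarrow> real ^ 'n"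
    unfolding locally_integrable_on_def
  proof (intro allI impI)
    fix c d assume "a < c \<and> d < b"
    then have "integrable lborel (\<lambda>s. indicator {c..d} s *\<^sub>R g s)"
      using that by (auto simp: locally_integrable_on_def set_integrable_def)
    from integrable_bounded_linear[OF bounded_linear_vec_nth[of i] this]
    show "set_integrable lborel {c..d} (\<lambda>s. g s $ i)" by (simp add: set_integrable_def)
  qed
  have lin: "(LINT s:{a<..<b}|lborel. \<psi> s *\<^sub>R g s) $ i = (LINT s:{a<..<b}|lborel. \<psi> s *\<^sub>R (g s $ i))"
    if "set_integrable lborel {a<..<b} (\<lambda>s. \<psi> s *\<^sub>R g s)" for g :: "real \<Rightarrow> real ^ 'n" and \<psi> :: "real \<Rightarrow> real"
    using integral_bounded_linear[OF bounded_linear_vec_nth[of i] that[unfolded set_integrable_def]]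
    by (simp add: set_lebesgue_integral_def mult.assoc)
  have lf: "locally_integrable_on a b f" and lv: "locally_integrable_on a b v" using assms by (auto simp: has_weak_derivative_def)
  have "(LINT s:{a<..<b}|lborel. deriv \<phi> s *\<^sub>R f s $ i) = - (LINT s:{a<..<b}|lborel. \<phi> s *\<^sub>R v s $ i)"
    if \<phi>: "test_function_on a b \<phi>" for \<phi>
  proof -
    obtain c d where cd: "a < c" "d < b" "continuous_on UNIV (deriv \<phi>)" "continuous_on UNIV \<phi>"
      "\<And>s. s \<notin> {c..d} \<Longrightarrow> \<phi> s = 0" "\<And>s. s \<notin> {c..d} \<Longrightarrow> deriv \<phi> s = 0"
      using test_functionE[OF \<phi> \<open>a < b\<close>] by metis
    have "(LINT s:{a<..<b}|lborel. deriv \<phi> s *\<^sub>R f s) = - (LINT s:{a<..<b}|lborel. \<phi> s *\<^sub>R v s)"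
      using assms \<phi> by (auto simp: has_weak_derivative_def)
    then show ?thesis
      using lin[OF set_integral_locally_integrable_times_compactly_supported(2)[OF lf cd(1,2,3,6)]]
        lin[OF set_integral_locally_integrable_times_compactly_supported(2)[OF lv cd(1,2,4,5)]] by auto
  qed
  then show ?thesis using comp lf lv by (auto simp: has_weak_derivative_def)
qed

lemma has_weak_derivative_componentI:
  fixes f v :: "real \<Rightarrow> real ^ 'n::finite"
  assumes w: "\<And>i. has_weak_derivative a b (\<lambda>s. f s $ i) (\<lambda>s. v s $ i)" and "a < b"
  shows "has_weak_derivative a b f v"
proof -
  have comp: "locally_integrable_on a b g" if "\<And>i. locally_integrable_on a b (\<lambda>s. g s $ i)" for g :: "real \<Rightarrow> real ^ 'n"
    unfolding locally_integrable_on_def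
  proof (intro allI impI)
    fix c d assume cd: "a < c \<and> d < b"
    have "integrable lborel (\<lambda>s. \<Sum>i\<in>UNIV. (indicator {c..d} s *\<^sub>R g s $ i) *\<^sub>R axis i (1::real))"
      using that cd by (intro Bochner_Integration.integrable_sum integrable_scaleR_left)
        (auto simp: locally_integrable_on_def set_integrable_def)
    also have "(\<lambda>s. \<Sum>i\<in>UNIV. (indicator {c..d} s *\<^sub>R g s $ i) *\<^sub>R axis i (1::real)) = (\<lambda>s. indicator {c..d} s *\<^sub>R g s)"
      by (intro ext) (simp add: vec_eq_iff axis_def if_distrib cong: if_cong)
    finally show "set_integrable lborel {c..d} g" by (simp add: set_integrable_def)
  qed
  have lf: "locally_integrable_on a b f" and lv: "locally_integrable_on a b v"
    using w by (auto simp: has_weak_derivative_def intro!: comp)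
  have lin: "(LINT s:{a<..<b}|lborel. \<psi> s *\<^sub>R g s) $ i = (LINT s:{a<..<b}|lborel. \<psi> s *\<^sub>R (g s $ i))"
    if "set_integrable lborel {a<..<b} (\<lambda>s. \<psi> s *\<^sub>R g s)" for g :: "real \<Rightarrow> real ^ 'n" and \<psi> :: "real \<Rightarrow> real" and i
    using integral_bounded_linear[OF bounded_linear_vec_nth[of i] that[unfolded set_integrable_def]]
    by (simp add: set_lebesgue_integral_def mult.assoc)
  have "(LINT s:{a<..<b}|lborel. deriv \<phi> s *\<^sub>R f s) = - (LINT s:{a<..<b}|lborel. \<phi> s *\<^sub>R v s)"
    if \<phi>: "test_function_on a b \<phi>" for \<phi>
  proof -
    obtain c d where cd: "a < c" "d < b" "continuous_on UNIV (deriv \<phi>)" "continuous_on UNIV \<phi>"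
      "\<And>s. s \<notin> {c..d} \<Longrightarrow> \<phi> s = 0" "\<And>s. s \<notin> {c..d} \<Longrightarrow> deriv \<phi> s = 0"
      using test_functionE[OF \<phi> \<open>a < b\<close>] by metis
    show ?thesis
      using lin[OF set_integral_locally_integrable_times_compactly_supported(2)[OF lf cd(1,2,3,6)]]
        lin[OF set_integral_locally_integrable_times_compactly_supported(2)[OF lv cd(1,2,4,5)]] w \<phi>
      by (auto simp: vec_eq_iff has_weak_derivative_def)
  qed
  then show ?thesis using lf lv by (auto simp: has_weak_derivative_def)
qed

lemma absolutely_integrable_if_set_integrable_lborel:
  fixes f :: "real \<Rightarrow> 'a::euclidean_space"
  assumes "set_integrable lborel S f"
  shows "f absolutely_integrable_on S"
  using assms unfolding set_integrable_def
  by (subst integrable_completion) (auto dest: borel_measurable_integrable)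

lemma deriv_has_integral_primitive:
  fixes \<phi> :: "real \<Rightarrow> real"
  assumes "\<And>s. (\<phi> has_real_derivative deriv \<phi> s) (at s)" "a \<le> s"
  shows "\<phi> s = \<phi> a + integral {a..s} (deriv \<phi>)"
proof -
  have "(deriv \<phi> has_integral (\<phi> s - \<phi> a)) {a..s}"
    by (rule fundamental_theorem_of_calculus[OF assms(2)])
      (use assms(1) in \<open>auto simp: has_real_derivative_iff_has_vector_derivative[symmetric] intro: has_field_derivative_at_within\<close>)
  then show ?thesis by (simp add: integral_unique)
qed

text \<open>Integration by parts against a test function; the boundary terms vanish because its
  support stays inside the open interval.\<close>

lemma has_weak_derivative_indefinite_integral:
  fixes f v :: "real \<Rightarrow> real"
  assumes "a < b" and v: "set_integrable lborel {a..b} v"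
    and f: "\<And>s. s \<in> {a..b} \<Longrightarrow> f s = f a + integral {a..s} v"
  shows "has_weak_derivative a b f v"
proof -
  have va: "v absolutely_integrable_on {a..b}" by (rule absolutely_integrable_if_set_integrable_lborel[OF v])
  then have vi: "v integrable_on {a..b}" by (auto simp: absolutely_integrable_on_def)
  have fc: "continuous_on {a..b} f"
  proof -
    have "continuous_on {a..b} (\<lambda>s. f a + integral {a..s} v)"
      by (intro continuous_intros indefinite_integral_continuous_1 vi)
    then show ?thesis
      by (rule continuous_on_eq) (simp add: f[symmetric])
  qed
  have lf: "locally_integrable_on a b f"
    unfolding locally_integrable_on_def
    by (intro allI impI borel_integrable_atLeastAtMost' continuous_on_subset[OF fc]) auto
  have lv: "locally_integrable_on a b v"
    unfolding locally_integrable_on_def by (intro allI impI set_integrable_subset[OF v]) auto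
  have "(LINT s:{a<..<b}|lborel. deriv \<phi> s *\<^sub>R f s) = - (LINT s:{a<..<b}|lborel. \<phi> s *\<^sub>R v s)"
    if \<phi>: "test_function_on a b \<phi>" for \<phi>
  proof -
    obtain c d where cd: "a < c" "c < d" "d < b" "\<And>s. (\<phi> has_real_derivative deriv \<phi> s) (at s)"
      "continuous_on UNIV (deriv \<phi>)" "continuous_on UNIV \<phi>"
      "\<And>s. s \<notin> {c..d} \<Longrightarrow> \<phi> s = 0" "\<And>s. s \<notin> {c..d} \<Longrightarrow> deriv \<phi> s = 0"
      using test_functionE[OF \<phi> \<open>a < b\<close>] by metis
    have dz: "\<phi> a = 0" "\<phi> b = 0" using cd by auto
    have "((\<lambda>s. \<phi> s * v s + f s * deriv \<phi> s) has_integral (\<phi> b * f b - \<phi> a * f a)) {a..b}"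
    proof (rule integration_by_parts_indefinite_integral)
      show "deriv \<phi> absolutely_integrable_on {a..b}"
        by (rule absolutely_integrable_continuous_real) (rule continuous_on_subset[OF cd(5)], simp)
      show "\<phi> s = \<phi> a + integral {a..s} (deriv \<phi>)" if "s \<in> {a..b}" for s
        by (rule deriv_has_integral_primitive) (use cd that in auto)
    qed (fact less_imp_le[OF \<open>a < b\<close>] va f)+
    then have 0: "((\<lambda>s. \<phi> s * v s + f s * deriv \<phi> s) has_integral 0) {a..b}" using dz by simp
    have 1: "((\<lambda>s. \<phi> s * v s + deriv \<phi> s * f s) has_integral 0) {a<..<b}"
      using 0 by (simp add: has_integral_Icc_iff_Ioo mult.commute)
    have 2: "((\<lambda>s. \<phi> s * v s) has_integral (LINT s:{a<..<b}|lborel. \<phi> s *\<^sub>R v s)) {a<..<b}"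
      using set_borel_integral_eq_integral[OF set_integral_locally_integrable_times_compactly_supported(2)[OF lv cd(1,3,6,7)]]
      by (simp add: has_integral_integrable_integral)
    have 3: "((\<lambda>s. deriv \<phi> s * f s) has_integral (LINT s:{a<..<b}|lborel. deriv \<phi> s *\<^sub>R f s)) {a<..<b}"
      using set_borel_integral_eq_integral[OF set_integral_locally_integrable_times_compactly_supported(2)[OF lf cd(1,3,5,8)]]
      by (simp add: has_integral_integrable_integral)
    from has_integral_unique[OF 1 has_integral_add[OF 2 3]] show ?thesis by linarith
  qed
  then show ?thesis using lf lv by (auto simp: has_weak_derivative_def)
qed

text \<open>The tent function \<open>s \<mapsto> max 0 (\<eta> - \<bar>s\<bar>)\<close> is the derivative of \<open>smooth_step \<eta>\<close>.\<close>

definition smooth_step :: "real \<Rightarrow> real \<Rightarrow> real" where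
  "smooth_step \<eta> s = ((max 0 (s + \<eta>))\<^sup>2 - 2 * (max 0 s)\<^sup>2 + (max 0 (s - \<eta>))\<^sup>2) / 2"

lemma has_real_derivative_max_0_square:
  "((\<lambda>s::real. (max 0 s)\<^sup>2) has_real_derivative 2 * max 0 x) (at x)"
proof -
  consider "x > 0" | "x < 0" | "x = 0" by linarith
  then show ?thesis
  proof cases
    case 1
    have "((\<lambda>s. s\<^sup>2) has_real_derivative 2 * x) (at x)" by (auto intro!: derivative_eq_intros)
    then have "((\<lambda>s. (max 0 s)\<^sup>2) has_real_derivative 2 * x) (at x)"
      by (rule has_field_derivative_transform_within_open[of _ _ _ "{0<..}"]) (use 1 in auto)
    then show ?thesis using 1 by simp
  next
    case 2
    have "((\<lambda>s. 0) has_real_derivative 0) (at x)" by simp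
    then have "((\<lambda>s. (max 0 s)\<^sup>2) has_real_derivative 0) (at x)"
      by (rule has_field_derivative_transform_within_open[of _ _ _ "{..<0}"]) (use 2 in auto)
    then show ?thesis using 2 by simp
  next
    case 3
    have "((\<lambda>y. (max 0 y)\<^sup>2 / y) \<longlongrightarrow> 0) (at (0::real))"
    proof (rule Lim_null_comparison[of _ "\<lambda>y. \<bar>y\<bar>"])
      show "\<forall>\<^sub>F y in at 0. norm ((max 0 y)\<^sup>2 / y) \<le> \<bar>y::real\<bar>"
        by (intro always_eventually) (auto simp: max_def power2_eq_square)
      show "((\<lambda>y. \<bar>y::real\<bar>) \<longlongrightarrow> 0) (at 0)" by (auto intro!: tendsto_eq_intros)
    qed
    then show ?thesis using 3 by (simp add: has_field_derivative_iff)
  qed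
qed

lemma smooth_step:
  assumes "\<eta> > 0"
  shows "(smooth_step \<eta> has_real_derivative max 0 (\<eta> - \<bar>s\<bar>)) (at s)"
    and "s \<le> - \<eta> \<Longrightarrow> smooth_step \<eta> s = 0" and "s \<ge> \<eta> \<Longrightarrow> smooth_step \<eta> s = \<eta>\<^sup>2"
proof -
  have sh: "((\<lambda>s::real. (max 0 (s + c))\<^sup>2) has_real_derivative 2 * max 0 (s + c)) (at s)" for c
    using has_real_derivative_max_0_square[of "s + c"] by (simp only: DERIV_shift)
  have "(smooth_step \<eta> has_real_derivative
      (2 * max 0 (s + \<eta>) - 2 * (2 * max 0 s) + 2 * max 0 (s - \<eta>)) / 2) (at s)"
    unfolding smooth_step_def[abs_def]
    by (rule DERIV_cdivide[OF DERIV_add[OF DERIV_diff[OF sh DERIV_cmult[OF has_real_derivative_max_0_square]]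
          sh[of "-\<eta>", unfolded add_uminus_conv_diff]]])
  also have "(2 * max 0 (s + \<eta>) - 2 * (2 * max 0 s) + 2 * max 0 (s - \<eta>)) / 2 = max 0 (\<eta> - \<bar>s\<bar>)"
    using assms by (auto simp: max_def abs_if)
  finally show "(smooth_step \<eta> has_real_derivative max 0 (\<eta> - \<bar>s\<bar>)) (at s)" .
  show "s \<le> - \<eta> \<Longrightarrow> smooth_step \<eta> s = 0" "s \<ge> \<eta> \<Longrightarrow> smooth_step \<eta> s = \<eta>\<^sup>2"
    using assms by (auto simp: smooth_step_def max_def power2_eq_square algebra_simps)
qed

text \<open>The height \<open>\<eta>\<^sup>2\<close> of a smooth step does not depend on its centre,
  so the difference of two translated steps is compactly supported. Its derivative is a tent around
  \<open>s1\<close> minus a tent around \<open>s2\<close>, both of mass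
  \<open>\<eta>\<^sup>2\<close>; testing with it says that the weighted means of \<open>F\<close>
  near the two points agree, which contradicts \<open>F s1 < F s2\<close> for narrow tents.\<close>

lemma du_Bois_Reymond:
  fixes F :: "real \<Rightarrow> real"
  assumes F: "continuous_on {a<..<b} F"
    and 0: "\<And>\<phi>. test_function_on a b \<phi> \<Longrightarrow> (LINT s:{a<..<b}|lborel. deriv \<phi> s *\<^sub>R F s) = 0"
    and s: "s1 \<in> {a<..<b}" "s2 \<in> {a<..<b}"
  shows "F s1 = F s2"
proof -
  have False if s: "s1 \<in> {a<..<b}" "s2 \<in> {a<..<b}" and less: "F s1 < F s2" for s1 s2
  proof -
    \<comment> \<open>A third of the gap, so that the perturbed values \<open>F s1 + k\<close> and
      \<open>F s2 - k\<close> are still strictly ordered.\<close>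
    define k where "k = (F s2 - F s1) / 3"
    have k: "k > 0" using less by (simp add: k_def)
    have nb: "\<exists>e>0. \<forall>x. \<bar>x - s\<bar> < e \<longrightarrow> x \<in> {a<..<b} \<and> \<bar>F x - F s\<bar> < k" if sab: "s \<in> {a<..<b}" for s
    proof -
      obtain e where e: "e > 0" "\<And>x. x \<in> {a<..<b} \<Longrightarrow> \<bar>x - s\<bar> < e \<Longrightarrow> \<bar>F x - F s\<bar> < k"
        using F[unfolded continuous_on_iff, rule_format, OF sab k] by (auto simp: dist_real_def)
      show ?thesis
      proof (intro exI[of _ "min e (min (s - a) (b - s))"] conjI allI impI)
        fix x assume x: "\<bar>x - s\<bar> < min e (min (s - a) (b - s))"
        then show ab: "x \<in> {a<..<b}" by (auto simp: abs_less_iff)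
        show "\<bar>F x - F s\<bar> < k" using e(2)[OF ab] x by simp
      qed (use e sab in auto)
    qed
    obtain e1 where e1: "e1 > 0" "\<And>x. \<bar>x - s1\<bar> < e1 \<Longrightarrow> x \<in> {a<..<b} \<and> \<bar>F x - F s1\<bar> < k" using nb[OF s(1)] by blast
    obtain e2 where e2: "e2 > 0" "\<And>x. \<bar>x - s2\<bar> < e2 \<Longrightarrow> x \<in> {a<..<b} \<and> \<bar>F x - F s2\<bar> < k" using nb[OF s(2)] by blast
    define \<eta> where "\<eta> = min e1 e2 / 2"
    have \<eta>: "\<eta> > 0" "\<eta> < e1" "\<eta> < e2" using e1 e2 by (auto simp: \<eta>_def)
    define tent where "tent s' s = max 0 (\<eta> - \<bar>s - s'\<bar>)" for s' s :: real
    define \<phi> where "\<phi> s = smooth_step \<eta> (s - s1) - smooth_step \<eta> (s - s2)" for s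
    have ds: "((\<lambda>s. smooth_step \<eta> (s - s')) has_real_derivative tent s' s) (at s)" for s s'
      unfolding tent_def using smooth_step(1)[OF \<eta>(1), of "s + (- s')"] unfolding DERIV_shift by simp
    have d\<phi>: "(\<phi> has_real_derivative (tent s1 s - tent s2 s)) (at s)" for s
      unfolding \<phi>_def[abs_def] by (intro derivative_intros ds)
    then have deriv: "deriv \<phi> = (\<lambda>s. tent s1 s - tent s2 s)" by (auto intro: DERIV_imp_deriv)
    have tc: "continuous_on S (tent s')" for S s' unfolding tent_def[abs_def] by (intro continuous_intros)
    define c d where "c = min s1 s2 - \<eta>" and "d = max s1 s2 + \<eta>"
    have cd: "a < c" "d < b"
      using e1(2)[of "s1 - \<eta>"] e1(2)[of "s1 + \<eta>"] e2(2)[of "s2 - \<eta>"] e2(2)[of "s2 + \<eta>"] \<eta>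
      by (auto simp: c_def d_def min_def max_def)
    have out: "\<phi> s = 0" if "s \<notin> {c..d}" for s
      using that smooth_step(2,3)[OF \<eta>(1)] by (auto simp: \<phi>_def c_def d_def)
    have cl: "closure {s. \<phi> s \<noteq> 0} \<subseteq> {c..d}"
      by (rule closure_minimal) (use out in blast, simp)
    have test: "test_function_on a b \<phi>"
      unfolding test_function_on_def
    proof (intro conjI)
      show "\<phi> C1_differentiable_on UNIV"
        unfolding C1_differentiable_on_def using d\<phi>
        by (intro exI[of _ "\<lambda>s. tent s1 s - tent s2 s"])
          (auto intro!: continuous_intros tc simp: has_real_derivative_iff_has_vector_derivative)
      show "closure {s. \<phi> s \<noteq> 0} \<subseteq> {a<..<b}" using cl cd by auto
      show "compact (closure {s. \<phi> s \<noteq> 0})"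
        by (rule compact_closure[THEN iffD2], rule bounded_subset[of "{c..d}"]) (simp, use out in blast)
    qed
    have int1: "((\<lambda>s. tent s' s) has_integral \<eta>\<^sup>2) {s' - \<eta>..s' + \<eta>}" for s'
    proof -
      have "((\<lambda>s. tent s' s) has_integral (smooth_step \<eta> (s' + \<eta> - s') - smooth_step \<eta> (s' - \<eta> - s'))) {s' - \<eta>..s' + \<eta>}"
        by (rule fundamental_theorem_of_calculus)
          (use \<eta> ds in \<open>auto simp: has_real_derivative_iff_has_vector_derivative[symmetric] intro: has_field_derivative_at_within\<close>)
      then show ?thesis using smooth_step(2,3)[OF \<eta>(1)] by simp
    qed
    have fc: "continuous_on {c..d} F" by (rule continuous_on_subset[OF F]) (use cd in auto)
    have tI: "integral {c..d} (\<lambda>s. tent s' s * F s) = integral {s' - \<eta>..s' + \<eta>} (\<lambda>s. tent s' s * F s)"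
      if "s' = s1 \<or> s' = s2" for s'
    proof -
      have sub: "{s' - \<eta>..s' + \<eta>} \<subseteq> {c..d}" using that by (auto simp: c_def d_def)
      have "integral {c..d} (\<lambda>s. tent s' s * F s) = integral {c..d} (\<lambda>s. if s \<in> {s' - \<eta>..s' + \<eta>} then tent s' s * F s else 0)"
        by (rule integral_cong) (auto simp: tent_def max_def)
      also have "\<dots> = integral {s' - \<eta>..s' + \<eta>} (\<lambda>s. tent s' s * F s)"
        using sub by (subst integral_restrict_Int) (auto simp: Int_absorb2)
      finally show ?thesis .
    qed
    have ci: "(\<lambda>s. tent s' s * F s) integrable_on {s' - \<eta>..s' + \<eta>}" if "s' = s1 \<or> s' = s2" for s'
      using that by (intro integrable_continuous_real continuous_intros tc continuous_on_subset[OF fc]) (auto simp: c_def d_def)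
    have le1: "F x \<le> F s1 + k" if "s1 - \<eta> \<le> x \<and> x \<le> s1 + \<eta>" for x
      using e1(2)[of x] that \<eta> by (auto simp: abs_less_iff)
    have le2: "F s2 - k \<le> F x" if "s2 - \<eta> \<le> x \<and> x \<le> s2 + \<eta>" for x
      using e2(2)[of x] that \<eta> by (auto simp: abs_less_iff)
    have "integral {c..d} (\<lambda>s. tent s1 s * F s) \<le> \<eta>\<^sup>2 * (F s1 + k)"
      unfolding tI[of s1, simplified]
      by (rule has_integral_le[OF integrable_integral[OF ci] has_integral_mult_left[OF int1]])
        (use le1 in \<open>auto intro!: mult_left_mono simp: tent_def\<close>)
    moreover have "\<eta>\<^sup>2 * (F s2 - k) \<le> integral {c..d} (\<lambda>s. tent s2 s * F s)"
      unfolding tI[of s2, simplified]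
      by (rule has_integral_le[OF has_integral_mult_left[OF int1] integrable_integral[OF ci]])
        (use le2 in \<open>auto intro!: mult_left_mono simp: tent_def\<close>)
    moreover have "integral {c..d} (\<lambda>s. tent s1 s * F s) = integral {c..d} (\<lambda>s. tent s2 s * F s)"
    proof -
      have lF: "locally_integrable_on a b F"
        unfolding locally_integrable_on_def
        by (intro allI impI borel_integrable_atLeastAtMost' continuous_on_subset[OF F]) auto
      have z: "deriv \<phi> s = 0" if "s \<notin> {c..d}" for s
      proof -
        have "\<eta> \<le> \<bar>s - s1\<bar>" "\<eta> \<le> \<bar>s - s2\<bar>" using that by (auto simp: c_def d_def)
        then show ?thesis by (simp add: deriv tent_def)
      qed
      have cder: "continuous_on UNIV (deriv \<phi>)" unfolding deriv by (intro continuous_intros tc)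
      note si = set_integral_locally_integrable_times_compactly_supported[OF lF cd cder z]
      have "0 = integral {c..d} (\<lambda>s. deriv \<phi> s * F s)"
        using 0[OF test] si(3) set_borel_integral_eq_integral(2)[OF si(1)] by simp
      also have "\<dots> = integral {c..d} (\<lambda>s. tent s1 s * F s) - integral {c..d} (\<lambda>s. tent s2 s * F s)"
        unfolding deriv left_diff_distrib
        by (rule Henstock_Kurzweil_Integration.integral_diff) (intro integrable_continuous_real continuous_intros tc fc)+
      finally show ?thesis by simp
    qed
    ultimately have "\<eta>\<^sup>2 * (F s2 - k) \<le> \<eta>\<^sup>2 * (F s1 + k)" by linarith
    then have "F s2 - k \<le> F s1 + k" using \<eta>(1) by simp
    then show False using k by (simp add: k_def field_simps)
  qed
  from this[OF s] this[OF s(2,1)] show ?thesis by (metis linorder_neqE_linordered_idom)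
qed

text \<open>Subtracting the primitive of \<open>v\<close> leaves a continuous function with zero
  weak derivative, constant inside by \<open>du_Bois_Reymond\<close> and up to the endpoints by
  continuity.\<close>

lemma weak_derivative_continuous_function:
  fixes f v :: "real \<Rightarrow> real"
  assumes "a < b" and f: "continuous_on {a..b} f" and w: "has_weak_derivative a b f v"
    and v: "set_integrable lborel {a..b} v" and s: "s \<in> {a..b}"
  shows "f s = f a + integral {a..s} v"
proof -
  have vi: "v integrable_on {a..b}"
    using absolutely_integrable_if_set_integrable_lborel[OF v] by (auto simp: absolutely_integrable_on_def)
  define F where "F s = f s - integral {a..s} v" for s
  have Fc: "continuous_on {a..b} F" unfolding F_def
    by (intro continuous_intros f indefinite_integral_continuous_1 vi)
  have w2: "has_weak_derivative a b (\<lambda>s. integral {a..s} v) v"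
    by (rule has_weak_derivative_indefinite_integral[OF \<open>a < b\<close> v]) simp
  have eq: "F s1 = F s2" if "s1 \<in> {a<..<b}" "s2 \<in> {a<..<b}" for s1 s2
  proof (rule du_Bois_Reymond[OF _ _ that])
    show "continuous_on {a<..<b} F" by (rule continuous_on_subset[OF Fc]) auto
    fix \<phi> assume \<phi>: "test_function_on a b \<phi>"
    obtain c d where cd: "a < c" "d < b" "continuous_on UNIV (deriv \<phi>)"
      "\<And>s. s \<notin> {c..d} \<Longrightarrow> deriv \<phi> s = 0"
      using test_functionE[OF \<phi> \<open>a < b\<close>] by metis
    have "locally_integrable_on a b f" "locally_integrable_on a b (\<lambda>s. integral {a..s} v)"
      using w w2 by (auto simp: has_weak_derivative_def)
    from this[THEN set_integral_locally_integrable_times_compactly_supported(2)[OF _ cd]]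
    have "(LINT s:{a<..<b}|lborel. deriv \<phi> s *\<^sub>R F s) =
        (LINT s:{a<..<b}|lborel. deriv \<phi> s *\<^sub>R f s) - (LINT s:{a<..<b}|lborel. deriv \<phi> s *\<^sub>R integral {a..s} v)"
      by (subst set_integral_diff(2)[symmetric]) (auto simp: F_def algebra_simps)
    then show "(LINT s:{a<..<b}|lborel. deriv \<phi> s *\<^sub>R F s) = 0"
      using w w2 \<phi> by (auto simp: has_weak_derivative_def)
  qed
  define k where "k = F ((a+b)/2)"
  have "F s = k" if "s \<in> {a..b}" for s
  proof (rule continuous_constant_on_closure[of "{a<..<b}" F k s])
    show "continuous_on (closure {a<..<b}) F" using \<open>a < b\<close> Fc by simp
    show "F x = k" if "x \<in> {a<..<b}" for x using that \<open>a < b\<close> by (auto simp: k_def intro: eq)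
  qed (use that \<open>a < b\<close> in auto)
  from this[OF s] this[of a] \<open>a < b\<close> show ?thesis by (simp add: F_def)
qed

text \<open>On a compact subinterval the difference of the two derivatives is integrable. Its
  primitive is annihilated by derivatives of test functions, hence constant, so the difference
  vanishes almost everywhere there; countably many such subintervals exhaust
  \<open>{a<..<b}\<close>.\<close>

lemma weak_derivative_unique_AE:
  fixes f v w :: "real \<Rightarrow> real"
  assumes v: "has_weak_derivative a b f v" and w: "has_weak_derivative a b f w"
  shows "AE s in lborel. s \<in> {a<..<b} \<longrightarrow> v s = w s"
proof (cases "a < b")
  case True
  define z where "z s = v s - w s" for s
  have lv: "locally_integrable_on a b v" and lw: "locally_integrable_on a b w"
    using v w by (auto simp: has_weak_derivative_def)
  have *: "AE s in lborel. s \<in> {c..d} \<longrightarrow> z s = 0" if cd: "a < c" "c < d" "d < b" for c d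
  proof -
    have zi: "set_integrable lborel {c..d} z"
      using lv lw cd unfolding z_def[abs_def] by (intro set_integral_diff) (auto simp: locally_integrable_on_def)
    have zi': "z integrable_on {c..d}" by (rule set_borel_integral_eq_integral(1)[OF zi])
    define F where "F s = integral {c..s} z" for s
    have Fc: "continuous_on {c..d} F" unfolding F_def by (intro indefinite_integral_continuous_1 zi')
    have wF: "has_weak_derivative c d F z"
      by (rule has_weak_derivative_indefinite_integral[OF \<open>c < d\<close> zi]) (simp add: F_def)
    have eq: "F s1 = F s2" if "s1 \<in> {c<..<d}" "s2 \<in> {c<..<d}" for s1 s2
    proof (rule du_Bois_Reymond[OF _ _ that])
      show "continuous_on {c<..<d} F" by (rule continuous_on_subset[OF Fc]) auto
      fix \<phi> assume \<phi>: "test_function_on c d \<phi>"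
      then have \<phi>': "test_function_on a b \<phi>" using cd by (auto simp: test_function_on_def)
      obtain c' d' where cd': "c < c'" "d' < d" "continuous_on UNIV \<phi>"
        "\<And>s. s \<notin> {c'..d'} \<Longrightarrow> \<phi> s = 0"
        using test_functionE[OF \<phi> \<open>c < d\<close>] by metis
      have acd: "a < c'" "d' < b" using cd cd' by auto
      note sv = set_integral_locally_integrable_times_compactly_supported[OF lv acd cd'(3,4)]
      note sw = set_integral_locally_integrable_times_compactly_supported[OF lw acd cd'(3,4)]
      have lz: "locally_integrable_on c d z" using wF by (auto simp: has_weak_derivative_def)
      note sz = set_integral_locally_integrable_times_compactly_supported[OF lz cd'(1,2,3,4)]
      have "(LINT s:{c<..<d}|lborel. deriv \<phi> s *\<^sub>R F s) = - (LINT s:{c<..<d}|lborel. \<phi> s *\<^sub>R z s)"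
        using wF \<phi> by (auto simp: has_weak_derivative_def)
      also have "\<dots> = - (LINT s:{c'..d'}|lborel. \<phi> s *\<^sub>R v s - \<phi> s *\<^sub>R w s)"
        using sz(3) by (simp add: z_def algebra_simps)
      also have "\<dots> = - ((LINT s:{a<..<b}|lborel. \<phi> s *\<^sub>R v s) - (LINT s:{a<..<b}|lborel. \<phi> s *\<^sub>R w s))"
        using sv sw by (subst set_integral_diff(2)) auto
      also have "\<dots> = 0" using v w \<phi>' by (auto simp: has_weak_derivative_def)
      finally show "(LINT s:{c<..<d}|lborel. deriv \<phi> s *\<^sub>R F s) = 0" .
    qed
    have const: "F s = F ((c+d)/2)" if "s \<in> {c..d}" for s
    proof (rule continuous_constant_on_closure[of "{c<..<d}" F _ s])
      show "continuous_on (closure {c<..<d}) F" using \<open>c < d\<close> Fc by simp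
      show "F x = F ((c+d)/2)" if "x \<in> {c<..<d}" for x using that \<open>c < d\<close> by (auto intro: eq)
    qed (use that \<open>c < d\<close> in auto)
    have "integral {c..s} z = 0" if "s \<in> {c..d}" for s
    proof -
      have "F s = F c" using const[OF that] const[of c] \<open>c < d\<close> by simp
      then show ?thesis by (simp add: F_def)
    qed
    from AE_zero_if_indefinite_integral_zero[OF zi' this]
    have "AE s in lebesgue. s \<in> {c..d} \<longrightarrow> z s = 0" by simp
    then have "AE s in lebesgue. indicator {c..d} s *\<^sub>R z s = 0"
      by eventually_elim (auto simp: indicator_def)
    then have "AE s in lborel. indicator {c..d} s *\<^sub>R z s = 0"
      by (subst (asm) AE_completion_iff) auto
    then show ?thesis by eventually_elim (auto simp: indicator_def split: if_splits)
  qed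
  \<comment> \<open>The shift by \<open>3\<close> keeps the removed margins below half the length,
    so each subinterval is nondegenerate.\<close>
  have "AE s in lborel. \<forall>n. s \<in> {a + (b - a) / (real n + 3)..b - (b - a) / (real n + 3)} \<longrightarrow> z s = 0" (is "AE s in _. \<forall>n. ?P n s")
    unfolding AE_all_countable
  proof
    fix n :: nat
    show "AE s in lborel. ?P n s"
    proof (rule *)
      have "(b - a) / (real n + 3) < (b - a) / 2" using True by (intro divide_strict_left_mono) auto
      moreover have "a + r < b - r" if "r < (b - a) / 2" for r using that by (simp add: field_simps)
      ultimately show "a + (b - a) / (real n + 3) < b - (b - a) / (real n + 3)" by blast
    qed (use True in auto)
  qed
  then show ?thesis
  proof eventually_elim
    case (elim s)
    show ?case
    proof
      assume s: "s \<in> {a<..<b}"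
      define r where "r = min (s - a) (b - s)"
      have r: "r > 0" using s by (auto simp: r_def)
      obtain n :: nat where n: "(b - a) / r < n" using reals_Archimedean2 by blast
      have "(b - a) < r * (real n + 3)" using n r True by (simp add: field_simps)
      then have "(b - a) / (real n + 3) < r" by (simp add: field_simps)
      then have "s \<in> {a + (b - a) / (real n + 3)..b - (b - a) / (real n + 3)}" by (auto simp: r_def)
      then show "v s = w s" using elim[rule_format, of n] by (simp add: z_def)
    qed
  qed
qed simp

section \<open>Geometry of the junction\<close>

lemma edge_iff: "x \<in> edge i \<longleftrightarrow> 0 \<le> x $ i \<and> (\<forall>j. j \<noteq> i \<longrightarrow> x $ j = 0)"
  unfolding edge_def by (auto simp: vec_eq_iff axis_def intro!: exI[of _ "x $ i"])

lemma junctionE: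
  assumes "x \<in> junction"
  obtains i where "x \<in> edge i" "0 \<le> x $ i" "\<And>j. j \<noteq> i \<Longrightarrow> x $ j = 0" "x = x $ i *\<^sub>R axis i 1"
proof -
  obtain i where i: "x \<in> edge i" using assms by (auto simp: junction_def)
  then have "x = x $ i *\<^sub>R axis i 1" by (auto simp: edge_iff vec_eq_iff axis_def)
  then show ?thesis using that[of i] i by (simp add: edge_iff)
qed

lemma edge_junction: "x \<in> edge i \<Longrightarrow> x \<in> junction"
  by (auto simp: junction_def)

lemma zero_junction [simp]: "0 \<in> junction"
  by (rule edge_junction[of _ undefined]) (simp add: edge_iff)

lemma axis_junction [simp]: "0 \<le> r \<Longrightarrow> r *\<^sub>R axis i 1 \<in> junction"
  by (rule edge_junction[of _ i]) (simp add: edge_iff axis_def)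

lemma junction_nonneg: "x \<in> junction \<Longrightarrow> 0 \<le> x $ i"
  by (erule junctionE) (metis order_refl)

lemma junction_pos_unique: "x \<in> junction \<Longrightarrow> 0 < x $ i \<Longrightarrow> 0 < x $ j \<Longrightarrow> i = j"
  by (erule junctionE) (metis less_irrefl)

lemma junction_pos_component: "x \<in> junction \<Longrightarrow> x \<noteq> 0 \<Longrightarrow> \<exists>i. 0 < x $ i"
  by (metis junction_nonneg order_le_less vec_eq_iff zero_index)

lemma junction_pos_edge: "x \<in> junction \<Longrightarrow> 0 < x $ i \<Longrightarrow> x \<in> edge i"
  by (erule junctionE) (metis less_irrefl)

lemma edge_eq_axis: "x \<in> edge i \<Longrightarrow> x = x $ i *\<^sub>R axis i 1"
  by (auto simp: edge_iff vec_eq_iff axis_def)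

lemma sum_edge: "x \<in> edge i \<Longrightarrow> (\<Sum>j\<in>UNIV. f (x $ j)) = f (x $ i)" if "f 0 = (0::real)"
  using that by (subst sum.remove[of _ i]) (auto simp: edge_iff)

lemma norm_edge: "x \<in> edge i \<Longrightarrow> norm x = x $ i"
  by (subst edge_eq_axis, assumption) (simp add: edge_iff norm_axis_1)

lemma norm_junction: "x \<in> junction \<Longrightarrow> norm x = (\<Sum>i\<in>UNIV. x $ i)"
  by (erule junctionE) (simp add: norm_edge sum_edge[of "\<lambda>x. x"])

text \<open>Agrees with \<open>junction_dist\<close> on the junction, but is continuous on the whole
  space and satisfies the triangle inequality without distinguishing edges.\<close>

definition l1_dist :: "real ^ 'n::finite \<Rightarrow> real ^ 'n \<Rightarrow> real" where
  "l1_dist x z = (\<Sum>i\<in>UNIV. \<bar>x $ i - z $ i\<bar>)"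

lemma l1_dist_nonneg [simp]: "0 \<le> l1_dist x z"
  by (auto simp: l1_dist_def intro: sum_nonneg)

lemma l1_dist_commute: "l1_dist x z = l1_dist z x"
  by (simp add: l1_dist_def abs_minus_commute)

lemma l1_dist_self [simp]: "l1_dist x x = 0"
  by (simp add: l1_dist_def)

lemma l1_dist_triangle: "l1_dist x z \<le> l1_dist x w + l1_dist w z"
  unfolding l1_dist_def sum.distrib[symmetric] by (intro sum_mono) linarith

lemma l1_dist_zero: "x \<in> junction \<Longrightarrow> l1_dist x 0 = norm x" "x \<in> junction \<Longrightarrow> l1_dist 0 x = norm x"
  by (auto simp: l1_dist_def norm_junction junction_nonneg intro!: sum.cong)

lemma l1_dist_same_edge:
  assumes "x \<in> edge i" "z \<in> edge i"
  shows "l1_dist x z = \<bar>x $ i - z $ i\<bar>"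
  unfolding l1_dist_def using assms by (subst sum.remove[of _ i]) (auto simp: edge_iff)

lemma l1_dist_different_edges:
  assumes "x \<in> edge i" "z \<in> edge j" "i \<noteq> j"
  shows "l1_dist x z = norm x + norm z"
proof -
  have "\<bar>x $ k - z $ k\<bar> = x $ k + z $ k" for k
    using assms by (cases "k = i"; cases "k = j") (auto simp: edge_iff)
  then have "l1_dist x z = (\<Sum>k\<in>UNIV. x $ k) + (\<Sum>k\<in>UNIV. z $ k)"
    by (simp add: l1_dist_def sum.distrib)
  then show ?thesis using assms by (simp add: norm_junction edge_junction)
qed

lemma norm_same_edge:
  assumes "x \<in> edge i" "z \<in> edge i"
  shows "norm (x - z) = \<bar>x $ i - z $ i\<bar>"
proof -
  have "x - z = (x $ i - z $ i) *\<^sub>R axis i 1"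
    using assms by (auto simp: edge_iff vec_eq_iff axis_def)
  then show ?thesis by (simp add: norm_axis_1)
qed

lemma junction_dist_eq_l1_dist:
  assumes "x \<in> junction" "z \<in> junction"
  shows "junction_dist x z = l1_dist x z"
proof (cases "\<exists>i. x \<in> edge i \<and> z \<in> edge i")
  case True
  then obtain i where "x \<in> edge i" "z \<in> edge i" by blast
  then show ?thesis using True by (simp add: junction_dist_def norm_same_edge l1_dist_same_edge)
next
  case False
  obtain i where i: "x \<in> edge i" using assms(1) by (auto simp: junction_def)
  obtain j where j: "z \<in> edge j" using assms(2) by (auto simp: junction_def)
  have "i \<noteq> j" using i j False by auto
  then show ?thesis using l1_dist_different_edges[OF i j] False unfolding junction_dist_def by metis
qed

lemma norm_le_l1_dist: "norm (x - z) \<le> l1_dist x z"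
  using norm_le_l1_cart[of "x - z"] by (simp add: l1_dist_def)

lemma l1_dist_le_norm: "l1_dist x z \<le> CARD('n) * norm (x - z)" for x z :: "real ^ 'n::finite"
proof -
  have "l1_dist x z \<le> (\<Sum>i\<in>(UNIV :: 'n set). norm (x - z))"
    unfolding l1_dist_def
    by (rule sum_mono) (metis component_le_norm_cart vector_minus_component)
  then show ?thesis by simp
qed

lemma norm_diff_le_l1_dist: "x \<in> junction \<Longrightarrow> z \<in> junction \<Longrightarrow> \<bar>norm x - norm z\<bar> \<le> l1_dist x z"
  using norm_le_l1_dist[of x z] norm_triangle_ineq3[of x z] by linarith

lemma continuous_on_l1_dist [continuous_intros]:
  "continuous_on S f \<Longrightarrow> continuous_on S g \<Longrightarrow> continuous_on S (\<lambda>s. l1_dist (f s) (g s))"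
  unfolding l1_dist_def by (intro continuous_intros)

section \<open>Elementary inequalities for powers\<close>

text \<open>Superlinear growth in linear form: the slope \<open>l powr (p - 1)\<close> can be made
  as large as desired at the price of a constant. All later gains from high speed come from this
  choice of \<open>l\<close>.\<close>

lemma powr_ge_linear:
  fixes b l p :: real
  assumes "0 \<le> b" "0 < l" "1 < p"
  shows "l powr (p - 1) * b - l powr p \<le> b powr p"
proof (cases "l \<le> b")
  case True
  have "l powr (p - 1) * b \<le> b powr (p - 1) * b"
    using assms True by (intro mult_right_mono powr_mono2) auto
  also have "\<dots> = b powr p" using assms True by (simp add: powr_mult_base mult.commute)
  also have "\<dots> \<le> l powr p + b powr p" by simp
  finally show ?thesis by simp
next
  case False
  then have "l powr (p - 1) * b \<le> l powr (p - 1) * l" using assms by (intro mult_left_mono) auto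
  also have "\<dots> = l powr p" using assms by (simp add: powr_mult_base mult.commute)
  finally show ?thesis by (smt (verit) powr_ge_zero)
qed

lemma le_powr_div:
  fixes b l p :: real
  assumes "0 \<le> b" "0 < l" "1 < p"
  shows "b \<le> l + b powr p / l powr (p - 1)"
proof -
  have "l powr (p - 1) * b \<le> l powr p + b powr p" using powr_ge_linear[OF assms] by simp
  also have "l powr p = l powr (p - 1) * l" using assms by (simp add: powr_mult_base mult.commute)
  finally show ?thesis using assms by (simp add: field_simps)
qed

text \<open>Converts the growth \<open>\<bar>a\<bar> powr (p - 1)\<close> of the velocity derivative
  of the cost into energy with the small weight \<open>1 / V\<close>.\<close>

lemma powr_minus_one_le:
  fixes X V p :: real
  assumes "0 \<le> X" "0 < V" "1 < p"
  shows "X powr (p - 1) \<le> V powr (p - 1) + X powr p / V"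
proof (cases "X \<le> V")
  case True
  then have "X powr (p - 1) \<le> V powr (p - 1)" using assms by (intro powr_mono2) auto
  moreover have "0 \<le> X powr p / V" using assms by simp
  ultimately show ?thesis by linarith
next
  case False
  have "X powr (p - 1) * V \<le> X powr (p - 1) * X" using False by (intro mult_left_mono) auto
  also have "\<dots> = X powr p" using assms by (simp add: powr_mult_base mult.commute)
  finally have "X powr (p - 1) \<le> X powr p / V" using assms by (simp add: field_simps)
  then show ?thesis by (simp add: add_increasing)
qed

lemma powr_add_le:
  fixes x y q :: real
  assumes "0 \<le> x" "0 \<le> y" "0 < q"
  shows "(x + y) powr q \<le> 2 powr q * (x powr q + y powr q)"
proof -
  have "(x + y) powr q \<le> (2 * max x y) powr q" using assms by (intro powr_mono2) auto
  also have "\<dots> = 2 powr q * (max x y) powr q" using assms by (simp add: powr_mult)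
  also have "\<dots> \<le> 2 powr q * (x powr q + y powr q)"
    using assms by (intro mult_left_mono) (auto simp: max_def)
  finally show ?thesis .
qed

lemma le_one_plus_powr: "0 \<le> b \<Longrightarrow> 1 < p \<Longrightarrow> b \<le> 1 + b powr p" for b p :: real
  using le_powr_div[of b 1 p] by simp

section \<open>Controlled paths\<close>

text \<open>\<open>a\<close> is the radial velocity of \<open>y\<close>, normalised to vanish while \<open>y\<close> sits at the vertex.\<close>

definition controlled ::
    "real \<Rightarrow> real \<Rightarrow> real \<Rightarrow> (real \<Rightarrow> real ^ 'n::finite) \<Rightarrow> (real \<Rightarrow> real) \<Rightarrow> bool" where
  "controlled p t t' y a \<longleftrightarrow> t \<le> t' \<and> (\<forall>s\<in>{t..t'}. y s \<in> junction) \<and>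
     set_borel_measurable lborel {t..t'} a \<and> (\<lambda>s. \<bar>a s\<bar> powr p) integrable_on {t..t'} \<and>
     (\<forall>s\<in>{t..t'}. y s = 0 \<longrightarrow> a s = 0) \<and>
     (\<forall>i. \<forall>s\<in>{t..t'}. ((\<lambda>\<sigma>. if 0 < y \<sigma> $ i then a \<sigma> else 0) has_integral (y s $ i - y t $ i)) {t..s})"

lemma controlledD:
  assumes "controlled p t t' y a"
  shows "t \<le> t'" "\<And>s. s \<in> {t..t'} \<Longrightarrow> y s \<in> junction" "set_borel_measurable lborel {t..t'} a"
    "(\<lambda>s. \<bar>a s\<bar> powr p) integrable_on {t..t'}" "\<And>s. s \<in> {t..t'} \<Longrightarrow> y s = 0 \<Longrightarrow> a s = 0"
    "\<And>i s. s \<in> {t..t'} \<Longrightarrow> ((\<lambda>\<sigma>. if 0 < y \<sigma> $ i then a \<sigma> else 0) has_integral (y s $ i - y t $ i)) {t..s}"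
  using assms by (auto simp: controlled_def)

lemma set_borel_measurable_abs_integrable:
  fixes a :: "real \<Rightarrow> real"
  assumes "set_borel_measurable lborel {t..t'} a" "h integrable_on {t..t'}"
    "\<And>s. s \<in> {t..t'} \<Longrightarrow> \<bar>a s\<bar> \<le> h s"
  shows "a absolutely_integrable_on {t..t'}" "set_integrable lborel {t..t'} a"
proof -
  have m: "(\<lambda>s. indicator {t..t'} s *\<^sub>R a s) \<in> borel_measurable lborel"
    using assms(1) by (simp add: set_borel_measurable_def)
  then have m': "(\<lambda>s. indicator {t..t'} s *\<^sub>R a s) \<in> borel_measurable lebesgue"
    by (rule measurable_completion)
  have "a \<in> borel_measurable (lebesgue_on {t..t'})"
    using m' by (subst borel_measurable_restrict_space_iff) auto
  then show ai: "a absolutely_integrable_on {t..t'}"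
    by (rule measurable_bounded_by_integrable_imp_absolutely_integrable)
      (use assms in auto)
  then show "set_integrable lborel {t..t'} a"
    using integrable_completion[OF m] by (simp add: set_integrable_def)
qed

lemma controlled_integrable:
  assumes y: "controlled p t t' y a" and p: "1 < p"
  shows "a absolutely_integrable_on {t..t'}" "set_integrable lborel {t..t'} a"
    "a integrable_on {t..t'}" "(\<lambda>s. \<bar>a s\<bar>) integrable_on {t..t'}"
proof -
  have i: "(\<lambda>s. 1 + \<bar>a s\<bar> powr p) integrable_on {t..t'}"
    using controlledD(4)[OF y] by (intro integrable_add) auto
  show "a absolutely_integrable_on {t..t'}" "set_integrable lborel {t..t'} a"
    by (rule set_borel_measurable_abs_integrable[OF controlledD(3)[OF y] i],
        use le_one_plus_powr[of "\<bar>a _\<bar>" p] p in auto)+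
  then show "a integrable_on {t..t'}" "(\<lambda>s. \<bar>a s\<bar>) integrable_on {t..t'}"
    by (auto simp: absolutely_integrable_on_def)
qed

lemma controlled_subset:
  assumes y: "controlled p t t' y a" and s: "t \<le> s" "s \<le> s'" "s' \<le> t'"
  shows "controlled p s s' y a"
  unfolding controlled_def
proof (intro conjI allI ballI impI)
  show "set_borel_measurable lborel {s..s'} a"
    by (rule set_borel_measurable_subset[OF controlledD(3)[OF y]]) (use s in auto)
  show "(\<lambda>s. \<bar>a s\<bar> powr p) integrable_on {s..s'}"
    by (rule integrable_subinterval_real[OF controlledD(4)[OF y]]) (use s in auto)
  fix i r assume r: "r \<in> {s..s'}"
  let ?f = "\<lambda>\<sigma>. if 0 < y \<sigma> $ i then a \<sigma> else 0"
  have 1: "(?f has_integral (y s $ i - y t $ i)) {t..s}" and 2: "(?f has_integral (y r $ i - y t $ i)) {t..r}"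
    using controlledD(6)[OF y, of s i] controlledD(6)[OF y, of r i] s r by auto
  have "?f integrable_on {s..r}"
    by (rule integrable_subinterval_real[OF has_integral_integrable[OF 2]]) (use s in auto)
  then obtain I where I: "(?f has_integral I) {s..r}" by blast
  from has_integral_combine[OF _ _ 1 I] s r have "(?f has_integral ((y s $ i - y t $ i) + I)) {t..r}" by auto
  from has_integral_unique[OF this 2] have "I = y r $ i - y s $ i" by simp
  then show "(?f has_integral (y r $ i - y s $ i)) {s..r}" using I by simp
qed (use s controlledD[OF y] in auto)

lemma controlled_join:
  assumes y: "controlled p t s y a" and z: "controlled p s t' z b" and eq: "y s = z s"
  shows "controlled p t t' (\<lambda>\<sigma>. if \<sigma> \<le> s then y \<sigma> else z \<sigma>) (\<lambda>\<sigma>. if \<sigma> \<le> s then a \<sigma> else b \<sigma>)"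
    (is "controlled p t t' ?y ?a")
  unfolding controlled_def
proof (intro conjI allI ballI impI)
  have ts: "t \<le> s" "s \<le> t'" using controlledD(1)[OF y] controlledD(1)[OF z] by auto
  then show "t \<le> t'" by simp
  have 1: "(\<lambda>x. indicator {t..s} x *\<^sub>R a x) \<in> borel_measurable lborel"
    using controlledD(3)[OF y] by (simp add: set_borel_measurable_def)
  have 2: "(\<lambda>x. indicator {s..t'} x *\<^sub>R b x) \<in> borel_measurable lborel"
    using controlledD(3)[OF z] by (simp add: set_borel_measurable_def)
  have "(\<lambda>x. if x \<le> s then indicator {t..s} x *\<^sub>R a x else indicator {s..t'} x *\<^sub>R b x) \<in> borel_measurable lborel"
    using 1 2 by measurable
  also have "(\<lambda>x. if x \<le> s then indicator {t..s} x *\<^sub>R a x else indicator {s..t'} x *\<^sub>R b x)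
      = (\<lambda>x. indicator {t..t'} x *\<^sub>R ?a x)"
    using ts by (intro ext) (auto simp: indicator_def)
  finally show "set_borel_measurable lborel {t..t'} ?a" by (simp add: set_borel_measurable_def)
  have glue: "((\<lambda>\<sigma>. f (?y \<sigma>) (?a \<sigma>)) has_integral (I + J)) {t..r}"
    if I: "((\<lambda>\<sigma>. f (y \<sigma>) (a \<sigma>)) has_integral I) {t..s}" and J: "((\<lambda>\<sigma>. f (z \<sigma>) (b \<sigma>)) has_integral J) {s..r}" and r: "s \<le> r"
    for f :: "real ^ 'a \<Rightarrow> real \<Rightarrow> real" and I J r
  proof (rule has_integral_combine[OF ts(1) r])
    show "((\<lambda>\<sigma>. f (?y \<sigma>) (?a \<sigma>)) has_integral I) {t..s}"
      by (rule has_integral_eq[OF _ I]) auto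
    show "((\<lambda>\<sigma>. f (?y \<sigma>) (?a \<sigma>)) has_integral J) {s..r}"
      by (rule has_integral_spike_finite[OF _ _ J, of "{s}"]) (use r in auto)
  qed
  show "(\<lambda>\<sigma>. \<bar>?a \<sigma>\<bar> powr p) integrable_on {t..t'}"
    using glue[of "\<lambda>_ a. \<bar>a\<bar> powr p", OF integrable_integral[OF controlledD(4)[OF y]] integrable_integral[OF controlledD(4)[OF z]] ts(2)]
    by (rule has_integral_integrable)
  fix i r assume r: "r \<in> {t..t'}"
  show "((\<lambda>\<sigma>. if 0 < ?y \<sigma> $ i then ?a \<sigma> else 0) has_integral (?y r $ i - ?y t $ i)) {t..r}"
  proof (cases "r \<le> s")
    case True
    then have "((\<lambda>\<sigma>. if 0 < y \<sigma> $ i then a \<sigma> else 0) has_integral (y r $ i - y t $ i)) {t..r}"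
      using controlledD(6)[OF y, of r i] r by auto
    then have "((\<lambda>\<sigma>. if 0 < ?y \<sigma> $ i then ?a \<sigma> else 0) has_integral (y r $ i - y t $ i)) {t..r}"
      by (rule has_integral_eq[rotated]) (use True in auto)
    then show ?thesis using True ts by simp
  next
    case False
    have "((\<lambda>\<sigma>. if 0 < ?y \<sigma> $ i then ?a \<sigma> else 0) has_integral ((y s $ i - y t $ i) + (z r $ i - z s $ i))) {t..r}"
      by (rule glue[of "\<lambda>y a. if 0 < y $ i then a else 0"])
        (use controlledD(6)[OF y, of s i] controlledD(6)[OF z, of r i] ts r False in auto)
    then show ?thesis using False ts eq by simp
  qed
qed (use controlledD[OF y] controlledD[OF z] in auto)

text \<open>The prescribed velocity is switched off on the zero set of \<open>\<rho>\<close>, as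
  \<open>controlled\<close> demands at the vertex; by \<open>integral_velocity_positive_part\<close>
  the motion is unchanged.\<close>

lemma controlled_axis:
  fixes \<rho> a :: "real \<Rightarrow> real" and i :: "'n::finite"
  assumes "t \<le> t'" and p: "1 < p" and m: "set_borel_measurable lborel {t..t'} a"
    and ap: "(\<lambda>s. \<bar>a s\<bar> powr p) integrable_on {t..t'}"
    and \<rho>: "\<And>s. s \<in> {t..t'} \<Longrightarrow> \<rho> s = \<rho> t + integral {t..s} a"
    and pos: "\<And>s. s \<in> {t..t'} \<Longrightarrow> 0 \<le> \<rho> s"
  shows "controlled p t t' (\<lambda>s. \<rho> s *\<^sub>R axis i 1) (\<lambda>s. if 0 < \<rho> s then a s else 0)"
proof -
  have "(\<lambda>s. 1 + \<bar>a s\<bar> powr p) integrable_on {t..t'}"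
    using ap by (intro integrable_add) auto
  from set_borel_measurable_abs_integrable(1)[OF m this]
  have ai: "a absolutely_integrable_on {t..t'}" using le_one_plus_powr[of "\<bar>a _\<bar>" p] p by auto
  then have ii: "a integrable_on {t..t'}" by (auto simp: absolutely_integrable_on_def)
  have \<rho>c: "continuous_on {t..t'} \<rho>"
  proof -
    have "continuous_on {t..t'} (\<lambda>s. \<rho> t + integral {t..s} a)"
      by (intro continuous_intros indefinite_integral_continuous_1 ii)
    then show ?thesis
      by (rule continuous_on_eq) (simp add: \<rho>[symmetric])
  qed
  have meas: "set_borel_measurable lborel {t..t'} (\<lambda>s. if 0 < \<rho> s then a s else 0)"
  proof -
    have [measurable]: "(\<lambda>s. indicator {t..t'} s *\<^sub>R a s) \<in> borel_measurable borel"
      using m by (simp add: set_borel_measurable_def)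
    have [measurable]: "(\<lambda>s. indicator {t..t'} s *\<^sub>R \<rho> s) \<in> borel_measurable borel"
      by (rule borel_measurable_continuous_on_indicator) (auto intro: \<rho>c)
    have "(\<lambda>s. if 0 < indicator {t..t'} s *\<^sub>R \<rho> s then indicator {t..t'} s *\<^sub>R a s else 0) \<in> borel_measurable borel"
      by measurable
    also have "(\<lambda>s. if 0 < indicator {t..t'} s *\<^sub>R \<rho> s then indicator {t..t'} s *\<^sub>R a s else 0) =
        (\<lambda>s. indicator {t..t'} s *\<^sub>R (if 0 < \<rho> s then a s else 0))"
      by (auto simp: indicator_def)
    finally show ?thesis by (simp add: set_borel_measurable_def)
  qed
  have "set_integrable lborel {t..t'} (\<lambda>s. \<bar>if 0 < \<rho> s then a s else 0\<bar> powr p)"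
  proof (rule set_borel_measurable_abs_integrable(2)[OF _ ap])
    have [measurable]: "(\<lambda>s. indicator {t..t'} s *\<^sub>R (if 0 < \<rho> s then a s else 0)) \<in> borel_measurable borel"
      using meas by (simp add: set_borel_measurable_def)
    have "(\<lambda>s. \<bar>indicator {t..t'} s *\<^sub>R (if 0 < \<rho> s then a s else 0)\<bar> powr p) \<in> borel_measurable borel"
      by measurable
    also have "(\<lambda>s. \<bar>indicator {t..t'} s *\<^sub>R (if 0 < \<rho> s then a s else 0)\<bar> powr p) =
       (\<lambda>s. indicator {t..t'} s *\<^sub>R (\<bar>if 0 < \<rho> s then a s else 0\<bar> powr p))"
      using p by (auto simp: indicator_def)
    finally show "set_borel_measurable lborel {t..t'} (\<lambda>s. \<bar>if 0 < \<rho> s then a s else 0\<bar> powr p)"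
      by (simp add: set_borel_measurable_def)
    show "\<bar>\<bar>if 0 < \<rho> s then a s else 0\<bar> powr p\<bar> \<le> \<bar>a s\<bar> powr p" for s
      using p by (cases "0 < \<rho> s") simp_all
  qed
  then have pint: "(\<lambda>s. \<bar>if 0 < \<rho> s then a s else 0\<bar> powr p) integrable_on {t..t'}"
    by (rule set_borel_integral_eq_integral(1))
  have comp: "((\<lambda>\<sigma>. if 0 < (\<rho> \<sigma> *\<^sub>R axis i (1::real)) $ j then if 0 < \<rho> \<sigma> then a \<sigma> else 0 else 0) has_integral
      ((\<rho> s *\<^sub>R axis i 1) $ j - (\<rho> t *\<^sub>R axis i 1) $ j)) {t..s}" if s: "s \<in> {t..t'}" for j s
  proof (cases "j = i")
    case True
    have "((\<lambda>\<sigma>. if 0 < \<rho> \<sigma> then a \<sigma> else 0) has_integral (\<rho> s - \<rho> t)) {t..s}"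
      by (rule integral_velocity_positive_part)
        (use s absolutely_integrable_on_subinterval[OF ai, of t s] in \<open>auto intro: pos \<rho>\<close>)
    also have "(\<lambda>\<sigma>. if 0 < \<rho> \<sigma> then a \<sigma> else 0) =
        (\<lambda>\<sigma>. if 0 < (\<rho> \<sigma> *\<^sub>R axis i (1::real)) $ j then if 0 < \<rho> \<sigma> then a \<sigma> else 0 else 0)"
      using True by (auto simp: axis_def)
    finally show ?thesis using True by (simp add: axis_def)
  qed (auto simp: axis_def)
  show ?thesis
    unfolding controlled_def using assms(1) meas pint pos comp
    by auto
qed

lemma controlled_affine:
  fixes i :: "'n::finite"
  assumes "t \<le> t'" "1 < p" "0 \<le> \<alpha>" "0 \<le> \<alpha> + \<beta> * (t' - t)"
  shows "controlled p t t' (\<lambda>s. (\<alpha> + \<beta> * (s - t)) *\<^sub>R axis i 1) (\<lambda>s. if 0 < \<alpha> + \<beta> * (s - t) then \<beta> else 0)"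
proof (rule controlled_axis[OF assms(1,2)])
  fix s assume s: "s \<in> {t..t'}"
  show "0 \<le> \<alpha> + \<beta> * (s - t)"
  proof (cases "0 \<le> \<beta>")
    case False
    then have "\<beta> * (t' - t) \<le> \<beta> * (s - t)" using s by (intro mult_left_mono_neg) auto
    then show ?thesis using assms by linarith
  qed (use assms s in auto)
qed (use assms in \<open>auto simp: set_borel_measurable_def\<close>)

lemma controlled_component_continuous:
  assumes y: "controlled p t t' y a"
  shows "continuous_on {t..t'} (\<lambda>s. y s $ i)"
proof -
  have "(\<lambda>\<sigma>. if 0 < y \<sigma> $ i then a \<sigma> else 0) integrable_on {t..t'}"
    using controlledD(6)[OF y, of t' i] controlledD(1)[OF y] by (auto simp: has_integral_integrable)
  from indefinite_integral_continuous_1[OF this]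
  have "continuous_on {t..t'} (\<lambda>s. y t $ i + integral {t..s} (\<lambda>\<sigma>. if 0 < y \<sigma> $ i then a \<sigma> else 0))"
    by (intro continuous_intros)
  then show ?thesis
    by (rule continuous_on_eq) (use integral_unique[OF controlledD(6)[OF y]] in auto)
qed

lemma controlled_continuous:
  assumes y: "controlled p t t' y a"
  shows "continuous_on {t..t'} y"
proof -
  have "continuous_on {t..t'} (\<lambda>s. \<chi> i. y s $ i)"
    by (intro continuous_on_vec_lambda controlled_component_continuous[OF y])
  then show ?thesis by simp
qed

text \<open>At each time at most one coordinate is positive, so the speeds of the coordinates sum to
  at most \<open>\<bar>a s\<bar>\<close>.\<close>

lemma controlled_l1_dist:
  assumes y: "controlled p t t' y a" and p: "1 < p"
  shows "l1_dist (y t) (y t') \<le> integral {t..t'} (\<lambda>s. \<bar>a s\<bar>)"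
proof -
  have tt: "t \<le> t'" using controlledD(1)[OF y] .
  let ?a = "\<lambda>i \<sigma>. if 0 < y \<sigma> $ i then a \<sigma> else 0"
  have ai: "?a i absolutely_integrable_on {t..t'}" for i
  proof (rule set_borel_measurable_abs_integrable(1)[OF _ controlled_integrable(4)[OF y p]])
    have [measurable]: "(\<lambda>s. indicator {t..t'} s *\<^sub>R a s) \<in> borel_measurable borel"
      using controlledD(3)[OF y] by (simp add: set_borel_measurable_def)
    have [measurable]: "(\<lambda>s. indicator {t..t'} s *\<^sub>R (y s $ i)) \<in> borel_measurable borel"
      by (rule borel_measurable_continuous_on_indicator) (auto intro: controlled_component_continuous[OF y])
    have "(\<lambda>s. if 0 < indicator {t..t'} s *\<^sub>R (y s $ i) then indicator {t..t'} s *\<^sub>R a s else 0) \<in> borel_measurable borel"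
      by measurable
    also have "(\<lambda>s. if 0 < indicator {t..t'} s *\<^sub>R (y s $ i) then indicator {t..t'} s *\<^sub>R a s else 0) =
        (\<lambda>s. indicator {t..t'} s *\<^sub>R ?a i s)"
      by (auto simp: indicator_def)
    finally show "set_borel_measurable lborel {t..t'} (?a i)" by (simp add: set_borel_measurable_def)
  qed auto
  then have ai': "(\<lambda>s. \<bar>?a i s\<bar>) integrable_on {t..t'}" for i
    by (auto simp: absolutely_integrable_on_def)
  have "\<bar>y t $ i - y t' $ i\<bar> \<le> integral {t..t'} (\<lambda>s. \<bar>?a i s\<bar>)" for i
  proof -
    have "\<bar>y t $ i - y t' $ i\<bar> = norm (integral {t..t'} (?a i))"
      using integral_unique[OF controlledD(6)[OF y, of t' i]] tt by (simp add: abs_minus_commute)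
    also have "\<dots> \<le> integral {t..t'} (\<lambda>s. \<bar>?a i s\<bar>)"
      by (rule Henstock_Kurzweil_Integration.integral_norm_bound_integral)
        (use controlledD(6)[OF y, of t' i] tt ai' in \<open>auto simp: has_integral_integrable\<close>)
    finally show ?thesis .
  qed
  then have "l1_dist (y t) (y t') \<le> (\<Sum>i\<in>UNIV. integral {t..t'} (\<lambda>s. \<bar>?a i s\<bar>))"
    unfolding l1_dist_def by (rule sum_mono)
  also have "\<dots> = integral {t..t'} (\<lambda>s. \<Sum>i\<in>UNIV. \<bar>?a i s\<bar>)"
    by (rule integral_sum[symmetric]) (use ai' in auto)
  also have "\<dots> \<le> integral {t..t'} (\<lambda>s. \<bar>a s\<bar>)"
  proof (rule integral_le)
    show "(\<lambda>s. \<Sum>i\<in>UNIV. \<bar>?a i s\<bar>) integrable_on {t..t'}" by (rule integrable_sum) (use ai' in auto)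
    show "(\<lambda>s. \<bar>a s\<bar>) integrable_on {t..t'}" by (rule controlled_integrable(4)[OF y p])
    fix s assume "s \<in> {t..t'}"
    then have "y s \<in> junction" using controlledD(2)[OF y] by blast
    then obtain j where "\<And>i. i \<noteq> j \<Longrightarrow> y s $ i = 0" using junctionE by metis
    then have "(\<Sum>i\<in>UNIV. \<bar>?a i s\<bar>) = \<bar>?a j s\<bar>" by (subst sum.remove[of _ j]) auto
    then show "(\<Sum>i\<in>UNIV. \<bar>?a i s\<bar>) \<le> \<bar>a s\<bar>" by simp
  qed
  finally show ?thesis .
qed

lemma controlled_edge_integral:
  assumes y: "controlled p t t' y a" and p: "1 < p" and pos: "\<And>s. t \<le> s \<Longrightarrow> s < t' \<Longrightarrow> 0 < y s $ i"
    and s: "s \<in> {t..t'}"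
  shows "y s $ i = y t $ i + integral {t..s} a"
proof -
  have "(a has_integral (y s $ i - y t $ i)) {t..s}"
    by (rule has_integral_spike_finite[OF _ _ controlledD(6)[OF y s], of "{t'}"]) (use pos s in force)+
  then show ?thesis by (simp add: integral_unique)
qed

text \<open>The continuous function \<open>f\<close> below equals the norm on edge \<open>i\<close>
  and minus the norm on every other edge. A change of edge would therefore produce a zero of
  \<open>f\<close>, and \<open>f\<close> vanishes only at the vertex.\<close>

lemma controlled_stays_on_edge:
  assumes y: "controlled p t t' y a" and i: "y r \<in> edge i" "r \<in> {t..t'}" "y r \<noteq> 0"
    and nz: "\<And>s. s \<in> {t..t'} \<Longrightarrow> y s \<noteq> 0" and s: "s \<in> {t..t'}"
  shows "0 < y s $ i"
proof (rule ccontr)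
  assume "\<not> 0 < y s $ i"
  have yj: "y \<sigma> \<in> junction" if "\<sigma> \<in> {t..t'}" for \<sigma> using controlledD(2)[OF y that] .
  have si: "y s $ i = 0" using \<open>\<not> 0 < y s $ i\<close> junction_nonneg[OF yj[OF s], of i] by simp
  have ri: "0 < y r $ i" using i junction_nonneg[OF yj[OF i(2)]] by (metis edge_eq_axis order_le_less scale_eq_0_iff)
  define f where "f \<sigma> = 2 * y \<sigma> $ i - (\<Sum>j\<in>UNIV. y \<sigma> $ j)" for \<sigma>
  have fn: "f \<sigma> = 2 * y \<sigma> $ i - norm (y \<sigma>)" if "\<sigma> \<in> {t..t'}" for \<sigma>
    using norm_junction[OF yj[OF that]] by (simp add: f_def)
  have fc: "continuous_on {t..t'} f"
    unfolding f_def by (intro continuous_intros controlled_component_continuous[OF y])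
  have "connected (f ` {t..t'})" by (rule connected_continuous_image[OF fc]) simp
  moreover have "f s < 0" "f r > 0" using fn[OF s] fn[OF i(2)] si ri norm_edge[OF i(1)] nz[OF s] by auto
  ultimately have "0 \<in> f ` {t..t'}" using s i(2) by (meson connectedD_interval image_eqI less_imp_le)
  then obtain \<sigma> where \<sigma>: "\<sigma> \<in> {t..t'}" "2 * y \<sigma> $ i = norm (y \<sigma>)" using fn by fastforce
  have "0 < y \<sigma> $ i" using \<sigma>(2) nz[OF \<sigma>(1)] by (metis zero_less_mult_pos zero_less_norm_iff zero_less_numeral)
  then have "norm (y \<sigma>) = y \<sigma> $ i" using junction_pos_edge[OF yj[OF \<sigma>(1)]] norm_edge by blast
  then show False using \<sigma>(2) \<open>0 < y \<sigma> $ i\<close> by simp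
qed

section \<open>The optimal control problem\<close>

text \<open>The problem after the flow of measures has been inserted into the costs, with bounds
  uniform in time. Convexity enters through \<open>L_tangent\<close>, a supporting line at zero
  velocity; \<open>g\<close> is lower semicontinuous because the terminal cost may drop at the
  vertex.\<close>

locale control =
  fixes L :: "'n::finite \<Rightarrow> real \<Rightarrow> real \<Rightarrow> real \<Rightarrow> real" and L0 :: "real \<Rightarrow> real"
    and g :: "real ^ 'n \<Rightarrow> real" and p T C0 :: real
  assumes T: "0 < T" and p: "1 < p" and C0: "0 < C0"
    and L_continuous: "\<And>i. continuous_on UNIV (\<lambda>(s, x, a). L i s x a)"
    and L0_continuous: "continuous_on UNIV L0"
    and coercive: "\<And>i s x a. 0 \<le> x \<Longrightarrow> C0 * (\<bar>a\<bar> powr p - 1) \<le> L i s x a"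
    and L0_ge: "\<And>s. - C0 \<le> L0 s"
    and L0_le: "\<And>i s. L0 s \<le> L i s 0 0"
    and L_bounded: "\<And>r. 0 < r \<Longrightarrow> \<exists>K. \<forall>i s. \<forall>x\<in>{0..r}. \<bar>L i s x 0\<bar> \<le> K"
    and L0_bounded: "\<exists>K. \<forall>s. \<bar>L0 s\<bar> \<le> K"
    and L_lipschitz_x: "\<And>r. 0 < r \<Longrightarrow> \<exists>c\<ge>0. \<forall>i s a. \<forall>x\<in>{0..r}. \<forall>x'\<in>{0..r}.
      \<bar>L i s x a - L i s x' a\<bar> \<le> c * (\<bar>a\<bar> powr p + 1) * \<bar>x - x'\<bar>"
    and L_lipschitz_a: "\<And>r. 0 < r \<Longrightarrow> \<exists>c\<ge>0. \<forall>i s a a'. \<forall>x\<in>{0..r}.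
      \<bar>L i s x a - L i s x a'\<bar> \<le> c * ((max \<bar>a\<bar> \<bar>a'\<bar>) powr (p - 1) + 1) * \<bar>a - a'\<bar>"
    and L_time: "\<And>r e. 0 < r \<Longrightarrow> 0 < e \<Longrightarrow> \<exists>d>0. \<forall>i s s' a. \<forall>x\<in>{0..r}.
      \<bar>s - s'\<bar> < d \<longrightarrow> \<bar>L i s x a - L i s' x a\<bar> \<le> e * (1 + \<bar>a\<bar> powr p)"
    and L_tangent: "\<And>i s. \<exists>b. \<forall>a. L i s 0 0 + b * a \<le> L i s 0 a"
    and g_bounded: "\<exists>B. \<forall>x\<in>junction. \<bar>g x\<bar> \<le> B"
    and g_lsc: "\<And>x e. x \<in> junction \<Longrightarrow> 0 < e \<Longrightarrow> \<exists>d>0. \<forall>z\<in>junction. l1_dist x z < d \<longrightarrow> g x - e \<le> g z"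
begin

section \<open>The running cost along a controlled path\<close>

definition running :: "real \<Rightarrow> real ^ 'n \<Rightarrow> real \<Rightarrow> real" where
  "running s x a = (\<Sum>i\<in>UNIV. L i s (norm x) a * indicator (edge i - {0}) x) + L0 s * indicator {0} x"

lemma running_zero [simp]: "running s 0 a = L0 s"
  by (simp add: running_def)

lemma running_edge:
  assumes "x \<in> junction" "0 < x $ i"
  shows "running s x a = L i s (x $ i) a"
proof -
  have xi: "x \<in> edge i" using assms by (rule junction_pos_edge)
  have "x \<noteq> 0" using assms(2) by auto
  have "x \<notin> edge j" if "j \<noteq> i" for j using assms(2) that by (auto simp: edge_iff)
  then have "(\<Sum>j\<in>UNIV. L j s (norm x) a * indicator (edge j - {0}) x) = L i s (norm x) a"
    using xi \<open>x \<noteq> 0\<close> by (subst sum.remove[of _ i]) auto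
  then show ?thesis using \<open>x \<noteq> 0\<close> norm_edge[OF xi] by (simp add: running_def)
qed

text \<open>At the vertex the cost does not see the velocity, so coercivity there relies on the
  normalisation \<open>a = 0\<close>.\<close>

lemma running_lower:
  assumes x: "x \<in> junction" "x = 0 \<Longrightarrow> a = 0"
  shows "C0 * (\<bar>a\<bar> powr p - 1) \<le> running s x a"
proof (cases "x = 0")
  case True then show ?thesis using L0_ge x(2) by simp
next
  case False
  then obtain i where "0 < x $ i" using junction_pos_component x(1) by blast
  then show ?thesis using running_edge[OF x(1)] coercive by simp
qed

lemma running_upper:
  assumes "0 < r"
  obtains K where "1 \<le> K"
    "\<And>s x a. x \<in> junction \<Longrightarrow> norm x \<le> r \<Longrightarrow> \<bar>running s x a\<bar> \<le> K * (1 + \<bar>a\<bar> powr p)"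
proof -
  obtain K1 where K1: "\<And>i s x. x \<in> {0..r} \<Longrightarrow> \<bar>L i s x 0\<bar> \<le> K1" using L_bounded[OF assms] by metis
  obtain K2 where K2: "\<And>s. \<bar>L0 s\<bar> \<le> K2" using L0_bounded by blast
  obtain c where c: "c \<ge> 0" "\<And>i s a a' x. x \<in> {0..r} \<Longrightarrow>
      \<bar>L i s x a - L i s x a'\<bar> \<le> c * ((max \<bar>a\<bar> \<bar>a'\<bar>) powr (p - 1) + 1) * \<bar>a - a'\<bar>"
    using L_lipschitz_a[OF assms] by metis
  define K where "K = \<bar>K1\<bar> + \<bar>K2\<bar> + 2 * c + 1"
  have "\<bar>running s x a\<bar> \<le> K * (1 + \<bar>a\<bar> powr p)" if x: "x \<in> junction" "norm x \<le> r" for s x a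
  proof (cases "x = 0")
    case True
    have "\<bar>L0 s\<bar> \<le> K * 1" using K2[of s] c(1) by (simp add: K_def)
    also have "\<dots> \<le> K * (1 + \<bar>a\<bar> powr p)" using c(1) by (intro mult_left_mono) (auto simp: K_def)
    finally show ?thesis using True by simp
  next
    case False
    then obtain i where i: "0 < x $ i" using junction_pos_component x(1) by blast
    have xr: "x $ i \<in> {0..r}" using i x norm_edge[OF junction_pos_edge[OF x(1) i]] by simp
    have pw: "\<bar>a\<bar> powr (p - 1) * \<bar>a\<bar> = \<bar>a\<bar> powr p"
      using p by (cases "a = 0") (auto simp: powr_mult_base mult.commute)
    have "\<bar>L i s (x $ i) a\<bar> \<le> \<bar>K1\<bar> + c * (\<bar>a\<bar> powr (p - 1) + 1) * \<bar>a\<bar>"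
      using K1[OF xr, of i s] c(2)[OF xr, of i s a 0, unfolded abs_zero max_absorb1[OF abs_ge_zero]] by simp
    also have "c * (\<bar>a\<bar> powr (p - 1) + 1) * \<bar>a\<bar> = c * (\<bar>a\<bar> powr p + \<bar>a\<bar>)"
      using pw by (simp add: algebra_simps)
    also have "\<dots> \<le> c * (\<bar>a\<bar> powr p + (1 + \<bar>a\<bar> powr p))"
      using c(1) p by (intro mult_left_mono add_left_mono le_one_plus_powr) auto
    also have "\<bar>K1\<bar> + \<dots> \<le> (\<bar>K1\<bar> + 2 * c) * (1 + \<bar>a\<bar> powr p)"
      using c(1) by (simp add: algebra_simps)
    also have "\<dots> \<le> K * (1 + \<bar>a\<bar> powr p)" by (intro mult_right_mono) (auto simp: K_def)
    finally show ?thesis using running_edge[OF x(1) i] by simp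
  qed
  moreover have "1 \<le> K" using c(1) by (simp add: K_def)
  ultimately show ?thesis using that by blast
qed

lemma controlled_bounded:
  assumes "controlled p t t' (y :: real \<Rightarrow> real ^ 'n) a"
  obtains r where "0 < r" "\<And>s. s \<in> {t..t'} \<Longrightarrow> norm (y s) \<le> r"
proof -
  have "compact (y ` {t..t'})"
    by (intro compact_continuous_image controlled_continuous[OF assms]) auto
  then show ?thesis using that by (auto dest!: compact_imp_bounded simp: bounded_pos)
qed

lemma running_borel:
  assumes [measurable]: "y \<in> borel_measurable borel" "a \<in> borel_measurable borel"
  shows "(\<lambda>s. running s (y s) (a s)) \<in> borel_measurable borel"
proof -
  have Lm: "(\<lambda>(s, x, a). L i s x a) \<in> borel_measurable borel" for i
    using L_continuous by (rule borel_measurable_continuous_onI)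
  have [measurable]: "L0 \<in> borel_measurable borel"
    using L0_continuous by (rule borel_measurable_continuous_onI)
  have [measurable]: "(\<lambda>s. L i s (norm (y s)) (a s)) \<in> borel_measurable borel" for i
  proof -
    have "(\<lambda>s. (s, norm (y s), a s)) \<in> borel_measurable borel"
      by (intro borel_measurable_Pair) measurable
    from measurable_compose[OF this Lm] show ?thesis by simp
  qed
  have closed: "closed (edge i)" for i :: 'n
  proof -
    have "edge i = {x. 0 \<le> x $ i} \<inter> (\<Inter>j\<in>-{i}. {x. x $ j = 0})" by (auto simp: edge_iff)
    also have "closed \<dots>" by (intro closed_Int closed_INT ballI closed_Collect_le closed_Collect_eq continuous_intros)
    finally show ?thesis .
  qed
  have [measurable]: "edge i \<in> sets borel" for i :: 'n using closed by (rule borel_closed)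
  show ?thesis unfolding running_def by measurable
qed

lemma running_set_integrable:
  assumes y: "controlled p t t' y a"
  shows "set_integrable lborel {t..t'} (\<lambda>s. running s (y s) (a s))"
proof -
  obtain r where r: "0 < r" "\<And>s. s \<in> {t..t'} \<Longrightarrow> norm (y s) \<le> r" using controlled_bounded[OF y] by blast
  obtain K where K: "1 \<le> K" "\<And>s x a. x \<in> junction \<Longrightarrow> norm x \<le> r \<Longrightarrow> \<bar>running s x a\<bar> \<le> K * (1 + \<bar>a\<bar> powr p)"
    using running_upper[OF r(1)] by metis
  have meas: "set_borel_measurable lborel {t..t'} (\<lambda>s. running s (y s) (a s))"
  proof -
    define y' where "y' s = indicator {t..t'} s *\<^sub>R y s" for s
    define a' where "a' s = indicator {t..t'} s *\<^sub>R a s" for s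
    have [measurable]: "y' \<in> borel_measurable borel"
      unfolding y'_def[abs_def]
      by (rule borel_measurable_continuous_on_indicator) (auto intro: controlled_continuous[OF y])
    have [measurable]: "a' \<in> borel_measurable borel"
      using controlledD(3)[OF y] by (simp add: a'_def[abs_def] set_borel_measurable_def)
    have "(\<lambda>s. indicator {t..t'} s *\<^sub>R running s (y' s) (a' s)) \<in> borel_measurable borel"
      using running_borel[of y' a'] by measurable
    also have "(\<lambda>s. indicator {t..t'} s *\<^sub>R running s (y' s) (a' s)) = (\<lambda>s. indicator {t..t'} s *\<^sub>R running s (y s) (a s))"
      by (auto simp: y'_def a'_def indicator_def)
    finally show ?thesis by (simp add: set_borel_measurable_def)
  qed
  show ?thesis
  proof (rule set_borel_measurable_abs_integrable(2)[OF meas])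
    show "(\<lambda>s. K * (1 + \<bar>a s\<bar> powr p)) integrable_on {t..t'}"
      by (intro integrable_on_mult_right integrable_add controlledD(4)[OF y]) auto
  qed (use K r controlledD(2)[OF y] in auto)
qed

lemma running_integrable:
  "controlled p t t' y a \<Longrightarrow> (\<lambda>s. running s (y s) (a s)) integrable_on {t..t'}"
  using running_set_integrable set_borel_integral_eq_integral(1) by blast

section \<open>Cost and energy of a path\<close>

definition cost :: "real \<Rightarrow> real \<Rightarrow> (real \<Rightarrow> real ^ 'n) \<Rightarrow> (real \<Rightarrow> real) \<Rightarrow> real" where
  "cost t t' y a = integral {t..t'} (\<lambda>s. running s (y s) (a s))"

definition energy :: "real \<Rightarrow> real \<Rightarrow> (real \<Rightarrow> real) \<Rightarrow> real" where
  "energy t t' a = integral {t..t'} (\<lambda>s. \<bar>a s\<bar> powr p)"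

lemma cost_refl [simp]: "cost t t y a = 0"
  by (simp add: cost_def)

lemma cost_combine:
  assumes "controlled p t t' y a" "t \<le> s" "s \<le> t'"
  shows "cost t s y a + cost s t' y a = cost t t' y a"
  unfolding cost_def using assms
  by (intro Henstock_Kurzweil_Integration.integral_combine running_integrable)

lemma cost_cong:
  "(\<And>s. s \<in> {t..t'} \<Longrightarrow> y s = y' s) \<Longrightarrow> (\<And>s. s \<in> {t..t'} \<Longrightarrow> a s = a' s) \<Longrightarrow> cost t t' y a = cost t t' y' a'"
  unfolding cost_def by (rule integral_cong) simp

lemma cost_join:
  assumes y: "controlled p t s y a" and z: "controlled p s t' z b" and eq: "y s = z s"
  shows "cost t t' (\<lambda>\<sigma>. if \<sigma> \<le> s then y \<sigma> else z \<sigma>) (\<lambda>\<sigma>. if \<sigma> \<le> s then a \<sigma> else b \<sigma>) =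
    cost t s y a + cost s t' z b"
proof -
  let ?y = "\<lambda>\<sigma>. if \<sigma> \<le> s then y \<sigma> else z \<sigma>" and ?a = "\<lambda>\<sigma>. if \<sigma> \<le> s then a \<sigma> else b \<sigma>"
  have "cost s t' ?y ?a = cost s t' z b"
    unfolding cost_def by (rule integral_spike[of "{s}"]) auto
  moreover have "cost t s ?y ?a = cost t s y a" by (rule cost_cong) auto
  ultimately show ?thesis
    using cost_combine[OF controlled_join[OF y z eq], of s] controlledD(1)[OF y] controlledD(1)[OF z] by simp
qed

lemma energy_nonneg [simp]: "0 \<le> energy t t' a"
  unfolding energy_def by (cases "(\<lambda>s. \<bar>a s\<bar> powr p) integrable_on {t..t'}")
    (auto intro: Henstock_Kurzweil_Integration.integral_nonneg simp: not_integrable_integral)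

lemma energy_mono:
  assumes "controlled p t t' y a" "t \<le> s" "s \<le> s'" "s' \<le> t'"
  shows "energy s s' a \<le> energy t t' a"
  unfolding energy_def
  by (rule integral_subset_le)
    (use assms controlledD(4)[OF assms(1)] in \<open>auto intro: integrable_subinterval_real\<close>)

lemma cost_lower:
  assumes y: "controlled p t t' y a"
  shows "C0 * (energy t t' a - (t' - t)) \<le> cost t t' y a"
proof -
  have i: "(\<lambda>s. \<bar>a s\<bar> powr p - 1) integrable_on {t..t'}"
    using controlledD(4)[OF y] by (intro integrable_diff) auto
  have "integral {t..t'} (\<lambda>s. C0 * (\<bar>a s\<bar> powr p - 1)) \<le> cost t t' y a"
    unfolding cost_def
    by (rule integral_le) (use i running_integrable[OF y] controlledD(2,5)[OF y] in \<open>auto intro!: running_lower integrable_on_mult_right\<close>)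
  also have "integral {t..t'} (\<lambda>s. C0 * (\<bar>a s\<bar> powr p - 1)) = C0 * (energy t t' a - (t' - t))"
    using controlledD(1)[OF y] Henstock_Kurzweil_Integration.integral_diff[OF controlledD(4)[OF y] integrable_const_ivl[of "1::real" t t']]
    by (simp add: energy_def)
  finally show ?thesis .
qed

lemma cost_ge: "controlled p t t' y a \<Longrightarrow> - C0 * (t' - t) \<le> cost t t' y a"
  using cost_lower[of t t' y a] mult_nonneg_nonneg[OF less_imp_le[OF C0] energy_nonneg[of t t' a]]
  unfolding right_diff_distrib by linarith

text \<open>The integrated form of \<open>powr_ge_linear\<close>: for every reference speed
  \<open>l\<close>, distance is paid for at rate \<open>l powr (p - 1)\<close>, up to a term linear
  in time.\<close>

lemma energy_ge:
  assumes y: "controlled p t t' (y :: real \<Rightarrow> real ^ 'n) a" and l: "0 < l"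
  shows "l powr (p - 1) * l1_dist (y t) (y t') - l powr p * (t' - t) \<le> energy t t' a"
proof -
  have "l powr (p - 1) * l1_dist (y t) (y t') \<le> l powr (p - 1) * integral {t..t'} (\<lambda>s. \<bar>a s\<bar>)"
    using controlled_l1_dist[OF y p] by (intro mult_left_mono) auto
  moreover have "l powr (p - 1) * integral {t..t'} (\<lambda>s. \<bar>a s\<bar>) - l powr p * (t' - t) =
      integral {t..t'} (\<lambda>s. l powr (p - 1) * \<bar>a s\<bar> - l powr p)"
    using controlledD(1)[OF y] controlled_integrable(4)[OF y p]
    by (subst Henstock_Kurzweil_Integration.integral_diff) (auto intro: integrable_on_mult_right)
  moreover have "\<dots> \<le> energy t t' a"
    unfolding energy_def
    by (rule integral_le)
      (use controlled_integrable(4)[OF y p] controlledD(4)[OF y] powr_ge_linear[OF _ l p] in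
        \<open>auto intro!: integrable_diff integrable_on_mult_right\<close>)
  ultimately show ?thesis by linarith
qed

lemma l1_dist_le_energy:
  assumes y: "controlled p t t' (y :: real \<Rightarrow> real ^ 'n) a" and l: "0 < l"
  shows "l1_dist (y t) (y t') \<le> l * (t' - t) + energy t t' a / l powr (p - 1)"
proof -
  have "l powr (p - 1) * l1_dist (y t) (y t') \<le> l powr p * (t' - t) + energy t t' a"
    using energy_ge[OF y l] by simp
  also have "l powr p = l powr (p - 1) * l" using l by (simp add: powr_mult_base mult.commute)
  finally show ?thesis using l by (simp add: field_simps)
qed

lemma cost_upper:
  assumes y: "controlled p t t' y a" and K: "\<And>s x a. x \<in> junction \<Longrightarrow> norm x \<le> r \<Longrightarrow> \<bar>running s x a\<bar> \<le> K * (1 + \<bar>a\<bar> powr p)"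
    and b: "\<And>s. s \<in> {t..t'} \<Longrightarrow> norm (y s) \<le> r" "\<And>s. s \<in> {t..t'} \<Longrightarrow> \<bar>a s\<bar> \<le> v" and "0 \<le> K"
  shows "cost t t' y a \<le> K * (1 + v powr p) * (t' - t)"
proof -
  have "cost t t' y a \<le> integral {t..t'} (\<lambda>s. K * (1 + v powr p))"
    unfolding cost_def
  proof (rule integral_le)
    fix s assume s: "s \<in> {t..t'}"
    have "running s (y s) (a s) \<le> K * (1 + \<bar>a s\<bar> powr p)"
      using K[OF controlledD(2)[OF y s] b(1)[OF s], of s "a s"] by linarith
    also have "\<dots> \<le> K * (1 + v powr p)"
      using b(2)[OF s] p \<open>0 \<le> K\<close> by (intro mult_left_mono add_left_mono powr_mono2) auto
    finally show "running s (y s) (a s) \<le> K * (1 + v powr p)" .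
  qed (use running_integrable[OF y] in auto)
  then show ?thesis using controlledD(1)[OF y] by (simp add: ac_simps)
qed

section \<open>Explicit competitors\<close>

lemma controlled_const:
  fixes x :: "real ^ 'n"
  assumes "x \<in> junction" "t \<le> t'"
  shows "controlled p t t' (\<lambda>_. x) (\<lambda>_. 0)"
proof -
  obtain i where i: "0 \<le> x $ i" "x = x $ i *\<^sub>R axis i 1" using junctionE[OF assms(1)] by metis
  have "controlled p t t' (\<lambda>s. (x $ i + 0 * (s - t)) *\<^sub>R axis i 1) (\<lambda>s. if 0 < x $ i + 0 * (s - t) then 0 else 0)"
    by (rule controlled_affine) (use assms i p in auto)
  then show ?thesis using i(2) by simp
qed

lemma move_along_edge:
  fixes x w :: "real ^ 'n"
  assumes "x \<in> edge i" "w \<in> edge i" "t < t'"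
  obtains y a where "controlled p t t' y a" "y t = x" "y t' = w"
    "\<And>s. s \<in> {t..t'} \<Longrightarrow> \<bar>a s\<bar> \<le> l1_dist x w / (t' - t)" "\<And>s. s \<in> {t..t'} \<Longrightarrow> norm (y s) \<le> max (norm x) (norm w)"
proof
  let ?b = "(w $ i - x $ i) / (t' - t)"
  let ?\<rho> = "\<lambda>s. x $ i + ?b * (s - t)"
  have xw: "0 \<le> x $ i" "0 \<le> w $ i" "x = x $ i *\<^sub>R axis i 1" "w = w $ i *\<^sub>R axis i 1"
    using assms edge_eq_axis by (auto simp: edge_iff)
  show "controlled p t t' (\<lambda>s. ?\<rho> s *\<^sub>R axis i 1) (\<lambda>s. if 0 < ?\<rho> s then ?b else 0)"
    by (rule controlled_affine) (use assms xw p in auto)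
  show "?\<rho> t *\<^sub>R axis i 1 = x" "?\<rho> t' *\<^sub>R axis i 1 = w" using xw assms by auto
  fix s assume s: "s \<in> {t..t'}"
  show "\<bar>if 0 < ?\<rho> s then ?b else 0\<bar> \<le> l1_dist x w / (t' - t)"
    using assms by (auto simp: l1_dist_same_edge abs_minus_commute)
  define \<theta> where "\<theta> = (s - t) / (t' - t)"
  have \<theta>: "0 \<le> \<theta>" "\<theta> \<le> 1" using s assms by (auto simp: \<theta>_def)
  have eq: "?\<rho> s = (1 - \<theta>) * x $ i + \<theta> * w $ i" by (simp add: \<theta>_def algebra_simps diff_divide_distrib)
  have "(1 - \<theta>) * x $ i + \<theta> * w $ i \<le> max (x $ i) (w $ i)"
    using \<theta> by (intro convex_bound_le) auto
  moreover have "0 \<le> (1 - \<theta>) * x $ i + \<theta> * w $ i" using \<theta> xw by simp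
  ultimately show "norm (?\<rho> s *\<^sub>R axis i (1::real)) \<le> max (norm x) (norm w)"
    unfolding eq using assms by (simp add: norm_axis_1 norm_edge)
qed

text \<open>Points on different edges are joined through the vertex at one constant speed, so the
  speed bound is the same as on a single edge.\<close>

lemma move:
  fixes x w :: "real ^ 'n"
  assumes x: "x \<in> junction" and w: "w \<in> junction" and tt: "t < t'"
  obtains y a where "controlled p t t' y a" "y t = x" "y t' = w"
    "\<And>s. s \<in> {t..t'} \<Longrightarrow> \<bar>a s\<bar> \<le> l1_dist x w / (t' - t)" "\<And>s. s \<in> {t..t'} \<Longrightarrow> norm (y s) \<le> max (norm x) (norm w)"
proof (cases "\<exists>i. x \<in> edge i \<and> w \<in> edge i")
  case True
  then show ?thesis using move_along_edge[OF _ _ tt] that by metis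
next
  case False
  obtain i where i: "x \<in> edge i" using junctionE[OF x] by metis
  obtain j where j: "w \<in> edge j" using junctionE[OF w] by metis
  have "i \<noteq> j" using False i j by auto
  have x0: "x \<noteq> 0" and w0: "w \<noteq> 0" using False i j by (auto simp: edge_iff)
  have d: "l1_dist x w = norm x + norm w" using l1_dist_different_edges[OF i j \<open>i \<noteq> j\<close>] .
  \<comment> \<open>The reciprocal of the common speed; the vertex is then reached at time
    \<open>r\<close>.\<close>
  define \<tau> where "\<tau> = (t' - t) / (norm x + norm w)"
  have \<tau>: "0 < \<tau>" using x0 tt by (simp add: \<tau>_def add_pos_nonneg)
  define r where "r = t + \<tau> * norm x"
  have tr: "t < r" using \<tau> x0 by (simp add: r_def)
  have sum: "0 < norm x + norm w" using x0 by (simp add: add_pos_nonneg)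
  have "\<tau> * (norm x + norm w) = t' - t" using sum by (simp add: \<tau>_def)
  then have rt': "t' - r = \<tau> * norm w" by (simp add: r_def algebra_simps)
  then have rt: "r < t'" using \<tau> w0 by (metis diff_gt_0_iff_gt mult_pos_pos zero_less_norm_iff)
  have z: "0 \<in> edge i" "0 \<in> edge j" by (auto simp: edge_iff)
  obtain y a where y: "controlled p t r y a" "y t = x" "y r = 0"
    "\<And>s. s \<in> {t..r} \<Longrightarrow> \<bar>a s\<bar> \<le> l1_dist x 0 / (r - t)" "\<And>s. s \<in> {t..r} \<Longrightarrow> norm (y s) \<le> max (norm x) (norm (0::real^'n))"
    using move_along_edge[OF i z(1) tr] by metis
  obtain y' a' where y': "controlled p r t' y' a'" "y' r = 0" "y' t' = w"
    "\<And>s. s \<in> {r..t'} \<Longrightarrow> \<bar>a' s\<bar> \<le> l1_dist 0 w / (t' - r)" "\<And>s. s \<in> {r..t'} \<Longrightarrow> norm (y' s) \<le> max (norm (0::real^'n)) (norm w)"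
    using move_along_edge[OF z(2) j rt] by metis
  have v: "l1_dist x 0 / (r - t) = 1 / \<tau>" "l1_dist 0 w / (t' - r) = 1 / \<tau>" "l1_dist x w / (t' - t) = 1 / \<tau>"
    using x0 w0 \<tau> rt' d x w tt by (auto simp: l1_dist_zero r_def \<tau>_def)
  show ?thesis
    by (rule that[OF controlled_join[OF y(1) y'(1)]])
      (use y y' tr rt v in \<open>force simp: le_max_iff_disj\<close>)+
qed

lemma move_cost:
  fixes x w :: "real ^ 'n"
  assumes x: "x \<in> junction" and w: "w \<in> junction" and tt: "t < t'"
    and K: "\<And>s x a. x \<in> junction \<Longrightarrow> norm x \<le> r \<Longrightarrow> \<bar>running s x a\<bar> \<le> K * (1 + \<bar>a\<bar> powr p)" "0 \<le> K"
    and r: "norm x \<le> r" "norm w \<le> r" and v: "l1_dist x w \<le> v * (t' - t)"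
  obtains y a where "controlled p t t' y a" "y t = x" "y t' = w" "cost t t' y a \<le> K * (1 + v powr p) * (t' - t)"
proof -
  obtain y a where y: "controlled p t t' y a" "y t = x" "y t' = w"
    "\<And>s. s \<in> {t..t'} \<Longrightarrow> \<bar>a s\<bar> \<le> l1_dist x w / (t' - t)" "\<And>s. s \<in> {t..t'} \<Longrightarrow> norm (y s) \<le> max (norm x) (norm w)"
    using move[OF x w tt] by metis
  have "l1_dist x w / (t' - t) \<le> v" using v tt by (simp add: field_simps)
  then have "cost t t' y a \<le> K * (1 + v powr p) * (t' - t)"
    using y r by (intro cost_upper[OF y(1) K(1) _ _ K(2)]) force+
  then show ?thesis using that y by blast
qed

subsection \<open>The value function\<close>

definition payoffs :: "real ^ 'n \<Rightarrow> real \<Rightarrow> real set" where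
  "payoffs x t = {cost t T y a + g (y T) | y a. controlled p t T y a \<and> y t = x}"

definition val :: "real ^ 'n \<Rightarrow> real \<Rightarrow> real" where
  "val x t = Inf (payoffs x t)"

definition near_optimal :: "real \<Rightarrow> real \<Rightarrow> (real \<Rightarrow> real ^ 'n) \<Rightarrow> (real \<Rightarrow> real) \<Rightarrow> bool" where
  "near_optimal e t y a \<longleftrightarrow> controlled p t T y a \<and> cost t T y a + g (y T) \<le> val (y t) t + e"

lemma payoffs_bdd_below: "bdd_below (payoffs x t)"
proof -
  obtain B where B: "\<And>x. x \<in> junction \<Longrightarrow> \<bar>g x\<bar> \<le> B" using g_bounded by blast
  have "- C0 * (T - t) - B \<le> cost t T y a + g (y T)" if y: "controlled p t T y a" for y a
    using cost_ge[OF y] B[of "y T"] controlledD(1,2)[OF y] by force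
  then show ?thesis unfolding bdd_below_def payoffs_def by blast
qed

lemma payoffs_nonempty: "x \<in> junction \<Longrightarrow> t \<le> T \<Longrightarrow> payoffs x t \<noteq> {}"
  unfolding payoffs_def using controlled_const[of x t T] by blast

lemma val_le: "controlled p t T y a \<Longrightarrow> val (y t) t \<le> cost t T y a + g (y T)"
  unfolding val_def by (rule cInf_lower[OF _ payoffs_bdd_below]) (auto simp: payoffs_def)

lemma near_optimal_exists:
  assumes "x \<in> junction" "t \<le> T" "0 < e"
  obtains y a where "near_optimal e t y a" "y t = x"
proof -
  have "Inf (payoffs x t) < val x t + e" using assms by (simp add: val_def)
  then obtain q where "q \<in> payoffs x t" "q < val x t + e"
    using payoffs_nonempty[OF assms(1,2)] payoffs_bdd_below by (meson cInf_less_iff)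
  then show ?thesis using that unfolding payoffs_def near_optimal_def by force
qed

lemma val_terminal:
  assumes x: "x \<in> junction" shows "val x T = g x"
proof -
  have "payoffs x T = {g x}"
    unfolding payoffs_def using controlled_const[OF x, of T T] by force
  then show ?thesis by (simp add: val_def)
qed

lemma val_le_cost_add_val:
  assumes y: "controlled p t s y a" and "s \<le> T"
  shows "val (y t) t \<le> cost t s y a + val (y s) s"
proof (rule field_le_epsilon)
  fix e :: real assume "0 < e"
  have ts: "t \<le> s" "y s \<in> junction" using controlledD(1,2)[OF y] by auto
  obtain z b where z: "near_optimal e s z b" "z s = y s"
    using near_optimal_exists[OF ts(2) \<open>s \<le> T\<close> \<open>0 < e\<close>] by metis
  have zc: "controlled p s T z b" using z(1) by (simp add: near_optimal_def)
  let ?y = "\<lambda>\<sigma>. if \<sigma> \<le> s then y \<sigma> else z \<sigma>" and ?a = "\<lambda>\<sigma>. if \<sigma> \<le> s then a \<sigma> else b \<sigma>"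
  have "val (?y t) t \<le> cost t T ?y ?a + g (?y T)"
    by (rule val_le[OF controlled_join[OF y zc z(2)[symmetric]]])
  also have "?y T = z T" using z(2) \<open>s \<le> T\<close> by auto
  also have "cost t T ?y ?a = cost t s y a + cost s T z b"
    by (rule cost_join[OF y zc z(2)[symmetric]])
  finally show "val (y t) t \<le> cost t s y a + val (y s) s + e"
    using z ts by (simp add: near_optimal_def)
qed

lemma near_optimal_cost:
  assumes y: "near_optimal e t y a" and s: "t \<le> s" "s \<le> T"
  shows "cost t s y a + val (y s) s \<le> val (y t) t + e"
proof -
  have c: "controlled p t T y a" using y by (simp add: near_optimal_def)
  have "val (y s) s \<le> cost s T y a + g (y T)" by (rule val_le[OF controlled_subset[OF c]]) (use s in auto)
  then show ?thesis using y cost_combine[OF c s] by (simp add: near_optimal_def)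
qed

text \<open>The initial piece costs at least the drop of the value function, so the whole error is
  available to the tail and does not grow.\<close>

lemma near_optimal_tail:
  assumes y: "near_optimal e t y a" and s: "t \<le> s" "s \<le> T"
  shows "near_optimal e s y a"
proof -
  have c: "controlled p t T y a" using y by (simp add: near_optimal_def)
  have "val (y t) t \<le> cost t s y a + val (y s) s"
    by (rule val_le_cost_add_val[OF controlled_subset[OF c]]) (use s in auto)
  then show ?thesis using y cost_combine[OF c s] controlled_subset[OF c s(1,2)]
    by (simp add: near_optimal_def)
qed

text \<open>The tool for all estimates on near-optimal paths: an initial piece may be replaced by
  any competitor with the same endpoints. The error \<open>e\<close> is independent of the length of
  the piece, so it has to be absorbed by other means when the piece is short.\<close>

lemma near_optimal_compare:
  assumes y: "near_optimal e t y a" and z: "controlled p t s z b" "z t = y t" "z s = y s" and s: "s \<le> T"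
  shows "cost t s y a \<le> cost t s z b + e"
  using near_optimal_cost[OF y _ s] controlledD(1)[OF z(1)] val_le_cost_add_val[OF z(1) s] z by auto

lemma dynamic_programming:
  assumes x: "x \<in> junction" and t: "t \<le> t'" "t' \<le> T"
  shows "val x t = Inf {cost t t' y a + val (y t') t' | y a. controlled p t t' y a \<and> y t = x}"
    (is "_ = Inf ?S")
proof (rule antisym)
  have le: "val x t \<le> q" if q: "q \<in> ?S" for q
  proof -
    obtain y a where "q = cost t t' y a + val (y t') t'" "controlled p t t' y a" "y t = x" using q by blast
    then show ?thesis using val_le_cost_add_val[of t t' y a] t(2) by simp
  qed
  have ne: "?S \<noteq> {}" using controlled_const[OF x t(1)] by blast
  show "val x t \<le> Inf ?S"
    by (rule cInf_greatest[OF ne]) (rule le)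
  have bd: "bdd_below ?S" by (rule bdd_belowI[OF le])
  show "Inf ?S \<le> val x t"
  proof (rule field_le_epsilon)
    fix e :: real assume "0 < e"
    have tT: "t \<le> T" using t by simp
    obtain y a where y: "near_optimal e t y a" "y t = x"
      using near_optimal_exists[OF x tT \<open>0 < e\<close>] by metis
    have "controlled p t T y a" using y(1) by (simp add: near_optimal_def)
    then have "controlled p t t' y a" by (rule controlled_subset) (use t in auto)
    then have "Inf ?S \<le> cost t t' y a + val (y t') t'" using y by (intro cInf_lower bd) blast
    also have "\<dots> \<le> val x t + e" using near_optimal_cost[OF y(1) t] y(2) by simp
    finally show "Inf ?S \<le> val x t + e" .
  qed
qed

lemma energy_bound:
  assumes "0 < r"
  obtains E where "0 < E"
    "\<And>e t y a. 0 \<le> t \<Longrightarrow> e \<le> 1 \<Longrightarrow> near_optimal e t y a \<Longrightarrow> norm (y t) \<le> r \<Longrightarrow> energy t T a \<le> E"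
    "\<And>e t y a s. 0 \<le> t \<Longrightarrow> e \<le> 1 \<Longrightarrow> near_optimal e t y a \<Longrightarrow> norm (y t) \<le> r \<Longrightarrow> s \<in> {t..T} \<Longrightarrow> norm (y s) \<le> r + T + E"
proof -
  obtain B where B: "\<And>x. x \<in> junction \<Longrightarrow> \<bar>g x\<bar> \<le> B" using g_bounded by blast
  have B0: "0 \<le> B" using B[of 0] by simp
  obtain K where K: "1 \<le> K" "\<And>s x a. x \<in> junction \<Longrightarrow> norm x \<le> r \<Longrightarrow> \<bar>running s x a\<bar> \<le> K * (1 + \<bar>a\<bar> powr p)"
    using running_upper[OF assms] by metis
  \<comment> \<open>\<open>K * T\<close> bounds the cost of standing still, \<open>2 * B\<close> the
    two terminal costs, \<open>1\<close> the error, and the final \<open>T\<close> compensates the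
    constant \<open>-1\<close> in the coercivity bound.\<close>
  define E where "E = (K * T + 2 * B + 1) / C0 + T"
  have E: "0 < E" using K(1) B0 C0 T by (auto simp: E_def intro!: add_pos_pos divide_pos_pos add_nonneg_pos)
  have 1: "energy t T a \<le> E" if t: "0 \<le> t" and e: "e \<le> 1" and y: "near_optimal e t y a" and n: "norm (y t) \<le> r" for e t y a
  proof -
    have c: "controlled p t T y a" using y by (simp add: near_optimal_def)
    have tT: "t \<le> T" and yj: "y t \<in> junction" "y T \<in> junction" using controlledD(1,2)[OF c] by auto
    have cc: "controlled p t T (\<lambda>_. y t) (\<lambda>_. 0)" by (rule controlled_const[OF yj(1) tT])
    have "cost t T (\<lambda>_. y t) (\<lambda>_. 0) \<le> K * (1 + 0 powr p) * (T - t)"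
      by (rule cost_upper[OF cc K(2)]) (use n K(1) in auto)
    also have "\<dots> \<le> K * T" using t K(1) p by (simp add: mult_left_mono)
    finally have "val (y t) t \<le> K * T + B" using val_le[OF cc] B[OF yj(1)] by force
    then have "cost t T y a \<le> K * T + 2 * B + 1" using y e B[OF yj(2)] by (force simp: near_optimal_def)
    then have "C0 * (energy t T a - (T - t)) \<le> K * T + 2 * B + 1" using cost_lower[OF c] by linarith
    then have "energy t T a - (T - t) \<le> (K * T + 2 * B + 1) / C0" using C0 by (simp add: field_simps)
    then show ?thesis using t by (simp add: E_def)
  qed
  have 2: "norm (y s) \<le> r + T + E" if t: "0 \<le> t" and e: "e \<le> 1" and y: "near_optimal e t y a" and n: "norm (y t) \<le> r"
    and s: "s \<in> {t..T}" for e t y a s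
  proof -
    have c: "controlled p t T y a" using y by (simp add: near_optimal_def)
    have cs: "controlled p t s y a" by (rule controlled_subset[OF c]) (use s in auto)
    have "l1_dist (y t) (y s) \<le> 1 * (s - t) + energy t s a / 1 powr (p - 1)" by (rule l1_dist_le_energy[OF cs]) simp
    also have "\<dots> \<le> T + E" using energy_mono[OF c, of t s] s t 1[OF t e y n] by simp
    finally show ?thesis
      using norm_diff_le_l1_dist[of "y t" "y s"] controlledD(2)[OF c] s n by force
  qed
  show ?thesis by (rule that[OF E]) (use 1 2 in blast)+
qed

end

section \<open>Displacement of near-optimal paths\<close>

lemma first_zero:
  fixes f :: "real \<Rightarrow> real"
  assumes f: "continuous_on {h..H} f" and "h \<le> H" "0 \<le> f h" "f H \<le> 0"
  obtains q where "q \<in> {h..H}" "f q = 0" "\<And>s. s \<in> {h..q} \<Longrightarrow> 0 \<le> f s"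
proof -
  have "compact {s \<in> {h..H}. f s \<le> 0}"
    using continuous_closed_preimage[OF f, of "{..0}"]
    by (intro compact_eq_bounded_closed[THEN iffD2])
      (auto simp: vimage_def Int_def intro: bounded_subset[of "{h..H}"])
  moreover have "{s \<in> {h..H}. f s \<le> 0} \<noteq> {}" using assms by auto
  ultimately obtain q where q: "q \<in> {h..H}" "f q \<le> 0" "\<And>s. s \<in> {h..H} \<Longrightarrow> f s \<le> 0 \<Longrightarrow> q \<le> s"
    using compact_attains_inf[of "{s \<in> {h..H}. f s \<le> 0}"] by auto
  have c: "continuous_on {h..q} f" by (rule continuous_on_subset[OF f]) (use q(1) in auto)
  have "h \<le> q" using q(1) by simp
  from IVT2'[OF q(2) assms(3) this c] obtain s where s: "h \<le> s" "s \<le> q" "f s = 0" by blast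
  have "q \<le> s" by (rule q(3)) (use q(1) s in auto)
  then have "f q = 0" using s by simp
  moreover have "0 \<le> f s" if "s \<in> {h..q}" for s
  proof (rule ccontr)
    assume neg: "\<not> 0 \<le> f s"
    then have "q \<le> s" using q(1) that by (intro q(3)) auto
    then show False using neg that calculation by simp
  qed
  ultimately show ?thesis using that q(1) by blast
qed

lemma last_nonpos:
  fixes f :: "real \<Rightarrow> real"
  assumes f: "continuous_on {h..H} f" and "h \<le> H" "f h \<le> 0"
  obtains q where "q \<in> {h..H}" "f q \<le> 0" "q < H \<Longrightarrow> f q = 0" "\<And>s. q < s \<Longrightarrow> s \<le> H \<Longrightarrow> 0 < f s"
proof -
  have "compact {s \<in> {h..H}. f s \<le> 0}"
    using continuous_closed_preimage[OF f, of "{..0}"]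
    by (intro compact_eq_bounded_closed[THEN iffD2])
      (auto simp: vimage_def Int_def intro: bounded_subset[of "{h..H}"])
  moreover have "{s \<in> {h..H}. f s \<le> 0} \<noteq> {}" using assms by auto
  ultimately obtain q where q: "q \<in> {h..H}" "f q \<le> 0" "\<And>s. s \<in> {h..H} \<Longrightarrow> f s \<le> 0 \<Longrightarrow> s \<le> q"
    using compact_attains_sup[of "{s \<in> {h..H}. f s \<le> 0}"] by auto
  have pos: "0 < f s" if "q < s" "s \<le> H" for s
  proof (rule ccontr)
    assume "\<not> 0 < f s"
    then have "s \<le> q" using q(1) that by (intro q(3)) auto
    then show False using that by simp
  qed
  have "f q = 0" if "q < H"
  proof -
    have c: "continuous_on {q..H} f" by (rule continuous_on_subset[OF f]) (use q(1) in auto)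
    have "0 \<le> f H" "q \<le> H" using pos[of H] that by auto
    from IVT'[OF q(2) this c] obtain s where s: "q \<le> s" "s \<le> H" "f s = 0" by blast
    have "s \<le> q" by (rule q(3)) (use q(1) s in auto)
    then show ?thesis using s by simp
  qed
  then show ?thesis using that q pos by blast
qed

lemma exists_powr_gt:
  fixes X M q :: real
  assumes "0 < q"
  obtains V where "M \<le> V" "1 \<le> V" "X < V powr q"
proof
  let ?V = "max (max M 1) ((\<bar>X\<bar> + 1) powr (1 / q))"
  show "M \<le> ?V" "1 \<le> ?V" by auto
  have "X < ((\<bar>X\<bar> + 1) powr (1 / q)) powr q" using assms by (simp add: powr_powr)
  also have "\<dots> \<le> ?V powr q" using assms by (intro powr_mono2) auto
  finally show "X < ?V powr q" .
qed

context control
begin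

lemma running_axis:
  assumes "0 < r"
  shows "running s (r *\<^sub>R axis i 1) a = L i s r a"
proof -
  have c: "(r *\<^sub>R axis i (1::real)) $ i = r" by (simp add: axis_def)
  show ?thesis
    using running_edge[OF axis_junction[of r i], of i s a] assms unfolding c by simp
qed

text \<open>A mean speed of at least \<open>2 * l\<close> makes the subtracted term of
  \<open>energy_ge\<close> at most half of the main one.\<close>

lemma energy_ge_fast:
  assumes y: "controlled p t t' (y :: real \<Rightarrow> real ^ 'n) a" and l: "0 < l" and w: "2 * l * (t' - t) \<le> w" "w \<le> l1_dist (y t) (y t')"
  shows "l powr (p - 1) * w / 2 \<le> energy t t' a"
proof -
  have e: "l powr p = l powr (p - 1) * l" using l by (simp add: powr_mult_base mult.commute)
  have "l powr (p - 1) * w \<le> l powr (p - 1) * l1_dist (y t) (y t')" using w by (intro mult_left_mono) auto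
  moreover have "l powr (p - 1) * (2 * l * (t' - t)) \<le> l powr (p - 1) * w" using w by (intro mult_left_mono) auto
  ultimately show ?thesis using energy_ge[OF y l] unfolding e by (simp add: algebra_simps)
qed

text \<open>A path on one edge is pulled towards the point at coordinate \<open>z\<close> by an
  amount that decreases linearly from \<open>w\<close> to \<open>0\<close>. The sign
  \<open>sg\<close> tells on which side of \<open>z\<close> the path lies; as the path stays at
  distance at least \<open>w\<close> from \<open>z\<close> on that side, the translated one stays on
  the edge and in the ball. The loss splits into a position error of size \<open>w\<close> and a
  velocity error of size \<open>w / \<kappa>\<close>, weighted by the growth of the derivatives of
  the cost.\<close>

lemma translation_cost:
  assumes R: "0 < R"
  obtains c where "0 \<le> c"
    "\<And>y a q r z w \<kappa> sg V i. controlled p q r y a \<Longrightarrow> \<kappa> = r - q \<Longrightarrow> 0 < \<kappa> \<Longrightarrow> (\<And>s. s \<in> {q..r} \<Longrightarrow> norm (y s) \<le> R) \<Longrightarrow>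
      (\<And>s. q \<le> s \<Longrightarrow> s < r \<Longrightarrow> 0 < y s $ i) \<Longrightarrow> y r \<in> edge i \<Longrightarrow> 0 \<le> z \<Longrightarrow> z \<le> R \<Longrightarrow> 0 < w \<Longrightarrow> sg = 1 \<or> sg = - 1 \<Longrightarrow>
      sg * (y q $ i - z) = w \<Longrightarrow> (\<And>s. s \<in> {q..r} \<Longrightarrow> w \<le> sg * (y s $ i - z)) \<Longrightarrow> 1 \<le> V \<Longrightarrow> w \<le> 2 * V * \<kappa> \<Longrightarrow>
      \<exists>y' a'. controlled p q r y' a' \<and> y' q = z *\<^sub>R axis i 1 \<and> y' r = y r \<and>
        cost q r y' a' \<le> cost q r y a + (c * w + c * (w / \<kappa>) / V) * (2 powr p * (energy q r a + (2 * V) powr p * \<kappa>)) +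
          (c * w + c * (w / \<kappa>) * (V powr (p - 1) + 1)) * \<kappa>"
proof -
  obtain c1 where c1: "c1 \<ge> 0" "\<And>i s a x x'. x \<in> {0..R} \<Longrightarrow> x' \<in> {0..R} \<Longrightarrow>
      \<bar>L i s x a - L i s x' a\<bar> \<le> c1 * (\<bar>a\<bar> powr p + 1) * \<bar>x - x'\<bar>"
    using L_lipschitz_x[OF R] by metis
  obtain c2 where c2: "c2 \<ge> 0" "\<And>i s a a' x. x \<in> {0..R} \<Longrightarrow>
      \<bar>L i s x a - L i s x a'\<bar> \<le> c2 * ((max \<bar>a\<bar> \<bar>a'\<bar>) powr (p - 1) + 1) * \<bar>a - a'\<bar>"
    using L_lipschitz_a[OF R] by metis
  define c where "c = max c1 c2"
  have c: "0 \<le> c" "c1 \<le> c" "c2 \<le> c" using c1 by (auto simp: c_def)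
  show ?thesis
  proof (rule that[OF c(1)])
    fix y :: "real \<Rightarrow> real ^ 'n" and a q r z w \<kappa> sg V i
    assume y: "controlled p q r y a" and \<kappa>: "\<kappa> = r - q" "0 < \<kappa>" and yR: "\<And>s. s \<in> {q..r} \<Longrightarrow> norm (y s) \<le> R"
      and pos: "\<And>s. q \<le> s \<Longrightarrow> s < r \<Longrightarrow> 0 < y s $ i" and yr: "y r \<in> edge i" and z: "0 \<le> z" "z \<le> R" and w: "0 < w"
      and sg: "sg = 1 \<or> sg = - 1" and yq: "sg * (y q $ i - z) = w"
      and away: "\<And>s. s \<in> {q..r} \<Longrightarrow> w \<le> sg * (y s $ i - z)" and V: "1 \<le> V" and wV: "w \<le> 2 * V * \<kappa>"
    have qr: "q < r" using \<kappa> by simp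
    have yj: "y s \<in> junction" if "s \<in> {q..r}" for s using controlledD(2)[OF y that] .
    have yi: "0 \<le> y s $ i" "y s $ i \<le> R" if "s \<in> {q..r}" for s
    proof -
      show "0 \<le> y s $ i" using junction_nonneg[OF yj[OF that]] .
      have "y s $ i \<le> norm (y s)" using component_le_norm_cart[of "y s" i] by linarith
      then show "y s $ i \<le> R" using yR[OF that] by simp
    qed
    \<comment> \<open>The shift starts at the full gap \<open>sg * w\<close>, so the new path starts
      at \<open>z\<close>, and it ends at \<open>0\<close>, so the endpoint is kept.\<close>
    define \<rho> where "\<rho> s = y s $ i - sg * w * ((r - s) / \<kappa>)" for s
    define b where "b s = a s + sg * w / \<kappa>" for s
    have wk: "0 \<le> w / \<kappa>" "w / \<kappa> \<le> 2 * V" using w \<kappa> wV by (auto simp: field_simps)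
    have frac: "0 \<le> (r - s) / \<kappa>" "(r - s) / \<kappa> \<le> 1" if "s \<in> {q..r}" for s using that \<kappa> by auto
    have frac': "(r - s) / \<kappa> < 1" "0 < (r - s) / \<kappa>" if "q < s" "s < r" for s using that \<kappa> by auto
    have \<rho>bounds: "0 \<le> \<rho> s \<and> \<rho> s \<le> R \<and> \<bar>\<rho> s - y s $ i\<bar> \<le> w" if s: "s \<in> {q..r}" for s
    proof -
      have 1: "0 \<le> w * ((r - s) / \<kappa>)" "w * ((r - s) / \<kappa>) \<le> w"
        using mult_nonneg_nonneg[OF less_imp_le[OF w] frac(1)[OF s]] mult_left_mono[OF frac(2)[OF s] less_imp_le[OF w]] by auto
      show ?thesis using sg away[OF s] yi[OF s] z 1 by (auto simp: \<rho>_def)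
    qed
    have \<rho>pos: "0 < \<rho> s" if "q < s" "s < r" for s
    proof -
      have s: "s \<in> {q..r}" using that by simp
      have 1: "0 < w * ((r - s) / \<kappa>)" "w * ((r - s) / \<kappa>) < w"
        using mult_pos_pos[OF w frac'(2)[OF that]] mult_strict_left_mono[OF frac'(1)[OF that] w] by auto
      show ?thesis using sg away[OF s] yi[OF s] z 1 by (auto simp: \<rho>_def)
    qed
    have bm: "set_borel_measurable lborel {q..r} b"
    proof -
      have [measurable]: "(\<lambda>s. indicator {q..r} s *\<^sub>R a s) \<in> borel_measurable borel"
        using controlledD(3)[OF y] by (simp add: set_borel_measurable_def)
      have "(\<lambda>s. indicator {q..r} s *\<^sub>R a s + indicator {q..r} s * (sg * w / \<kappa>)) \<in> borel_measurable borel"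
        by measurable
      then show ?thesis by (simp add: set_borel_measurable_def b_def algebra_simps)
    qed
    have sgw: "\<bar>sg * w / \<kappa>\<bar> = w / \<kappa>" using sg w \<kappa> by auto
    have bB: "\<bar>b s\<bar> \<le> \<bar>a s\<bar> + 2 * V" for s
    proof -
      have "\<bar>b s\<bar> \<le> \<bar>a s\<bar> + \<bar>sg * w / \<kappa>\<bar>" unfolding b_def by (rule abs_triangle_ineq)
      then show ?thesis using sgw wk by linarith
    qed
    have Bp: "(\<bar>a s\<bar> + 2 * V) powr p \<le> 2 powr p * (\<bar>a s\<bar> powr p + (2 * V) powr p)" for s
      using powr_add_le[of "\<bar>a s\<bar>" "2 * V" p] V p by simp
    have bp: "(\<lambda>s. \<bar>b s\<bar> powr p) integrable_on {q..r}"
    proof -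
      have [measurable]: "(\<lambda>s. indicator {q..r} s *\<^sub>R b s) \<in> borel_measurable borel"
        using bm by (simp add: set_borel_measurable_def)
      have "(\<lambda>s. \<bar>indicator {q..r} s *\<^sub>R b s\<bar> powr p) \<in> borel_measurable borel" by measurable
      also have "(\<lambda>s. \<bar>indicator {q..r} s *\<^sub>R b s\<bar> powr p) = (\<lambda>s. indicator {q..r} s *\<^sub>R (\<bar>b s\<bar> powr p))"
        using p by (auto simp: indicator_def)
      finally have "set_borel_measurable lborel {q..r} (\<lambda>s. \<bar>b s\<bar> powr p)"
        by (simp add: set_borel_measurable_def)
      then have "set_integrable lborel {q..r} (\<lambda>s. \<bar>b s\<bar> powr p)"
      proof (rule set_borel_measurable_abs_integrable(2))
        show "(\<lambda>s. 2 powr p * (\<bar>a s\<bar> powr p + (2 * V) powr p)) integrable_on {q..r}"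
          using controlledD(4)[OF y] by (intro integrable_on_mult_right integrable_add) auto
        fix s
        have "\<bar>b s\<bar> powr p \<le> (\<bar>a s\<bar> + 2 * V) powr p" using bB[of s] p by (intro powr_mono2) auto
        then show "\<bar>\<bar>b s\<bar> powr p\<bar> \<le> 2 powr p * (\<bar>a s\<bar> powr p + (2 * V) powr p)" using Bp[of s] by simp
      qed
      then show ?thesis by (rule set_borel_integral_eq_integral(1))
    qed
    have \<rho>int: "\<rho> s = \<rho> q + integral {q..s} b" if s: "s \<in> {q..r}" for s
    proof -
      have "y s $ i = y q $ i + integral {q..s} a" by (rule controlled_edge_integral[OF y p pos s])
      moreover have "integral {q..s} b = integral {q..s} a + (s - q) * (sg * w / \<kappa>)"
        unfolding b_def using s integrable_subinterval_real[OF controlled_integrable(3)[OF y p], of q s]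
        by (subst Henstock_Kurzweil_Integration.integral_add) auto
      moreover have "(s - q) * (sg * w / \<kappa>) = sg * w * ((r - q) / \<kappa>) - sg * w * ((r - s) / \<kappa>)"
        by (simp add: algebra_simps diff_divide_distrib)
      ultimately show ?thesis by (simp add: \<rho>_def)
    qed
    let ?y = "\<lambda>s. \<rho> s *\<^sub>R axis i (1::real)" and ?b = "\<lambda>s. if 0 < \<rho> s then b s else 0"
    have yc: "controlled p q r ?y ?b"
      by (rule controlled_axis[OF _ p bm bp \<rho>int]) (use qr \<rho>bounds in auto)
    define \<beta> where "\<beta> = c * w + c * (w / \<kappa>) / V"
    have \<beta>0: "0 \<le> \<beta>" unfolding \<beta>_def using c(1) w \<kappa>(2) V
      by (intro add_nonneg_nonneg mult_nonneg_nonneg divide_nonneg_nonneg) auto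
    define \<alpha> where "\<alpha> = c * w + c * (w / \<kappa>) * (V powr (p - 1) + 1)"
    define G where "G s = running s (y s) (a s) + (\<beta> * (2 powr p * (\<bar>a s\<bar> powr p + (2 * V) powr p)) + \<alpha>)" for s
    have G: "(G has_integral (cost q r y a + (\<beta> * (2 powr p * (energy q r a + (2 * V) powr p * \<kappa>)) + \<alpha> * \<kappa>))) {q..r}"
    proof -
      have 1: "((\<lambda>s. \<bar>a s\<bar> powr p) has_integral energy q r a) {q..r}"
        unfolding energy_def by (rule integrable_integral[OF controlledD(4)[OF y]])
      have 2: "((\<lambda>s. running s (y s) (a s)) has_integral cost q r y a) {q..r}"
        unfolding cost_def by (rule integrable_integral[OF running_integrable[OF y]])
      have 3: "((\<lambda>s. k) has_integral k * \<kappa>) {q..r}" for k :: real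
        using has_integral_const_real[of k q r] qr \<kappa> by (simp add: mult.commute)
      show ?thesis unfolding G_def
        by (intro has_integral_add has_integral_mult_right 1 2 3)
    qed
    have pw: "running s (?y s) (?b s) \<le> G s" if s: "q < s" "s < r" for s
    proof -
      have sq: "s \<in> {q..r}" using s by simp
      have 1: "running s (?y s) (?b s) = L i s (\<rho> s) (b s)"
        using running_axis[OF \<rho>pos[OF s]] \<rho>pos[OF s] by simp
      have 2: "running s (y s) (a s) = L i s (y s $ i) (a s)"
        using running_edge[OF yj[OF sq] pos[of s]] s by simp
      let ?B = "\<bar>a s\<bar> + 2 * V"
      have B0: "0 \<le> ?B" using V by simp
      have "\<bar>L i s (\<rho> s) (b s) - L i s (y s $ i) (b s)\<bar> \<le> c1 * (\<bar>b s\<bar> powr p + 1) * \<bar>\<rho> s - y s $ i\<bar>"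
        using c1(2)[of "\<rho> s" "y s $ i" i s "b s"] \<rho>bounds[OF sq] yi[OF sq] by simp
      also have "\<dots> \<le> c * (?B powr p + 1) * w"
        using c c1(1) bB[of s] p \<rho>bounds[OF sq] by (intro mult_mono add_right_mono powr_mono2 mult_nonneg_nonneg) auto
      finally have d1: "\<bar>L i s (\<rho> s) (b s) - L i s (y s $ i) (b s)\<bar> \<le> c * (?B powr p + 1) * w" .
      have "\<bar>L i s (y s $ i) (b s) - L i s (y s $ i) (a s)\<bar> \<le> c2 * ((max \<bar>b s\<bar> \<bar>a s\<bar>) powr (p - 1) + 1) * \<bar>b s - a s\<bar>"
        using c2(2)[of "y s $ i" i s "b s" "a s"] yi[OF sq] by simp
      also have "\<dots> \<le> c * (?B powr (p - 1) + 1) * (w / \<kappa>)"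
        using c c2(1) bB[of s] p V sgw wk
        by (intro mult_mono add_right_mono powr_mono2 mult_nonneg_nonneg) (auto simp: b_def)
      \<comment> \<open>With reference speed \<open>V\<close> the energy produced by the velocity
        error carries the factor \<open>1 / V\<close>, which later cancels the additional power of
        \<open>V\<close> in the energy.\<close>
      also have "\<dots> \<le> c * ((V powr (p - 1) + ?B powr p / V) + 1) * (w / \<kappa>)"
        using c V p B0 wk powr_minus_one_le[of ?B V p] by (intro mult_right_mono mult_left_mono add_right_mono) auto
      finally have d2: "\<bar>L i s (y s $ i) (b s) - L i s (y s $ i) (a s)\<bar> \<le> c * ((V powr (p - 1) + ?B powr p / V) + 1) * (w / \<kappa>)" .
      have "L i s (\<rho> s) (b s) \<le> L i s (y s $ i) (a s) + c * (?B powr p + 1) * w + c * ((V powr (p - 1) + ?B powr p / V) + 1) * (w / \<kappa>)"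
        using d1 d2 by linarith
      also have "\<dots> = L i s (y s $ i) (a s) + (\<beta> * ?B powr p + \<alpha>)"
        by (simp add: \<alpha>_def \<beta>_def algebra_simps)
      also have "\<dots> \<le> G s"
        unfolding G_def 2 by (intro add_left_mono add_right_mono mult_left_mono Bp \<beta>0)
      finally show ?thesis unfolding 1 .
    qed
    have "cost q r ?y ?b \<le> cost q r y a + (\<beta> * (2 powr p * (energy q r a + (2 * V) powr p * \<kappa>)) + \<alpha> * \<kappa>)"
    proof (rule has_integral_le[OF _ G])
      have "((\<lambda>s. running s (?y s) (?b s)) has_integral cost q r ?y ?b) {q..r}"
        unfolding cost_def by (rule integrable_integral[OF running_integrable[OF yc]])
      \<comment> \<open>Either endpoint of the translated path may be the vertex, where the vertex
        cost replaces the edge cost, so the integrands are compared in the open interval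
        only.\<close>
      then show "((\<lambda>s. if s \<in> {q, r} then G s else running s (?y s) (?b s)) has_integral cost q r ?y ?b) {q..r}"
        by (rule has_integral_spike_finite[of "{q, r}", rotated 2]) auto
      show "(if s \<in> {q, r} then G s else running s (?y s) (?b s)) \<le> G s" if "s \<in> {q..r}" for s
        using pw[of s] that by auto
    qed
    moreover have "?y q = z *\<^sub>R axis i (1::real)"
    proof -
      have "\<rho> q = z" using yq sg \<kappa> by (auto simp: \<rho>_def)
      then show ?thesis by simp
    qed
    moreover have "?y r = y r" using edge_eq_axis[OF yr] by (simp add: \<rho>_def)
    ultimately show "\<exists>y' a'. controlled p q r y' a' \<and> y' q = z *\<^sub>R axis i 1 \<and> y' r = y r \<and>
        cost q r y' a' \<le> cost q r y a + (c * w + c * (w / \<kappa>) / V) * (2 powr p * (energy q r a + (2 * V) powr p * \<kappa>)) +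
          (c * w + c * (w / \<kappa>) * (V powr (p - 1) + 1)) * \<kappa>"
      using yc unfolding \<alpha>_def \<beta>_def by (intro exI[of _ ?y] exI[of _ ?b]) (simp add: add.assoc)
  qed
qed

end

text \<open>What matters is the form of the right-hand side: \<open>w * V powr (p - 1)\<close> times
  a constant that does not involve \<open>V\<close>. The energy contributes
  \<open>V powr p * hs\<close>, in which \<open>V * hs\<close> is bounded by the diameter
  \<open>2 * R\<close>; the factor \<open>w / \<kappa>\<close> is harmless because \<open>hs\<close>
  and \<open>\<kappa>\<close> are comparable.\<close>

lemma translation_loss_bound:
  fixes c w V \<kappa> hs R \<Phi> K1 p :: real
  assumes "0 \<le> c" "0 \<le> w" "1 \<le> V" "0 < \<kappa>" "\<kappa> \<le> hs" "hs \<le> 2 * \<kappa>" "V * hs \<le> 2 * R" "\<Phi> \<le> K1 * V powr p * hs" "0 \<le> K1" "1 < p"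
  shows "(c * w + c * (w / \<kappa>) / V) * (2 powr p * (\<Phi> + (2 * V) powr p * \<kappa>)) +
      (c * w + c * (w / \<kappa>) * (V powr (p - 1) + 1)) * \<kappa> \<le>
    w * V powr (p - 1) * (c * (2 * R * (2 powr p * (K1 + 2 powr p)) + 2 * (2 powr p * (K1 + 2 powr p)) + 2 * R + 2))"
proof -
  define Q where "Q = V powr (p - 1)"
  define K2 where "K2 = 2 powr p * (K1 + 2 powr p)"
  have Q: "1 \<le> Q" unfolding Q_def using assms by (simp add: ge_one_powr_ge_zero)
  have VQ: "V powr p = V * Q" using assms by (simp add: Q_def powr_mult_base)
  have K2: "0 \<le> K2" using assms by (simp add: K2_def)
  define U where "U = 2 powr p * (\<Phi> + (2 * V) powr p * \<kappa>)"
  have "(2 * V) powr p * \<kappa> \<le> 2 powr p * V powr p * hs"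
    using assms by (simp add: powr_mult mult_left_mono)
  then have "\<Phi> + (2 * V) powr p * \<kappa> \<le> (K1 + 2 powr p) * V powr p * hs"
    using assms(8) by (simp add: algebra_simps)
  then have "U \<le> 2 powr p * ((K1 + 2 powr p) * V powr p * hs)"
    unfolding U_def by (intro mult_left_mono) auto
  also have "\<dots> = K2 * Q * (V * hs)" by (simp add: K2_def VQ)
  finally have U: "U \<le> K2 * Q * (V * hs)" .
  have "c * w * U \<le> c * w * (K2 * Q * (V * hs))" using U assms by (intro mult_left_mono) auto
  also have "\<dots> \<le> c * w * (K2 * Q * (2 * R))" using assms K2 Q by (intro mult_left_mono mult_nonneg_nonneg) auto
  finally have 1: "c * w * U \<le> c * w * (K2 * Q * (2 * R))" .
  have "c * (w / \<kappa>) / V * U \<le> c * (w / \<kappa>) / V * (K2 * Q * (V * hs))"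
    using U assms by (intro mult_left_mono) auto
  also have "\<dots> = c * w * K2 * Q * (hs / \<kappa>)" using assms by (simp add: field_simps)
  also have "\<dots> \<le> c * w * K2 * Q * 2"
    using assms K2 Q by (intro mult_left_mono mult_nonneg_nonneg) (auto simp: field_simps)
  finally have 2: "c * (w / \<kappa>) / V * U \<le> c * w * K2 * Q * 2" .
  have "1 * hs \<le> V * hs" by (rule mult_right_mono) (use assms in auto)
  then have "\<kappa> \<le> V * hs" using assms(5) by linarith
  then have kR: "\<kappa> \<le> 2 * R" using assms by linarith
  then have R0: "0 \<le> 2 * R" using assms by linarith
  have "\<kappa> \<le> 2 * R * Q" using kR mult_left_mono[OF Q R0] by linarith
  then have 3: "c * w * \<kappa> \<le> c * w * (2 * R * Q)" using assms by (intro mult_left_mono) auto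
  have "c * (w / \<kappa>) * (Q + 1) * \<kappa> = c * w * (Q + 1)" using assms by simp
  also have "\<dots> \<le> c * w * (2 * Q)" using assms Q by (intro mult_left_mono) auto
  finally have 4: "c * (w / \<kappa>) * (Q + 1) * \<kappa> \<le> c * w * (2 * Q)" .
  have "(c * w + c * (w / \<kappa>) / V) * U + (c * w + c * (w / \<kappa>) * (Q + 1)) * \<kappa>
      = c * w * U + c * (w / \<kappa>) / V * U + c * w * \<kappa> + c * (w / \<kappa>) * (Q + 1) * \<kappa>"
    by (simp add: algebra_simps)
  also have "\<dots> \<le> c * w * (K2 * Q * (2 * R)) + c * w * K2 * Q * 2 + c * w * (2 * R * Q) + c * w * (2 * Q)"
    using 1 2 3 4 by linarith
  also have "\<dots> = w * Q * (c * (2 * R * K2 + 2 * K2 + 2 * R + 2))" by (simp add: algebra_simps)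
  finally show ?thesis unfolding U_def Q_def K2_def .
qed

context control
begin

text \<open>Let \<open>w\<close> be the displacement after time \<open>h\<close> and \<open>q\<close> the last time in \<open>{h..hs}\<close> at which the
  displacement is at most \<open>w\<close>. If the displacement after time \<open>q\<close> is at most a fixed multiple of \<open>V * q\<close>,
  the competitor is the straight line to \<open>y (t + q)\<close>; otherwise it waits until \<open>t + q\<close> and then follows
  the path translated by an amount decreasing linearly from \<open>w\<close> to \<open>0\<close> at \<open>t + hs\<close>.\<close>

lemma displacement_core:
  assumes R: "0 < R" and V: "1 \<le> V"
  obtains V' where "V \<le> V'" "\<And>e t y a h hs. 0 \<le> e \<Longrightarrow> near_optimal e t y a \<Longrightarrow> (\<And>s. s \<in> {t..T} \<Longrightarrow> norm (y s) \<le> R) \<Longrightarrow>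
    0 < h \<Longrightarrow> h \<le> hs \<Longrightarrow> t + hs \<le> T \<Longrightarrow> l1_dist (y t) (y (t + hs)) = V * hs \<Longrightarrow>
    (\<And>s. s \<in> {h..hs} \<Longrightarrow> V * s \<le> l1_dist (y t) (y (t + s))) \<Longrightarrow>
    y t = 0 \<or> (\<forall>s. t \<le> s \<and> s < t + hs \<longrightarrow> y s \<noteq> 0) \<Longrightarrow>
    l1_dist (y t) (y (t + h)) \<le> V' * (h + e)"
proof -
  obtain K where K: "1 \<le> K" "\<And>s x a. x \<in> junction \<Longrightarrow> norm x \<le> R \<Longrightarrow> \<bar>running s x a\<bar> \<le> K * (1 + \<bar>a\<bar> powr p)"
    using running_upper[OF R] by metis
  show ?thesis
  proof (rule translation_cost[OF R], goal_cases)
  case (1 c)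
  note c = 1(1) and transl = 1(2)
  have p1: "0 < p - 1" using p by simp
  \<comment> \<open>Energy constant of the comparison with the straight line at speed
    \<open>V\<close>: \<open>1\<close> for the coercivity constant, \<open>2 * K\<close> from
    \<open>1 + V powr p \<le> 2 * V powr p\<close>, and \<open>1\<close> for the error.\<close>
  define K1 where "K1 = 1 + (2 * K + 1) / C0"
  define K4 where "K4 = c * (2 * R * (2 powr p * (K1 + 2 powr p)) + 2 * (2 powr p * (K1 + 2 powr p)) + 2 * R + 2)"
  have K1: "0 \<le> K1" using K C0 by (simp add: K1_def)
  have K4: "0 \<le> K4" using K1 c R by (simp add: K4_def)
  \<comment> \<open>\<open>\<Lambda>\<close> beats the translation loss and depends on
    \<open>K4\<close> but not on \<open>V\<close>; this is possible because loss and gain scale with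
    the same power of \<open>V\<close>.\<close>
  obtain \<Lambda> where \<Lambda>: "1 \<le> \<Lambda>" "2 * (C0 + K + K4 + 1) / C0 < \<Lambda> powr (p - 1)"
    using exists_powr_gt[OF p1] by metis
  define V2 where "V2 = 2 * \<Lambda> * V"
  \<comment> \<open>\<open>W\<close> beats the cost of the straight line, whose speed may reach
    \<open>V2\<close>; it is chosen last and may depend on \<open>V\<close>.\<close>
  obtain W where W: "V \<le> W" "1 \<le> W" "2 * (C0 + 1 + K * (1 + V2 powr p)) / C0 < W powr (p - 1)"
    using exists_powr_gt[OF p1] by metis
  have V2V: "V \<le> V2" using \<Lambda>(1) V mult_right_mono[of 1 "2 * \<Lambda>" V] by (simp add: V2_def)
  show ?thesis
  proof (rule that[of "2 * W"])
    show "V \<le> 2 * W" using W by simp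
    fix e t y a h hs
    assume e: "0 \<le> e" and y: "near_optimal e t y a" and yR: "\<And>s. s \<in> {t..T} \<Longrightarrow> norm (y s) \<le> R"
      and h: "0 < h" "h \<le> hs" "t + hs \<le> T" and Dhs: "l1_dist (y t) (y (t + hs)) = V * hs"
      and Dge: "\<And>s. s \<in> {h..hs} \<Longrightarrow> V * s \<le> l1_dist (y t) (y (t + s))"
      and hit: "y t = 0 \<or> (\<forall>s. t \<le> s \<and> s < t + hs \<longrightarrow> y s \<noteq> 0)"
    define D where "D s = l1_dist (y t) (y (t + s))" for s
    define w where "w = D h"
    have yc: "controlled p t T y a" using y by (simp add: near_optimal_def)
    have tT: "t \<le> T" using controlledD(1)[OF yc] .
    have yj: "y s \<in> junction" if "s \<in> {t..T}" for s using controlledD(2)[OF yc that] .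
    have sub: "controlled p q r y a" if "t \<le> q" "q \<le> r" "r \<le> T" for q r
      using controlled_subset[OF yc that] .
    have Dc: "continuous_on {0..T - t} D"
      unfolding D_def by (intro continuous_intros continuous_on_compose2[OF controlled_continuous[OF yc]]) auto
    show "l1_dist (y t) (y (t + h)) \<le> 2 * W * (h + e)"
    proof (rule ccontr)
      assume "\<not> l1_dist (y t) (y (t + h)) \<le> 2 * W * (h + e)"
      \<comment> \<open>The negated claim serves twice: the mean speed up to \<open>h\<close>
        exceeds \<open>2 * W\<close>, which forces energy, and \<open>e\<close> is dominated by
        \<open>w\<close>.\<close>
      then have wgt: "2 * W * h + 2 * W * e < w" by (simp add: w_def D_def algebra_simps)
      have We: "0 \<le> 2 * W * e" "e \<le> 2 * W * e" "0 < 2 * W * h"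
        using W(2) e h mult_right_mono[of 1 "2 * W" e] by auto
      have w0: "0 < w" and ew: "e \<le> w" and hw: "2 * W * h \<le> w" using wgt We by linarith+
      have Eh: "W powr (p - 1) * w / 2 \<le> energy t (t + h) a"
        using energy_ge_fast[OF sub[of t "t + h"], of W w] W h hw by (simp add: w_def D_def)
      have "continuous_on {h..hs} (\<lambda>s. D s - w)"
        by (intro continuous_intros continuous_on_subset[OF Dc]) (use h in auto)
      from last_nonpos[OF this h(2)] obtain q where q: "q \<in> {h..hs}" "D q \<le> w" "q < hs \<Longrightarrow> D q = w"
        "\<And>s. q < s \<Longrightarrow> s \<le> hs \<Longrightarrow> w < D s" by (auto simp: w_def)
      have q0: "0 < q" using q(1) h by simp
      \<comment> \<open>Since the displacement is at least \<open>V * q\<close> at time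
        \<open>q\<close>, the elapsed time is dominated by \<open>w\<close> too; every error term
        becomes a multiple of \<open>w\<close>.\<close>
      have "V * q \<le> w" using Dge[OF q(1)] q(2) by (simp add: D_def)
      moreover have "q \<le> V * q" using V q0 by simp
      ultimately have qw: "q \<le> w" by linarith
      have tq: "t \<le> t + q" "t + q \<le> T" "t < t + q" using q0 q(1) h by auto
      show False
      proof (cases "D q \<le> V2 * q")
        case True
        obtain z b where z: "controlled p t (t + q) z b" "z t = y t" "z (t + q) = y (t + q)"
          "cost t (t + q) z b \<le> K * (1 + V2 powr p) * (t + q - t)"
          using move_cost[of "y t" "y (t + q)" t "t + q" R K V2] yj[of t] yj[of "t + q"] yR[of t] yR[of "t + q"] tq tT K True
          by (auto simp: D_def)
        have "C0 * (energy t (t + q) a - q) \<le> K * (1 + V2 powr p) * q + e"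
          using near_optimal_compare[OF y z(1,2,3) tq(2)] z(4) cost_lower[OF sub[OF order_refl tq(1,2)]] by simp
        moreover have "energy t (t + h) a \<le> energy t (t + q) a"
          by (rule energy_mono[OF sub[OF order_refl tq(1,2)]]) (use q(1) h in auto)
        then have "C0 * (W powr (p - 1) * w / 2) \<le> C0 * energy t (t + q) a" using Eh C0 by (intro mult_left_mono) auto
        moreover have "K * (1 + V2 powr p) * q \<le> K * (1 + V2 powr p) * w" using K qw by (intro mult_left_mono) auto
        moreover have "C0 * q \<le> C0 * w" using C0 qw by simp
        ultimately have "C0 * (W powr (p - 1) * w / 2) \<le> (C0 + 1 + K * (1 + V2 powr p)) * w"
          using ew by (simp add: algebra_simps)
        then have "W powr (p - 1) * w \<le> 2 * (C0 + 1 + K * (1 + V2 powr p)) / C0 * w" using C0 by (simp add: field_simps)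
        then have "W powr (p - 1) \<le> 2 * (C0 + 1 + K * (1 + V2 powr p)) / C0" by (rule mult_right_le_imp_le[OF _ w0])
        then show False using W(3) by simp
      next
        case False
        have "q < hs"
        proof (rule ccontr)
          assume "\<not> q < hs"
          then have "q = hs" using q(1) by simp
          then show False using False Dhs mult_right_mono[OF V2V, of hs] h by (simp add: D_def)
        qed
        then have Dq: "D q = w" using q(3) by simp
        have Dw: "w \<le> D s" if "s \<in> {q..hs}" for s using q(4)[of s] Dq that by (cases "s = q") auto
        define \<kappa> where "\<kappa> = hs - q"
        have whs: "w \<le> V * hs" using Dw[of hs] Dhs \<open>q < hs\<close> by (simp add: D_def)
        have V2w: "V2 * q < w" using False Dq by simp
        \<comment> \<open>The path covers \<open>w\<close> up to time \<open>q\<close> at mean speed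
          above \<open>2 * \<Lambda> * V\<close>, but \<open>w\<close> is at most
          \<open>V * hs\<close>. Hence \<open>q\<close> takes less than half of \<open>hs\<close>,
          and \<open>\<kappa>\<close> is comparable to \<open>hs\<close>.\<close>
        have "2 * \<Lambda> * q < hs"
        proof -
          have "V * (2 * \<Lambda> * q) < V * hs" using V2w whs by (simp add: V2_def mult_ac)
          then show ?thesis using V by simp
        qed
        moreover have "2 * q \<le> 2 * \<Lambda> * q" using \<Lambda>(1) q0 by simp
        ultimately have q2: "2 * q < hs" by linarith
        have \<kappa>: "0 < \<kappa>" "\<kappa> \<le> hs" "hs \<le> 2 * \<kappa>" using q2 q0 by (auto simp: \<kappa>_def)
        define q' where "q' = t + q"
        define r where "r = t + hs"
        have qr: "t \<le> q'" "q' < r" "r \<le> T" "\<kappa> = r - q'" "t < r" using q0 \<open>q < hs\<close> h by (auto simp: q'_def r_def \<kappa>_def)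
        have Dq': "w \<le> l1_dist (y t) (y s)" if "s \<in> {q'..r}" for s
          using Dw[of "s - t"] that by (auto simp: D_def q'_def r_def)
        \<comment> \<open>Here the alternative \<open>hit\<close> is used: a path from the vertex is
          at distance at least \<open>w\<close> from it during this period, and any other path
          avoids it by assumption. The path is thus confined to one edge and can be
          translated.\<close>
        have nz: "y s \<noteq> 0" if s: "q' \<le> s" "s < r" for s
          using hit
        proof
          assume 0: "y t = 0"
          have "w \<le> norm (y s)" using Dq'[of s] s qr 0 yj[of s] by (simp add: l1_dist_zero)
          then show ?thesis using w0 by auto
        next
          assume "\<forall>s. t \<le> s \<and> s < t + hs \<longrightarrow> y s \<noteq> 0"
          then show ?thesis using s qr by (auto simp: r_def)
        qed
        obtain i where i: "0 < y q' $ i" using junction_pos_component[OF yj[of q'] nz[of q']] qr by auto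
        have iq: "y q' \<in> edge i" by (rule junction_pos_edge[OF yj i]) (use qr in auto)
        have pos: "0 < y s $ i" if s: "q' \<le> s" "s < r" for s
          by (rule controlled_stays_on_edge[OF sub[of q' s] iq]) (use s qr nz in auto)
        have ir: "y r \<in> edge i"
        proof (cases "y r = 0")
          case True then show ?thesis by (simp add: edge_iff)
        next
          case False
          have "0 < y r $ i"
            by (rule controlled_stays_on_edge[OF sub[of q' r] iq])
              (use qr nz False in \<open>auto simp: le_less\<close>)
          then show ?thesis using junction_pos_edge[OF yj[of r]] qr by auto
        qed
        have it: "y t \<in> edge i" using hit
        proof
          assume "y t = 0" then show ?thesis by (simp add: edge_iff)
        next
          assume nz': "\<forall>s. t \<le> s \<and> s < t + hs \<longrightarrow> y s \<noteq> 0"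
          have "0 < y t $ i"
            by (rule controlled_stays_on_edge[OF sub[of t q'] iq]) (use qr nz' in \<open>auto simp: r_def\<close>)
          then show ?thesis using junction_pos_edge[OF yj[of t]] tT by auto
        qed
        have ei: "y s \<in> edge i" if "s \<in> {q'..r}" for s
          using that pos[of s] ir junction_pos_edge[OF yj[of s]] qr by (cases "s = r") auto
        define z where "z = y t $ i"
        have z0: "0 \<le> z" "z \<le> R" using it norm_edge[OF it] yR[of t] tT by (auto simp: z_def edge_iff)
        have Dz: "w \<le> \<bar>y s $ i - z\<bar>" if "s \<in> {q'..r}" for s
          using Dq'[OF that] l1_dist_same_edge[OF it ei[OF that]] by (simp add: z_def abs_minus_commute)
        have Dzq: "\<bar>y q' $ i - z\<bar> = w"
          using Dq l1_dist_same_edge[OF it iq] by (simp add: D_def q'_def z_def abs_minus_commute)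
        define sg where "sg = (if z < y q' $ i then 1 else - 1 :: real)"
        have sg: "sg = 1 \<or> sg = - 1" by (simp add: sg_def)
        have sgq: "sg * (y q' $ i - z) = w" using Dzq by (auto simp: sg_def)
        \<comment> \<open>The distance to \<open>z\<close> never falls below \<open>w\<close>, so by
          the intermediate value theorem the path cannot pass to the other side of
          \<open>z\<close>.\<close>
        have away: "w \<le> sg * (y s $ i - z)" if s: "s \<in> {q'..r}" for s
        proof (rule ccontr)
          assume neg: "\<not> w \<le> sg * (y s $ i - z)"
          have ab: "\<bar>sg * (y \<sigma> $ i - z)\<bar> = \<bar>y \<sigma> $ i - z\<bar>" for \<sigma> using sg by (auto simp: abs_mult)
          have "sg * (y s $ i - z) < 0" using neg ab[of s] Dz[OF s] by linarith
          then have le: "sg * (y s $ i - z) \<le> 0" "0 \<le> sg * (y q' $ i - z)" using sgq w0 by auto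
          have c: "continuous_on {q'..s} (\<lambda>\<sigma>. sg * (y \<sigma> $ i - z))"
            by (intro continuous_intros controlled_component_continuous[OF sub]) (use s qr in auto)
          have "q' \<le> s" using s by simp
          from IVT2'[OF le this c] obtain \<sigma> where \<sigma>: "q' \<le> \<sigma>" "\<sigma> \<le> s" "sg * (y \<sigma> $ i - z) = 0" by blast
          have "w \<le> 0" using Dz[of \<sigma>] ab[of \<sigma>] \<sigma> s by auto
          then show False using w0 by simp
        qed
        have w2: "w \<le> 2 * V * \<kappa>"
        proof -
          have "V * hs \<le> V * (2 * \<kappa>)" using \<kappa>(3) V by (intro mult_left_mono) auto
          then show ?thesis using whs by simp
        qed
        obtain y' a' where y': "controlled p q' r y' a'" "y' q' = z *\<^sub>R axis i 1" "y' r = y r"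
          "cost q' r y' a' \<le> cost q' r y a + (c * w + c * (w / \<kappa>) / V) * (2 powr p * (energy q' r a + (2 * V) powr p * \<kappa>)) +
          (c * w + c * (w / \<kappa>) * (V powr (p - 1) + 1)) * \<kappa>"
          using transl[OF sub[of q' r] qr(4) \<kappa>(1) yR pos ir z0 w0 sg sgq away V w2] qr by auto
        have yt: "y t = z *\<^sub>R axis i 1" using edge_eq_axis[OF it] by (simp add: z_def)
        have Vp: "1 \<le> V powr p" "V \<le> V powr p"
          using V p powr_mono[of 1 p V] by (auto simp: ge_one_powr_ge_zero)
        \<comment> \<open>The straight line from \<open>y t\<close> to \<open>y r\<close> has speed
          exactly \<open>V\<close> by the choice of \<open>hs\<close>, which bounds the energy of
          the near-optimal path over the whole period.\<close>
        have E: "energy q' r a \<le> K1 * V powr p * hs"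
        proof -
          obtain z b where z: "controlled p t r z b" "z t = y t" "z r = y r" "cost t r z b \<le> K * (1 + V powr p) * (r - t)"
            using move_cost[of "y t" "y r" t r R K V] yj[of t] yj[of r] yR[of t] yR[of r] tT K Dhs qr
            by (auto simp: r_def)
          have "C0 * (energy t r a - hs) \<le> K * (1 + V powr p) * hs + e"
            using near_optimal_compare[OF y z(1,2,3) qr(3)] z(4) cost_lower[OF sub[of t r]] qr by (simp add: r_def)
          also have "K * (1 + V powr p) * hs \<le> K * (2 * V powr p) * hs"
            using K h Vp by (intro mult_right_mono mult_left_mono) auto
          also have "e \<le> V powr p * hs" using ew whs mult_right_mono[OF Vp(2), of hs] h by linarith
          finally have "C0 * (energy t r a - hs) \<le> (2 * K + 1) * V powr p * hs" by (simp add: algebra_simps)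
          then have "energy t r a \<le> hs + (2 * K + 1) * V powr p * hs / C0" using C0 by (simp add: field_simps)
          moreover have "hs \<le> V powr p * hs" using mult_right_mono[OF Vp(1), of hs] h by simp
          moreover have "K1 * V powr p * hs = V powr p * hs + (2 * K + 1) * V powr p * hs / C0"
            by (simp add: K1_def algebra_simps add_divide_distrib)
          ultimately have "energy t r a \<le> K1 * V powr p * hs" by linarith
          moreover have "energy q' r a \<le> energy t r a"
            by (rule energy_mono[OF sub[of t r]]) (use qr in auto)
          ultimately show ?thesis by simp
        qed
        have "V * hs \<le> 2 * R"
        proof -
          have "l1_dist (y t) (y r) \<le> l1_dist (y t) 0 + l1_dist 0 (y r)" by (rule l1_dist_triangle)
          also have "\<dots> = norm (y t) + norm (y r)" using yj[of t] yj[of r] qr tT by (simp add: l1_dist_zero)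
          also have "\<dots> \<le> 2 * R" using yR[of t] yR[of r] qr tT by simp
          finally show ?thesis using Dhs by (simp add: r_def)
        qed
        from translation_loss_bound[OF c less_imp_le[OF w0] V \<kappa> this E K1 p]
        have loss: "cost q' r y' a' \<le> cost q' r y a + w * V powr (p - 1) * K4"
          using y'(4) unfolding K4_def by linarith
        have cc: "controlled p t q' (\<lambda>_. y t) (\<lambda>_. 0)" by (rule controlled_const) (use yj tT qr in auto)
        have "cost t q' (\<lambda>_. y t) (\<lambda>_. 0) \<le> K * (1 + 0 powr p) * (q' - t)"
          by (rule cost_upper[OF cc K(2)]) (use yR[of t] tT K in auto)
        then have wait: "cost t q' (\<lambda>_. y t) (\<lambda>_. 0) \<le> K * q" using p by (simp add: q'_def)
        have eq: "y t = y' q'" using y'(2) yt by simp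
        let ?z = "\<lambda>\<sigma>. if \<sigma> \<le> q' then y t else y' \<sigma>" and ?b = "\<lambda>\<sigma>. if \<sigma> \<le> q' then 0 else a' \<sigma>"
        have "cost t r y a \<le> cost t r ?z ?b + e"
          by (rule near_optimal_compare[OF y controlled_join[OF cc y'(1) eq]]) (use qr y'(3) in auto)
        also have "cost t r ?z ?b = cost t q' (\<lambda>_. y t) (\<lambda>_. 0) + cost q' r y' a'"
          by (rule cost_join[OF cc y'(1) eq])
        finally have "cost t q' y a \<le> K * q + w * V powr (p - 1) * K4 + e"
          using wait loss cost_combine[OF sub[of t r], of q'] qr by linarith
        then have main: "C0 * (energy t q' a - q) \<le> K * q + w * V powr (p - 1) * K4 + e"
          using cost_lower[OF sub[of t q']] qr by (simp add: q'_def)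
        \<comment> \<open>The gain from waiting: the fast initial piece is no longer paid
          for.\<close>
        have "(\<Lambda> * V) powr (p - 1) * w / 2 \<le> energy t q' a"
          by (rule energy_ge_fast[OF sub[of t q']])
            (use \<Lambda> V qr V2w Dq in \<open>auto simp: q'_def V2_def D_def mult_ac\<close>)
        then have "C0 * ((\<Lambda> * V) powr (p - 1) * w / 2) \<le> C0 * energy t q' a" using C0 by simp
        moreover have "C0 * q \<le> C0 * w" "K * q \<le> K * w" using C0 K qw by auto
        ultimately have "C0 * ((\<Lambda> * V) powr (p - 1) * w / 2) \<le> (C0 + K + 1) * w + w * V powr (p - 1) * K4"
          using main ew by (simp add: algebra_simps)
        \<comment> \<open>The lower order terms are inflated by
          \<open>V powr (p - 1) \<ge> 1\<close>, so that this factor cancels and only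
          \<open>\<Lambda>\<close> remains.\<close>
        also have "(C0 + K + 1) * w \<le> (C0 + K + 1) * w * V powr (p - 1)"
          using C0 K w0 V p mult_left_mono[of 1 "V powr (p - 1)" "(C0 + K + 1) * w"] by (simp add: ge_one_powr_ge_zero)
        finally have "C0 * (\<Lambda> powr (p - 1) * V powr (p - 1) * w / 2) \<le> (C0 + K + K4 + 1) * (V powr (p - 1) * w)"
          using \<Lambda> V by (simp add: powr_mult algebra_simps)
        then have "\<Lambda> powr (p - 1) * (V powr (p - 1) * w) \<le> 2 * (C0 + K + K4 + 1) / C0 * (V powr (p - 1) * w)"
          using C0 by (simp add: field_simps)
        moreover have "0 < V powr (p - 1) * w" using V w0 by simp
        ultimately have "\<Lambda> powr (p - 1) \<le> 2 * (C0 + K + K4 + 1) / C0" by (simp only: mult_le_cancel_right_pos)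
        then show False using \<Lambda>(2) by simp
      qed
    qed
  qed
qed
qed

end

context control
begin

text \<open>If the displacement at \<open>h\<close> exceeds \<open>V * h\<close>, there is a first
  later time at which it equals \<open>V\<close> times the elapsed time, and it stays above that
  rate in between; \<open>displacement_core\<close> applies with this time as
  \<open>hs\<close>.\<close>

lemma displacement_until:
  assumes R: "0 < R" and V: "1 \<le> V"
  obtains V' where "V \<le> V'" "\<And>e t y a h H. 0 \<le> e \<Longrightarrow> near_optimal e t y a \<Longrightarrow> (\<And>s. s \<in> {t..T} \<Longrightarrow> norm (y s) \<le> R) \<Longrightarrow>
    0 < h \<Longrightarrow> h \<le> H \<Longrightarrow> t + H \<le> T \<Longrightarrow> l1_dist (y t) (y (t + H)) \<le> V * H \<Longrightarrow>
    y t = 0 \<or> (\<forall>s. t \<le> s \<and> s < t + H \<longrightarrow> y s \<noteq> 0) \<Longrightarrow>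
    l1_dist (y t) (y (t + h)) \<le> V' * (h + e)"
proof -
  show ?thesis
  proof (rule displacement_core[OF R V], goal_cases)
  case (1 V')
  note V' = 1(1) and core = 1(2)
  show ?thesis
  proof (rule that[OF V'])
    fix e t y a h H
    assume e: "0 \<le> e" and y: "near_optimal e t y a" and yR: "\<And>s. s \<in> {t..T} \<Longrightarrow> norm (y s) \<le> R"
      and h: "0 < h" "h \<le> H" "t + H \<le> T" and DH: "l1_dist (y t) (y (t + H)) \<le> V * H"
      and hit: "y t = 0 \<or> (\<forall>s. t \<le> s \<and> s < t + H \<longrightarrow> y s \<noteq> 0)"
    have yc: "controlled p t T y a" using y by (simp add: near_optimal_def)
    show "l1_dist (y t) (y (t + h)) \<le> V' * (h + e)"
    proof (cases "l1_dist (y t) (y (t + h)) \<le> V * h")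
      case True
      also have "V * h \<le> V' * (h + e)" using V V' e h by (intro mult_mono) auto
      finally show ?thesis .
    next
      case False
      define f where "f s = l1_dist (y t) (y (t + s)) - V * s" for s
      have "continuous_on {h..H} f"
        unfolding f_def using h
        by (intro continuous_intros continuous_on_compose2[OF controlled_continuous[OF yc]]) auto
      from first_zero[OF this h(2)] obtain q where q: "q \<in> {h..H}" "f q = 0" "\<And>s. s \<in> {h..q} \<Longrightarrow> 0 \<le> f s"
        using False DH by (auto simp: f_def)
      show ?thesis
        by (rule core[OF e y yR h(1), of q]) (use q h hit in \<open>auto simp: f_def\<close>)
    qed
  qed
qed
qed

text \<open>An arbitrary path is cut at its first visit of the vertex. The piece before the visit
  avoids the vertex and the piece after it starts there, so \<open>displacement_until\<close>
  handles both, provided the vertex is not reached at excessive speed. The lower bound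
  \<open>e \<le> norm (y t)\<close> lets the distance to the vertex absorb the error in that last
  point.\<close>

lemma displacement_bound:
  assumes R: "0 < R" and V0: "1 \<le> V0" and gap: "0 < gap"
  obtains M where "0 \<le> M" "\<And>e t y a h. 0 \<le> e \<Longrightarrow> near_optimal e t y a \<Longrightarrow> (\<And>s. s \<in> {t..T} \<Longrightarrow> norm (y s) \<le> R) \<Longrightarrow>
    (\<And>s. s \<in> {t..T} \<Longrightarrow> s \<le> t + gap \<Longrightarrow> e \<le> 2 * (T - s) \<Longrightarrow> l1_dist (y s) (y T) \<le> V0 * (T - s)) \<Longrightarrow>
    0 < h \<Longrightarrow> t + h \<le> T \<Longrightarrow> e \<le> h \<Longrightarrow> y t = 0 \<or> e \<le> norm (y t) \<Longrightarrow>
    l1_dist (y t) (y (t + h)) \<le> M * h"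
proof -
  show ?thesis
  proof (rule displacement_until[OF R V0], goal_cases)
  case (1 V1)
  note V1 = 1(1) and until0 = 1(2)
  obtain K where K: "1 \<le> K" "\<And>s x a. x \<in> junction \<Longrightarrow> norm x \<le> R \<Longrightarrow> \<bar>running s x a\<bar> \<le> K * (1 + \<bar>a\<bar> powr p)"
    using running_upper[OF R] by metis
  have p1: "0 < p - 1" using p by simp
  \<comment> \<open>Speed of the competitor used to exclude a fast approach to the vertex:
    \<open>1\<close> for the way to the vertex, \<open>2 * V1\<close> for the way after it (time and
    error both at most \<open>z\<close>), and \<open>V0\<close> for the case that the final time
    comes first.\<close>
  define V2 where "V2 = 1 + V0 + 2 * V1"
  obtain W where W: "1 \<le> W" "2 * (C0 + K * (1 + V2 powr p) + 1) / C0 < W powr (p - 1)"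
    using exists_powr_gt[OF p1] by metis
  \<comment> \<open>\<open>2 * W\<close> makes an approach faster than \<open>V\<close> expensive,
    and \<open>R / gap\<close> forces such an approach to end within \<open>gap\<close>, where the
    terminal hypothesis is available.\<close>
  define V where "V = max (max V0 (2 * W)) (R / gap)"
  have V: "1 \<le> V" "V0 \<le> V" "2 * W \<le> V" "2 \<le> V" "R \<le> V * gap"
  proof -
    show "1 \<le> V" "V0 \<le> V" "2 * W \<le> V" using V0 by (auto simp: V_def)
    then show "2 \<le> V" using W(1) by linarith
    have "R / gap \<le> V" by (simp add: V_def)
    then show "R \<le> V * gap" using gap by (simp add: field_simps)
  qed
  show ?thesis
  proof (rule displacement_until[OF R V(1)], goal_cases)
    case (1 V')
    note V' = 1(1) and until = 1(2)
    \<comment> \<open>The \<open>3\<close> is a path length \<open>1 * h\<close> at unit reference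
      speed plus \<open>2 * h\<close> from the coercivity constant on a remaining time of at most
      \<open>2 * h\<close>.\<close>
    define Md where "Md = 3 + (2 * K * (1 + V0 powr p) + 1) / C0"
    define M where "M = 2 * R / gap + Md + 2 * V' + V + 2 * V1"
    have Md0: "0 \<le> Md" using K C0 by (simp add: Md_def)
    have M: "2 * R / gap \<le> M" "Md \<le> M" "2 * V' \<le> M" "V + 2 * V1 \<le> M" "0 \<le> M"
    proof -
      have "0 \<le> 2 * R / gap" using R gap by simp
      then show "2 * R / gap \<le> M" "Md \<le> M" "2 * V' \<le> M" "V + 2 * V1 \<le> M" "0 \<le> M"
        using Md0 V(1) V' V1 V0 unfolding M_def by linarith+
    qed
    show ?thesis
    proof (rule that[OF M(5)])
      fix e t y a h
      assume e: "0 \<le> e" and y: "near_optimal e t y a" and yR: "\<And>s. s \<in> {t..T} \<Longrightarrow> norm (y s) \<le> R"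
        and fin: "\<And>s. s \<in> {t..T} \<Longrightarrow> s \<le> t + gap \<Longrightarrow> e \<le> 2 * (T - s) \<Longrightarrow> l1_dist (y s) (y T) \<le> V0 * (T - s)"
        and h: "0 < h" "t + h \<le> T" and eh: "e \<le> h" and ez: "y t = 0 \<or> e \<le> norm (y t)"
      have yc: "controlled p t T y a" using y by (simp add: near_optimal_def)
      have tT: "t \<le> T" using controlledD(1)[OF yc] .
      have yj: "y s \<in> junction" if "s \<in> {t..T}" for s using controlledD(2)[OF yc that] .
      have sub: "controlled p q r y a" if "t \<le> q" "q \<le> r" "r \<le> T" for q r
        using controlled_subset[OF yc that] .
      have hM: "X * h \<le> M * h" if "X \<le> M" for X using that h by (intro mult_right_mono) auto
      have finT: "l1_dist (y t) (y T) \<le> V0 * (T - t)"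
        by (rule fin) (use tT gap eh h in auto)
      have compare: "C0 * (energy t (t + q) a - q) \<le> K * (1 + v powr p) * q + e"
        if q: "0 < q" "t + q \<le> T" and v: "l1_dist (y t) (y (t + q)) \<le> v * q" for q v
      proof -
        obtain z b where z: "controlled p t (t + q) z b" "z t = y t" "z (t + q) = y (t + q)"
          "cost t (t + q) z b \<le> K * (1 + v powr p) * (t + q - t)"
          using move_cost[of "y t" "y (t + q)" t "t + q" R K v] yj[of t] yj[of "t + q"] yR[of t] yR[of "t + q"] q tT K v
          by auto
        show ?thesis
          using near_optimal_compare[OF y z(1,2,3) q(2)] z(4) cost_lower[OF sub[of t "t + q"]] q by simp
      qed
      show "l1_dist (y t) (y (t + h)) \<le> M * h"
      proof (cases "gap < h")
        case True
        have "l1_dist (y t) (y (t + h)) \<le> l1_dist (y t) 0 + l1_dist 0 (y (t + h))" by (rule l1_dist_triangle)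
        also have "\<dots> = norm (y t) + norm (y (t + h))" using yj[of t] yj[of "t + h"] h tT by (simp add: l1_dist_zero)
        also have "\<dots> \<le> 2 * R" using yR[of t] yR[of "t + h"] h tT by simp
        also have "\<dots> \<le> 2 * R / gap * h" using True gap R by (simp add: field_simps)
        finally show ?thesis using hM[OF M(1)] by linarith
      next
        case hgap: False
        show ?thesis
        \<comment> \<open>Close to the final time the straight line to \<open>y T\<close> is a good
          enough competitor. Otherwise a visit of the vertex before \<open>t + h\<close> leaves time
          at least \<open>h\<close>, hence enough for the condition on \<open>e\<close> in the
          terminal hypothesis.\<close>
        proof (cases "T - t \<le> 2 * h")
          case True
          have "C0 * (energy t T a - (T - t)) \<le> K * (1 + V0 powr p) * (T - t) + e"
            using compare[of "T - t" V0] finT h by simp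
          also have "\<dots> \<le> K * (1 + V0 powr p) * (2 * h) + h"
            using True K eh by (intro add_mono mult_left_mono) auto
          also have "\<dots> = (2 * K * (1 + V0 powr p) + 1) * h" by (simp add: algebra_simps)
          finally have "energy t T a \<le> (T - t) + (2 * K * (1 + V0 powr p) + 1) * h / C0" using C0 by (simp add: field_simps)
          also have "\<dots> \<le> 2 * h + (2 * K * (1 + V0 powr p) + 1) * h / C0" using True by simp
          finally have "energy t (t + h) a \<le> 2 * h + (2 * K * (1 + V0 powr p) + 1) * h / C0"
            using energy_mono[OF yc, of t "t + h"] h by simp
          then have "l1_dist (y t) (y (t + h)) \<le> Md * h"
            using l1_dist_le_energy[OF sub[of t "t + h"], of 1] h by (simp add: Md_def algebra_simps)
          then show ?thesis using hM[OF M(2)] by linarith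
        next
          case T2h: False
          have eh2: "V' * (h + e) \<le> M * h"
          proof -
            have "V' * (h + e) \<le> V' * (2 * h)" using V' V eh by (intro mult_left_mono) auto
            then show ?thesis using hM[OF M(3)] by simp
          qed
          have finV: "l1_dist (y t) (y (t + (T - t))) \<le> V * (T - t)"
            using finT mult_right_mono[OF V(2), of "T - t"] tT by simp
          show ?thesis
          proof (cases "y t = 0 \<or> (\<forall>s\<in>{t..T}. y s \<noteq> 0)")
            case True
            have "l1_dist (y t) (y (t + h)) \<le> V' * (h + e)"
              by (rule until[OF e y yR h(1) _ _ finV]) (use h True in auto)
            then show ?thesis using eh2 by linarith
          next
            case False
            define z where "z = norm (y t)"
            have z: "0 < z" "e \<le> z" "z \<le> R" using False ez yR[of t] tT by (auto simp: z_def)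
            have "closed ({t..T} \<inter> y -` {0})"
              by (rule continuous_closed_preimage[OF controlled_continuous[OF yc]]) auto
            then have "compact ({t..T} \<inter> y -` {0})"
              by (intro compact_eq_bounded_closed[THEN iffD2]) (auto intro: bounded_subset[of "{t..T}"])
            moreover have "{t..T} \<inter> y -` {0} \<noteq> {}" using False by auto
            ultimately have "\<exists>q\<in>{t..T} \<inter> y -` {0}. \<forall>s\<in>{t..T} \<inter> y -` {0}. q \<le> s"
              by (rule compact_attains_inf)
            then obtain q where q: "q \<in> {t..T}" "y q = 0" "\<And>s. s \<in> {t..T} \<Longrightarrow> y s = 0 \<Longrightarrow> q \<le> s"
              by auto
            define k where "k = q - t"
            have k: "0 < k" "t + k \<le> T" "y (t + k) = 0" "\<And>s. t \<le> s \<Longrightarrow> s < t + k \<Longrightarrow> y s \<noteq> 0"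
              using q False by (auto simp: k_def order_less_le) force+
            have Dk: "l1_dist (y t) (y (t + k)) = z" using yj[of t] tT k by (simp add: l1_dist_zero z_def)
            have tail: "l1_dist 0 (y (t + k + s)) \<le> V1 * (s + e)"
              if s: "0 < s" "t + k + s \<le> T" "k \<le> gap" "e \<le> 2 * (T - (t + k))" for s
            proof -
              have n: "near_optimal e (t + k) y a" by (rule near_optimal_tail[OF y]) (use k in auto)
              have f: "l1_dist (y (t + k)) (y (t + k + (T - (t + k)))) \<le> V0 * (T - (t + k))"
                using fin[of "t + k"] k s by simp
              show ?thesis
                using until0[OF e n _ s(1) _ _ f] yR k s by simp
            qed
            \<comment> \<open>A visit at speed above \<open>V\<close> would cost energy of order
              \<open>W powr (p - 1) * z\<close>. Over the longer period \<open>H\<close>, comparable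
              to \<open>z\<close>, the same endpoint is reached by a straight line at cost of order
              \<open>z\<close>.\<close>
            have zVk: "z \<le> V * k"
            proof (rule ccontr)
              assume "\<not> z \<le> V * k"
              then have Vk: "V * k < z" by simp
              have "2 * k \<le> V * k" using V(4) k by (intro mult_right_mono) auto
              then have kz: "2 * k \<le> z" using Vk by linarith
              have "V * k < V * gap" using Vk z V(5) by linarith
              then have kgap: "k < gap" using V(1) by simp
              \<comment> \<open>Long enough for the competitor to have bounded speed, but not beyond
                the final time.\<close>
              define H where "H = min z (T - t)"
              have H: "k \<le> H" "0 < H" "t + H \<le> T" "H \<le> z" using kz k z by (auto simp: H_def)
              have DH: "l1_dist (y t) (y (t + H)) \<le> V2 * H"
              proof (cases "T - t \<le> z")
                case True
                then have "l1_dist (y t) (y (t + H)) \<le> V0 * H" using finT by (simp add: H_def)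
                also have "\<dots> \<le> V2 * H" using V1 V0 H by (intro mult_right_mono) (auto simp: V2_def)
                finally show ?thesis .
              next
                case False
                have "l1_dist 0 (y (t + k + (z - k))) \<le> V1 * ((z - k) + e)"
                  by (rule tail) (use False kz k kgap z in auto)
                also have "\<dots> \<le> V1 * (2 * z)" using z k V1 V0 by (intro mult_left_mono) auto
                finally have "l1_dist 0 (y (t + z)) \<le> 2 * V1 * z" by simp
                moreover have "l1_dist (y t) (y (t + z)) \<le> l1_dist (y t) 0 + l1_dist 0 (y (t + z))" by (rule l1_dist_triangle)
                moreover have "l1_dist (y t) 0 = z" using yj[of t] tT by (simp add: l1_dist_zero z_def)
                ultimately have "l1_dist (y t) (y (t + z)) \<le> (1 + 2 * V1) * z" by (simp add: algebra_simps)
                also have "\<dots> \<le> V2 * z" using V0 z by (intro mult_right_mono) (auto simp: V2_def)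
                finally show ?thesis using False by (simp add: H_def)
              qed
              have "W powr (p - 1) * z / 2 \<le> energy t (t + k) a"
              proof (rule energy_ge_fast[OF sub[of t "t + k"]])
                have "2 * W * k \<le> V * k" using V(3) k by (intro mult_right_mono) auto
                then show "2 * W * (t + k - t) \<le> z" using Vk by simp
              qed (use W k Dk in auto)
              also have "\<dots> \<le> energy t (t + H) a"
                by (rule energy_mono[OF sub[of t "t + H"]]) (use H k in auto)
              finally have "C0 * (W powr (p - 1) * z / 2) \<le> C0 * energy t (t + H) a" using C0 by simp
              moreover have "C0 * (energy t (t + H) a - H) \<le> K * (1 + V2 powr p) * H + e"
                by (rule compare[OF H(2,3) DH])
              moreover have "K * (1 + V2 powr p) * H \<le> K * (1 + V2 powr p) * z" using K H by (intro mult_left_mono) auto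
              moreover have "C0 * H \<le> C0 * z" using C0 H by simp
              ultimately have "C0 * (W powr (p - 1) * z / 2) \<le> (C0 + K * (1 + V2 powr p) + 1) * z"
                using z by (simp add: algebra_simps)
              then have "W powr (p - 1) * z \<le> 2 * (C0 + K * (1 + V2 powr p) + 1) / C0 * z" using C0 by (simp add: field_simps)
              then have "W powr (p - 1) \<le> 2 * (C0 + K * (1 + V2 powr p) + 1) / C0" by (rule mult_right_le_imp_le[OF _ z(1)])
              then show False using W by simp
            qed
            show ?thesis
            proof (cases "k \<le> h")
              case True
              have zh: "z \<le> V * h" using zVk mult_left_mono[OF True, of V] V by linarith
              show ?thesis
              proof (cases "k = h")
                case True
                have "V * h \<le> M * h" by (rule hM) (use M(4) V1 V0 in linarith)
                then show ?thesis using Dk zh True by simp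
              next
                case False
                have "l1_dist 0 (y (t + k + (h - k))) \<le> V1 * ((h - k) + e)"
                  by (rule tail) (use False True h hgap T2h eh k in auto)
                also have "\<dots> \<le> V1 * (2 * h)" using eh k V1 V0 by (intro mult_left_mono) auto
                finally have "l1_dist 0 (y (t + h)) \<le> 2 * V1 * h" by simp
                moreover have "l1_dist (y t) (y (t + h)) \<le> l1_dist (y t) 0 + l1_dist 0 (y (t + h))" by (rule l1_dist_triangle)
                moreover have "l1_dist (y t) 0 = z" using yj[of t] tT by (simp add: l1_dist_zero z_def)
                ultimately have "l1_dist (y t) (y (t + h)) \<le> (V + 2 * V1) * h" using zh by (simp add: algebra_simps)
                then show ?thesis using hM[OF M(4)] by linarith
              qed
            next
              case False
              have "l1_dist (y t) (y (t + h)) \<le> V' * (h + e)"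
                by (rule until[OF e y yR h(1), of k]) (use False k Dk zVk in auto)
              then show ?thesis using eh2 by linarith
            qed
          qed
        qed
      qed
    qed
  qed
qed
qed

section \<open>Regularity of the value function\<close>

definition g_locally_lipschitz :: bool where
  "g_locally_lipschitz \<longleftrightarrow> (\<forall>r>0. \<exists>k\<ge>0. \<forall>x\<in>junction. \<forall>z\<in>junction. norm x \<le> r \<longrightarrow> norm z \<le> r \<longrightarrow> \<bar>g x - g z\<bar> \<le> k * l1_dist x z)"

lemma g_locally_lipschitzE:
  assumes "g_locally_lipschitz" "0 < r"
  obtains k where "0 \<le> k" "\<And>x z. x \<in> junction \<Longrightarrow> z \<in> junction \<Longrightarrow> norm x \<le> r \<Longrightarrow> norm z \<le> r \<Longrightarrow> \<bar>g x - g z\<bar> \<le> k * l1_dist x z"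
proof -
  obtain k where "0 \<le> k \<and> (\<forall>x\<in>junction. \<forall>z\<in>junction. norm x \<le> r \<longrightarrow> norm z \<le> r \<longrightarrow> \<bar>g x - g z\<bar> \<le> k * l1_dist x z)"
    using assms(1)[unfolded g_locally_lipschitz_def, THEN spec, THEN mp, OF assms(2)] by (elim exE)
  then show ?thesis using that[of k] by simp
qed

text \<open>In the first alternative the times \<open>s\<close> keep distance
  \<open>\<delta>\<close> from \<open>T\<close>, so the energy bound \<open>E\<close> is at most
  \<open>E / \<delta>\<close> times the remaining time. In the second, compare with standing still:
  travelling gains at most the Lipschitz constant times the distance in terminal cost, while the
  energy charges a higher rate.\<close>

lemma terminal_displacement:
  assumes r: "0 < r" and T1: "T1 \<le> T" and \<delta>: "0 < \<delta>" and reg: "T1 + 2 * \<delta> \<le> T \<or> g_locally_lipschitz"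
  obtains V0 R where "1 \<le> V0" "r \<le> R"
    "\<And>e t y a s. e \<le> 1 \<Longrightarrow> 0 \<le> t \<Longrightarrow> near_optimal e t y a \<Longrightarrow> norm (y t) \<le> r \<Longrightarrow> s \<in> {t..T} \<Longrightarrow> norm (y s) \<le> R"
    "\<And>e t y a s. e \<le> 1 \<Longrightarrow> 0 \<le> t \<Longrightarrow> t \<le> T1 \<Longrightarrow> near_optimal e t y a \<Longrightarrow> norm (y t) \<le> r \<Longrightarrow> s \<in> {t..T} \<Longrightarrow>
      s \<le> t + \<delta> \<Longrightarrow> e \<le> 2 * (T - s) \<Longrightarrow> l1_dist (y s) (y T) \<le> V0 * (T - s)"
proof -
  obtain E where E: "0 < E"
    "\<And>e t y a. 0 \<le> t \<Longrightarrow> e \<le> 1 \<Longrightarrow> near_optimal e t y a \<Longrightarrow> norm (y t) \<le> r \<Longrightarrow> energy t T a \<le> E"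
    "\<And>e t y a s. 0 \<le> t \<Longrightarrow> e \<le> 1 \<Longrightarrow> near_optimal e t y a \<Longrightarrow> norm (y t) \<le> r \<Longrightarrow> s \<in> {t..T} \<Longrightarrow> norm (y s) \<le> r + T + E"
    using energy_bound[OF r] by metis
  define R where "R = r + T + E"
  have R: "0 < R" "r \<le> R" using r T E by (auto simp: R_def)
  have yR: "norm (y s) \<le> R" if "e \<le> 1" "0 \<le> t" "near_optimal e t y a" "norm (y t) \<le> r" "s \<in> {t..T}" for e t y a s
    using E(3)[of t e y a s] that by (simp add: R_def)
  from reg show ?thesis
  proof
    assume far: "T1 + 2 * \<delta> \<le> T"
    show ?thesis
    proof (rule that[of "1 + E / \<delta>" R])
      show "1 \<le> 1 + E / \<delta>" using E \<delta> by simp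
      fix e t y a s
      assume *: "e \<le> 1" "0 \<le> t" "t \<le> T1" "near_optimal e t y a" "norm (y t) \<le> r" "s \<in> {t..T}" "s \<le> t + \<delta>"
      have yc: "controlled p t T y a" using * by (simp add: near_optimal_def)
      have "l1_dist (y s) (y T) \<le> 1 * (T - s) + energy s T a / 1 powr (p - 1)"
        by (rule l1_dist_le_energy[OF controlled_subset[OF yc]]) (use * in auto)
      also have "energy s T a \<le> energy t T a" by (rule energy_mono[OF yc]) (use * in auto)
      also have "energy t T a \<le> E" using E(2) * by blast
      finally have a: "l1_dist (y s) (y T) \<le> (T - s) + E" by (simp add: divide_right_mono)
      have "E / \<delta> * \<delta> \<le> E / \<delta> * (T - s)"
        using E(1) \<delta> far * by (intro mult_left_mono) auto
      then have "E \<le> E / \<delta> * (T - s)" using \<delta> by simp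
      then show "l1_dist (y s) (y T) \<le> (1 + E / \<delta>) * (T - s)" using a by (simp add: algebra_simps)
    qed (use R yR in blast)+
  next
    assume lip: g_locally_lipschitz
    obtain k where k: "0 \<le> k" "\<And>x z. x \<in> junction \<Longrightarrow> z \<in> junction \<Longrightarrow> norm x \<le> R \<Longrightarrow> norm z \<le> R \<Longrightarrow> \<bar>g x - g z\<bar> \<le> k * l1_dist x z"
      using g_locally_lipschitzE[OF lip R(1)] by metis
    obtain K where K: "1 \<le> K" "\<And>s x a. x \<in> junction \<Longrightarrow> norm x \<le> R \<Longrightarrow> \<bar>running s x a\<bar> \<le> K * (1 + \<bar>a\<bar> powr p)"
      using running_upper[OF R(1)] by metis
    have p1: "0 < p - 1" using p by simp
    \<comment> \<open>The rate charged per unit of distance exceeds the Lipschitz constant by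
      \<open>1\<close>; this surplus is the distance that gets bounded.\<close>
    obtain l where l: "1 \<le> l" "(k + 1) / C0 < l powr (p - 1)" using exists_powr_gt[OF p1] by metis
    define V0 where "V0 = K + C0 + 2 + C0 * l powr p"
    show ?thesis
    proof (rule that[of V0 R])
      show "1 \<le> V0" using K C0 by (simp add: V0_def)
      fix e t y a s
      assume *: "e \<le> 1" "0 \<le> t" "t \<le> T1" "near_optimal e t y a" "norm (y t) \<le> r" "s \<in> {t..T}" "e \<le> 2 * (T - s)"
      have yc: "controlled p t T y a" using * by (simp add: near_optimal_def)
      have sc: "controlled p s T y a" by (rule controlled_subset[OF yc]) (use * in auto)
      have sn: "near_optimal e s y a" by (rule near_optimal_tail[OF *(4)]) (use * in auto)
      have yj: "y s \<in> junction" "y T \<in> junction" using controlledD(1,2)[OF sc] by auto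
      have yRs: "norm (y s) \<le> R" "norm (y T) \<le> R" using yR[OF *(1,2,4,5)] * by auto
      have cc: "controlled p s T (\<lambda>_. y s) (\<lambda>_. 0)" by (rule controlled_const) (use yj * in auto)
      have "cost s T (\<lambda>_. y s) (\<lambda>_. 0) \<le> K * (1 + 0 powr p) * (T - s)"
        by (rule cost_upper[OF cc K(2)]) (use yRs K in auto)
      then have "val (y s) s \<le> K * (T - s) + g (y s)" using val_le[OF cc] p by simp
      then have "cost s T y a + g (y T) \<le> K * (T - s) + g (y s) + e"
        using sn by (simp add: near_optimal_def)
      moreover have "C0 * (energy s T a - (T - s)) \<le> cost s T y a" by (rule cost_lower[OF sc])
      moreover have "C0 * (l powr (p - 1) * l1_dist (y s) (y T) - l powr p * (T - s)) \<le> C0 * energy s T a"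
        using energy_ge[OF sc, of l] l C0 by (intro mult_left_mono) auto
      moreover have "g (y s) - g (y T) \<le> k * l1_dist (y s) (y T)" using k(2)[OF yj yRs] by linarith
      moreover have "(k + 1) * l1_dist (y s) (y T) \<le> C0 * l powr (p - 1) * l1_dist (y s) (y T)"
        using l(2) C0 by (intro mult_right_mono) (auto simp: field_simps)
      ultimately show "l1_dist (y s) (y T) \<le> V0 * (T - s)"
        using *(7) by (simp add: V0_def algebra_simps)
    qed (use R yR in blast)+
  qed
qed

section \<open>Lipschitz bounds for the value function\<close>

text \<open>All that the Lipschitz bounds need to know about near-optimal paths; the point
  \<open>w\<close> is the position after time \<open>h\<close>, and the path itself is
  forgotten.\<close>

lemma val_displacement:
  assumes r: "0 < r" and T1: "T1 \<le> T" and \<delta>: "0 < \<delta>" and reg: "T1 + 2 * \<delta> \<le> T \<or> g_locally_lipschitz"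
  obtains M R where "0 \<le> M" "r \<le> R"
    "\<And>t z h. 0 \<le> t \<Longrightarrow> t \<le> T1 \<Longrightarrow> z \<in> junction \<Longrightarrow> norm z \<le> r \<Longrightarrow> 0 < h \<Longrightarrow> t + h \<le> T \<Longrightarrow>
      \<exists>w\<in>junction. norm w \<le> R \<and> l1_dist z w \<le> M * h \<and> val w (t + h) \<le> val z t + M * h"
proof -
  show ?thesis
  proof (rule terminal_displacement[OF assms], goal_cases)
  case (1 V0 R)
  note V0 = 1(1) and rR = 1(2) and yR = 1(3) and fin = 1(4)
  have R: "0 < R" using r rR by simp
  show ?thesis
  proof (rule displacement_bound[OF R V0 \<delta>], goal_cases)
    case (1 M)
    note M = 1(1) and disp = 1(2)
    show ?thesis
    proof (rule that[of "max M (1 + C0)" R])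
      show "0 \<le> max M (1 + C0)" using M by simp
      show "r \<le> R" by (rule rR)
      fix t h :: real and z :: "real ^ 'n" assume t: "0 \<le> t" "t \<le> T1" and z: "z \<in> junction" "norm z \<le> r" and h: "0 < h" "t + h \<le> T"
      \<comment> \<open>The error may be chosen after \<open>h\<close> and \<open>z\<close>: below
        \<open>h\<close> and \<open>norm z\<close> for the displacement bound (at the vertex only
        \<open>h\<close> counts), and below \<open>1\<close> for the energy bound.\<close>
      define e where "e = min (min h 1) (if z = 0 then 1 else norm z)"
      have e: "0 < e" "e \<le> h" "e \<le> 1" "z = 0 \<or> e \<le> norm z" using h by (auto simp: e_def)
      have tT: "t \<le> T" using h by simp
      obtain y a where y: "near_optimal e t y a" "y t = z" using near_optimal_exists[OF z(1) tT e(1)] by metis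
      have yc: "controlled p t T y a" using y by (simp add: near_optimal_def)
      have yh: "controlled p t (t + h) y a" by (rule controlled_subset[OF yc]) (use h in auto)
      have "l1_dist (y t) (y (t + h)) \<le> M * h"
        by (rule disp[OF less_imp_le[OF e(1)] y(1)]) (use yR[OF e(3) t(1) y(1)] fin[OF e(3) t y(1)] y z e h in auto)
      also have "\<dots> \<le> max M (1 + C0) * h" using h by (intro mult_right_mono) auto
      finally have d: "l1_dist z (y (t + h)) \<le> max M (1 + C0) * h" using y by simp
      have "val (y (t + h)) (t + h) \<le> val z t + e - cost t (t + h) y a"
        using near_optimal_cost[OF y(1), of "t + h"] h y(2) by simp
      also have "\<dots> \<le> val z t + (1 + C0) * h"
        using cost_ge[OF yh] e by (simp add: algebra_simps)
      also have "(1 + C0) * h \<le> max M (1 + C0) * h" using h by (intro mult_right_mono) auto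
      finally have "val (y (t + h)) (t + h) \<le> val z t + max M (1 + C0) * h" by simp
      moreover have "y (t + h) \<in> junction" using controlledD(2)[OF yc] h by simp
      moreover have "norm (y (t + h)) \<le> R" using yR[OF e(3) t(1) y(1)] y z h by simp
      ultimately show "\<exists>w\<in>junction. norm w \<le> R \<and> l1_dist z w \<le> max M (1 + C0) * h \<and> val w (t + h) \<le> val z t + max M (1 + C0) * h"
        using d by blast
    qed
  qed
qed
qed

lemma val_move:
  assumes x: "x \<in> junction" and w: "w \<in> junction" and h: "0 < h" "t + h \<le> T"
    and K: "\<And>s x a. x \<in> junction \<Longrightarrow> norm x \<le> r \<Longrightarrow> \<bar>running s x a\<bar> \<le> K * (1 + \<bar>a\<bar> powr p)" "0 \<le> K"
    and r: "norm x \<le> r" "norm w \<le> r" and v: "l1_dist x w \<le> v * h"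
  shows "val x t \<le> K * (1 + v powr p) * h + val w (t + h)"
proof -
  obtain y a where y: "controlled p t (t + h) y a" "y t = x" "y (t + h) = w" "cost t (t + h) y a \<le> K * (1 + v powr p) * (t + h - t)"
    using move_cost[OF x w _ K r, of t "t + h" v] h v by auto
  then show ?thesis using val_le_cost_add_val[OF y(1) h(2)] by simp
qed

text \<open>The time lag is taken equal to the distance \<open>d\<close> of the two points. The
  point \<open>w\<close> reached from \<open>z\<close> after time \<open>d\<close> is within
  \<open>(1 + M) * d\<close> of \<open>x\<close>, so the straight line from \<open>x\<close> to
  \<open>w\<close> takes the same time at bounded speed.\<close>

lemma val_lipschitz_space:
  assumes r: "0 < r" and T1: "T1 \<le> T" and \<delta>: "0 < \<delta>" and reg: "T1 + 2 * \<delta> \<le> T \<or> g_locally_lipschitz"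
  obtains k where "0 \<le> k"
    "\<And>t x z. 0 \<le> t \<Longrightarrow> t \<le> T1 \<Longrightarrow> x \<in> junction \<Longrightarrow> z \<in> junction \<Longrightarrow> norm x \<le> r \<Longrightarrow> norm z \<le> r \<Longrightarrow> l1_dist x z \<le> \<delta> \<Longrightarrow>
      \<bar>val x t - val z t\<bar> \<le> k * l1_dist x z"
proof -
  show ?thesis
  proof (rule val_displacement[OF assms], goal_cases)
  case (1 M R)
  note M = 1(1) and rR = 1(2) and disp = 1(3)
  have R: "0 < R" using r rR by simp
  obtain K where K: "1 \<le> K" "\<And>s x a. x \<in> junction \<Longrightarrow> norm x \<le> R \<Longrightarrow> \<bar>running s x a\<bar> \<le> K * (1 + \<bar>a\<bar> powr p)"
    using running_upper[OF R] by metis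
  obtain q where q: "0 \<le> q" "g_locally_lipschitz \<Longrightarrow> x \<in> junction \<Longrightarrow> z \<in> junction \<Longrightarrow> norm x \<le> R \<Longrightarrow> norm z \<le> R \<Longrightarrow> \<bar>g x - g z\<bar> \<le> q * l1_dist x z" for x z
  proof (cases g_locally_lipschitz)
    case True
    obtain q where "0 \<le> q" "\<And>x z. x \<in> junction \<Longrightarrow> z \<in> junction \<Longrightarrow> norm x \<le> R \<Longrightarrow> norm z \<le> R \<Longrightarrow> \<bar>g x - g z\<bar> \<le> q * l1_dist x z"
      using g_locally_lipschitzE[OF True R] by metis
    then show ?thesis by (rule that)
  qed (use that[of 0] in auto)
  define k where "k = K * (1 + (1 + M) powr p) + M + q * (1 + M)"
  have k: "K * (1 + (1 + M) powr p) + M \<le> k" "0 \<le> k" "q \<le> k"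
  proof -
    have "0 \<le> q * M" "0 \<le> K * (1 + (1 + M) powr p)" using q(1) K(1) M by auto
    then show "K * (1 + (1 + M) powr p) + M \<le> k" "0 \<le> k" "q \<le> k" using q(1) M unfolding k_def distrib_left by linarith+
  qed
  have one: "val x t \<le> val z t + k * l1_dist x z"
    if t: "0 \<le> t" "t \<le> T1" and xz: "x \<in> junction" "z \<in> junction" "norm x \<le> r" "norm z \<le> r" "l1_dist x z \<le> \<delta>" for t x z
  proof -
    define d where "d = l1_dist x z"
    have d0: "0 \<le> d" by (simp add: d_def)
    have nR: "norm x \<le> R" "norm z \<le> R" using xz rR by auto
    show ?thesis
    proof (cases "d = 0")
      case True
      then have "x = z" using norm_le_l1_dist[of x z] by (simp add: d_def)
      then show ?thesis by simp
    next
      case False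
      then have dpos: "0 < d" using d0 by simp
      show ?thesis
      proof (cases "t + d \<le> T")
        case True
        obtain w where w: "w \<in> junction" "norm w \<le> R" "l1_dist z w \<le> M * d" "val w (t + d) \<le> val z t + M * d"
          using disp[OF t xz(2,4) dpos True] by blast
        have "l1_dist x w \<le> (1 + M) * d" using l1_dist_triangle[of x w z] w(3) by (simp add: d_def algebra_simps)
        then have "val x t \<le> K * (1 + (1 + M) powr p) * d + val w (t + d)"
          using val_move[OF xz(1) w(1) dpos True K(2) _ nR(1) w(2)] K(1) by simp
        also have "\<dots> \<le> (K * (1 + (1 + M) powr p) + M) * d + val z t" using w(4) by (simp add: algebra_simps)
        also have "\<dots> \<le> k * d + val z t" using k d0 by (intro add_right_mono mult_right_mono) auto
        finally show ?thesis by (simp add: d_def)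
      next
        case False
        have "\<not> T1 + 2 * \<delta> \<le> T" using False t xz(5) dpos by (auto simp: d_def)
        then have lip: g_locally_lipschitz using reg by simp
        note gl = q(2)[OF lip]
        show ?thesis
        proof (cases "t = T")
          case True
          have "g x - g z \<le> q * d" using gl[OF xz(1,2) nR] by (simp add: d_def abs_le_iff)
          also have "\<dots> \<le> k * d" using k d0 by (intro mult_right_mono)
          finally show ?thesis using True val_terminal xz by (simp add: d_def)
        next
          case tT: False
          \<comment> \<open>No time \<open>d\<close> is left: waiting at \<open>x\<close> until
            \<open>T\<close> replaces the straight line, and the Lipschitz bound of \<open>g\<close>
            compares the terminal costs at \<open>x\<close> and \<open>w\<close>.\<close>
          define h where "h = T - t"
          have h: "0 < h" "t + h \<le> T" "h < d" "t + h = T" using tT t T1 False by (auto simp: h_def)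
          obtain w where w: "w \<in> junction" "norm w \<le> R" "l1_dist z w \<le> M * h" "val w (t + h) \<le> val z t + M * h"
            using disp[OF t xz(2,4) h(1,2)] by blast
          have hd: "M * h \<le> M * d" using M h by (intro mult_left_mono) auto
          have "val x t \<le> K * (1 + 0 powr p) * h + val x (t + h)"
            by (rule val_move[OF xz(1) xz(1) h(1,2) K(2) _ nR(1) nR(1)]) (use K(1) in auto)
          also have "\<dots> = K * h + g x" using p val_terminal[OF xz(1)] h(4) by simp
          also have "K * h \<le> K * d" using K h by simp
          also have "K * d \<le> K * (1 + (1 + M) powr p) * d" using K d0 by (simp add: mult_right_mono)
          also have "g x \<le> g w + q * l1_dist x w" using gl[OF xz(1) w(1) nR(1) w(2)] by (simp add: abs_le_iff)
          also have "q * l1_dist x w \<le> q * ((1 + M) * d)"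
            using l1_dist_triangle[of x w z] w(3) hd q(1) by (intro mult_left_mono) (auto simp: d_def algebra_simps)
          also have "g w \<le> val z t + M * d" using w(4) val_terminal[OF w(1)] h(4) hd by simp
          finally show ?thesis by (simp add: k_def d_def algebra_simps)
        qed
      qed
    qed
  qed
  show ?thesis
  proof (rule that[OF k(2)])
    fix t :: real and x z :: "real ^ 'n"
    assume *: "0 \<le> t" "t \<le> T1" "x \<in> junction" "z \<in> junction" "norm x \<le> r" "norm z \<le> r" "l1_dist x z \<le> \<delta>"
    have "val x t \<le> val z t + k * l1_dist x z" by (rule one) (fact *)+
    moreover have "val z t \<le> val x t + k * l1_dist z x" by (rule one) (use * l1_dist_commute[of x z] in auto)
    ultimately show "\<bar>val x t - val z t\<bar> \<le> k * l1_dist x z" using l1_dist_commute[of x z] by (simp add: abs_le_iff)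
  qed
qed
qed

text \<open>In time, one inequality comes from standing still. For the other, a near-optimal
  position \<open>w\<close> after time \<open>h\<close> is near \<open>z\<close>, and the spatial
  bound at the later time moves \<open>w\<close> back to \<open>z\<close>.\<close>

lemma val_lipschitz:
  assumes r: "0 < r" and T1: "T1 \<le> T" and \<delta>: "0 < \<delta>" and reg: "T1 + 2 * \<delta> \<le> T \<or> g_locally_lipschitz"
  obtains k \<rho> where "0 \<le> k" "0 < \<rho>"
    "\<And>t t' x z. 0 \<le> t \<Longrightarrow> t \<le> T1 \<Longrightarrow> 0 \<le> t' \<Longrightarrow> t' \<le> T1 \<Longrightarrow> x \<in> junction \<Longrightarrow> z \<in> junction \<Longrightarrow> norm x \<le> r \<Longrightarrow> norm z \<le> r \<Longrightarrow>
      l1_dist x z \<le> \<rho> \<Longrightarrow> \<bar>t - t'\<bar> \<le> \<rho> \<Longrightarrow> \<bar>val x t - val z t'\<bar> \<le> k * (l1_dist x z + \<bar>t - t'\<bar>)"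
proof -
  show ?thesis
  proof (rule val_displacement[OF assms], goal_cases)
  case (1 M R)
  note M = 1(1) and rR = 1(2) and disp = 1(3)
  have R: "0 < R" using r rR by simp
  obtain K where K: "1 \<le> K" "\<And>s x a. x \<in> junction \<Longrightarrow> norm x \<le> R \<Longrightarrow> \<bar>running s x a\<bar> \<le> K * (1 + \<bar>a\<bar> powr p)"
    using running_upper[OF R] by metis
  show ?thesis
  \<comment> \<open>The spatial bound is taken in the larger ball of radius \<open>R\<close>, since
    \<open>w\<close> may leave the ball of radius \<open>r\<close>.\<close>
  proof (rule val_lipschitz_space[OF R T1 \<delta> reg], goal_cases)
    case (1 k)
    note k = 1(1) and space = 1(2)
    \<comment> \<open>Ensures \<open>M * \<rho> \<le> \<delta>\<close>, so that \<open>w\<close> is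
      within the range of the spatial bound.\<close>
    define \<rho> where "\<rho> = \<delta> / (M + 1)"
    have \<rho>: "0 < \<rho>" "\<rho> \<le> \<delta>" using \<delta> M by (auto simp: \<rho>_def field_simps)
    define q where "q = K + M + k * M + k"
    have q: "K \<le> q" "M + k * M \<le> q" "k \<le> q" "0 \<le> q" using K M k by (auto simp: q_def)
    have time: "\<bar>val z t - val z t'\<bar> \<le> q * (t' - t)"
      if t: "0 \<le> t" "t < t'" "t' \<le> T1" and z: "z \<in> junction" "norm z \<le> r" and tt: "t' - t \<le> \<rho>" for t t' z
    proof -
      define h where "h = t' - t"
      have h: "0 < h" "t + h \<le> T" "t + h = t'" using t T1 by (auto simp: h_def)
      have zR: "norm z \<le> R" using z rR by simp
      have "val z t \<le> K * (1 + 0 powr p) * h + val z (t + h)"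
        by (rule val_move[OF z(1) z(1) h(1,2) K(2) _ zR zR]) (use K(1) in auto)
      then have 1: "val z t - val z t' \<le> K * h" using p h by simp
      have tT1: "t \<le> T1" using t by simp
      obtain w where w: "w \<in> junction" "norm w \<le> R" "l1_dist z w \<le> M * h" "val w (t + h) \<le> val z t + M * h"
        using disp[OF t(1) tT1 z h(1,2)] by blast
      have "M * h \<le> M * \<rho>" using tt M by (intro mult_left_mono) (auto simp: h_def)
      also have "\<dots> \<le> \<delta>" using M \<delta> by (simp add: \<rho>_def field_simps)
      finally have "l1_dist z w \<le> \<delta>" using w(3) by simp
      then have "val z t' \<le> val w t' + k * l1_dist z w"
        using space[of t' z w] t z zR w by (simp add: abs_le_iff)
      also have "k * l1_dist z w \<le> k * (M * h)" using w(3) k by (intro mult_left_mono)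
      finally have 2: "val z t' - val z t \<le> (M + k * M) * h" using w(4) h by (simp add: algebra_simps)
      have "K * h \<le> q * h" "(M + k * M) * h \<le> q * h" using q h by (auto intro!: mult_right_mono)
      then show ?thesis using 1 2 by (simp add: h_def abs_le_iff)
    qed
    show ?thesis
    proof (rule that[OF q(4) \<rho>(1)])
      fix t t' :: real and x z :: "real ^ 'n"
      assume t: "0 \<le> t" "t \<le> T1" "0 \<le> t'" "t' \<le> T1" and xz: "x \<in> junction" "z \<in> junction" "norm x \<le> r" "norm z \<le> r"
        and d: "l1_dist x z \<le> \<rho>" "\<bar>t - t'\<bar> \<le> \<rho>"
      have "\<bar>val x t - val z t\<bar> \<le> k * l1_dist x z" using space[of t x z] t xz rR d \<rho> by simp
      also have "\<dots> \<le> q * l1_dist x z" using q by (intro mult_right_mono) auto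
      finally have "\<bar>val x t - val z t\<bar> \<le> q * l1_dist x z" .
      moreover have "\<bar>val z t - val z t'\<bar> \<le> q * \<bar>t - t'\<bar>"
        using time[of t t' z] time[of t' t z] t xz d by (cases t t' rule: linorder_cases) (auto simp: abs_minus_commute)
      ultimately show "\<bar>val x t - val z t'\<bar> \<le> q * (l1_dist x z + \<bar>t - t'\<bar>)" by (simp add: algebra_simps)
    qed
  qed
qed
qed

end

lemma locally_lipschitz_junction_continuous:
  assumes "locally_lipschitz_junction I (u :: real ^ 'n::finite \<Rightarrow> real \<Rightarrow> real)"
  shows "continuous_on (junction \<times> I) (\<lambda>(x, t). u x t)"
  unfolding continuous_on_iff
proof (intro ballI allI impI)
  fix q :: "(real ^ 'n) \<times> real" and e :: real
  assume q: "q \<in> junction \<times> I" and e: "0 < e"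
  obtain x t where xt: "q = (x, t)" "x \<in> junction" "t \<in> I" using q by auto
  obtain r K where r: "r > 0" "\<forall>y\<in>junction. \<forall>z\<in>junction. \<forall>s\<in>I. \<forall>s'\<in>I.
        junction_dist x y < r \<and> junction_dist x z < r \<and> \<bar>s - t\<bar> < r \<and> \<bar>s' - t\<bar> < r \<longrightarrow>
        \<bar>u y s - u z s'\<bar> \<le> K * (junction_dist y z + \<bar>s - s'\<bar>)"
    using assms xt unfolding locally_lipschitz_junction_def by blast
  \<comment> \<open>\<open>CARD('n)\<close> converts the Euclidean distance into
    \<open>l1_dist\<close>; the additional \<open>1\<close> gives a strict inequality.\<close>
  define c where "c = real CARD('n) + 1"
  define d where "d = min r (e / (\<bar>K\<bar> + 1)) / (2 * c)"
  have c: "1 \<le> c" by (simp add: c_def)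
  have m: "0 < min r (e / (\<bar>K\<bar> + 1))" using r(1) e by (simp add: add_nonneg_pos)
  have cd: "2 * c * d = min r (e / (\<bar>K\<bar> + 1))" using c by (simp add: d_def)
  have d: "0 < d" "c * d < r" "2 * c * d \<le> e / (\<bar>K\<bar> + 1)"
  proof -
    show "0 < d" using m c by (simp add: d_def)
    show "2 * c * d \<le> e / (\<bar>K\<bar> + 1)" unfolding cd by simp
    have "2 * (c * d) \<le> r" using cd by simp
    then show "c * d < r" using r(1) \<open>0 < d\<close> c by linarith
  qed
  show "\<exists>d>0. \<forall>q'\<in>junction \<times> I. dist q' q < d \<longrightarrow> dist (case q' of (x, t) \<Rightarrow> u x t) (case q of (x, t) \<Rightarrow> u x t) < e"
  proof (intro exI[of _ d] conjI d(1) ballI impI)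
    fix q' assume q': "q' \<in> junction \<times> I" "dist q' q < d"
    obtain z s where zs: "q' = (z, s)" "z \<in> junction" "s \<in> I" using q' by auto
    have "dist z x < d" "dist s t < d" using q'(2) dist_fst_le[of q' q] dist_snd_le[of q' q] by (auto simp: zs xt)
    then have ds: "norm (z - x) < d" "\<bar>s - t\<bar> < d" by (auto simp: dist_norm)
    have "l1_dist z x \<le> CARD('n) * norm (z - x)" by (rule l1_dist_le_norm)
    also have "\<dots> \<le> real CARD('n) * d" using ds by (intro mult_left_mono) auto
    also have "\<dots> < c * d" using d by (simp add: c_def)
    finally have l: "l1_dist z x < c * d" .
    have sd: "\<bar>s - t\<bar> < c * d" using ds mult_right_mono[OF c, of d] d by linarith
    have j: "junction_dist x z = l1_dist z x" "junction_dist z x = l1_dist z x" "junction_dist x x = 0"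
      using junction_dist_eq_l1_dist[OF xt(2) zs(2)] junction_dist_eq_l1_dist[OF zs(2) xt(2)] junction_dist_eq_l1_dist[OF xt(2) xt(2)]
      by (simp_all add: l1_dist_commute)
    have "\<bar>u z s - u x t\<bar> \<le> K * (l1_dist z x + \<bar>s - t\<bar>)"
      using r(2)[rule_format, OF zs(2) xt(2) zs(3) xt(3)] j l sd d(2) r(1) by auto
    also have "\<dots> \<le> \<bar>K\<bar> * (l1_dist z x + \<bar>s - t\<bar>)" by (intro mult_right_mono) auto
    also have "\<dots> \<le> \<bar>K\<bar> * (2 * c * d)" using l sd by (intro mult_left_mono) auto
    also have "\<dots> \<le> \<bar>K\<bar> * (e / (\<bar>K\<bar> + 1))" using d(3) by (intro mult_left_mono) auto
    also have "\<dots> < e" using e by (simp add: field_simps)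
    finally show "dist (case q' of (x, t) \<Rightarrow> u x t) (case q of (x, t) \<Rightarrow> u x t) < e"
      by (simp add: zs xt dist_real_def)
  qed
qed

context control
begin

lemma val_locally_lipschitz_on:
  assumes "\<And>t. t \<in> I \<Longrightarrow> \<exists>T1 \<delta>. t < T1 + \<delta> \<and> 0 < \<delta> \<and> T1 \<le> T \<and> (T1 + 2 * \<delta> \<le> T \<or> g_locally_lipschitz) \<and> (\<exists>r>0. \<forall>s\<in>I. \<bar>s - t\<bar> < r \<longrightarrow> s \<le> T1)"
    and I: "I \<subseteq> {0..}"
  shows "locally_lipschitz_junction I val"
  unfolding locally_lipschitz_junction_def
proof (intro ballI)
  fix x :: "real ^ 'n" and t assume x: "x \<in> junction" and t: "t \<in> I"
  obtain T1 \<delta> r where T1: "0 < \<delta>" "T1 \<le> T" "T1 + 2 * \<delta> \<le> T \<or> g_locally_lipschitz"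
    and r: "0 < r" "\<And>s. s \<in> I \<Longrightarrow> \<bar>s - t\<bar> < r \<Longrightarrow> s \<le> T1" using assms(1)[OF t] by blast
  have R: "0 < norm x + 1" by (simp add: add_nonneg_pos)
  show "\<exists>r>0. \<exists>K. \<forall>y\<in>junction. \<forall>z\<in>junction. \<forall>s\<in>I. \<forall>s'\<in>I.
        junction_dist x y < r \<and> junction_dist x z < r \<and> \<bar>s - t\<bar> < r \<and> \<bar>s' - t\<bar> < r \<longrightarrow>
        \<bar>val y s - val z s'\<bar> \<le> K * (junction_dist y z + \<bar>s - s'\<bar>)"
  proof (rule val_lipschitz[OF R T1(2,1,3)], goal_cases)
    case (1 k \<rho>)
    note k = 1(1,2) and lip = 1(3)
    define q where "q = min (min r 1) (\<rho> / 2)"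
    have q: "0 < q" "q \<le> r" "q \<le> 1" "2 * q \<le> \<rho>" using r k by (auto simp: q_def)
    have "\<bar>val y s - val z s'\<bar> \<le> k * (junction_dist y z + \<bar>s - s'\<bar>)"
      if *: "y \<in> junction" "z \<in> junction" "s \<in> I" "s' \<in> I" "junction_dist x y < q" "junction_dist x z < q" "\<bar>s - t\<bar> < q" "\<bar>s' - t\<bar> < q" for y z s s'
    proof -
      have d: "l1_dist x y < q" "l1_dist x z < q" using junction_dist_eq_l1_dist[OF x *(1)] junction_dist_eq_l1_dist[OF x *(2)] *(5,6) by simp_all
      have n: "norm y \<le> norm x + 1" "norm z \<le> norm x + 1"
        using norm_diff_le_l1_dist[OF x *(1)] norm_diff_le_l1_dist[OF x *(2)] d q(3) by linarith+
      have "l1_dist y z \<le> \<rho>" using l1_dist_triangle[of y z x] l1_dist_commute[of x y] d q(4) by linarith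
      moreover have "\<bar>s - s'\<bar> \<le> \<rho>" using * q(4) by linarith
      ultimately show ?thesis
        using lip[of s s' y z] * r(2)[of s] r(2)[of s'] q I n junction_dist_eq_l1_dist[of y z] by fastforce
    qed
    then show ?case using q(1) by blast
  qed
qed

lemma val_locally_lipschitz: "locally_lipschitz_junction {0..<T} val"
proof (rule val_locally_lipschitz_on)
  fix t assume t: "t \<in> {0..<T}"
  show "\<exists>T1 \<delta>. t < T1 + \<delta> \<and> 0 < \<delta> \<and> T1 \<le> T \<and> (T1 + 2 * \<delta> \<le> T \<or> g_locally_lipschitz) \<and> (\<exists>r>0. \<forall>s\<in>{0..<T}. \<bar>s - t\<bar> < r \<longrightarrow> s \<le> T1)"
    \<comment> \<open>The midpoint between \<open>t\<close> and \<open>T\<close> serves as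
      \<open>T1\<close>, and \<open>2 * \<delta>\<close> is exactly the time from there to
      \<open>T\<close>.\<close>
    by (rule exI[of _ "(t + T) / 2"], rule exI[of _ "(T - t) / 4"]) (use t in \<open>auto intro!: exI[of _ "(T - t) / 2"] simp: field_simps abs_less_iff\<close>)
qed auto

lemma val_locally_lipschitz_closed: "g_locally_lipschitz \<Longrightarrow> locally_lipschitz_junction {0..T} val"
  by (rule val_locally_lipschitz_on, rule exI[of _ T], rule exI[of _ 1])
    (auto intro!: exI[of _ "1::real"])

lemma val_continuous: "continuous_on (junction \<times> {0..<T}) (\<lambda>(x, t). val x t)"
  by (rule locally_lipschitz_junction_continuous[OF val_locally_lipschitz])

section \<open>Continuity in time up to the final time\<close>

text \<open>Equicontinuity at the initial point from the energy bound alone. It gives no linear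
  rate, but it holds up to \<open>T\<close> and requires no relation between \<open>e\<close> and
  the elapsed time.\<close>

lemma near_optimal_stays_close:
  assumes x: "x \<in> junction" and r: "0 < r"
  obtains d where "0 < d" "\<And>e t y a s. 0 \<le> t \<Longrightarrow> e \<le> 1 \<Longrightarrow> near_optimal e t y a \<Longrightarrow> y t = x \<Longrightarrow> t \<le> s \<Longrightarrow> s \<le> T \<Longrightarrow> s - t < d \<Longrightarrow> l1_dist x (y s) < r"
proof -
  have R: "0 < norm x + 1" by (simp add: add_nonneg_pos)
  obtain E where E: "0 < E" "\<And>e t y a. 0 \<le> t \<Longrightarrow> e \<le> 1 \<Longrightarrow> near_optimal e t y a \<Longrightarrow> norm (y t) \<le> norm x + 1 \<Longrightarrow> energy t T a \<le> E"
    using energy_bound[OF R] by metis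
  have p1: "0 < p - 1" using p by simp
  obtain l where l: "1 \<le> l" "2 * E / r < l powr (p - 1)" using exists_powr_gt[OF p1] by metis
  show ?thesis
  proof (rule that[of "r / (2 * l)"])
    show "0 < r / (2 * l)" using r l by simp
    fix e t y a s
    assume *: "0 \<le> t" "e \<le> 1" "near_optimal e t y a" "y t = x" "t \<le> s" "s \<le> T" "s - t < r / (2 * l)"
    have yc: "controlled p t T y a" using * by (simp add: near_optimal_def)
    have "l1_dist (y t) (y s) \<le> l * (s - t) + energy t s a / l powr (p - 1)"
      by (rule l1_dist_le_energy[OF controlled_subset[OF yc]]) (use * l in auto)
    moreover have "l * (s - t) < r / 2" using *(7) l by (simp add: field_simps)
    moreover have "energy t s a / l powr (p - 1) \<le> E / l powr (p - 1)"
      using energy_mono[OF yc, of t s] E(2)[OF *(1,2,3)] * by (intro divide_right_mono) auto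
    moreover have "E / l powr (p - 1) \<le> r / 2" using l r by (simp add: field_simps)
    ultimately have "l1_dist (y t) (y s) < r" by linarith
    then show "l1_dist x (y s) < r" using *(4) by simp
  qed
qed

text \<open>At \<open>T\<close> standing still gives the upper bound. For the lower bound,
  near-optimal paths started shortly before \<open>T\<close> end near \<open>x\<close>, where
  \<open>g\<close> is not much smaller than \<open>g x\<close>.\<close>

lemma val_time_continuous:
  assumes x: "x \<in> junction"
  shows "continuous_on {0..T} (val x)"
  unfolding continuous_on_eq_continuous_within
proof
  fix t assume t: "t \<in> {0..T}"
  show "continuous (at t within {0..T}) (val x)"
  proof (cases "t < T")
    case True
    have "continuous_on {0..<T} (\<lambda>s. case (x, s) of (x, t) \<Rightarrow> val x t)"
      by (rule continuous_on_compose2[OF val_continuous]) (auto intro!: continuous_intros x)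
    then have "continuous (at t within {0..<T}) (val x)" using t True by (simp add: continuous_on_eq_continuous_within)
    moreover have "at t within {0..<T} = at t within {0..T}"
      by (rule at_within_nhd[of _ "{..<T}"]) (use t True in auto)
    ultimately show ?thesis by (simp add: continuous_within)
  next
    case False
    then have tT: "t = T" using t by simp
    have R: "0 < norm x + 1" by (simp add: add_nonneg_pos)
    obtain K where K: "1 \<le> K" "\<And>s z a. z \<in> junction \<Longrightarrow> norm z \<le> norm x + 1 \<Longrightarrow> \<bar>running s z a\<bar> \<le> K * (1 + \<bar>a\<bar> powr p)"
      using running_upper[OF R] by metis
    show ?thesis unfolding tT continuous_within_eps_delta
    proof (intro allI impI)
      fix e :: real assume e: "0 < e"
      then have e3: "0 < min (e / 3) 1" "0 < e / 3" by auto
      obtain d1 where d1: "0 < d1" "\<And>z. z \<in> junction \<Longrightarrow> l1_dist x z < d1 \<Longrightarrow> g x - e / 3 \<le> g z"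
        using g_lsc[OF x e3(2)] by blast
      obtain d2 where d2: "0 < d2" "\<And>e t y a s. 0 \<le> t \<Longrightarrow> e \<le> 1 \<Longrightarrow> near_optimal e t y a \<Longrightarrow> y t = x \<Longrightarrow> t \<le> s \<Longrightarrow> s \<le> T \<Longrightarrow> s - t < d2 \<Longrightarrow> l1_dist x (y s) < d1"
        using near_optimal_stays_close[OF x d1(1)] by metis
      define d where "d = min d2 (e / (3 * (K + C0)))"
      have KC0: "0 < K + C0" using K C0 by simp
      have d: "0 < d" "d \<le> d2" using d2 e KC0 by (auto simp: d_def)
      have "(K + C0) * d \<le> (K + C0) * (e / (3 * (K + C0)))"
        using KC0 by (intro mult_left_mono) (auto simp: d_def)
      also have "\<dots> = e / 3"
      proof -
        have "k * (e / (3 * k)) = e / 3" if "0 < k" for k using that by simp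
        from this[OF KC0] show ?thesis .
      qed
      finally have d3: "(K + C0) * d \<le> e / 3" .
      show "\<exists>d>0. \<forall>s\<in>{0..T}. dist s T < d \<longrightarrow> dist (val x s) (val x T) < e"
      proof (intro exI[of _ d] conjI d(1) ballI impI)
        fix s assume s: "s \<in> {0..T}" "dist s T < d"
        have sT: "T - s < d" "0 \<le> s" "s \<le> T" using s by (auto simp: dist_real_def)
        have "(K + C0) * (T - s) \<le> (K + C0) * d" using sT K C0 by (intro mult_left_mono) auto
        then have KC: "(K + C0) * (T - s) \<le> e / 3" using d3 by linarith
        have KC': "K * (T - s) \<le> (K + C0) * (T - s)" "C0 * (T - s) \<le> (K + C0) * (T - s)"
          using sT C0 K by (auto intro!: mult_right_mono)
        have cc: "controlled p s T (\<lambda>_. x) (\<lambda>_. 0)" by (rule controlled_const[OF x sT(3)])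
        have "cost s T (\<lambda>_. x) (\<lambda>_. 0) \<le> K * (1 + 0 powr p) * (T - s)"
          by (rule cost_upper[OF cc K(2)]) (use K in auto)
        then have up: "val x s \<le> g x + e / 3" using val_le[OF cc] p KC KC' by simp
        obtain y a where y: "near_optimal (min (e / 3) 1) s y a" "y s = x"
          using near_optimal_exists[OF x sT(3) e3(1)] by metis
        have yc: "controlled p s T y a" using y by (simp add: near_optimal_def)
        have "l1_dist x (y T) < d1" by (rule d2(2)[OF sT(2) _ y]) (use sT d in auto)
        then have "g x - e / 3 \<le> g (y T)" using d1(2) controlledD(1,2)[OF yc] by auto
        moreover have "cost s T y a + g (y T) \<le> val x s + e / 3"
        proof -
          have "cost s T y a + g (y T) \<le> val x s + min (e / 3) 1" using y by (simp add: near_optimal_def)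
          also have "min (e / 3) 1 \<le> e / 3" by simp
          finally show ?thesis by simp
        qed
        moreover have "- C0 * (T - s) \<le> cost s T y a" by (rule cost_ge[OF yc])
        ultimately have "g x - e < val x s \<or> g x - e = val x s" using KC KC' by linarith
        moreover have "g x - 2 * (e/3) - C0 * (T - s) \<le> val x s"
          using \<open>g x - e / 3 \<le> g (y T)\<close> \<open>cost s T y a + g (y T) \<le> val x s + e / 3\<close> \<open>- C0 * (T - s) \<le> cost s T y a\<close> by linarith
        moreover have "C0 * (T - s) < e / 3"
        proof -
          have "C0 * (T - s) \<le> C0 * d" using sT C0 by (intro mult_left_mono) auto
          also have "\<dots> < (K + C0) * d" using K d by simp
          finally show ?thesis using d3 by linarith
        qed
        ultimately show "dist (val x s) (val x T) < e" using up val_terminal[OF x] e by (simp add: dist_real_def abs_less_iff)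
      qed
    qed
  qed
qed

section \<open>Viscosity inequalities\<close>

text \<open>The derivatives in the equation are taken in each variable separately, and one-sidedly
  at the vertex. They are identified with the partials of the joint derivative on the half-strip,
  which is what controls simultaneous changes of position and time.\<close>

lemma C1_junction_expansion:
  fixes \<phi> :: "real ^ 'n \<Rightarrow> real \<Rightarrow> real"
  assumes \<phi>: "C1_junction T \<phi>" and r: "0 \<le> r" and t: "t \<in> {0<..<T}" and e: "0 < e"
  shows "\<exists>d>0. \<forall>r' t'. 0 \<le> r' \<longrightarrow> t' \<in> {0<..<T} \<longrightarrow> \<bar>r' - r\<bar> < d \<longrightarrow> \<bar>t' - t\<bar> < d \<longrightarrow>
    \<bar>\<phi> (r' *\<^sub>R axis i 1) t' - \<phi> (r *\<^sub>R axis i 1) t - edge_derivative \<phi> i r t * (r' - r) - deriv (\<phi> (r *\<^sub>R axis i 1)) t * (t' - t)\<bar>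
      \<le> e * (\<bar>r' - r\<bar> + \<bar>t' - t\<bar>)"
proof -
  let ?S = "{0..} \<times> {0<..<T} :: (real \<times> real) set"
  let ?f = "\<lambda>(s, t). \<phi> (s *\<^sub>R axis i 1) t"
  obtain f' where f': "\<And>z. z \<in> ?S \<Longrightarrow> (?f has_derivative blinfun_apply (f' z)) (at z within ?S)"
    using \<phi> unfolding C1_junction_def C1_on_def by metis
  define A where "A = blinfun_apply (f' (r, t))"
  have A: "(?f has_derivative A) (at (r, t) within ?S)" unfolding A_def by (rule f') (use r t in auto)
  have lin: "A (u, v) = A (1, 0) * u + A (0, 1) * v" for u v
  proof -
    have "(u, v) = u *\<^sub>R (1, 0) + v *\<^sub>R (0, 1 :: real)" by simp
    then show ?thesis unfolding A_def by (simp only: blinfun.add_right blinfun.scaleR_right real_scaleR_def mult.commute)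
  qed
  have 1: "edge_derivative \<phi> i r t = A (1, 0)"
  proof -
    have f1: "(?f has_derivative A) (at (r, t) within (\<lambda>s. (s, t)) ` {0..})"
      by (rule has_derivative_subset[OF A]) (use t in auto)
    have f2: "((\<lambda>s. (s, t)) has_derivative (\<lambda>h. (h, 0))) (at r within {0..})"
      by (auto intro!: derivative_eq_intros)
    have "A (h, 0) = h *\<^sub>R A (1, 0)" for h using lin[of h 0] by (simp add: mult.commute)
    then have eq: "(\<lambda>h. A (h, 0)) = (\<lambda>h. h *\<^sub>R A (1, 0))" by (rule ext)
    have "((\<lambda>s. \<phi> (s *\<^sub>R axis i 1) t) has_vector_derivative A (1, 0)) (at r within {0..})"
    proof -
      have "((\<lambda>s. ?f (s, t)) has_derivative (\<lambda>h. A (h, 0))) (at r within {0..})"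
        by (rule has_derivative_in_compose[OF f2 f1])
      then show ?thesis unfolding has_vector_derivative_def by (simp only: eq prod.case)
    qed
    moreover have "at r within {0..} \<noteq> bot"
    proof
      assume "at r within {0..} = bot"
      moreover have "at_right r \<le> at r within {0..}" by (rule at_le) (use r in auto)
      ultimately show False by (metis le_bot trivial_limit_at_right_real)
    qed
    ultimately show ?thesis unfolding edge_derivative_def by (simp add: vector_derivative_within)
  qed
  have 2: "deriv (\<phi> (r *\<^sub>R axis i 1)) t = A (0, 1)"
  proof -
    have f1: "(?f has_derivative A) (at (r, t) within (\<lambda>s. (r, s)) ` {0<..<T})"
      by (rule has_derivative_subset[OF A]) (use r in auto)
    have f2: "((\<lambda>s. (r, s)) has_derivative (\<lambda>h. (0, h))) (at t within {0<..<T})"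
      by (auto intro!: derivative_eq_intros)
    have at: "at t within {0<..<T} = at t" by (rule at_within_open) (use t in auto)
    have "((\<lambda>s. ?f (r, s)) has_derivative (\<lambda>h. A (0, h))) (at t within {0<..<T})"
      by (rule has_derivative_in_compose[OF f2 f1])
    then have "(\<phi> (r *\<^sub>R axis i 1) has_derivative (\<lambda>h. A (0, h))) (at t)"
      by (simp only: at prod.case)
    then have "(\<phi> (r *\<^sub>R axis i 1) has_field_derivative A (0, 1)) (at t)"
      by (rule has_derivative_imp_has_field_derivative) (subst (2) lin, simp)
    then show ?thesis by (rule DERIV_imp_deriv)
  qed
  from A[unfolded has_derivative_within_alt] e obtain d where d: "d > 0"
    "\<And>z. z \<in> ?S \<Longrightarrow> norm (z - (r, t)) < d \<Longrightarrow> norm (?f z - ?f (r, t) - A (z - (r, t))) \<le> e * norm (z - (r, t))"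
    by blast
  show ?thesis
  proof (intro exI[of _ "d / 2"] conjI allI impI)
    fix r' t' assume *: "0 \<le> r'" "t' \<in> {0<..<T}" "\<bar>r' - r\<bar> < d / 2" "\<bar>t' - t\<bar> < d / 2"
    have n: "norm ((r', t') - (r, t)) \<le> \<bar>r' - r\<bar> + \<bar>t' - t\<bar>"
      using norm_Pair_le[of "r' - r" "t' - t"] by simp
    have "norm (?f (r', t') - ?f (r, t) - A ((r', t') - (r, t))) \<le> e * norm ((r', t') - (r, t))"
      by (rule d(2)) (use * n in auto)
    also have "\<dots> \<le> e * (\<bar>r' - r\<bar> + \<bar>t' - t\<bar>)" using n e by (intro mult_left_mono) auto
    finally show "\<bar>\<phi> (r' *\<^sub>R axis i 1) t' - \<phi> (r *\<^sub>R axis i 1) t - edge_derivative \<phi> i r t * (r' - r) - deriv (\<phi> (r *\<^sub>R axis i 1)) t * (t' - t)\<bar>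
      \<le> e * (\<bar>r' - r\<bar> + \<bar>t' - t\<bar>)"
      using lin[of "r' - r" "t' - t"] by (simp add: 1 2 algebra_simps)
  qed (use d in auto)
qed

text \<open>The initial instant is left out since a path leaving the vertex pays the vertex cost
  there.\<close>

lemma cost_le_open:
  assumes y: "controlled p t t' y a" and b: "\<And>s. t < s \<Longrightarrow> s \<le> t' \<Longrightarrow> running s (y s) (a s) \<le> c"
  shows "cost t t' y a \<le> c * (t' - t)"
proof -
  have tt: "t \<le> t'" using controlledD(1)[OF y] .
  have "((\<lambda>s. running s (y s) (a s)) has_integral cost t t' y a) {t..t'}"
    unfolding cost_def by (rule integrable_integral[OF running_integrable[OF y]])
  then have 1: "((\<lambda>s. if s = t then c else running s (y s) (a s)) has_integral cost t t' y a) {t..t'}"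
    by (rule has_integral_spike_finite[of "{t}", rotated 2]) auto
  have 2: "((\<lambda>s. c) has_integral c * (t' - t)) {t..t'}"
    using has_integral_const_real[of c t t'] tt by (simp add: mult.commute)
  show ?thesis by (rule has_integral_le[OF 1 2]) (use b in auto)
qed

lemma eventually_at_junction:
  assumes "\<forall>\<^sub>F (y, s) in at (x, t) within junction \<times> {0<..<T}. P y s" and "P x t"
  obtains d where "0 < d" "\<And>y s. y \<in> junction \<Longrightarrow> s \<in> {0<..<T} \<Longrightarrow> norm (y - x) + \<bar>s - t\<bar> < d \<Longrightarrow> P y s"
proof -
  obtain d where d: "0 < d" "\<And>q. q \<in> junction \<times> {0<..<T} \<Longrightarrow> q \<noteq> (x, t) \<Longrightarrow> dist q (x, t) < d \<Longrightarrow> case q of (y, s) \<Rightarrow> P y s"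
    using assms(1) unfolding eventually_at by blast
  show ?thesis
  proof (rule that[OF d(1)])
    fix y s assume *: "y \<in> junction" "s \<in> {0<..<T}" "norm (y - x) + \<bar>s - t\<bar> < d"
    have "dist (y, s) (x, t) \<le> norm (y - x) + \<bar>s - t\<bar>"
      using norm_Pair_le[of "y - x" "s - t"] by (simp add: dist_norm)
    then show "P y s" using d(2)[of "(y, s)"] * assms(2) by (cases "(y, s) = (x, t)") auto
  qed
qed

section \<open>Subsolution property\<close>

text \<open>Dynamic programming along a competitor with constant velocity, divided by
  \<open>h\<close>. The cost rate \<open>l\<close> is kept abstract so that motion along an edge and
  waiting at the vertex, which is charged at a different rate, are covered together.\<close>

lemma subsolution_step:
  assumes \<phi>: "C1_junction T \<phi>" and r: "0 \<le> r" and t: "t \<in> {0<..<T}"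
    and touch: "touches_from_above T \<phi> val (r *\<^sub>R axis i 1) t"
    and family: "\<And>e. 0 < e \<Longrightarrow> \<exists>d>0. \<forall>h. 0 < h \<longrightarrow> h < d \<longrightarrow> 0 \<le> r + \<zeta> * h \<and>
      (\<exists>y a. controlled p t (t + h) y a \<and> y t = r *\<^sub>R axis i 1 \<and> y (t + h) = (r + \<zeta> * h) *\<^sub>R axis i 1 \<and> cost t (t + h) y a \<le> (l + e) * h)"
  shows "- deriv (\<phi> (r *\<^sub>R axis i 1)) t - edge_derivative \<phi> i r t * \<zeta> - l \<le> 0"
proof (rule field_le_epsilon)
  fix \<eta> :: real assume \<eta>: "0 < \<eta>"
  let ?x = "r *\<^sub>R axis i (1::real)" and ?D = "edge_derivative \<phi> i r t" and ?b = "deriv (\<phi> (r *\<^sub>R axis i 1)) t"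
  \<comment> \<open>The error is \<open>e\<close> from the cost plus
    \<open>e * (\<bar>\<zeta>\<bar> + 1)\<close> from the expansion of the test function.\<close>
  define e where "e = \<eta> / (\<bar>\<zeta>\<bar> + 2)"
  have z: "0 < \<bar>\<zeta>\<bar> + 2" by linarith
  have e: "0 < e" "e * (\<bar>\<zeta>\<bar> + 2) = \<eta>" using \<eta> z by (auto simp: e_def)
  have \<phi>x: "\<phi> ?x t = val ?x t" and "\<forall>\<^sub>F (y, s) in at (?x, t) within junction \<times> {0<..<T}. val y s \<le> \<phi> y s"
    using touch by (auto simp: touches_from_above_def)
  then obtain d0 where d0: "0 < d0" "\<And>y s. y \<in> junction \<Longrightarrow> s \<in> {0<..<T} \<Longrightarrow> norm (y - ?x) + \<bar>s - t\<bar> < d0 \<Longrightarrow> val y s \<le> \<phi> y s"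
    using eventually_at_junction[where P = "\<lambda>y s. val y s \<le> \<phi> y s" and x = ?x and t = t] \<phi>x by auto
  obtain d1 where d1: "d1>0" "\<And>r' t'. 0 \<le> r' \<Longrightarrow> t' \<in> {0<..<T} \<Longrightarrow> \<bar>r' - r\<bar> < d1 \<Longrightarrow> \<bar>t' - t\<bar> < d1 \<Longrightarrow>
    \<bar>\<phi> (r' *\<^sub>R axis i 1) t' - \<phi> ?x t - ?D * (r' - r) - ?b * (t' - t)\<bar> \<le> e * (\<bar>r' - r\<bar> + \<bar>t' - t\<bar>)"
    using C1_junction_expansion[OF \<phi> r t e(1), of i] by blast
  obtain d2 where d2: "0 < d2" "\<And>h. 0 < h \<Longrightarrow> h < d2 \<Longrightarrow> 0 \<le> r + \<zeta> * h \<and>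
      (\<exists>y a. controlled p t (t + h) y a \<and> y t = ?x \<and> y (t + h) = (r + \<zeta> * h) *\<^sub>R axis i 1 \<and> cost t (t + h) y a \<le> (l + e) * h)"
    using family[OF e(1)] by blast
  define c where "c = \<bar>\<zeta>\<bar> + 1"
  have c: "1 \<le> c" by (simp add: c_def)
  define h where "h = min (min (d0 / c) (d1 / c)) (min d2 (T - t)) / 2"
  have half: "q / 2 < q" if "0 < q" for q :: real using that by simp
  have h: "0 < h" "h < d2" "t + h < T" "c * h < d0" "c * h < d1"
  proof -
    have m: "0 < min (min (d0 / c) (d1 / c)) (min d2 (T - t))" using d0 d1 d2 t c by auto
    then show "0 < h" by (simp add: h_def)
    have lt: "h < min (min (d0 / c) (d1 / c)) (min d2 (T - t))" unfolding h_def by (rule half[OF m])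
    then show "h < d2" "t + h < T" by auto
    have "h < d0 / c" "h < d1 / c" using lt by auto
    then show "c * h < d0" "c * h < d1" using c by (auto simp: field_simps)
  qed
  have ch: "\<bar>\<zeta>\<bar> * h + h = c * h" by (simp add: c_def algebra_simps)
  obtain y a where y: "0 \<le> r + \<zeta> * h" "controlled p t (t + h) y a" "y t = ?x" "y (t + h) = (r + \<zeta> * h) *\<^sub>R axis i 1"
    "cost t (t + h) y a \<le> (l + e) * h" using d2(2)[OF h(1,2)] by blast
  have "\<bar>\<phi> (y (t + h)) (t + h) - \<phi> ?x t - ?D * (r + \<zeta> * h - r) - ?b * (t + h - t)\<bar> \<le> e * (\<bar>r + \<zeta> * h - r\<bar> + \<bar>t + h - t\<bar>)"
    unfolding y(4)
  proof (rule d1(2)[OF y(1)])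
    show "\<bar>r + \<zeta> * h - r\<bar> < d1" "\<bar>t + h - t\<bar> < d1" using h ch by (auto simp: abs_mult) (smt (verit) mult_nonneg_nonneg abs_ge_zero)+
  qed (use t h in auto)
  also have "e * (\<bar>r + \<zeta> * h - r\<bar> + \<bar>t + h - t\<bar>) = e * (c * h)" using h ch by (simp add: abs_mult)
  finally have exp: "\<phi> (y (t + h)) (t + h) \<le> \<phi> ?x t + ?D * \<zeta> * h + ?b * h + e * (c * h)" by (simp add: abs_le_iff algebra_simps)
  have "val (y (t + h)) (t + h) \<le> \<phi> (y (t + h)) (t + h)"
  proof (rule d0(2))
    have "y (t + h) - ?x = (\<zeta> * h) *\<^sub>R axis i 1" unfolding y(4) by (simp add: algebra_simps)
    then have "norm (y (t + h) - ?x) = \<bar>\<zeta>\<bar> * h" using h by (simp add: norm_axis_1 abs_mult)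
    then show "norm (y (t + h) - ?x) + \<bar>t + h - t\<bar> < d0" using h ch by simp
    show "y (t + h) \<in> junction" unfolding y(4) by (rule axis_junction[OF y(1)])
  qed (use t h in auto)
  moreover have "val ?x t \<le> cost t (t + h) y a + val (y (t + h)) (t + h)"
    using val_le_cost_add_val[OF y(2)] h y(3) by simp
  ultimately have "0 \<le> (l + e) * h + ?D * \<zeta> * h + ?b * h + e * (c * h)" using exp \<phi>x y(5) by linarith
  also have "\<dots> = (l + ?D * \<zeta> + ?b + e * (\<bar>\<zeta>\<bar> + 2)) * h" by (simp add: c_def algebra_simps)
  finally have "0 \<le> l + ?D * \<zeta> + ?b + \<eta>" using h(1) by (simp add: e(2) zero_le_mult_iff)
  then show "- ?b - ?D * \<zeta> - l \<le> 0 + \<eta>" by linarith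
qed

text \<open>The last hypothesis keeps the affine path strictly inside the edge right after its
  start, where only the edge cost is paid.\<close>

lemma subsolution_direction:
  assumes \<phi>: "C1_junction T \<phi>" and r: "0 \<le> r" and t: "t \<in> {0<..<T}"
    and touch: "touches_from_above T \<phi> val (r *\<^sub>R axis i 1) t" and z: "0 < r \<or> 0 < \<zeta>"
  shows "- deriv (\<phi> (r *\<^sub>R axis i 1)) t - edge_derivative \<phi> i r t * \<zeta> - L i t r \<zeta> \<le> 0"
proof (rule subsolution_step[OF \<phi> r t touch])
  fix e :: real assume e: "0 < e"
  have "continuous_on UNIV (\<lambda>s. case (s, r + \<zeta> * (s - t), \<zeta>) of (s, x, a) \<Rightarrow> L i s x a)"
    by (rule continuous_on_compose2[OF L_continuous]) (auto intro!: continuous_intros)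
  then have "isCont (\<lambda>s. L i s (r + \<zeta> * (s - t)) \<zeta>) t" by (simp add: continuous_on_eq_continuous_at)
  then obtain d where d: "0 < d" "\<And>s. \<bar>s - t\<bar> < d \<Longrightarrow> \<bar>L i s (r + \<zeta> * (s - t)) \<zeta> - L i t r \<zeta>\<bar> < e"
    using e unfolding continuous_at_eps_delta by (auto simp: dist_real_def)
  \<comment> \<open>For \<open>r > 0\<close> the time is limited so that even motion towards the
    vertex does not reach it.\<close>
  define d' where "d' = (if 0 < r then min d (r / (\<bar>\<zeta>\<bar> + 1)) else d)"
  have z1: "0 < \<bar>\<zeta>\<bar> + 1" by linarith
  have d': "0 < d'" "d' \<le> d" using d z1 by (auto simp: d'_def)
  have pos: "0 < r + \<zeta> * k" if k: "0 < k" "k < d'" for k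
  proof (cases "0 < r")
    case True
    have "k < r / (\<bar>\<zeta>\<bar> + 1)" using k True by (simp add: d'_def)
    then have "(\<bar>\<zeta>\<bar> + 1) * k < r" using z1 by (simp add: field_simps)
    moreover have "- (\<bar>\<zeta>\<bar> * k) \<le> \<zeta> * k" using k mult_right_mono[of "- \<bar>\<zeta>\<bar>" \<zeta> k] by simp
    ultimately show ?thesis using k by (simp add: algebra_simps)
  next
    case False
    then show ?thesis using z k r by simp
  qed
  show "\<exists>d>0. \<forall>h. 0 < h \<longrightarrow> h < d \<longrightarrow> 0 \<le> r + \<zeta> * h \<and>
      (\<exists>y a. controlled p t (t + h) y a \<and> y t = r *\<^sub>R axis i 1 \<and> y (t + h) = (r + \<zeta> * h) *\<^sub>R axis i 1 \<and> cost t (t + h) y a \<le> (L i t r \<zeta> + e) * h)"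
  proof (intro exI[of _ d'] conjI d'(1) allI impI)
    fix h assume h: "0 < h" "h < d'"
    show "0 \<le> r + \<zeta> * h" using pos[OF h] by simp
    let ?y = "\<lambda>s. (r + \<zeta> * (s - t)) *\<^sub>R axis i (1::real)" and ?a = "\<lambda>s. if 0 < r + \<zeta> * (s - t) then \<zeta> else 0"
    have yc: "controlled p t (t + h) ?y ?a" by (rule controlled_affine) (use h p r pos[OF h] in auto)
    have "cost t (t + h) ?y ?a \<le> (L i t r \<zeta> + e) * (t + h - t)"
    proof (rule cost_le_open[OF yc])
      fix s assume s: "t < s" "s \<le> t + h"
      have "0 < r + \<zeta> * (s - t)" by (rule pos) (use s h in auto)
      then show "running s (?y s) (?a s) \<le> L i t r \<zeta> + e"
        using d(2)[of s] s h d' by (simp add: running_axis abs_less_iff)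
    qed
    then show "\<exists>y a. controlled p t (t + h) y a \<and> y t = r *\<^sub>R axis i 1 \<and> y (t + h) = (r + \<zeta> * h) *\<^sub>R axis i 1 \<and> cost t (t + h) y a \<le> (L i t r \<zeta> + e) * h"
      using yc by (intro exI[of _ ?y] exI[of _ ?a]) auto
  qed
qed

lemma subsolution_vertex_wait:
  assumes \<phi>: "C1_junction T \<phi>" and t: "t \<in> {0<..<T}" and touch: "touches_from_above T \<phi> val 0 t"
  shows "- deriv (\<phi> 0) t - L0 t \<le> 0"
proof -
  have "- deriv (\<phi> (0 *\<^sub>R axis i 1)) t - edge_derivative \<phi> i 0 t * 0 - L0 t \<le> 0" for i
  proof (rule subsolution_step[OF \<phi> order_refl t])
    show "touches_from_above T \<phi> val (0 *\<^sub>R axis i 1) t" using touch by simp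
    fix e :: real assume e: "0 < e"
    have "isCont L0 t" using L0_continuous by (simp add: continuous_on_eq_continuous_at)
    then obtain d where d: "0 < d" "\<And>s. \<bar>s - t\<bar> < d \<Longrightarrow> \<bar>L0 s - L0 t\<bar> < e"
      using e unfolding continuous_at_eps_delta by (auto simp: dist_real_def)
    show "\<exists>d>0. \<forall>h. 0 < h \<longrightarrow> h < d \<longrightarrow> 0 \<le> 0 + 0 * h \<and>
      (\<exists>y a. controlled p t (t + h) y a \<and> y t = 0 *\<^sub>R axis i 1 \<and> y (t + h) = (0 + 0 * h) *\<^sub>R axis i 1 \<and> cost t (t + h) y a \<le> (L0 t + e) * h)"
    proof (intro exI[of _ d] conjI d(1) allI impI)
      fix h assume h: "0 < h" "h < d"
      have yc: "controlled p t (t + h) (\<lambda>_. 0 :: real ^ 'n) (\<lambda>_. 0)" by (rule controlled_const) (use h in auto)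
      have "cost t (t + h) (\<lambda>_. 0) (\<lambda>_. 0) \<le> (L0 t + e) * (t + h - t)"
      proof (rule cost_le_open[OF yc])
        fix s assume "t < s" "s \<le> t + h"
        then show "running s 0 0 \<le> L0 t + e" using d(2)[of s] h by (simp add: abs_less_iff)
      qed
      then show "\<exists>y a. controlled p t (t + h) y a \<and> y t = 0 *\<^sub>R axis i 1 \<and> y (t + h) = (0 + 0 * h) *\<^sub>R axis i 1 \<and> cost t (t + h) y a \<le> (L0 t + e) * h"
        using yc by (intro exI[of _ "\<lambda>_. 0"] exI[of _ "\<lambda>_. 0"]) auto
    qed simp
  qed
  then show ?thesis by simp
qed

section \<open>Supersolution property\<close>

text \<open>\<open>Dv\<close> is the displacement weighted by the slopes; it cancels between the
  lower bounds for the value function and for the cost. What remains are errors proportional to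
  displacement and energy, and these are of order \<open>h\<close> only for near-optimal paths. The
  local hypothesis is therefore used twice: with \<open>e = 1\<close> to bound the energy by
  \<open>Kc * h\<close>, then with a small \<open>e\<close>.\<close>

lemma supersolution_step:
  assumes x: "x \<in> junction" and t: "t \<in> {0<..<T}" and K1: "0 \<le> K1"
    and loc: "\<And>e. 0 < e \<Longrightarrow> \<exists>d>0. \<forall>h y a e'. 0 < h \<longrightarrow> h < d \<longrightarrow> t + h < T \<longrightarrow> near_optimal e' t y a \<longrightarrow> e' \<le> 1 \<longrightarrow> y t = x \<longrightarrow>
      (\<exists>Dv. \<bar>Dv\<bar> \<le> K1 * l1_dist x (y (t + h)) \<and> Dv + \<beta> * h - e * (l1_dist x (y (t + h)) + h) \<le> val (y (t + h)) (t + h) - val x t \<and>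
        - Dv - S * h - e * (h + energy t (t + h) a) \<le> cost t (t + h) y a)"
  shows "\<beta> \<le> S"
proof (rule field_le_epsilon)
  fix \<eta> :: real assume \<eta>: "0 < \<eta>"
  have p1: "0 < p - 1" using p by simp
  \<comment> \<open>At this reference speed the displacement term \<open>(K1 + 1) * d\<close> uses
    up at most half of the coercive energy \<open>C0 * En\<close>.\<close>
  obtain l where l: "1 \<le> l" "2 * (K1 + 1) / C0 < l powr (p - 1)" using exists_powr_gt[OF p1] by metis
  define Kc where "Kc = 2 * (C0 + 2 + \<bar>\<beta>\<bar> + (K1 + 1) * l) / C0"
  have Kc: "0 \<le> Kc" using C0 K1 l by (simp add: Kc_def)
  define e where "e = min 1 (\<eta> / (4 + 2 * Kc))"
  have e: "0 < e" "e \<le> 1" "e * (4 + 2 * Kc) \<le> \<eta>"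
  proof -
    show "0 < e" "e \<le> 1" using \<eta> Kc by (auto simp: e_def)
    have "e * (4 + 2 * Kc) \<le> \<eta> / (4 + 2 * Kc) * (4 + 2 * Kc)" using Kc by (intro mult_right_mono) (auto simp: e_def)
    then show "e * (4 + 2 * Kc) \<le> \<eta>" using Kc by simp
  qed
  define Q where "Q e d \<longleftrightarrow> (\<forall>h y a e'. 0 < h \<longrightarrow> h < d \<longrightarrow> t + h < T \<longrightarrow> near_optimal e' t y a \<longrightarrow> e' \<le> 1 \<longrightarrow> y t = x \<longrightarrow>
      (\<exists>Dv. \<bar>Dv\<bar> \<le> K1 * l1_dist x (y (t + h)) \<and> Dv + \<beta> * h - e * (l1_dist x (y (t + h)) + h) \<le> val (y (t + h)) (t + h) - val x t \<and>
        - Dv - S * h - e * (h + energy t (t + h) a) \<le> cost t (t + h) y a))" for e d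
  have exQ: "\<exists>d>0. Q e d" if "0 < e" for e unfolding Q_def by (rule loc[OF that])
  obtain d1 where d1: "0 < d1" and "Q 1 d1" using exQ[OF zero_less_one] by blast
  note loc1 = \<open>Q 1 d1\<close>[unfolded Q_def, rule_format]
  obtain d2 where d2: "0 < d2" and "Q e d2" using exQ[OF e(1)] by blast
  note loc2 = \<open>Q e d2\<close>[unfolded Q_def, rule_format]
  define h where "h = min (min d1 d2) (min 1 (T - t)) / 2"
  have half: "q / 2 < q" if "0 < q" for q :: real using that by simp
  have m: "0 < min (min d1 d2) (min 1 (T - t))" using d1 d2 t by auto
  have "h < min (min d1 d2) (min 1 (T - t))" unfolding h_def by (rule half[OF m])
  then have h: "0 < h" "h < d1" "h < d2" "h < 1" "t + h < T" using m by (auto simp: h_def)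
  have eh: "0 < e * h" "e * h \<le> 1" "e * h \<le> h" using e h mult_left_le_one_le[of h e] mult_le_one[of e h] by auto
  have tT: "t \<le> T" using t by simp
  \<comment> \<open>The path is chosen after \<open>h\<close>, with error \<open>e * h\<close>, so
    that the error survives division by \<open>h\<close> only as \<open>e\<close>.\<close>
  obtain y a where y: "near_optimal (e * h) t y a" "y t = x" using near_optimal_exists[OF x tT eh(1)] by metis
  have yc: "controlled p t T y a" using y by (simp add: near_optimal_def)
  have yh: "controlled p t (t + h) y a" by (rule controlled_subset[OF yc]) (use h in auto)
  define En where "En = energy t (t + h) a"
  define d where "d = l1_dist x (y (t + h))"
  define vd where "vd = val (y (t + h)) (t + h) - val x t"
  have cst: "cost t (t + h) y a + vd \<le> e * h" using near_optimal_cost[OF y(1), of "t + h"] h y(2) by (simp add: vd_def)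
  have En0: "0 \<le> En" by (simp add: En_def)
  have d_le: "d \<le> k * h + En / k powr (p - 1)" if "0 < k" for k
    using l1_dist_le_energy[OF yh that] y(2) by (simp add: d_def En_def)
  obtain Dv where Dv: "\<bar>Dv\<bar> \<le> K1 * d" "Dv + \<beta> * h - (d + h) \<le> vd"
    using loc1[OF h(1,2,5) y(1) eh(2) y(2)] by (auto simp: d_def vd_def)
  have "C0 * (En - h) \<le> cost t (t + h) y a" using cost_lower[OF yh] by (simp add: En_def)
  moreover have "- (\<bar>\<beta>\<bar> * h) \<le> \<beta> * h" using mult_right_mono[of "- \<bar>\<beta>\<bar>" \<beta> h] h by simp
  ultimately have E1: "C0 * En \<le> C0 * h + 2 * h + \<bar>\<beta>\<bar> * h + (K1 + 1) * d"
    using cst Dv eh by (simp add: algebra_simps abs_le_iff)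
  have "(K1 + 1) * d \<le> (K1 + 1) * (l * h + En / l powr (p - 1))" using d_le[of l] l K1 by (intro mult_left_mono) auto
  also have "\<dots> = (K1 + 1) * l * h + (K1 + 1) / l powr (p - 1) * En" by (simp add: algebra_simps)
  also have "(K1 + 1) / l powr (p - 1) * En \<le> C0 / 2 * En"
    using l C0 En0 by (intro mult_right_mono) (auto simp: field_simps)
  finally have "C0 / 2 * En \<le> (C0 + 2 + \<bar>\<beta>\<bar> + (K1 + 1) * l) * h" using E1 by (simp add: algebra_simps)
  then have EnK: "En \<le> Kc * h" using C0 by (simp add: Kc_def field_simps)
  have dK: "d \<le> h + Kc * h" using d_le[of 1] EnK by simp
  obtain Dv where Dv: "Dv + \<beta> * h - e * (d + h) \<le> vd" "- Dv - S * h - e * (h + En) \<le> cost t (t + h) y a"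
    using loc2[OF h(1,3,5) y(1) eh(2) y(2)] by (auto simp: d_def vd_def En_def)
  have "(\<beta> - S) * h \<le> e * h + e * (d + h) + e * (h + En)" using Dv cst by (simp add: algebra_simps)
  also have "\<dots> = e * (3 * h + d + En)" by (simp add: algebra_simps)
  also have "\<dots> \<le> e * ((4 + 2 * Kc) * h)" using dK EnK e by (intro mult_left_mono) (auto simp: algebra_simps)
  also have "\<dots> = e * (4 + 2 * Kc) * h" by simp
  also have "\<dots> \<le> \<eta> * h" using e h by (intro mult_right_mono) auto
  finally have "\<beta> - S \<le> \<eta>" by (rule mult_right_le_imp_le[OF _ h(1)])
  then show "\<beta> \<le> S + \<eta>" by simp
qed

end

context control
begin

text \<open>Half of \<open>e\<close> pays for the change of time, half for the change of position;
  the factor \<open>1 + \<bar>a\<bar> powr p\<close> makes this uniform over all velocities and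
  integrates to time plus energy.\<close>

lemma running_freeze:
  assumes R: "0 < R" and e: "0 < e"
  obtains \<rho> where "0 < \<rho>" "\<And>i s s' x x' a. x \<in> {0..R} \<Longrightarrow> x' \<in> {0..R} \<Longrightarrow> \<bar>s - s'\<bar> < \<rho> \<Longrightarrow> \<bar>x - x'\<bar> < \<rho> \<Longrightarrow>
    L i s' x' a - e * (1 + \<bar>a\<bar> powr p) \<le> L i s x a"
proof -
  obtain d where d: "d > 0" "\<And>i s s' a x. x \<in> {0..R} \<Longrightarrow> \<bar>s - s'\<bar> < d \<Longrightarrow> \<bar>L i s x a - L i s' x a\<bar> \<le> e / 2 * (1 + \<bar>a\<bar> powr p)"
    using L_time[OF R, of "e / 2"] e by (meson half_gt_zero)
  obtain c where c: "c \<ge> 0" "\<And>i s a x x'. x \<in> {0..R} \<Longrightarrow> x' \<in> {0..R} \<Longrightarrow>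
      \<bar>L i s x a - L i s x' a\<bar> \<le> c * (\<bar>a\<bar> powr p + 1) * \<bar>x - x'\<bar>"
    using L_lipschitz_x[OF R] by metis
  define \<rho> where "\<rho> = min d (e / (2 * (c + 1)))"
  have \<rho>: "0 < \<rho>" "\<rho> \<le> d" using d c e by (auto simp: \<rho>_def)
  have "(c + 1) * \<rho> \<le> (c + 1) * (e / (2 * (c + 1)))" using c by (intro mult_left_mono) (auto simp: \<rho>_def)
  also have "\<dots> = e / 2"
  proof -
    have "k * (e / (2 * k)) = e / 2" if "0 < k" for k using that by simp
    from this[of "c + 1"] c show ?thesis by simp
  qed
  finally have c\<rho>: "c * \<rho> \<le> e / 2" using \<rho> by (simp add: algebra_simps)
  show ?thesis
  proof (rule that[OF \<rho>(1)])
    fix i s s' x x' a assume *: "x \<in> {0..R}" "x' \<in> {0..R}" "\<bar>s - s'\<bar> < \<rho>" "\<bar>x - x'\<bar> < \<rho>"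
    have 1: "\<bar>L i s x a - L i s' x a\<bar> \<le> e / 2 * (1 + \<bar>a\<bar> powr p)" using d(2) * \<rho> by auto
    have "\<bar>L i s' x a - L i s' x' a\<bar> \<le> c * (\<bar>a\<bar> powr p + 1) * \<bar>x - x'\<bar>" by (rule c(2)[OF *(1,2)])
    also have "\<dots> \<le> c * (\<bar>a\<bar> powr p + 1) * \<rho>" using * c by (intro mult_left_mono) auto
    also have "\<dots> = c * \<rho> * (1 + \<bar>a\<bar> powr p)" by (simp add: algebra_simps)
    also have "\<dots> \<le> e / 2 * (1 + \<bar>a\<bar> powr p)" using c\<rho> by (intro mult_right_mono) auto
    finally have 2: "\<bar>L i s' x a - L i s' x' a\<bar> \<le> e / 2 * (1 + \<bar>a\<bar> powr p)" .
    have "e * (1 + \<bar>a\<bar> powr p) = e / 2 * (1 + \<bar>a\<bar> powr p) + e / 2 * (1 + \<bar>a\<bar> powr p)" by (simp add: algebra_simps)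
    then show "L i s' x' a - e * (1 + \<bar>a\<bar> powr p) \<le> L i s x a" using 1 2 by linarith
  qed
qed

text \<open>The slopes \<open>q\<close> make both local hypotheses linear: the sum over the edges of
  slope times active velocity integrates exactly to the weighted displacement, so a pointwise bound
  on the cost becomes the integrated one required by \<open>supersolution_step\<close>.\<close>

lemma supersolution_core:
  fixes q :: "'n \<Rightarrow> real"
  assumes x: "x \<in> junction" and t: "t \<in> {0<..<T}" and touch: "touches_from_below T \<phi> val x t"
    and lower: "\<And>e. 0 < e \<Longrightarrow> \<exists>\<rho>>0. \<forall>s y a. \<bar>s - t\<bar> < \<rho> \<longrightarrow> y \<in> junction \<longrightarrow> l1_dist x y < \<rho> \<longrightarrow>
      - (\<Sum>j\<in>UNIV. q j * (if 0 < y $ j then a else 0)) - S - e * (1 + \<bar>a\<bar> powr p) \<le> running s y a"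
    and expand: "\<And>e. 0 < e \<Longrightarrow> \<exists>\<rho>>0. \<forall>s y. \<bar>s - t\<bar> < \<rho> \<longrightarrow> s \<in> {0<..<T} \<longrightarrow> y \<in> junction \<longrightarrow> l1_dist x y < \<rho> \<longrightarrow>
      (\<Sum>j\<in>UNIV. q j * (y $ j - x $ j)) + \<beta> * (s - t) - e * (l1_dist x y + \<bar>s - t\<bar>) \<le> \<phi> y s - \<phi> x t"
  shows "\<beta> \<le> S"
proof (rule supersolution_step[OF x t, of "\<Sum>j\<in>UNIV. \<bar>q j\<bar>"])
  show "0 \<le> (\<Sum>j\<in>UNIV. \<bar>q j\<bar>)" by (simp add: sum_nonneg)
  fix e :: real assume e: "0 < e"
  have \<phi>x: "\<phi> x t = val x t" and "\<forall>\<^sub>F (y, s) in at (x, t) within junction \<times> {0<..<T}. \<phi> y s \<le> val y s"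
    using touch by (auto simp: touches_from_below_def)
  then obtain d0 where d0: "0 < d0" "\<And>y s. y \<in> junction \<Longrightarrow> s \<in> {0<..<T} \<Longrightarrow> norm (y - x) + \<bar>s - t\<bar> < d0 \<Longrightarrow> \<phi> y s \<le> val y s"
    using eventually_at_junction[where P = "\<lambda>y s. \<phi> y s \<le> val y s" and x = x and t = t] by auto
  obtain d1 where d1: "0 < d1" "\<And>s y a. \<bar>s - t\<bar> < d1 \<Longrightarrow> y \<in> junction \<Longrightarrow> l1_dist x y < d1 \<Longrightarrow>
      - (\<Sum>j\<in>UNIV. q j * (if 0 < y $ j then a else 0)) - S - e * (1 + \<bar>a\<bar> powr p) \<le> running s y a"
    using lower[OF e] by blast
  obtain d2 where d2: "0 < d2" "\<And>s y. \<bar>s - t\<bar> < d2 \<Longrightarrow> s \<in> {0<..<T} \<Longrightarrow> y \<in> junction \<Longrightarrow> l1_dist x y < d2 \<Longrightarrow>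
      (\<Sum>j\<in>UNIV. q j * (y $ j - x $ j)) + \<beta> * (s - t) - e * (l1_dist x y + \<bar>s - t\<bar>) \<le> \<phi> y s - \<phi> x t"
    using expand[OF e] by blast
  define \<rho> where "\<rho> = min (d0 / 2) (min d1 d2)"
  have \<rho>: "0 < \<rho>" "2 * \<rho> \<le> d0" "\<rho> \<le> d1" "\<rho> \<le> d2" using d0 d1 d2 by (auto simp: \<rho>_def)
  obtain d where d: "0 < d" "\<And>e t y a s. 0 \<le> t \<Longrightarrow> e \<le> 1 \<Longrightarrow> near_optimal e t y a \<Longrightarrow> y t = x \<Longrightarrow> t \<le> s \<Longrightarrow> s \<le> T \<Longrightarrow> s - t < d \<Longrightarrow> l1_dist x (y s) < \<rho>"
    using near_optimal_stays_close[OF x \<rho>(1)] by metis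
  show "\<exists>d>0. \<forall>h y a e'. 0 < h \<longrightarrow> h < d \<longrightarrow> t + h < T \<longrightarrow> near_optimal e' t y a \<longrightarrow> e' \<le> 1 \<longrightarrow> y t = x \<longrightarrow>
      (\<exists>Dv. \<bar>Dv\<bar> \<le> (\<Sum>j\<in>UNIV. \<bar>q j\<bar>) * l1_dist x (y (t + h)) \<and> Dv + \<beta> * h - e * (l1_dist x (y (t + h)) + h) \<le> val (y (t + h)) (t + h) - val x t \<and>
        - Dv - S * h - e * (h + energy t (t + h) a) \<le> cost t (t + h) y a)"
  proof (rule exI[of _ "min d \<rho>"], intro conjI allI impI)
    show "0 < min d \<rho>" using d \<rho> by simp
    fix h y a e'
    assume h: "0 < h" "h < min d \<rho>" "t + h < T" and y: "near_optimal e' t y a" "e' \<le> 1" "y t = x"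
    have yc: "controlled p t T y a" using y by (simp add: near_optimal_def)
    have yh: "controlled p t (t + h) y a" by (rule controlled_subset[OF yc]) (use h in auto)
    have yj: "y s \<in> junction" if "s \<in> {t..t + h}" for s using controlledD(2)[OF yh that] .
    have near: "l1_dist x (y s) < \<rho>" if "s \<in> {t..t + h}" for s
      by (rule d(2)[OF _ y(2,1,3)]) (use t h that in auto)
    have end_in: "t + h \<in> {t..t + h}" using h by simp
    define Dv where "Dv = (\<Sum>j\<in>UNIV. q j * (y (t + h) $ j - x $ j))"
    have "\<bar>Dv\<bar> \<le> (\<Sum>j\<in>UNIV. \<bar>q j * (y (t + h) $ j - x $ j)\<bar>)" unfolding Dv_def by (rule sum_abs)
    also have "\<dots> \<le> (\<Sum>j\<in>UNIV. \<bar>q j\<bar> * l1_dist x (y (t + h)))"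
    proof (rule sum_mono)
      fix j
      have "\<bar>x $ j - y (t + h) $ j\<bar> \<le> l1_dist x (y (t + h))"
        unfolding l1_dist_def by (rule member_le_sum) auto
      then show "\<bar>q j * (y (t + h) $ j - x $ j)\<bar> \<le> \<bar>q j\<bar> * l1_dist x (y (t + h))"
        by (simp add: abs_mult abs_minus_commute mult_left_mono)
    qed
    finally have D1: "\<bar>Dv\<bar> \<le> (\<Sum>j\<in>UNIV. \<bar>q j\<bar>) * l1_dist x (y (t + h))" by (simp add: sum_distrib_right)
    have "Dv + \<beta> * h - e * (l1_dist x (y (t + h)) + h) \<le> \<phi> (y (t + h)) (t + h) - \<phi> x t"
      using d2(2)[of "t + h" "y (t + h)"] h \<rho> near[OF end_in] yj[OF end_in] t by (simp add: Dv_def)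
    also have "\<phi> (y (t + h)) (t + h) \<le> val (y (t + h)) (t + h)"
    proof (rule d0(2)[OF yj[OF end_in]])
      show "norm (y (t + h) - x) + \<bar>t + h - t\<bar> < d0"
        using norm_le_l1_dist[of x "y (t + h)"] near[OF end_in] h \<rho> by (simp add: norm_minus_commute)
    qed (use t h in auto)
    finally have D2: "Dv + \<beta> * h - e * (l1_dist x (y (t + h)) + h) \<le> val (y (t + h)) (t + h) - val x t" using \<phi>x by simp
    have I: "((\<lambda>s. - (\<Sum>j\<in>UNIV. q j * (if 0 < y s $ j then a s else 0)) - S - e * (1 + \<bar>a s\<bar> powr p)) has_integral
        (- Dv - S * h - e * (h + energy t (t + h) a))) {t..t + h}"
    proof -
      have c: "((\<lambda>s. k) has_integral k * h) {t..t + h}" for k :: real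
        using has_integral_const_real[of k t "t + h"] h by (simp add: mult.commute)
      have E: "((\<lambda>s. \<bar>a s\<bar> powr p) has_integral energy t (t + h) a) {t..t + h}"
        unfolding energy_def by (rule integrable_integral[OF controlledD(4)[OF yh]])
      have "((\<lambda>s. if 0 < y s $ j then a s else 0) has_integral (y (t + h) $ j - x $ j)) {t..t + h}" for j
        using controlledD(6)[OF yh end_in, of j] y(3) by simp
      then have "((\<lambda>s. \<Sum>j\<in>UNIV. q j * (if 0 < y s $ j then a s else 0)) has_integral Dv) {t..t + h}"
        unfolding Dv_def by (intro has_integral_sum has_integral_mult_right) auto
      from has_integral_diff[OF has_integral_diff[OF has_integral_neg[OF this] c[of S]] has_integral_mult_right[OF has_integral_add[OF c[of 1] E], of e]]
      show ?thesis by simp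
    qed
    have "- Dv - S * h - e * (h + energy t (t + h) a) \<le> cost t (t + h) y a"
    proof (rule has_integral_le)
      show "((\<lambda>s. - (\<Sum>j\<in>UNIV. q j * (if 0 < y s $ j then a s else 0)) - S - e * (1 + \<bar>a s\<bar> powr p)) has_integral
        (- Dv - S * h - e * (h + energy t (t + h) a))) {t..t + h}" by (rule I)
      show "((\<lambda>s. running s (y s) (a s)) has_integral cost t (t + h) y a) {t..t + h}"
        unfolding cost_def by (rule integrable_integral[OF running_integrable[OF yh]])
      fix s assume s: "s \<in> {t..t + h}"
      show "- (\<Sum>j\<in>UNIV. q j * (if 0 < y s $ j then a s else 0)) - S - e * (1 + \<bar>a s\<bar> powr p) \<le> running s (y s) (a s)"
        by (rule d1(2)) (use s h \<rho> near[OF s] yj[OF s] in auto)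
    qed
    then show "\<exists>Dv. \<bar>Dv\<bar> \<le> (\<Sum>j\<in>UNIV. \<bar>q j\<bar>) * l1_dist x (y (t + h)) \<and> Dv + \<beta> * h - e * (l1_dist x (y (t + h)) + h) \<le> val (y (t + h)) (t + h) - val x t \<and>
        - Dv - S * h - e * (h + energy t (t + h) a) \<le> cost t (t + h) y a"
      using D1 D2 by blast
  qed
qed

lemma sum_single_edge:
  fixes q :: "'n \<Rightarrow> real"
  assumes "y \<in> junction" "0 < y $ i"
  shows "(\<Sum>j\<in>UNIV. q j * (if 0 < y $ j then a else 0)) = q i * a"
proof -
  have "\<not> 0 < y $ j" if "j \<noteq> i" for j using junction_pos_unique[OF assms(1,2), of j] that by auto
  then show ?thesis using assms(2) by (subst sum.remove[of _ i]) auto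
qed

text \<open>Only the slope on edge \<open>i\<close> is nonzero; within distance \<open>r\<close> of
  the point no other edge is met.\<close>

lemma supersolution_edge:
  assumes \<phi>: "C1_junction T \<phi>" and r: "0 < r" and t: "t \<in> {0<..<T}"
    and touch: "touches_from_below T \<phi> val (r *\<^sub>R axis i 1) t"
    and S: "\<And>\<zeta>. - edge_derivative \<phi> i r t * \<zeta> - L i t r \<zeta> \<le> S"
  shows "deriv (\<phi> (r *\<^sub>R axis i 1)) t \<le> S"
proof -
  let ?x = "r *\<^sub>R axis i (1::real)" and ?D = "edge_derivative \<phi> i r t" and ?b = "deriv (\<phi> (r *\<^sub>R axis i 1)) t"
  define q where "q j = (if j = i then ?D else 0)" for j
  have x: "?x \<in> junction" "?x \<in> edge i" "?x $ i = r" using r by (auto simp: edge_iff axis_def axis_junction[unfolded axis_def])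
  have on_edge: "y \<in> edge i \<and> 0 < y $ i \<and> y $ i < 2 * r \<and> l1_dist ?x y = \<bar>y $ i - r\<bar>" if y: "y \<in> junction" "l1_dist ?x y < r" for y
  proof -
    have "\<bar>?x $ i - y $ i\<bar> \<le> l1_dist ?x y" unfolding l1_dist_def by (rule member_le_sum) auto
    then have a: "\<bar>r - y $ i\<bar> < r" using x(3) y(2) by linarith
    then have "0 < y $ i" by linarith
    then have e: "y \<in> edge i" by (rule junction_pos_edge[OF y(1)])
    show ?thesis using l1_dist_same_edge[OF x(2) e] a e \<open>0 < y $ i\<close> unfolding x(3) by linarith
  qed
  show ?thesis
  proof (rule supersolution_core[OF x(1) t touch, of q])
    fix e :: real assume e: "0 < e"
    have R: "0 < 2 * r" using r by simp
    obtain \<rho> where \<rho>: "0 < \<rho>" "\<And>i s s' x x' a. x \<in> {0..2 * r} \<Longrightarrow> x' \<in> {0..2 * r} \<Longrightarrow> \<bar>s - s'\<bar> < \<rho> \<Longrightarrow> \<bar>x - x'\<bar> < \<rho> \<Longrightarrow>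
        L i s' x' a - e * (1 + \<bar>a\<bar> powr p) \<le> L i s x a" using running_freeze[OF R e] by metis
    show "\<exists>\<rho>>0. \<forall>s y a. \<bar>s - t\<bar> < \<rho> \<longrightarrow> y \<in> junction \<longrightarrow> l1_dist ?x y < \<rho> \<longrightarrow>
      - (\<Sum>j\<in>UNIV. q j * (if 0 < y $ j then a else 0)) - S - e * (1 + \<bar>a\<bar> powr p) \<le> running s y a"
    proof (intro exI[of _ "min \<rho> r"] conjI allI impI)
      show "0 < min \<rho> r" using \<rho> r by simp
      fix s a :: real and y :: "real ^ 'n" assume *: "\<bar>s - t\<bar> < min \<rho> r" "y \<in> junction" "l1_dist ?x y < min \<rho> r"
      then have y: "0 < y $ i" "y $ i < 2 * r" "\<bar>y $ i - r\<bar> < \<rho>" using on_edge[OF *(2)] by auto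
      have "L i t r a - e * (1 + \<bar>a\<bar> powr p) \<le> L i s (y $ i) a"
        by (rule \<rho>(2)) (use y * r in auto)
      then show "- (\<Sum>j\<in>UNIV. q j * (if 0 < y $ j then a else 0)) - S - e * (1 + \<bar>a\<bar> powr p) \<le> running s y a"
        using S[of a] unfolding sum_single_edge[OF *(2) y(1)] running_edge[OF *(2) y(1)] by (simp add: q_def)
    qed
    obtain d1 where d1: "d1>0" "\<And>r' t'. 0 \<le> r' \<Longrightarrow> t' \<in> {0<..<T} \<Longrightarrow> \<bar>r' - r\<bar> < d1 \<Longrightarrow> \<bar>t' - t\<bar> < d1 \<Longrightarrow>
      \<bar>\<phi> (r' *\<^sub>R axis i 1) t' - \<phi> ?x t - ?D * (r' - r) - ?b * (t' - t)\<bar> \<le> e * (\<bar>r' - r\<bar> + \<bar>t' - t\<bar>)"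
      using C1_junction_expansion[OF \<phi> less_imp_le[OF r] t e, of i] by blast
    show "\<exists>\<rho>>0. \<forall>s y. \<bar>s - t\<bar> < \<rho> \<longrightarrow> s \<in> {0<..<T} \<longrightarrow> y \<in> junction \<longrightarrow> l1_dist ?x y < \<rho> \<longrightarrow>
      (\<Sum>j\<in>UNIV. q j * (y $ j - ?x $ j)) + ?b * (s - t) - e * (l1_dist ?x y + \<bar>s - t\<bar>) \<le> \<phi> y s - \<phi> ?x t"
    proof (intro exI[of _ "min d1 r"] conjI allI impI)
      show "0 < min d1 r" using d1 r by simp
      fix s :: real and y :: "real ^ 'n" assume *: "\<bar>s - t\<bar> < min d1 r" "s \<in> {0<..<T}" "y \<in> junction" "l1_dist ?x y < min d1 r"
      then have y: "y \<in> edge i" "0 < y $ i" "\<bar>y $ i - r\<bar> < d1" "l1_dist ?x y = \<bar>y $ i - r\<bar>" using on_edge[OF *(3)] by auto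
      have "\<bar>\<phi> y s - \<phi> ?x t - ?D * (y $ i - r) - ?b * (s - t)\<bar> \<le> e * (\<bar>y $ i - r\<bar> + \<bar>s - t\<bar>)"
        using d1(2)[of "y $ i" s] y * edge_eq_axis[OF y(1)] by simp
      moreover have "(\<Sum>j\<in>UNIV. q j * (y $ j - ?x $ j)) = ?D * (y $ i - r)"
        using x(3) by (subst sum.remove[of _ i]) (auto simp: q_def)
      ultimately show "(\<Sum>j\<in>UNIV. q j * (y $ j - ?x $ j)) + ?b * (s - t) - e * (l1_dist ?x y + \<bar>s - t\<bar>) \<le> \<phi> y s - \<phi> ?x t"
        unfolding y(4) by (simp add: abs_le_iff)
    qed
  qed
qed

text \<open>At the vertex, a slope \<open>q j\<close> not exceeding that of the test function turns the one-sided bound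
  defining the vertex Hamiltonian into a bound over all velocities. The replacement is harmless because
  the net displacement on each edge is nonnegative.\<close>

lemma supersolution_vertex:
  assumes \<phi>: "C1_junction T \<phi>" and t: "t \<in> {0<..<T}"
    and touch: "touches_from_below T \<phi> val 0 t"
    and S: "\<And>i \<zeta>. 0 \<le> \<zeta> \<Longrightarrow> - edge_derivative \<phi> i 0 t * \<zeta> - L i t 0 \<zeta> \<le> S" and S0: "- L0 t \<le> S"
  shows "deriv (\<phi> 0) t \<le> S"
proof -
  let ?D = "\<lambda>i. edge_derivative \<phi> i 0 t" and ?b = "deriv (\<phi> 0) t"
  obtain b where b: "\<And>i a. L i t 0 0 + b i * a \<le> L i t 0 a"
    using choice[of "\<lambda>i b. \<forall>a. L i t 0 0 + b * a \<le> L i t 0 a"] L_tangent by auto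
  \<comment> \<open>\<open>b i\<close> is the slope of a supporting line of the cost at zero
    velocity. With slope \<open>- b i\<close> the bound at every velocity reduces to the one at
    velocity \<open>0\<close>; if the slope of the test function is smaller, that line still
    controls the inward velocities and the hypothesis the outward ones.\<close>
  define q where "q i = min (?D i) (- b i)" for i
  have qS: "- q i * \<zeta> - L i t 0 \<zeta> \<le> S" for i \<zeta>
  proof -
    have S': "- L i t 0 0 \<le> S" using S[of 0 i] by simp
    show ?thesis
    proof (cases "?D i \<le> - b i")
      case True
      show ?thesis
      proof (cases "0 \<le> \<zeta>")
        case True with S[OF this, of i] \<open>?D i \<le> - b i\<close> show ?thesis by (simp add: q_def)
      next
        case False
        then have "- b i * \<zeta> \<le> ?D i * \<zeta>" using True by (intro mult_right_mono_neg) auto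
        then show ?thesis using b[of i \<zeta>] S' True by (simp add: q_def)
      qed
    next
      case False
      then show ?thesis using b[of i \<zeta>] S' by (simp add: q_def)
    qed
  qed
  show ?thesis
  proof (rule supersolution_core[OF zero_junction t touch, of q])
    fix e :: real assume e: "0 < e"
    obtain \<rho> where \<rho>: "0 < \<rho>" "\<And>i s s' x x' a. x \<in> {0..1} \<Longrightarrow> x' \<in> {0..1} \<Longrightarrow> \<bar>s - s'\<bar> < \<rho> \<Longrightarrow> \<bar>x - x'\<bar> < \<rho> \<Longrightarrow>
        L i s' x' a - e * (1 + \<bar>a\<bar> powr p) \<le> L i s x a" using running_freeze[OF zero_less_one e] by metis
    have "isCont L0 t" using L0_continuous by (simp add: continuous_on_eq_continuous_at)
    then obtain d where d: "0 < d" "\<And>s. \<bar>s - t\<bar> < d \<Longrightarrow> \<bar>L0 s - L0 t\<bar> < e"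
      using e unfolding continuous_at_eps_delta by (auto simp: dist_real_def)
    show "\<exists>\<rho>>0. \<forall>s y a. \<bar>s - t\<bar> < \<rho> \<longrightarrow> y \<in> junction \<longrightarrow> l1_dist 0 y < \<rho> \<longrightarrow>
      - (\<Sum>j\<in>UNIV. q j * (if 0 < y $ j then a else 0)) - S - e * (1 + \<bar>a\<bar> powr p) \<le> running s y a"
    proof (intro exI[of _ "min (min \<rho> d) 1"] conjI allI impI)
      show "0 < min (min \<rho> d) 1" using \<rho> d by simp
      fix s a :: real and y :: "real ^ 'n" assume *: "\<bar>s - t\<bar> < min (min \<rho> d) 1" "y \<in> junction" "l1_dist 0 y < min (min \<rho> d) 1"
      show "- (\<Sum>j\<in>UNIV. q j * (if 0 < y $ j then a else 0)) - S - e * (1 + \<bar>a\<bar> powr p) \<le> running s y a"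
      proof (cases "y = 0")
        case True
        have "e \<le> e * (1 + \<bar>a\<bar> powr p)" using e by simp
        moreover have "- S - e \<le> L0 s" using d(2)[of s] *(1) S0 by (simp add: abs_less_iff)
        ultimately have "- S - e * (1 + \<bar>a\<bar> powr p) \<le> L0 s" by linarith
        then show ?thesis using True by simp
      next
        case False
        then obtain i where i: "0 < y $ i" using junction_pos_component[OF *(2)] by blast
        have yi: "y $ i = l1_dist 0 y" using norm_edge[OF junction_pos_edge[OF *(2) i]] *(2) by (simp add: l1_dist_zero)
        have "L i t 0 a - e * (1 + \<bar>a\<bar> powr p) \<le> L i s (y $ i) a"
          by (rule \<rho>(2)) (use yi * i in auto)
        then show ?thesis using qS[of i a] unfolding sum_single_edge[OF *(2) i] running_edge[OF *(2) i] by simp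
      qed
    qed
    have "\<exists>d>0. \<forall>r' t'. 0 \<le> r' \<longrightarrow> t' \<in> {0<..<T} \<longrightarrow> \<bar>r' - 0\<bar> < d \<longrightarrow> \<bar>t' - t\<bar> < d \<longrightarrow>
      \<bar>\<phi> (r' *\<^sub>R axis i 1) t' - \<phi> (0 *\<^sub>R axis i 1) t - ?D i * (r' - 0) - deriv (\<phi> (0 *\<^sub>R axis i 1)) t * (t' - t)\<bar>
        \<le> e * (\<bar>r' - 0\<bar> + \<bar>t' - t\<bar>)" for i
      by (rule C1_junction_expansion[OF \<phi> order_refl t e])
    then obtain d1 where d1: "\<And>i. d1 i > 0" "\<And>i r' t'. 0 \<le> r' \<Longrightarrow> t' \<in> {0<..<T} \<Longrightarrow> \<bar>r'\<bar> < d1 i \<Longrightarrow> \<bar>t' - t\<bar> < d1 i \<Longrightarrow>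
      \<bar>\<phi> (r' *\<^sub>R axis i 1) t' - \<phi> 0 t - ?D i * r' - ?b * (t' - t)\<bar> \<le> e * (\<bar>r'\<bar> + \<bar>t' - t\<bar>)"
      by (simp only: diff_0_right scaleR_zero_left) metis
    define m where "m = Min (range d1)"
    have m: "0 < m" "m \<le> d1 i" for i using d1(1) by (auto simp: m_def)
    show "\<exists>\<rho>>0. \<forall>s y. \<bar>s - t\<bar> < \<rho> \<longrightarrow> s \<in> {0<..<T} \<longrightarrow> y \<in> junction \<longrightarrow> l1_dist 0 y < \<rho> \<longrightarrow>
      (\<Sum>j\<in>UNIV. q j * (y $ j - 0 $ j)) + ?b * (s - t) - e * (l1_dist 0 y + \<bar>s - t\<bar>) \<le> \<phi> y s - \<phi> 0 t"
    proof (intro exI[of _ m] conjI m(1) allI impI)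
      fix s :: real and y :: "real ^ 'n" assume *: "\<bar>s - t\<bar> < m" "s \<in> {0<..<T}" "y \<in> junction" "l1_dist 0 y < m"
      obtain i where i: "y \<in> edge i" "0 \<le> y $ i" "y = y $ i *\<^sub>R axis i 1" using junctionE[OF *(3)] by metis
      have l: "l1_dist 0 y = y $ i" using norm_edge[OF i(1)] *(3) by (simp add: l1_dist_zero)
      have "\<bar>\<phi> (y $ i *\<^sub>R axis i 1) s - \<phi> 0 t - ?D i * y $ i - ?b * (s - t)\<bar> \<le> e * (\<bar>y $ i\<bar> + \<bar>s - t\<bar>)"
        by (rule d1(2)) (use i * l m(2)[of i] in auto)
      then have 1: "\<bar>\<phi> y s - \<phi> 0 t - ?D i * y $ i - ?b * (s - t)\<bar> \<le> e * (y $ i + \<bar>s - t\<bar>)" using i by simp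
      have "(\<Sum>j\<in>UNIV. q j * (y $ j - 0 $ j)) = q i * y $ i"
        using i(1) by (subst sum.remove[of _ i]) (auto simp: edge_iff)
      also have "\<dots> \<le> ?D i * y $ i" using i(2) by (intro mult_right_mono) (auto simp: q_def)
      finally show "(\<Sum>j\<in>UNIV. q j * (y $ j - 0 $ j)) + ?b * (s - t) - e * (l1_dist 0 y + \<bar>s - t\<bar>) \<le> \<phi> y s - \<phi> 0 t"
        using 1 unfolding l by (simp add: abs_le_iff)
    qed
  qed
qed

end

section \<open>Sobolev trajectories as controlled paths\<close>

lemma has_weak_derivative_cong:
  assumes "\<And>s. s \<in> {a<..<b} \<Longrightarrow> f s = f' s" "\<And>s. s \<in> {a<..<b} \<Longrightarrow> v s = v' s"
  shows "has_weak_derivative a b f v \<longleftrightarrow> has_weak_derivative a b f' v'"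
proof -
  have 1: "locally_integrable_on a b g \<longleftrightarrow> locally_integrable_on a b g'"
    if "\<And>s. s \<in> {a<..<b} \<Longrightarrow> g s = g' s" for g g' :: "real \<Rightarrow> 'a"
    unfolding locally_integrable_on_def using that
    by (intro all_cong1 imp_cong refl set_integrable_cong) auto
  have 2: "(LINT s:{a<..<b}|lborel. \<psi> s *\<^sub>R g s) = (LINT s:{a<..<b}|lborel. \<psi> s *\<^sub>R g' s)"
    if "\<And>s. s \<in> {a<..<b} \<Longrightarrow> g s = g' s" for g g' :: "real \<Rightarrow> 'a" and \<psi> :: "real \<Rightarrow> real"
    using that by (intro set_lebesgue_integral_cong) auto
  have l: "locally_integrable_on a b f = locally_integrable_on a b f'" "locally_integrable_on a b v = locally_integrable_on a b v'"
    by (rule 1, rule assms, assumption)+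
  have i: "(LINT s:{a<..<b}|lborel. \<psi> s *\<^sub>R f s) = (LINT s:{a<..<b}|lborel. \<psi> s *\<^sub>R f' s)"
    "(LINT s:{a<..<b}|lborel. \<psi> s *\<^sub>R v s) = (LINT s:{a<..<b}|lborel. \<psi> s *\<^sub>R v' s)" for \<psi> :: "real \<Rightarrow> real"
    by (rule 2, rule assms, assumption)+
  show ?thesis unfolding has_weak_derivative_def l i ..
qed

text \<open>The representative chosen by \<open>weak_derivative\<close> is known only to be locally
  integrable; compact subintervals exhausting the open interval make its restriction
  measurable.\<close>

lemma locally_integrable_borel:
  fixes v :: "real \<Rightarrow> 'a::euclidean_space"
  assumes "locally_integrable_on a b v"
  shows "(\<lambda>s. indicator {a<..<b} s *\<^sub>R v s) \<in> borel_measurable borel"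
proof (rule borel_measurable_LIMSEQ_metric)
  define f where "f n s = indicator {a + inverse (real (Suc n))..b - inverse (real (Suc n))} s *\<^sub>R v s" for n s
  show "f n \<in> borel_measurable borel" for n
  proof -
    have "set_integrable lborel {a + inverse (real (Suc n))..b - inverse (real (Suc n))} v"
      using assms by (auto simp: locally_integrable_on_def)
    then show ?thesis unfolding f_def[abs_def] set_integrable_def by (simp add: borel_measurable_integrable)
  qed
  fix s :: real
  show "(\<lambda>n. f n s) \<longlonglongrightarrow> indicator {a<..<b} s *\<^sub>R v s"
  proof (cases "s \<in> {a<..<b}")
    case True
    define e where "e = min (s - a) (b - s)"
    have "0 < e" using True by (simp add: e_def)
    have "(\<lambda>n. inverse (real (Suc n))) \<longlonglongrightarrow> 0" by (rule LIMSEQ_inverse_real_of_nat)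
    then have "\<forall>\<^sub>F n in sequentially. inverse (real (Suc n)) < e" using \<open>0 < e\<close> by (rule order_tendstoD)
    then have "\<forall>\<^sub>F n in sequentially. f n s = v s"
      by eventually_elim (auto simp: f_def e_def indicator_def)
    then show ?thesis using True by (simp add: tendsto_eventually)
  next
    case False
    have "f n s = 0" for n
    proof -
      have "0 < inverse (real (Suc n))" by simp
      have "s \<notin> {a + inverse (real (Suc n))..b - inverse (real (Suc n))}"
      proof
        assume "s \<in> {a + inverse (real (Suc n))..b - inverse (real (Suc n))}"
        then have "a < s" "s < b" using \<open>0 < inverse (real (Suc n))\<close> unfolding atLeastAtMost_iff by linarith+
        then show False using False by simp
      qed
      then show ?thesis by (simp add: f_def)
    qed
    then show ?thesis using False by simp
  qed
qed

text \<open>Each coordinate is absolutely continuous and nonnegative, so its velocity may be dropped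
  where it vanishes. At most one coordinate is positive at a time, and its velocity is the radial
  velocity.\<close>

lemma trajectory_controlled:
  fixes y :: "real \<Rightarrow> real ^ 'n::finite"
  assumes y: "y \<in> trajectories p T t x" and p: "1 < p" and tT: "t \<le> T"
  obtains a where "controlled p t T y a" "y t = x"
proof (cases "t = T")
  case True
  \<comment> \<open>On a one-point interval nothing moves and the zero velocity serves.\<close>
  have "controlled p t T y (\<lambda>_. 0)"
    using y True by (auto simp: controlled_def trajectories_def set_borel_measurable_def intro: integrable_on_refl[where 'a = real, simplified])
  then show ?thesis using that y by (auto simp: trajectories_def)
next
  case False
  then have tT: "t < T" using tT by simp
  have yj: "\<And>s. s \<in> {t..T} \<Longrightarrow> y s \<in> junction" and yc: "continuous_on {t..T} y" and ytx: "y t = x"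
    using y by (auto simp: trajectories_def)
  obtain v where v: "Lp_function_on p t T v" "has_weak_derivative t T y v"
    using y by (auto simp: trajectories_def sobolev_1p_on_def)
  define w where "w s = indicator {t<..<T} s *\<^sub>R v s" for s
  have wm [measurable]: "w \<in> borel_measurable borel"
    using v(1) by (simp add: w_def[abs_def] Lp_function_on_def set_borel_measurable_def)
  have wp: "set_integrable lborel {t..T} (\<lambda>s. norm (w s) powr p)"
  proof -
    have "integrable lborel (\<lambda>s. indicator {t<..<T} s *\<^sub>R norm (v s) powr p)"
      using v(1) by (simp add: Lp_function_on_def set_integrable_def)
    also have "(\<lambda>s. indicator {t<..<T} s *\<^sub>R norm (v s) powr p) = (\<lambda>s. indicator {t..T} s *\<^sub>R norm (w s) powr p)"
      using p by (auto simp: w_def indicator_def)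
    finally show ?thesis by (simp add: set_integrable_def)
  qed
  have wpi: "(\<lambda>s. norm (w s) powr p) integrable_on {t..T}"
    by (rule set_borel_integral_eq_integral(1)[OF wp])
  have wweak: "has_weak_derivative t T y w"
    using v(2) by (subst has_weak_derivative_cong[of t T y y w v]) (auto simp: w_def)
  have wi: "set_integrable lborel {t..T} (\<lambda>s. w s $ i)" for i
  proof (rule set_borel_measurable_abs_integrable(2))
    have [measurable]: "(\<lambda>s. w s $ i) \<in> borel_measurable borel"
      by (rule measurable_compose[OF wm]) (intro borel_measurable_continuous_onI continuous_intros)
    show "set_borel_measurable lborel {t..T} (\<lambda>s. w s $ i)" by (simp add: set_borel_measurable_def)
    show "(\<lambda>s. 1 + norm (w s) powr p) integrable_on {t..T}" by (intro integrable_add wpi) auto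
    show "\<bar>w s $ i\<bar> \<le> 1 + norm (w s) powr p" for s
      using component_le_norm_cart[of "w s" i] le_one_plus_powr[of "norm (w s)" p] p by simp
  qed
  have wai: "(\<lambda>s. w s $ i) absolutely_integrable_on {t..T}" for i
    by (rule absolutely_integrable_if_set_integrable_lborel[OF wi])
  have yi: "continuous_on {t..T} (\<lambda>s. y s $ i)" for i by (intro continuous_intros yc)
  have rep: "y s $ i = y t $ i + integral {t..s} (\<lambda>s. w s $ i)" if "s \<in> {t..T}" for s i
    by (rule weak_derivative_continuous_function[OF tT yi has_weak_derivative_component[OF wweak tT] wi that])
  have pos: "((\<lambda>\<sigma>. if 0 < y \<sigma> $ i then w \<sigma> $ i else 0) has_integral (y s $ i - y t $ i)) {t..s}" if s: "s \<in> {t..T}" for s i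
  proof (rule integral_velocity_positive_part)
    have sub: "{t..s} \<subseteq> {t..T}" using s by simp
    show "t \<le> s" using s by simp
    show "(\<lambda>s. w s $ i) absolutely_integrable_on {t..s}" by (rule absolutely_integrable_on_subinterval[OF wai sub])
    show "y r $ i = y t $ i + integral {t..r} (\<lambda>s. w s $ i)" if "r \<in> {t..s}" for r
      by (rule rep) (use that sub in blast)
    show "0 \<le> y r $ i" if "r \<in> {t..s}" for r
      by (rule junction_nonneg[OF yj]) (use that sub in blast)
  qed
  define a where "a s = (\<Sum>j\<in>UNIV. if 0 < y s $ j then w s $ j else 0)" for s
  have ai: "a s = w s $ i" if "s \<in> {t..T}" "0 < y s $ i" for s i
  proof -
    have "\<not> 0 < y s $ j" if "j \<noteq> i" for j using junction_pos_unique[OF yj[OF \<open>s \<in> {t..T}\<close>] \<open>0 < y s $ i\<close>, of j] that by auto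
    then have "(\<Sum>j\<in>UNIV. if 0 < y s $ j then w s $ j else 0) = (\<Sum>j\<in>UNIV. if j = i then w s $ j else 0)"
      using that(2) by (intro sum.cong refl) auto
    then show ?thesis by (simp add: a_def)
  qed
  have ab: "\<bar>a s\<bar> \<le> norm (w s)" if s: "s \<in> {t..T}" for s
  proof (cases "\<exists>i. 0 < y s $ i")
    case True
    then obtain i where "a s = w s $ i" using ai[OF s] by blast
    then show ?thesis using component_le_norm_cart[of "w s" i] by simp
  qed (simp add: a_def)
  have am [measurable]: "(\<lambda>s. indicator {t..T} s *\<^sub>R a s) \<in> borel_measurable borel"
  proof -
    have [measurable]: "(\<lambda>s. indicator {t..T} s *\<^sub>R (y s $ i)) \<in> borel_measurable borel" for i
      by (rule borel_measurable_continuous_on_indicator) (auto intro: yi)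
    have [measurable]: "(\<lambda>s. w s $ i) \<in> borel_measurable borel" for i
      by (rule measurable_compose[OF wm]) (intro borel_measurable_continuous_onI continuous_intros)
    have "(\<lambda>s. \<Sum>j\<in>UNIV. if 0 < indicator {t..T} s *\<^sub>R (y s $ j) then w s $ j else 0) \<in> borel_measurable borel"
      by measurable
    also have "(\<lambda>s. \<Sum>j\<in>UNIV. if 0 < indicator {t..T} s *\<^sub>R (y s $ j) then w s $ j else 0) = (\<lambda>s. indicator {t..T} s *\<^sub>R a s)"
      by (auto simp: a_def indicator_def)
    finally show ?thesis .
  qed
  have "controlled p t T y a"
    unfolding controlled_def
  proof (intro conjI allI ballI impI)
    show "set_borel_measurable lborel {t..T} a" using am by (simp add: set_borel_measurable_def)
    have "set_integrable lborel {t..T} (\<lambda>s. \<bar>a s\<bar> powr p)"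
    proof (rule set_borel_measurable_abs_integrable(2)[OF _ wpi])
      have "(\<lambda>s. \<bar>indicator {t..T} s *\<^sub>R a s\<bar> powr p) \<in> borel_measurable borel" by measurable
      also have "(\<lambda>s. \<bar>indicator {t..T} s *\<^sub>R a s\<bar> powr p) = (\<lambda>s. indicator {t..T} s *\<^sub>R (\<bar>a s\<bar> powr p))"
        using p by (auto simp: indicator_def)
      finally show "set_borel_measurable lborel {t..T} (\<lambda>s. \<bar>a s\<bar> powr p)" by (simp add: set_borel_measurable_def)
      show "\<bar>\<bar>a s\<bar> powr p\<bar> \<le> norm (w s) powr p" if "s \<in> {t..T}" for s
        using ab[OF that] p by (simp add: powr_mono2)
    qed
    then show "(\<lambda>s. \<bar>a s\<bar> powr p) integrable_on {t..T}" by (rule set_borel_integral_eq_integral(1))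
    fix i s assume s: "s \<in> {t..T}"
    show "((\<lambda>\<sigma>. if 0 < y \<sigma> $ i then a \<sigma> else 0) has_integral (y s $ i - y t $ i)) {t..s}"
      by (rule has_integral_eq[OF _ pos[OF s]]) (use ai s in auto)
  qed (use tT yj in \<open>auto simp: a_def\<close>)
  then show ?thesis using that ytx by blast
qed

lemma controlled_positive_part:
  assumes y: "controlled p t T y a" and p: "1 < p"
  shows "set_borel_measurable lborel {t..T} (\<lambda>s. if 0 < y s $ i then a s else 0)"
    "set_integrable lborel {t..T} (\<lambda>s. if 0 < y s $ i then a s else 0)"
proof -
  have am [measurable]: "(\<lambda>s. indicator {t..T} s *\<^sub>R a s) \<in> borel_measurable borel"
    using controlledD(3)[OF y] by (simp add: set_borel_measurable_def)
  have [measurable]: "(\<lambda>s. indicator {t..T} s *\<^sub>R (y s $ i)) \<in> borel_measurable borel"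
    by (rule borel_measurable_continuous_on_indicator) (auto intro: controlled_component_continuous[OF y])
  have "(\<lambda>s. if 0 < indicator {t..T} s *\<^sub>R (y s $ i) then indicator {t..T} s *\<^sub>R a s else 0) \<in> borel_measurable borel"
    by measurable
  also have "(\<lambda>s. if 0 < indicator {t..T} s *\<^sub>R (y s $ i) then indicator {t..T} s *\<^sub>R a s else 0) =
      (\<lambda>s. indicator {t..T} s *\<^sub>R (if 0 < y s $ i then a s else 0))"
    by (auto simp: indicator_def)
  finally show m: "set_borel_measurable lborel {t..T} (\<lambda>s. if 0 < y s $ i then a s else 0)"
    by (simp add: set_borel_measurable_def)
  show "set_integrable lborel {t..T} (\<lambda>s. if 0 < y s $ i then a s else 0)"
    by (rule set_borel_measurable_abs_integrable(2)[OF m controlled_integrable(4)[OF y p]]) auto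
qed

text \<open>The vector velocity has the component \<open>a\<close> on the occupied edge and zeros
  elsewhere, so its norm is at most \<open>\<bar>a\<bar>\<close> and it inherits the
  integrability.\<close>

lemma controlled_trajectory:
  fixes y :: "real \<Rightarrow> real ^ 'n::finite"
  assumes y: "controlled p t T y a" and p: "1 < p"
  shows "restrict y {t..T} \<in> trajectories p T t (y t)"
proof -
  let ?y = "restrict y {t..T}"
  have tT: "t \<le> T" using controlledD(1)[OF y] .
  have yc: "continuous_on {t..T} y" by (rule controlled_continuous[OF y])
  have [measurable]: "(\<lambda>s. indicator {t..T} s *\<^sub>R y s) \<in> borel_measurable borel"
    by (rule borel_measurable_continuous_on_indicator) (auto intro: yc)
  have [measurable]: "(\<lambda>s. indicator {t..T} s *\<^sub>R (if 0 < y s $ i then a s else 0)) \<in> borel_measurable borel" for i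
    using controlled_positive_part(1)[OF y p, of i] by (simp add: set_borel_measurable_def)
  define c where "c i s = indicator {t..T} s *\<^sub>R (if 0 < y s $ i then a s else 0)" for i s
  define v where "v s = (\<chi> i. c i s)" for s
  have vm [measurable]: "v \<in> borel_measurable borel"
  proof -
    have [measurable]: "c i \<in> borel_measurable borel" for i unfolding c_def[abs_def] by measurable
    have "(\<lambda>s. \<Sum>i\<in>UNIV. c i s *\<^sub>R axis i (1::real)) \<in> borel_measurable borel"
      by measurable
    also have "(\<lambda>s. \<Sum>i\<in>UNIV. c i s *\<^sub>R axis i (1::real)) = v"
      by (intro ext) (simp add: v_def vec_eq_iff axis_def if_distrib cong: if_cong)
    finally show ?thesis .
  qed
  have vb: "norm (v s) \<le> \<bar>a s\<bar>" if s: "s \<in> {t..T}" for s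
  proof (cases "\<exists>i. 0 < y s $ i")
    case True
    then obtain i where i: "0 < y s $ i" by blast
    have "\<not> 0 < y s $ j" if "j \<noteq> i" for j
      using junction_pos_unique[OF controlledD(2)[OF y s] i, of j] that by auto
    then have "v s = a s *\<^sub>R axis i 1" using i s by (auto simp: v_def c_def vec_eq_iff axis_def)
    then show ?thesis by (simp add: norm_axis_1)
  next
    case False
    then have "v s = 0" by (auto simp: v_def c_def vec_eq_iff)
    then show ?thesis by simp
  qed
  have Lv: "Lp_function_on p t T v"
  proof -
    have "set_integrable lborel {t..T} (\<lambda>s. norm (v s) powr p)"
    proof (rule set_borel_measurable_abs_integrable(2)[OF _ controlledD(4)[OF y]])
      show "set_borel_measurable lborel {t..T} (\<lambda>s. norm (v s) powr p)" by (simp add: set_borel_measurable_def)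
      show "\<bar>norm (v s) powr p\<bar> \<le> \<bar>a s\<bar> powr p" if "s \<in> {t..T}" for s
        using vb[OF that] p by (simp add: powr_mono2)
    qed
    then have "set_integrable lborel {t<..<T} (\<lambda>s. norm (v s) powr p)" by (rule set_integrable_subset) auto
    then show ?thesis by (simp add: Lp_function_on_def set_borel_measurable_def)
  qed
  have Ly: "Lp_function_on p t T ?y"
  proof -
    have c: "continuous_on {t..T} (\<lambda>s. norm (y s) powr p)"
      using p by (intro continuous_on_powr' continuous_intros yc) auto
    have "set_integrable lborel {t..T} (\<lambda>s. norm (y s) powr p)" by (rule borel_integrable_atLeastAtMost'[OF c])
    then have "set_integrable lborel {t<..<T} (\<lambda>s. norm (y s) powr p)" by (rule set_integrable_subset) auto
    also have "set_integrable lborel {t<..<T} (\<lambda>s. norm (y s) powr p) \<longleftrightarrow> set_integrable lborel {t<..<T} (\<lambda>s. norm (?y s) powr p)"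
      by (rule set_integrable_cong) auto
    finally have 1: "set_integrable lborel {t<..<T} (\<lambda>s. norm (?y s) powr p)" .
    have "(\<lambda>s. indicator {t<..<T} s *\<^sub>R (indicator {t..T} s *\<^sub>R y s)) \<in> borel_measurable borel" by measurable
    also have "(\<lambda>s. indicator {t<..<T} s *\<^sub>R (indicator {t..T} s *\<^sub>R y s)) = (\<lambda>s. indicator {t<..<T} s *\<^sub>R ?y s)"
      by (auto simp: indicator_def)
    finally show ?thesis using 1 by (simp add: Lp_function_on_def set_borel_measurable_def)
  qed
  have "has_weak_derivative t T ?y v"
  proof (cases "t = T")
    case True
    \<comment> \<open>The open interval is empty and both integrals are zero.\<close>
    then show ?thesis by (auto simp: has_weak_derivative_def locally_integrable_on_def set_integrable_def set_lebesgue_integral_def)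
  next
    case False
    then have tT': "t < T" using tT by simp
    have "has_weak_derivative t T (\<lambda>s. y s $ i) (\<lambda>s. if 0 < y s $ i then a s else 0)" for i
    proof (rule has_weak_derivative_indefinite_integral[OF tT' controlled_positive_part(2)[OF y p]])
      show "y s $ i = y t $ i + integral {t..s} (\<lambda>s. if 0 < y s $ i then a s else 0)" if "s \<in> {t..T}" for s
        using integral_unique[OF controlledD(6)[OF y that, of i]] by simp
    qed
    also have "has_weak_derivative t T (\<lambda>s. y s $ i) (\<lambda>s. if 0 < y s $ i then a s else 0) \<longleftrightarrow>
        has_weak_derivative t T (\<lambda>s. ?y s $ i) (\<lambda>s. v s $ i)" for i
      by (rule has_weak_derivative_cong) (auto simp: v_def c_def)
    finally show ?thesis by (rule has_weak_derivative_componentI[OF _ tT'])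
  qed
  moreover have "continuous_on {t..T} ?y"
    by (rule continuous_on_eq[OF yc]) auto
  ultimately show ?thesis
    using Ly Lv tT controlledD(2)[OF y] by (auto simp: trajectories_def sobolev_1p_on_def)
qed

text \<open>On the junction the norm is the sum of the coordinates, and the restricted velocities
  sum to \<open>a\<close>, also at the vertex because \<open>a\<close> vanishes there.\<close>

lemma controlled_norm_weak_derivative:
  fixes y :: "real \<Rightarrow> real ^ 'n::finite"
  assumes y: "controlled p t t' y a" and p: "1 < p" and tt: "t < t'" and eq: "\<And>s. s \<in> {t..t'} \<Longrightarrow> y' s = y s"
  shows "has_weak_derivative t t' (\<lambda>s. norm (y' s)) a"
proof (rule has_weak_derivative_indefinite_integral[OF tt controlled_integrable(2)[OF y p]])
  fix s assume s: "s \<in> {t..t'}"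
  have yj: "y r \<in> junction" if "r \<in> {t..t'}" for r using controlledD(2)[OF y that] .
  have "((\<lambda>\<sigma>. \<Sum>i\<in>UNIV. if 0 < y \<sigma> $ i then a \<sigma> else 0) has_integral (\<Sum>i\<in>UNIV. y s $ i - y t $ i)) {t..s}"
    by (rule has_integral_sum) (use controlledD(6)[OF y s] in auto)
  then have "(a has_integral (\<Sum>i\<in>UNIV. y s $ i - y t $ i)) {t..s}"
  proof (rule has_integral_eq[rotated])
    fix r assume r: "r \<in> {t..s}"
    then have rt: "r \<in> {t..t'}" using s by auto
    show "(\<Sum>i\<in>UNIV. if 0 < y r $ i then a r else 0) = a r"
    proof (cases "y r = 0")
      case True
      then show ?thesis using controlledD(5)[OF y rt] by simp
    next
      case False
      then obtain i where i: "0 < y r $ i" using junction_pos_component[OF yj[OF rt]] by blast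
      have "\<not> 0 < y r $ j" if "j \<noteq> i" for j using junction_pos_unique[OF yj[OF rt] i, of j] that by auto
      then show ?thesis using i by (subst sum.remove[of _ i]) auto
    qed
  qed
  then have "integral {t..s} a = norm (y s) - norm (y t)"
    using norm_junction[OF yj[OF s]] norm_junction[OF yj[of t]] tt by (simp add: integral_unique sum_subtractf)
  then show "norm (y' s) = norm (y' t) + integral {t..s} a" using eq[OF s] eq[of t] tt by simp
qed

context control
begin

text \<open>\<open>weak_derivative\<close> picks an unspecified representative. It agrees with
  \<open>a\<close> almost everywhere, but equality of the integrals also needs the integrand built
  from it to be measurable.\<close>

lemma integrated_cost_eq_cost:
  assumes y: "controlled p t t' y a" and eq: "\<And>s. s \<in> {t..t'} \<Longrightarrow> y' s = y s"
    and rc: "\<And>s x b. s \<in> {t..t'} \<Longrightarrow> running_cost \<Lambda> \<Lambda>s (m s) x b = running s x b"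
  shows "integrated_cost \<Lambda> \<Lambda>s m t t' y' = cost t t' y a"
proof -
  define W where "W = weak_derivative t t' (\<lambda>s. norm (y' s))"
  let ?F = "\<lambda>s. indicator {t..t'} s *\<^sub>R running_cost \<Lambda> \<Lambda>s (m s) (y' s) (W s)"
  have ic: "integrated_cost \<Lambda> \<Lambda>s m t t' y' = integral\<^sup>L lborel ?F"
    by (simp add: integrated_cost_def set_lebesgue_integral_def W_def)
  have tt: "t \<le> t'" using controlledD(1)[OF y] .
  show ?thesis
  proof (cases "t = t'")
    case True
    have "AE s in lborel. s \<noteq> t" by (rule AE_lborel_singleton)
    then have "AE s in lborel. ?F s = 0" by eventually_elim (auto simp: True)
    then have "integral\<^sup>L lborel ?F = 0" by (rule integral_eq_zero_AE)
    then show ?thesis using ic True by simp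
  next
    case False
    then have tt: "t < t'" using tt by simp
    have wa: "has_weak_derivative t t' (\<lambda>s. norm (y' s)) a"
      by (rule controlled_norm_weak_derivative[OF y p tt]) (rule eq)
    have wW: "has_weak_derivative t t' (\<lambda>s. norm (y' s)) W"
      unfolding W_def weak_derivative_def by (rule someI[where P = "has_weak_derivative t t' (\<lambda>s. norm (y' s))"]) (rule wa)
    have AE: "AE s in lborel. s \<in> {t<..<t'} \<longrightarrow> W s = a s"
      by (rule weak_derivative_unique_AE[OF wW wa])
    define W0 where "W0 s = indicator {t<..<t'} s *\<^sub>R W s" for s
    define y0 where "y0 s = indicator {t..t'} s *\<^sub>R y s" for s
    have [measurable]: "W0 \<in> borel_measurable borel"
      unfolding W0_def[abs_def] by (rule locally_integrable_borel) (use wW in \<open>simp add: has_weak_derivative_def\<close>)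
    have [measurable]: "y0 \<in> borel_measurable borel"
      unfolding y0_def[abs_def]
      by (rule borel_measurable_continuous_on_indicator) (auto intro: controlled_continuous[OF y])
    have [measurable]: "(\<lambda>s. running s (y0 s) (W0 s)) \<in> borel_measurable borel"
      by (rule running_borel) measurable
    \<comment> \<open>Nothing is known about the representative outside the open interval, so the
      two endpoint values are split off as constants.\<close>
    have "(\<lambda>s. indicator {t<..<t'} s *\<^sub>R running s (y0 s) (W0 s) + indicator {t} s *\<^sub>R ?F t + indicator {t'} s *\<^sub>R ?F t') \<in> borel_measurable lborel"
      by measurable
    also have "(\<lambda>s. indicator {t<..<t'} s *\<^sub>R running s (y0 s) (W0 s) + indicator {t} s *\<^sub>R ?F t + indicator {t'} s *\<^sub>R ?F t') = ?F"
      using tt eq rc by (intro ext) (auto simp: indicator_def y0_def W0_def)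
    finally have Fm: "?F \<in> borel_measurable lborel" .
    have rs: "set_integrable lborel {t..t'} (\<lambda>s. running s (y s) (a s))" by (rule running_set_integrable[OF y])
    have "integral\<^sup>L lborel ?F = integral\<^sup>L lborel (\<lambda>s. indicator {t..t'} s *\<^sub>R running s (y s) (a s))"
    proof (rule integral_cong_AE[OF Fm])
      show "(\<lambda>s. indicator {t..t'} s *\<^sub>R running s (y s) (a s)) \<in> borel_measurable lborel"
        using rs by (simp add: set_integrable_def borel_measurable_integrable)
      have "AE s in lborel. s \<noteq> t" "AE s in lborel. s \<noteq> t'" by (rule AE_lborel_singleton)+
      with AE show "AE s in lborel. ?F s = indicator {t..t'} s *\<^sub>R running s (y s) (a s)"
        by eventually_elim (use eq rc in \<open>auto simp: indicator_def\<close>)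
    qed
    also have "\<dots> = cost t t' y a"
      using set_borel_integral_eq_integral(2)[OF rs] by (simp add: set_lebesgue_integral_def cost_def)
    finally show ?thesis using ic by simp
  qed
qed

end

section \<open>Continuity of the flow of measures\<close>

lemma space_borel_of [simp]: "space (borel_of X) = topspace X"
  unfolding borel_of_def by (rule space_measure_of) (auto dest: openin_subset)

lemma borel_of_openin: "openin X U \<Longrightarrow> U \<in> sets (borel_of X)"
  unfolding borel_of_def by (subst sets_measure_of) (auto dest: openin_subset)

lemma measurable_borel_of_top_of_set:
  assumes "f \<in> borel_measurable borel"
  shows "f \<in> borel_measurable (borel_of (top_of_set S))"
proof -
  have "(\<lambda>x. x) \<in> borel_of (top_of_set S) \<rightarrow>\<^sub>M borel"
  proof (rule borel_measurableI)
    fix U :: "'a set" assume "open U"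
    then have "openin (top_of_set S) (S \<inter> U)" by (rule openin_open_Int)
    then show "(\<lambda>x. x) -` U \<inter> space (borel_of (top_of_set S)) \<in> sets (borel_of (top_of_set S))"
      by (simp add: borel_of_openin Int_commute)
  qed
  from measurable_compose[OF this assms] show ?thesis .
qed

lemma fdist_evaluation:
  fixes f h :: "real \<Rightarrow> 'a::metric_space"
  assumes "f \<in> mspace (funspace S euclidean_metric)" "h \<in> mspace (funspace S euclidean_metric)" "s \<in> S"
  shows "dist (f s) (h s) \<le> mdist (funspace S euclidean_metric) f h"
proof -
  have fh: "f \<in> Metric_space.fspace UNIV dist S" "h \<in> Metric_space.fspace UNIV dist S" using assms by auto
  have "mdist (funspace S euclidean_metric) f h = (SUP x\<in>S. dist (f x) (h x))"
    using fh assms(3) by (auto simp: Metric_space.fdist_def[OF Met_TC.Metric_space_axioms])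
  moreover have "bdd_above ((\<lambda>x. dist (f x) (h x)) ` S)"
    by (rule Metric_space.bdd_above_dist[OF Met_TC.Metric_space_axioms fh])
      (use assms(3) in auto)
  ultimately show ?thesis using cSUP_upper[OF assms(3), of "\<lambda>x. dist (f x) (h x)"] by simp
qed

lemma topspace_trajectory_topology:
  "topspace (trajectory_topology p T C) \<subseteq> bounded_trajectories p T C"
  by (simp add: trajectory_topology_def)

text \<open>A violation of the almost everywhere bound at one time would, by continuity, persist on
  an interval of positive length.\<close>

lemma bounded_trajectory:
  fixes y :: "real \<Rightarrow> real ^ 'n::finite"
  assumes "y \<in> bounded_trajectories p T C" "0 < T" "s \<in> {0..T}"
  shows "y s \<in> junction" "norm (y s) \<le> C" "continuous_on {0..T} y"
proof -
  have j: "\<And>s. s \<in> {0..T} \<Longrightarrow> y s \<in> junction" and c: "continuous_on {0..T} y"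
    and AE: "AE s in lborel. s \<in> {0<..<T} \<longrightarrow> norm (y s) \<le> C"
    using assms(1) by (auto simp: bounded_trajectories_def bounded_trajectories_from_def trajectories_def)
  show "y s \<in> junction" "continuous_on {0..T} y" using j c assms(3) by auto
  show "norm (y s) \<le> C"
  proof (rule ccontr)
    assume "\<not> norm (y s) \<le> C"
    then have e: "0 < norm (y s) - C" by simp
    obtain d where d: "0 < d" "\<And>r. r \<in> {0..T} \<Longrightarrow> \<bar>r - s\<bar> < d \<Longrightarrow> norm (y r - y s) < norm (y s) - C"
      using c[unfolded continuous_on_iff, rule_format, OF assms(3) e] by (auto simp: dist_norm)
    define l where "l = max 0 (s - d)"
    define u where "u = min T (s + d)"
    have lu: "l < u" using d(1) assms by (auto simp: l_def u_def)
    have "C < norm (y r)" if r: "r \<in> {l<..<u}" for r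
    proof -
      have "norm (y r - y s) < norm (y s) - C" by (rule d(2)) (use r assms in \<open>auto simp: l_def u_def abs_less_iff\<close>)
      then show ?thesis using norm_triangle_ineq2[of "y s" "y r"] by (simp add: norm_minus_commute)
    qed
    then have "s \<in> {0<..<T} \<Longrightarrow> norm (y s) \<le> C \<Longrightarrow> s \<notin> {l<..<u}" for s by fastforce
    moreover have "{l<..<u} \<subseteq> {0<..<T}" by (auto simp: l_def u_def)
    ultimately have "AE r in lborel. r \<notin> {l<..<u}"
      by (intro eventually_mono[OF AE]) blast
    then have "{l<..<u} \<in> null_sets lborel" by (subst AE_iff_null_sets) auto
    then show False using lu by (simp add: null_sets_def)
  qed
qed

text \<open>Evaluation does not increase the uniform distance, so it pulls relatively open sets back
  to open sets.\<close>

lemma evaluation_measurable: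
  assumes T: "0 < T" and s: "s \<in> {0..T}"
  shows "(\<lambda>y. y s) \<in> borel_of (trajectory_topology p T C) \<rightarrow>\<^sub>M borel_of (top_of_set (junction :: (real ^ 'n::finite) set))"
proof -
  let ?F = "funspace {0..T} (euclidean_metric :: (real ^ 'n) metric)"
  let ?X = "trajectory_topology p T C :: (real \<Rightarrow> real ^ 'n) topology"
  have "(\<lambda>y. y s) \<in> borel_of ?X \<rightarrow>\<^sub>M sigma (topspace (top_of_set junction)) {U. openin (top_of_set junction) U}"
  proof (rule measurable_measure_of)
    show "{U. openin (top_of_set junction) U} \<subseteq> Pow (topspace (top_of_set (junction :: (real ^ 'n) set)))"
      by (auto dest: openin_imp_subset)
    show "(\<lambda>y. y s) \<in> space (borel_of ?X) \<rightarrow> topspace (top_of_set junction)"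
    proof
      fix y assume "y \<in> space (borel_of ?X)"
      then have "y \<in> bounded_trajectories p T C" using topspace_trajectory_topology by auto
      then show "y s \<in> topspace (top_of_set junction)" using bounded_trajectory(1)[OF _ T s] by simp
    qed
    fix U :: "(real ^ 'n) set" assume "U \<in> {U. openin (top_of_set junction) U}"
    then obtain V where V: "open V" "U = junction \<inter> V" by (auto simp: openin_open)
    define W where "W = {f \<in> mspace ?F. f s \<in> V}"
    have "openin (mtopology_of ?F) W"
      unfolding mtopology_of_def Metric_space.openin_mtopology[OF Metric_space_mspace_mdist]
    proof (intro conjI allI impI)
      show "W \<subseteq> mspace ?F" by (auto simp: W_def)
      fix f assume f: "f \<in> W"
      then obtain r where r: "r > 0" "ball (f s) r \<subseteq> V" using V(1) by (auto simp: W_def open_contains_ball)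
      have "Metric_space.mball (mspace ?F) (mdist ?F) f r \<subseteq> W"
      proof
        fix h assume "h \<in> Metric_space.mball (mspace ?F) (mdist ?F) f r"
        then have h: "h \<in> mspace ?F" "mdist ?F f h < r"
          by (simp_all only: Metric_space.in_mball[OF Metric_space_mspace_mdist])
        have fm: "f \<in> mspace ?F" using f by (simp add: W_def)
        have "dist (f s) (h s) < r" using fdist_evaluation[OF fm h(1) s] h(2) by linarith
        then show "h \<in> W" using r(2) h(1) by (auto simp: W_def simp del: mspace_funspace)
      qed
      then show "\<exists>r>0. Metric_space.mball (mspace ?F) (mdist ?F) f r \<subseteq> W" using r(1) by blast
    qed
    then have "openin ?X (W \<inter> bounded_trajectories p T C)"
      unfolding trajectory_topology_def by (rule openin_subtopology_Int)
    also have "W \<inter> bounded_trajectories p T C = (\<lambda>y. y s) -` U \<inter> space (borel_of ?X)"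
    proof -
      have "topspace ?X = mspace ?F \<inter> bounded_trajectories p T C"
        unfolding trajectory_topology_def topspace_subtopology topspace_mtopology_of ..
      then show ?thesis using V(2) bounded_trajectory(1)[OF _ T s] by (auto simp: W_def simp del: mspace_funspace)
    qed
    finally show "(\<lambda>y. y s) -` U \<inter> space (borel_of ?X) \<in> sets (borel_of ?X)" by (rule borel_of_openin)
  qed
  then show ?thesis by (simp only: borel_of_def[of "top_of_set junction"])
qed

lemma l1_dist_borel: "(\<lambda>z. l1_dist (fst z) (snd z)) \<in> borel_measurable (borel :: ((real ^ 'n::finite) \<times> (real ^ 'n)) measure)"
  by (intro borel_measurable_continuous_onI continuous_intros)

locale trajectory_measure =
  fixes p T C :: real and \<mu> :: "(real \<Rightarrow> real ^ 'n::finite) measure"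
  assumes T: "0 < T" and \<mu>: "\<mu> \<in> prob_measures (trajectory_topology p T C)"
begin

sublocale prob_space \<mu> using \<mu> by (simp add: prob_measures_def)

lemma sets_\<mu>: "sets \<mu> = sets (borel_of (trajectory_topology p T C))"
  using \<mu> by (simp add: prob_measures_def)

lemma space_\<mu>: "space \<mu> \<subseteq> bounded_trajectories p T C"
  using sets_eq_imp_space_eq[OF sets_\<mu>] topspace_trajectory_topology[of p T C] unfolding space_borel_of by blast

lemmas path_bounds = bounded_trajectory[OF subsetD[OF space_\<mu>] T]

lemma evaluation [measurable]:
  "s \<in> {0..T} \<Longrightarrow> (\<lambda>y. y s) \<in> \<mu> \<rightarrow>\<^sub>M borel_of (top_of_set junction)"
  using evaluation_measurable[OF T, of s p C] measurable_cong_sets[OF sets_\<mu> refl] by blast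

lemma sets_flow [simp]: "sets (flow \<mu> s) = sets (borel_of (top_of_set junction))"
  by (simp add: flow_def)

lemma space_flow [simp]: "space (flow \<mu> s) = junction"
  by (simp add: flow_def)

lemma evaluation_borel [measurable]: "s \<in> {0..T} \<Longrightarrow> (\<lambda>y. y s) \<in> borel_measurable \<mu>"
  using measurable_compose[OF evaluation measurable_borel_of_top_of_set[OF measurable_ident]] by simp

lemma l1_dist_integrable:
  assumes "s \<in> {0..T}" "s' \<in> {0..T}"
  shows "integrable \<mu> (\<lambda>y. l1_dist (y s) (y s'))"
    "y \<in> space \<mu> \<Longrightarrow> l1_dist (y s) (y s') \<le> 2 * C"
proof -
  have m: "(\<lambda>y. l1_dist (y s) (y s')) \<in> borel_measurable \<mu>"
  proof -
    have "(\<lambda>y. (y s, y s')) \<in> borel_measurable \<mu>"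
      using assms by (intro borel_measurable_Pair evaluation_borel)
    from measurable_compose[OF this l1_dist_borel] show ?thesis by simp
  qed
  have b: "l1_dist (y s) (y s') \<le> 2 * C" if y: "y \<in> space \<mu>" for y
  proof -
    have "l1_dist (y s) (y s') \<le> l1_dist (y s) 0 + l1_dist 0 (y s')" by (rule l1_dist_triangle)
    also have "\<dots> = norm (y s) + norm (y s')" using path_bounds(1)[OF y] assms by (simp add: l1_dist_zero)
    also have "\<dots> \<le> 2 * C" using path_bounds(2)[OF y assms(1)] path_bounds(2)[OF y assms(2)] by simp
    finally show ?thesis .
  qed
  then show "y \<in> space \<mu> \<Longrightarrow> l1_dist (y s) (y s') \<le> 2 * C" .
  show "integrable \<mu> (\<lambda>y. l1_dist (y s) (y s'))"
    by (rule integrable_const_bound[of _ "2 * C"]) (use b m in auto)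
qed

lemma flow_prob_measures_1:
  assumes s: "s \<in> {0..T}"
  shows "flow \<mu> s \<in> prob_measures_1"
proof -
  have "prob_space (flow \<mu> s)" unfolding flow_def by (rule prob_space_distr[OF evaluation[OF s]])
  moreover have "integrable (flow \<mu> s) (\<lambda>x. junction_dist 0 x)"
  proof -
    have nm: "(norm :: real ^ 'n \<Rightarrow> real) \<in> borel_measurable (borel_of (top_of_set junction))"
      by (rule measurable_borel_of_top_of_set) simp
    have "integrable \<mu> (\<lambda>y. norm (y s))"
      by (rule integrable_const_bound[of _ C]) (use path_bounds(2) s in auto)
    then have "integrable (flow \<mu> s) norm"
      unfolding flow_def using integrable_distr_eq[OF evaluation[OF s] nm] by simp
    also have "integrable (flow \<mu> s) norm \<longleftrightarrow> integrable (flow \<mu> s) (\<lambda>x. junction_dist 0 x)"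
      by (rule Bochner_Integration.integrable_cong) (simp_all add: junction_dist_eq_l1_dist l1_dist_zero)
    finally show ?thesis .
  qed
  ultimately show ?thesis by (simp add: prob_measures_1_def prob_measures_def)
qed

lemma junction_dist_nonneg: "0 \<le> junction_dist x (z :: real ^ 'n)"
  by (simp add: junction_dist_def)

text \<open>The joint law of the two positions is a coupling of their marginals. It bounds the
  infimum from above and shows that it is taken over a nonempty set.\<close>

lemma KR_dist_nonneg_le:
  assumes s: "s \<in> {0..T}" "s' \<in> {0..T}"
  shows "KR_dist (flow \<mu> s) (flow \<mu> s') \<le> (\<integral>y. l1_dist (y s) (y s') \<partial>\<mu>)"
    "0 \<le> KR_dist (flow \<mu> s) (flow \<mu> s')"
proof -
  let ?P = "flow \<mu> s \<Otimes>\<^sub>M flow \<mu> s'"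
  define \<gamma> where "\<gamma> = distr \<mu> ?P (\<lambda>y. (y s, y s'))"
  have es: "(\<lambda>y. y s) \<in> \<mu> \<rightarrow>\<^sub>M flow \<mu> s" "(\<lambda>y. y s') \<in> \<mu> \<rightarrow>\<^sub>M flow \<mu> s'"
    using evaluation[OF s(1)] evaluation[OF s(2)] by (simp_all cong: measurable_cong_sets)
  have pm: "(\<lambda>y. (y s, y s')) \<in> \<mu> \<rightarrow>\<^sub>M ?P" using es by (rule measurable_Pair)
  have "distr \<gamma> (flow \<mu> s) fst = flow \<mu> s"
  proof -
    have "distr \<gamma> (flow \<mu> s) fst = distr \<mu> (flow \<mu> s) (\<lambda>y. y s)"
      unfolding \<gamma>_def by (subst distr_distr[OF measurable_fst pm]) (simp add: comp_def)
    also have "\<dots> = flow \<mu> s" unfolding flow_def by (rule distr_cong) auto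
    finally show ?thesis .
  qed
  moreover have "distr \<gamma> (flow \<mu> s') snd = flow \<mu> s'"
  proof -
    have "distr \<gamma> (flow \<mu> s') snd = distr \<mu> (flow \<mu> s') (\<lambda>y. y s')"
      unfolding \<gamma>_def by (subst distr_distr[OF measurable_snd pm]) (simp add: comp_def)
    also have "\<dots> = flow \<mu> s'" unfolding flow_def by (rule distr_cong) auto
    finally show ?thesis .
  qed
  ultimately have \<gamma>: "\<gamma> \<in> couplings (flow \<mu> s) (flow \<mu> s')" by (simp add: couplings_def \<gamma>_def)
  have nn: "0 \<le> (\<integral>z. junction_dist (fst z) (snd z) \<partial>\<gamma>')" for \<gamma>' :: "((real ^ 'n) \<times> (real ^ 'n)) measure"
    by (rule Bochner_Integration.integral_nonneg) (rule junction_dist_nonneg)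
  then have bd: "bdd_below ((\<lambda>\<gamma>. \<integral>z. junction_dist (fst z) (snd z) \<partial>\<gamma>) ` couplings (flow \<mu> s) (flow \<mu> s'))"
    by (intro bdd_belowI2[of _ 0]) auto
  have "KR_dist (flow \<mu> s) (flow \<mu> s') \<le> (\<integral>z. junction_dist (fst z) (snd z) \<partial>\<gamma>)"
    unfolding KR_dist_def by (rule cINF_lower[OF bd \<gamma>])
  also have "\<dots> = (\<integral>z. l1_dist (fst z) (snd z) \<partial>\<gamma>)"
    by (rule Bochner_Integration.integral_cong) (auto simp: \<gamma>_def space_pair_measure junction_dist_eq_l1_dist)
  also have "\<dots> = (\<integral>y. l1_dist (fst (y s, y s')) (snd (y s, y s')) \<partial>\<mu>)"
    unfolding \<gamma>_def
  proof (rule integral_distr[OF pm])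
    have id: "(\<lambda>x. x) \<in> borel_measurable (flow \<mu> r)" for r
      using measurable_borel_of_top_of_set[OF measurable_ident_sets[OF refl], of junction] by (simp cong: measurable_cong_sets)
    have "(\<lambda>z. (fst z, snd z)) \<in> borel_measurable ?P"
      by (intro borel_measurable_Pair measurable_compose[OF measurable_fst id] measurable_compose[OF measurable_snd id])
    from measurable_compose[OF this l1_dist_borel] show "(\<lambda>z. l1_dist (fst z) (snd z)) \<in> borel_measurable ?P" by simp
  qed
  finally show "KR_dist (flow \<mu> s) (flow \<mu> s') \<le> (\<integral>y. l1_dist (y s) (y s') \<partial>\<mu>)" by simp
  show "0 \<le> KR_dist (flow \<mu> s) (flow \<mu> s')"
    unfolding KR_dist_def by (rule cINF_greatest) (use \<gamma> nn in auto)
qed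

text \<open>Bounding the Kantorovich distance by the coupling of \<open>y s\<close> and \<open>y s'\<close> under \<open>\<mu>\<close> reduces
  uniform continuity in time to dominated convergence.\<close>

lemma flow_uniformly_continuous:
  assumes e: "0 < e"
  obtains d where "0 < d" "\<And>s s'. s \<in> {0..T} \<Longrightarrow> s' \<in> {0..T} \<Longrightarrow> \<bar>s - s'\<bar> < d \<Longrightarrow> KR_dist (flow \<mu> s) (flow \<mu> s') < e"
proof -
  have "\<exists>d>0. \<forall>s\<in>{0..T}. \<forall>s'\<in>{0..T}. \<bar>s - s'\<bar> < d \<longrightarrow> (\<integral>y. l1_dist (y s) (y s') \<partial>\<mu>) < e"
  proof (rule ccontr)
    assume neg: "\<not> ?thesis"
    define bad where "bad n q \<longleftrightarrow> fst q \<in> {0..T} \<and> snd q \<in> {0..T} \<and> \<bar>fst q - snd q\<bar> < inverse (real (Suc n)) \<and>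
        e \<le> (\<integral>y. l1_dist (y (fst q)) (y (snd q)) \<partial>\<mu>)" for n q
    have "\<exists>q. bad n q" for n
    proof (rule ccontr)
      assume "\<nexists>q. bad n q"
      then have "\<not> bad n (s, s')" for s s' by blast
      moreover have "0 < inverse (real (Suc n))" by simp
      ultimately show False using neg unfolding bad_def fst_conv snd_conv not_le[symmetric] by blast
    qed
    then obtain q where q: "\<And>n. bad n (q n)" using choice[of bad] by blast
    define a where "a n = fst (q n)" for n
    define b where "b n = snd (q n)" for n
    have ab: "\<And>n. a n \<in> {0..T}" "\<And>n. b n \<in> {0..T}" "\<And>n. \<bar>a n - b n\<bar> < inverse (real (Suc n))"
      "\<And>n. e \<le> (\<integral>y. l1_dist (y (a n)) (y (b n)) \<partial>\<mu>)"
      using q unfolding bad_def a_def b_def by blast+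
    have "(\<lambda>n. \<integral>y. l1_dist (y (a n)) (y (b n)) \<partial>\<mu>) \<longlonglongrightarrow> (\<integral>y. 0 \<partial>\<mu>)"
    proof (rule integral_dominated_convergence[where w = "\<lambda>_. 2 * C"])
      show "(\<lambda>y. l1_dist (y (a n)) (y (b n))) \<in> borel_measurable \<mu>" for n
        by (rule borel_measurable_integrable[OF l1_dist_integrable(1)[OF ab(1,2)]])
      show "AE y in \<mu>. norm (l1_dist (y (a n)) (y (b n))) \<le> 2 * C" for n
        by (rule AE_I2) (use l1_dist_integrable(2)[OF ab(1,2)] in auto)
      show "AE y in \<mu>. (\<lambda>n. l1_dist (y (a n)) (y (b n))) \<longlonglongrightarrow> 0"
      proof (rule AE_I2)
        fix y assume y: "y \<in> space \<mu>"
        have "0 \<in> {0..T}" using T by simp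
        have "uniformly_continuous_on {0..T} y"
          by (rule compact_uniformly_continuous[OF path_bounds(3)[OF y \<open>0 \<in> {0..T}\<close>]]) auto
        then have 1: "(\<lambda>n. dist (y (a n)) (y (b n))) \<longlonglongrightarrow> 0"
        proof (rule uniformly_continuous_on_sequentially[THEN iffD1, rule_format])
          have "(\<lambda>n. dist (a n) (b n)) \<longlonglongrightarrow> 0"
            by (rule tendsto_sandwich[OF _ _ tendsto_const LIMSEQ_inverse_real_of_nat])
              (use ab(3) in \<open>auto simp: dist_real_def intro!: always_eventually less_imp_le\<close>)
          then show "(\<forall>n. a n \<in> {0..T}) \<and> (\<forall>n. b n \<in> {0..T}) \<and> (\<lambda>n. dist (a n) (b n)) \<longlonglongrightarrow> 0"
            using ab by blast
        qed
        have 2: "(\<lambda>n. CARD('n) * dist (y (a n)) (y (b n))) \<longlonglongrightarrow> 0"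
          using tendsto_mult_left[OF 1, of "real CARD('n)"] by simp
        show "(\<lambda>n. l1_dist (y (a n)) (y (b n))) \<longlonglongrightarrow> 0"
          by (rule tendsto_sandwich[OF _ _ tendsto_const 2])
            (auto simp: dist_norm intro!: always_eventually l1_dist_le_norm)
      qed
    qed auto
    then have "(\<lambda>n. \<integral>y. l1_dist (y (a n)) (y (b n)) \<partial>\<mu>) \<longlonglongrightarrow> 0" by simp
    then have "\<forall>\<^sub>F n in sequentially. (\<integral>y. l1_dist (y (a n)) (y (b n)) \<partial>\<mu>) < e" using e by (rule order_tendstoD)
    then obtain n where "(\<integral>y. l1_dist (y (a n)) (y (b n)) \<partial>\<mu>) < e" by (auto simp: eventually_sequentially)
    then show False using ab(4)[of n] by simp
  qed
  then obtain d where d: "0 < d" "\<And>s s'. s \<in> {0..T} \<Longrightarrow> s' \<in> {0..T} \<Longrightarrow> \<bar>s - s'\<bar> < d \<Longrightarrow> (\<integral>y. l1_dist (y s) (y s') \<partial>\<mu>) < e"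
    by blast
  show ?thesis
  proof (rule that[OF d(1)])
    show "KR_dist (flow \<mu> s) (flow \<mu> s') < e" if "s \<in> {0..T}" "s' \<in> {0..T}" "\<bar>s - s'\<bar> < d" for s s'
      by (rule order_le_less_trans[OF KR_dist_nonneg_le(1)[OF that(1,2)] d(2)[OF that]])
  qed
qed

end

lemma eventually_KR_nhds:
  "eventually P (KR_nhds m) \<longleftrightarrow> (\<exists>e>0. \<forall>m'\<in>prob_measures_1. KR_dist m m' < e \<longrightarrow> P m')"
proof -
  have "eventually P (KR_nhds m) \<longleftrightarrow> (\<exists>e\<in>{0<..}. eventually P (principal {m' \<in> prob_measures_1. KR_dist m m' < e}))"
    unfolding KR_nhds_def
  proof (rule eventually_INF_base)
    fix a b :: real assume "a \<in> {0<..}" "b \<in> {0<..}"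
    then show "\<exists>x\<in>{0<..}. principal {m' \<in> prob_measures_1. KR_dist m m' < x} \<le>
        inf (principal {m' \<in> prob_measures_1. KR_dist m m' < a}) (principal {m' \<in> prob_measures_1. KR_dist m m' < b})"
      by (intro bexI[of _ "min a b"]) auto
  qed auto
  then show ?thesis by (auto simp: eventually_principal)
qed

context trajectory_measure
begin

lemma tendsto_along_flow:
  assumes f: "\<And>m. m \<in> prob_measures_1 \<Longrightarrow> (f \<longlongrightarrow> (f m :: real)) (KR_nhds m)"
  shows "continuous_on {0..T} (\<lambda>s. f (flow \<mu> s))"
  unfolding continuous_on_iff
proof (intro ballI allI impI)
  fix s and e :: real assume s: "s \<in> {0..T}" and e: "0 < e"
  have "\<forall>\<^sub>F m' in KR_nhds (flow \<mu> s). dist (f m') (f (flow \<mu> s)) < e"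
    by (rule tendstoD[OF f[OF flow_prob_measures_1[OF s]] e])
  then obtain k where k: "0 < k" "\<And>m'. m' \<in> prob_measures_1 \<Longrightarrow> KR_dist (flow \<mu> s) m' < k \<Longrightarrow> dist (f m') (f (flow \<mu> s)) < e"
    unfolding eventually_KR_nhds by blast
  obtain d where d: "0 < d" "\<And>s s'. s \<in> {0..T} \<Longrightarrow> s' \<in> {0..T} \<Longrightarrow> \<bar>s - s'\<bar> < d \<Longrightarrow> KR_dist (flow \<mu> s) (flow \<mu> s') < k"
    using flow_uniformly_continuous[OF k(1)] by metis
  show "\<exists>d>0. \<forall>x'\<in>{0..T}. dist x' s < d \<longrightarrow> dist (f (flow \<mu> x')) (f (flow \<mu> s)) < e"
    using d k(2) flow_prob_measures_1 s by (intro exI[of _ d]) (auto simp: dist_real_def abs_minus_commute)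
qed

end

section \<open>The control problem along the flow\<close>

lemma at_within_half_line_nontrivial: "0 \<le> x \<Longrightarrow> at x within {0..} \<noteq> (bot :: real filter)"
proof -
  assume "0 \<le> x"
  then have "at_right x \<le> at x within {0..}" by (intro at_le) auto
  then show ?thesis by (metis bot.extremum_uniqueI trivial_limit_at_right_real)
qed

lemma C1_on_half_plane:
  fixes f :: "real \<Rightarrow> real \<Rightarrow> real"
  assumes "C1_on ({0..} \<times> UNIV) (\<lambda>(x, a). f x a)"
  shows "continuous_on ({0..} \<times> UNIV) (\<lambda>(x, a). f x a)"
    and "0 \<le> x \<Longrightarrow> ((\<lambda>s. f s a) has_real_derivative partial_x f x a) (at x within {0..})"
    and "0 \<le> x \<Longrightarrow> (f x has_real_derivative partial_a f x a) (at a)"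
proof -
  let ?S = "{0..} \<times> UNIV :: (real \<times> real) set"
  let ?f = "\<lambda>(x, a). f x a"
  obtain f' where f': "\<And>z. z \<in> ?S \<Longrightarrow> (?f has_derivative blinfun_apply (f' z)) (at z within ?S)"
    using assms unfolding C1_on_def by metis
  show "continuous_on ?S ?f"
    unfolding continuous_on_eq_continuous_within using f' has_derivative_continuous by blast
  assume x: "0 \<le> x"
  define D where "D = blinfun_apply (f' (x, a))"
  have D: "(?f has_derivative D) (at (x, a) within ?S)" unfolding D_def by (rule f') (use x in auto)
  have lin: "D (h, 0) = h *\<^sub>R D (1, 0)" "D (0, h) = h *\<^sub>R D (0, 1)" for h
    using blinfun.scaleR_right[of "f' (x, a)" h "(1, 0)"] blinfun.scaleR_right[of "f' (x, a)" h "(0, 1)"]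
    by (simp_all add: D_def)
  have eq: "(\<lambda>h. D (h, 0)) = (\<lambda>h. h *\<^sub>R D (1, 0))" "(\<lambda>h. D (0, h)) = (\<lambda>h. h *\<^sub>R D (0, 1))"
    by (rule ext, rule lin)+
  have "((\<lambda>s. ?f (s, a)) has_derivative (\<lambda>h. D (h, 0))) (at x within {0..})"
  proof (rule has_derivative_in_compose[where f = "\<lambda>s. (s, a)" and f' = "\<lambda>h. (h, 0)"])
    show "((\<lambda>s. (s, a)) has_derivative (\<lambda>h. (h, 0))) (at x within {0..})"
      by (intro has_derivative_Pair has_derivative_ident has_derivative_const)
    show "(?f has_derivative D) (at (x, a) within (\<lambda>s. (s, a)) ` {0..})"
      by (rule has_derivative_subset[OF D]) auto
  qed
  then have v: "((\<lambda>s. f s a) has_vector_derivative D (1, 0)) (at x within {0..})"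
    unfolding has_vector_derivative_def by (simp only: eq prod.case)
  then show "((\<lambda>s. f s a) has_real_derivative partial_x f x a) (at x within {0..})"
    using vector_derivative_within[OF at_within_half_line_nontrivial[OF x] v]
    by (simp add: partial_x_def has_real_derivative_iff_has_vector_derivative)
  have "((\<lambda>b. ?f (x, b)) has_derivative (\<lambda>h. D (0, h))) (at a within UNIV)"
  proof (rule has_derivative_in_compose[where f = "\<lambda>b. (x, b)" and f' = "\<lambda>h. (0, h)"])
    show "((\<lambda>b. (x, b)) has_derivative (\<lambda>h. (0, h))) (at a within UNIV)"
      by (intro has_derivative_Pair has_derivative_ident has_derivative_const)
    show "(?f has_derivative D) (at (x, a) within (\<lambda>b. (x, b)) ` UNIV)"
      by (rule has_derivative_subset[OF D]) (use x in auto)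
  qed
  then have "(f x has_real_derivative D (0, 1)) (at a)"
    unfolding has_real_derivative_iff_has_vector_derivative has_vector_derivative_def by (simp only: eq prod.case)
  then show "(f x has_real_derivative partial_a f x a) (at a)"
    using DERIV_imp_deriv[of "f x"] by (simp add: partial_a_def)
qed

lemma C1_on_half_line_lipschitz:
  fixes f :: "real \<Rightarrow> real"
  assumes "C1_on {0..} f"
  obtains B where "0 \<le> B" "\<And>x z. x \<in> {0..r} \<Longrightarrow> z \<in> {0..r} \<Longrightarrow> \<bar>f x - f z\<bar> \<le> B * \<bar>x - z\<bar>"
proof -
  obtain f' where f': "\<And>z. 0 \<le> z \<Longrightarrow> (f has_derivative blinfun_apply (f' z)) (at z within {0..})" "continuous_on {0..} f'"
    using assms unfolding C1_on_def by auto
  have "compact (f' ` {0..r})"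
    by (intro compact_continuous_image continuous_on_subset[OF f'(2)]) auto
  then obtain B where B: "0 < B" "\<And>z. z \<in> {0..r} \<Longrightarrow> norm (f' z) \<le> B"
    by (auto dest!: compact_imp_bounded simp: bounded_pos)
  have "norm (f x - f z) \<le> B * norm (x - z)" if "x \<in> {0..r}" "z \<in> {0..r}" for x z
  proof (rule differentiable_bound[OF _ _ _ that(1,2)])
    show "(f has_derivative blinfun_apply (f' z)) (at z within {0..r})" if "z \<in> {0..r}" for z
      by (rule has_derivative_subset[OF f'(1)]) (use that in auto)
    show "onorm (blinfun_apply (f' z)) \<le> B" if "z \<in> {0..r}" for z
      using B(2)[OF that] by (simp add: norm_blinfun.rep_eq)
  qed auto
  then show ?thesis using that[of B] B(1) by simp
qed

lemma continuous_on_Min: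
  fixes f :: "'i \<Rightarrow> 'a::topological_space \<Rightarrow> real"
  assumes "finite A" "A \<noteq> {}" "\<And>i. i \<in> A \<Longrightarrow> continuous_on S (f i)"
  shows "continuous_on S (\<lambda>s. Min ((\<lambda>i. f i s) ` A))"
  using assms
proof (induction rule: finite_ne_induct)
  case (insert i A)
  then have "continuous_on S (\<lambda>s. min (f i s) (Min ((\<lambda>i. f i s) ` A)))"
    by (intro continuous_on_min) auto
  then show ?case using insert by simp
qed simp

lemma strictly_convex_above_tangent:
  assumes "strictly_convex f" "(f has_real_derivative b) (at 0)"
  shows "f 0 + b * a \<le> f a"
proof -
  have "convex_on UNIV f"
  proof (rule convex_onI)
    fix \<theta> x z :: real assume t: "0 < \<theta>" "\<theta> < 1"
    show "f ((1 - \<theta>) *\<^sub>R x + \<theta> *\<^sub>R z) \<le> (1 - \<theta>) * f x + \<theta> * f z"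
    proof (cases "x = z")
      case True then show ?thesis by (simp add: algebra_simps)
    next
      case False
      then show ?thesis using assms(1) t unfolding strictly_convex_def by (auto intro: less_imp_le)
    qed
  qed auto
  from convex_on_imp_above_tangent[OF this, of 0 a b] show ?thesis using assms(2) by simp
qed

lemma terminal_cost_zero [simp]: "terminal_cost G Gs m 0 = min (Gs m) (Min (range (\<lambda>i. G i m 0)))"
  by (simp add: terminal_cost_def)

lemma terminal_cost_edge:
  assumes "x \<in> junction" "0 < x $ i"
  shows "terminal_cost G Gs m x = G i m (x $ i)"
proof -
  have xi: "x \<in> edge i" using assms by (rule junction_pos_edge)
  have "x \<noteq> 0" using assms(2) by auto
  have "x \<notin> edge j" if "j \<noteq> i" for j using assms(2) that by (auto simp: edge_iff)
  then have "(\<Sum>j\<in>UNIV. G j m (norm x) * indicator (edge j - {0}) x) = G i m (norm x)"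
    using xi \<open>x \<noteq> 0\<close> by (subst sum.remove[of _ i]) auto
  then show ?thesis using \<open>x \<noteq> 0\<close> norm_edge[OF xi] by (simp add: terminal_cost_def)
qed

locale mean_field_control = trajectory_measure p T C \<mu>
  for p T C :: real and \<mu> :: "(real \<Rightarrow> real ^ 'n::finite) measure" +
  fixes L :: "'n running" and Ls :: "'n vertex_cost" and G :: "'n terminal" and Gs :: "'n vertex_cost" and C0 :: real
  assumes p: "1 < p" and C0: "0 < C0"
    and L_C1: "\<And>i. continuous_into_C1 (L i)"
    and G_Cb: "\<And>i. Cb_into_Cb (G i)" and Ls_Cb: "Cb_real Ls" and Gs_Cb: "Cb_real Gs"
    and coercive: "\<And>m i x a. m \<in> prob_measures_1 \<Longrightarrow> 0 \<le> x \<Longrightarrow> C0 * (\<bar>a\<bar> powr p - 1) \<le> L i m x a"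
    and Ls_ge: "\<And>m. m \<in> prob_measures_1 \<Longrightarrow> - C0 \<le> Ls m"
    and modulus: "\<And>r. 0 < r \<Longrightarrow> \<exists>\<omega>. modulus_of_continuity \<omega> \<and>
      (\<forall>i. \<forall>m1\<in>prob_measures_1. \<forall>m2\<in>prob_measures_1. \<forall>x\<in>{0..r}. \<forall>a.
         \<bar>L i m1 x a - L i m2 x a\<bar> \<le> (1 + \<bar>a\<bar> powr p) * \<omega> (KR_dist m1 m2))"
    and growth: "\<And>r. 0 < r \<Longrightarrow> \<exists>c\<ge>0. \<forall>i. \<forall>m\<in>prob_measures_1. \<forall>x\<in>{0..r}. \<forall>a.
      \<bar>partial_x (L i m) x a\<bar> \<le> c * (\<bar>a\<bar> powr p + 1) \<and>
      \<bar>partial_a (L i m) x a\<bar> \<le> c * (\<bar>a\<bar> powr (p - 1) + 1)"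
    and convex: "\<And>i m x. m \<in> prob_measures_1 \<Longrightarrow> 0 \<le> x \<Longrightarrow> strictly_convex (L i m x)"
begin

text \<open>The time and space arguments are clamped so that the axioms of \<^locale>\<open>control\<close>, which are
  stated for all of \<open>\<real>\<close>, hold; on \<open>{0..T} \<times> {0..}\<close> nothing changes.\<close>

definition clamp :: "real \<Rightarrow> real" where
  "clamp s = max 0 (min T s)"

definition flow_L :: "'n \<Rightarrow> real \<Rightarrow> real \<Rightarrow> real \<Rightarrow> real" where
  "flow_L i s x a = L i (flow \<mu> (clamp s)) (max 0 x) a"

definition flow_L0 :: "real \<Rightarrow> real" where
  "flow_L0 s = vertex_running L Ls (flow \<mu> (clamp s))"

abbreviation final_cost :: "real ^ 'n \<Rightarrow> real" where
  "final_cost \<equiv> terminal_cost G Gs (flow \<mu> T)"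

lemma clamp [simp]: "0 \<le> clamp s" "clamp s \<le> T" "s \<in> {0..T} \<Longrightarrow> clamp s = s" "clamp (clamp s) = clamp s"
  using T by (auto simp: clamp_def)

lemma clamp_flow [simp]: "flow \<mu> (clamp s) \<in> prob_measures_1"
  by (rule flow_prob_measures_1) simp

lemma continuous_on_clamp [continuous_intros]: "continuous_on S f \<Longrightarrow> continuous_on S (\<lambda>s. clamp (f s))"
  unfolding clamp_def by (intro continuous_intros)

lemma flow_L_C1: "m \<in> prob_measures_1 \<Longrightarrow> C1_on ({0..} \<times> UNIV) (\<lambda>(x, a). L i m x a)"
  using L_C1 by (auto simp: continuous_into_C1_def)

lemma flow_L_coercive: "C0 * (\<bar>a\<bar> powr p - 1) \<le> flow_L i s x a"
  by (simp add: flow_L_def coercive)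

section \<open>Regularity of the costs along the flow\<close>

text \<open>The modulus in the measure argument is composed with the uniform continuity of the flow;
  clamping does not increase time differences.\<close>

lemma flow_L_time:
  assumes r: "0 < r" and e: "0 < e"
  shows "\<exists>d>0. \<forall>i s s' a. \<forall>x\<in>{0..r}. \<bar>s - s'\<bar> < d \<longrightarrow> \<bar>flow_L i s x a - flow_L i s' x a\<bar> \<le> e * (1 + \<bar>a\<bar> powr p)"
proof -
  obtain \<omega> where \<omega>: "modulus_of_continuity \<omega>"
    "\<And>i m1 m2 x a. m1 \<in> prob_measures_1 \<Longrightarrow> m2 \<in> prob_measures_1 \<Longrightarrow> x \<in> {0..r} \<Longrightarrow>
      \<bar>L i m1 x a - L i m2 x a\<bar> \<le> (1 + \<bar>a\<bar> powr p) * \<omega> (KR_dist m1 m2)"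
    using modulus[OF r] by blast
  have "\<forall>\<^sub>F k in at_right 0. \<omega> k < e"
    using \<omega>(1) e unfolding modulus_of_continuity_def by (blast intro: order_tendstoD)
  then obtain b where b: "0 < b" "\<And>k. 0 < k \<Longrightarrow> k < b \<Longrightarrow> \<omega> k < e"
    unfolding eventually_at_right_field by blast
  \<comment> \<open>The limit at \<open>0\<close> from the right says nothing about \<open>0\<close>
    itself, where the modulus vanishes by definition.\<close>
  have b': "\<omega> k \<le> e" if "0 \<le> k" "k < b" for k
    using b(2)[of k] that \<omega>(1) e by (cases "k = 0") (auto simp: modulus_of_continuity_def)
  obtain d where d: "0 < d" "\<And>s s'. s \<in> {0..T} \<Longrightarrow> s' \<in> {0..T} \<Longrightarrow> \<bar>s - s'\<bar> < d \<Longrightarrow> KR_dist (flow \<mu> s) (flow \<mu> s') < b"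
    using flow_uniformly_continuous[OF b(1)] by metis
  have "\<bar>flow_L i s x a - flow_L i s' x a\<bar> \<le> e * (1 + \<bar>a\<bar> powr p)" if "x \<in> {0..r}" "\<bar>s - s'\<bar> < d" for i s s' a x
  proof -
    have "\<bar>clamp s - clamp s'\<bar> < d" using that(2) by (auto simp: clamp_def)
    then have "KR_dist (flow \<mu> (clamp s)) (flow \<mu> (clamp s')) < b" by (intro d(2)) simp_all
    moreover have "0 \<le> KR_dist (flow \<mu> (clamp s)) (flow \<mu> (clamp s'))" by (rule KR_dist_nonneg_le(2)) simp_all
    ultimately have "\<omega> (KR_dist (flow \<mu> (clamp s)) (flow \<mu> (clamp s'))) \<le> e" by (intro b')
    then have "(1 + \<bar>a\<bar> powr p) * \<omega> (KR_dist (flow \<mu> (clamp s)) (flow \<mu> (clamp s'))) \<le> (1 + \<bar>a\<bar> powr p) * e"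
      by (intro mult_left_mono) auto
    then show ?thesis
      using \<omega>(2)[OF clamp_flow[of s] clamp_flow[of s'] that(1), of i a] that(1) by (simp add: flow_L_def mult.commute)
  qed
  then show ?thesis using d(1) by blast
qed

text \<open>The time increment is handled by the estimate \<open>flow_L_time\<close>, uniform for
  nearby positions and velocities, and the rest by continuity at the fixed measure.\<close>

lemma flow_L_continuous: "continuous_on UNIV (\<lambda>(s, x, a). flow_L i s x a)"
  unfolding continuous_on_iff
proof (intro ballI allI impI)
  fix q :: "real \<times> real \<times> real" and e :: real assume e: "0 < e"
  obtain s x a where q: "q = (s, x, a)" by (cases q)
  \<comment> \<open>Normalised so that the time increment contributes at most \<open>e / 2\<close>
    for velocities within \<open>1\<close> of \<open>a\<close>.\<close>
  define k where "k = 2 * (1 + (\<bar>a\<bar> + 1) powr p)"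
  have k: "0 < k" by (simp add: k_def add_pos_nonneg)
  have x1: "0 < \<bar>x\<bar> + 1" by (simp add: add_nonneg_pos)
  obtain d where d: "0 < d" "\<And>i s s' x' a. x' \<in> {0..\<bar>x\<bar> + 1} \<Longrightarrow> \<bar>s - s'\<bar> < d \<Longrightarrow>
      \<bar>flow_L i s x' a - flow_L i s' x' a\<bar> \<le> e / k * (1 + \<bar>a\<bar> powr p)"
    using flow_L_time[OF x1, of "e / k"] e k by auto
  have "continuous_on UNIV (\<lambda>z. case (max 0 (fst z), snd z) of (x, a) \<Rightarrow> L i (flow \<mu> (clamp s)) x a)"
    by (rule continuous_on_compose2[OF C1_on_half_plane(1)[OF flow_L_C1]]) (auto intro!: continuous_intros)
  then have "isCont (\<lambda>z. flow_L i s (fst z) (snd z)) (x, a)"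
    by (simp add: continuous_on_eq_continuous_at flow_L_def)
  moreover have "0 < e / 2" using e by simp
  ultimately obtain d' where d': "0 < d'" "\<And>z. dist z (x, a) < d' \<Longrightarrow>
      dist (flow_L i s (fst z) (snd z)) (flow_L i s (fst (x, a)) (snd (x, a))) < e / 2"
    unfolding continuous_at_eps_delta by blast
  show "\<exists>d>0. \<forall>q'\<in>UNIV. dist q' q < d \<longrightarrow>
      dist (case q' of (s, x, a) \<Rightarrow> flow_L i s x a) (case q of (s, x, a) \<Rightarrow> flow_L i s x a) < e"
  proof (intro exI[of _ "min d (min d' 1)"] conjI ballI impI)
    fix q' assume "dist q' q < min d (min d' 1)"
    moreover obtain s' x' a' where q': "q' = (s', x', a')" by (cases q')
    ultimately have near: "dist (s', x', a') (s, x, a) < min d (min d' 1)" using q by simp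
    have "dist s' s \<le> dist (s', x', a') (s, x, a)" "dist (x', a') (x, a) \<le> dist (s', x', a') (s, x, a)"
      using dist_fst_le[of "(s', x', a')" "(s, x, a)"] dist_snd_le[of "(s', x', a')" "(s, x, a)"] by auto
    moreover have "dist x' x \<le> dist (x', a') (x, a)" "dist a' a \<le> dist (x', a') (x, a)"
      using dist_fst_le[of "(x', a')" "(x, a)"] dist_snd_le[of "(x', a')" "(x, a)"] by auto
    ultimately have n: "\<bar>s' - s\<bar> < d" "dist (x', a') (x, a) < d'" "\<bar>x' - x\<bar> < 1" "\<bar>a' - a\<bar> < 1"
      using near by (auto simp: dist_real_def)
    have "flow_L i s' x' a' = flow_L i s' (max 0 x') a'" "flow_L i s x' a' = flow_L i s (max 0 x') a'"
      by (simp_all add: flow_L_def)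
    moreover have "\<bar>flow_L i s' (max 0 x') a' - flow_L i s (max 0 x') a'\<bar> \<le> e / k * (1 + \<bar>a'\<bar> powr p)"
      by (rule d(2)) (use n in auto)
    moreover have "e / k * (1 + \<bar>a'\<bar> powr p) \<le> e / k * (1 + (\<bar>a\<bar> + 1) powr p)"
      using e k p n by (intro mult_left_mono add_left_mono powr_mono2) auto
    moreover have "e / k * (1 + (\<bar>a\<bar> + 1) powr p) = e / 2"
      using k by (simp add: k_def field_simps)
    moreover have "\<bar>flow_L i s x' a' - flow_L i s x a\<bar> < e / 2" using d'(2)[OF n(2)] by (simp add: dist_real_def)
    ultimately show "dist (case q' of (s, x, a) \<Rightarrow> flow_L i s x a) (case q of (s, x, a) \<Rightarrow> flow_L i s x a) < e"
      unfolding q q' prod.case dist_real_def by linarith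
  qed (use d(1) d'(1) in auto)
qed

lemma flow_L0_continuous: "continuous_on UNIV flow_L0"
proof -
  have "continuous_on {0..T} (\<lambda>s. Ls (flow \<mu> s))"
    by (rule tendsto_along_flow) (use Ls_Cb in \<open>simp add: Cb_real_def\<close>)
  then have "continuous_on UNIV (\<lambda>s. Ls (flow \<mu> (clamp s)))"
    by (rule continuous_on_compose2[where f = clamp]) (use continuous_on_clamp[OF continuous_on_id] in auto)
  moreover have "continuous_on UNIV (\<lambda>s. L i (flow \<mu> (clamp s)) 0 0)" for i
  proof -
    have "continuous_on UNIV (\<lambda>s. case (s, 0, 0) of (s, x, a) \<Rightarrow> flow_L i s x a)"
      by (rule continuous_on_compose2[OF flow_L_continuous]) (auto intro!: continuous_intros)
    then show ?thesis by (simp add: flow_L_def)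
  qed
  ultimately show ?thesis
    unfolding flow_L0_def[abs_def] vertex_running_def by (intro continuous_on_min continuous_on_Min) auto
qed

lemma flow_L_bounded: "\<exists>K. \<forall>i s. \<forall>x\<in>{0..r}. \<bar>flow_L i s x 0\<bar> \<le> K"
proof -
  have "\<exists>K. \<forall>z\<in>{0..T} \<times> {0..r}. \<bar>flow_L i (fst z) (snd z) 0\<bar> \<le> K" for i
  proof -
    have "continuous_on ({0..T} \<times> {0..r}) (\<lambda>z. case (fst z, snd z, 0) of (s, x, a) \<Rightarrow> flow_L i s x a)"
      by (rule continuous_on_compose2[OF flow_L_continuous]) (auto intro!: continuous_intros)
    then have "compact ((\<lambda>z. flow_L i (fst z) (snd z) 0) ` ({0..T} \<times> {0..r}))"
      by (intro compact_continuous_image compact_Times) auto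
    then show ?thesis by (auto dest!: compact_imp_bounded simp: bounded_iff)
  qed
  then obtain K where K: "\<And>i z. z \<in> {0..T} \<times> {0..r} \<Longrightarrow> \<bar>flow_L i (fst z) (snd z) 0\<bar> \<le> K i" by metis
  have "\<bar>flow_L i s x 0\<bar> \<le> (\<Sum>j\<in>UNIV. \<bar>K j\<bar>)" if "x \<in> {0..r}" for i s x
  proof -
    have "flow_L i s x 0 = flow_L i (clamp s) x 0" by (simp add: flow_L_def)
    also have "\<bar>\<dots>\<bar> \<le> K i" using K[of "(clamp s, x)" i] that by simp
    also have "\<dots> \<le> \<bar>K i\<bar>" by simp
    also have "\<dots> \<le> (\<Sum>j\<in>UNIV. \<bar>K j\<bar>)" by (rule member_le_sum) auto
    finally show ?thesis .
  qed
  then show ?thesis by blast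
qed

lemma flow_L0_bounded: "\<exists>K. \<forall>s. \<bar>flow_L0 s\<bar> \<le> K"
proof -
  have "compact (flow_L0 ` {0..T})"
    by (intro compact_continuous_image continuous_on_subset[OF flow_L0_continuous]) auto
  then obtain K where K: "\<forall>s\<in>{0..T}. \<bar>flow_L0 s\<bar> \<le> K"
    by (auto dest!: compact_imp_bounded simp: bounded_iff)
  have "\<bar>flow_L0 s\<bar> \<le> K" for s using K[rule_format, of "clamp s"] by (simp add: flow_L0_def)
  then show ?thesis by blast
qed

lemma flow_L_lipschitz:
  assumes r: "0 < r"
  shows "\<exists>c\<ge>0. \<forall>i s a. \<forall>x\<in>{0..r}. \<forall>x'\<in>{0..r}. \<bar>flow_L i s x a - flow_L i s x' a\<bar> \<le> c * (\<bar>a\<bar> powr p + 1) * \<bar>x - x'\<bar>"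
    and "\<exists>c\<ge>0. \<forall>i s a a'. \<forall>x\<in>{0..r}. \<bar>flow_L i s x a - flow_L i s x a'\<bar> \<le> c * ((max \<bar>a\<bar> \<bar>a'\<bar>) powr (p - 1) + 1) * \<bar>a - a'\<bar>"
proof -
  obtain c where c: "0 \<le> c" "\<And>i m x a. m \<in> prob_measures_1 \<Longrightarrow> x \<in> {0..r} \<Longrightarrow> \<bar>partial_x (L i m) x a\<bar> \<le> c * (\<bar>a\<bar> powr p + 1)"
    "\<And>i m x a. m \<in> prob_measures_1 \<Longrightarrow> x \<in> {0..r} \<Longrightarrow> \<bar>partial_a (L i m) x a\<bar> \<le> c * (\<bar>a\<bar> powr (p - 1) + 1)"
    using growth[OF r] by blast
  have "\<bar>flow_L i s x a - flow_L i s x' a\<bar> \<le> c * (\<bar>a\<bar> powr p + 1) * \<bar>x - x'\<bar>"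
    if x: "x \<in> {0..r}" "x' \<in> {0..r}" for i s a x x'
  proof -
    let ?m = "flow \<mu> (clamp s)"
    have "norm (L i ?m x a - L i ?m x' a) \<le> c * (\<bar>a\<bar> powr p + 1) * norm (x - x')"
    proof (rule field_differentiable_bound[OF _ _ _ x])
      show "((\<lambda>x. L i ?m x a) has_real_derivative partial_x (L i ?m) z a) (at z within {0..r})" if "z \<in> {0..r}" for z
        by (rule DERIV_subset[OF C1_on_half_plane(2)[OF flow_L_C1]]) (use that in auto)
      show "norm (partial_x (L i ?m) z a) \<le> c * (\<bar>a\<bar> powr p + 1)" if "z \<in> {0..r}" for z
        using c(2)[OF clamp_flow that] by simp
    qed auto
    then show ?thesis using x by (simp add: flow_L_def)
  qed
  then show "\<exists>c\<ge>0. \<forall>i s a. \<forall>x\<in>{0..r}. \<forall>x'\<in>{0..r}. \<bar>flow_L i s x a - flow_L i s x' a\<bar> \<le> c * (\<bar>a\<bar> powr p + 1) * \<bar>x - x'\<bar>"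
    using c(1) by blast
  have "\<bar>flow_L i s x a - flow_L i s x a'\<bar> \<le> c * ((max \<bar>a\<bar> \<bar>a'\<bar>) powr (p - 1) + 1) * \<bar>a - a'\<bar>"
    if x: "x \<in> {0..r}" for i s a a' x
  proof -
    let ?m = "flow \<mu> (clamp s)" and ?M = "max \<bar>a\<bar> \<bar>a'\<bar>"
    have "norm (L i ?m x a - L i ?m x a') \<le> c * (?M powr (p - 1) + 1) * norm (a - a')"
    proof (rule field_differentiable_bound[where S = "{- ?M..?M}"])
      show "(L i ?m x has_real_derivative partial_a (L i ?m) x b) (at b within {- ?M..?M})" for b
        by (rule has_field_derivative_at_within[OF C1_on_half_plane(3)[OF flow_L_C1]]) (use x in auto)
      show "norm (partial_a (L i ?m) x b) \<le> c * (?M powr (p - 1) + 1)" if "b \<in> {- ?M..?M}" for b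
      proof -
        have "\<bar>b\<bar> \<le> ?M" using that by (auto simp: abs_le_iff)
        have "norm (partial_a (L i ?m) x b) \<le> c * (\<bar>b\<bar> powr (p - 1) + 1)" using c(3)[OF clamp_flow x] by simp
        also have "\<dots> \<le> c * (?M powr (p - 1) + 1)"
          using \<open>\<bar>b\<bar> \<le> ?M\<close> c(1) p by (intro mult_left_mono add_right_mono powr_mono2) auto
        finally show ?thesis .
      qed
    qed auto
    then show ?thesis using x by (simp add: flow_L_def)
  qed
  then show "\<exists>c\<ge>0. \<forall>i s a a'. \<forall>x\<in>{0..r}. \<bar>flow_L i s x a - flow_L i s x a'\<bar> \<le> c * ((max \<bar>a\<bar> \<bar>a'\<bar>) powr (p - 1) + 1) * \<bar>a - a'\<bar>"
    using c(1) by blast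
qed

section \<open>The terminal cost\<close>

lemma T_flow [simp]: "flow \<mu> T \<in> prob_measures_1"
  by (rule flow_prob_measures_1) (use T in auto)

lemma final_cost_bounded: "\<exists>B. \<forall>x\<in>junction. \<bar>final_cost x\<bar> \<le> B"
proof -
  have "\<exists>K. \<forall>x\<ge>0. \<bar>G i (flow \<mu> T) x\<bar> \<le> K" for i
    using G_Cb[of i] T_flow unfolding Cb_into_Cb_def by blast
  then obtain K where K: "\<And>i x. 0 \<le> x \<Longrightarrow> \<bar>G i (flow \<mu> T) x\<bar> \<le> K i" by metis
  have Ki: "K i \<le> (\<Sum>j\<in>UNIV. \<bar>K j\<bar>)" for i
    using member_le_sum[of i UNIV "\<lambda>j. \<bar>K j\<bar>"] by simp
  have "\<bar>final_cost x\<bar> \<le> \<bar>final_cost 0\<bar> + (\<Sum>j\<in>UNIV. \<bar>K j\<bar>)" if x: "x \<in> junction" for x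
  proof (cases "x = 0")
    case True then show ?thesis by (simp add: sum_nonneg)
  next
    case False
    then obtain i where i: "0 < x $ i" using junction_pos_component x by blast
    then have "\<bar>final_cost x\<bar> \<le> K i" using K[of "x $ i" i] terminal_cost_edge[OF x i] by simp
    then show ?thesis using Ki[of i] by simp
  qed
  then show ?thesis by blast
qed

lemma final_cost_zero_le: "final_cost 0 \<le> G i (flow \<mu> T) 0"
  by (simp add: min.coboundedI2)

text \<open>The value at the vertex is at most every limit along the edges, so the cost can only
  jump upwards when the vertex is left; away from the vertex it is continuous.\<close>

lemma final_cost_lsc:
  assumes x: "x \<in> junction" and e: "0 < e"
  shows "\<exists>d>0. \<forall>z\<in>junction. l1_dist x z < d \<longrightarrow> final_cost x - e \<le> final_cost z"
proof -
  have Gc: "continuous_on {0..} (G i (flow \<mu> T))" for i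
    using G_Cb[of i] T_flow unfolding Cb_into_Cb_def by blast
  have near: "\<exists>d>0. \<forall>r\<ge>0. \<bar>r - s\<bar> < d \<longrightarrow> G i (flow \<mu> T) s - e \<le> G i (flow \<mu> T) r" if s: "0 \<le> s" for i s
  proof -
    obtain d where "0 < d" "\<forall>r\<in>{0..}. dist r s < d \<longrightarrow> dist (G i (flow \<mu> T) r) (G i (flow \<mu> T) s) < e"
      using Gc[of i] s e unfolding continuous_on_iff by force
    then show ?thesis by (intro exI[of _ d]) (force simp: dist_real_def)
  qed
  show ?thesis
  proof (cases "x = 0")
    case True
    obtain d where d: "\<And>i. 0 < d i" "\<And>i r. 0 \<le> r \<Longrightarrow> \<bar>r - 0\<bar> < d i \<Longrightarrow> G i (flow \<mu> T) 0 - e \<le> G i (flow \<mu> T) r"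
      using near[OF order_refl] by metis
    let ?d = "Min (range d)"
    have dpos: "0 < ?d" using d(1) by (simp add: Min_gr_iff)
    have "final_cost x - e \<le> final_cost z" if z: "z \<in> junction" "l1_dist x z < ?d" for z
    proof (cases "z = 0")
      case True then show ?thesis using \<open>x = 0\<close> e by (simp del: terminal_cost_zero)
    next
      case False
      then obtain i where i: "0 < z $ i" using junction_pos_component z(1) by blast
      have "?d \<le> d i" by (rule Min_le) auto
      then have "\<bar>z $ i - 0\<bar> < d i"
        using z True i l1_dist_zero(2)[OF z(1)] norm_edge[OF junction_pos_edge[OF z(1) i]] by simp
      then have "G i (flow \<mu> T) 0 - e \<le> G i (flow \<mu> T) (z $ i)" using i by (intro d(2)) auto
      then show ?thesis unfolding True using final_cost_zero_le[of i] terminal_cost_edge[OF z(1) i, of G Gs "flow \<mu> T"] by linarith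
    qed
    then show ?thesis using dpos by blast
  next
    case False
    then obtain i where i: "0 < x $ i" using junction_pos_component x by blast
    obtain d where d: "0 < d" "\<And>r. 0 \<le> r \<Longrightarrow> \<bar>r - x $ i\<bar> < d \<Longrightarrow> G i (flow \<mu> T) (x $ i) - e \<le> G i (flow \<mu> T) r"
      using near[of "x $ i" i] i by auto
    have "final_cost x - e \<le> final_cost z" if z: "z \<in> junction" "l1_dist x z < min (x $ i) (d)" for z
    proof -
      have "\<bar>x $ i - z $ i\<bar> \<le> l1_dist x z" unfolding l1_dist_def by (rule member_le_sum) auto
      then have zi: "0 < z $ i" "\<bar>z $ i - x $ i\<bar> < d" using z(2) by auto
      then have "G i (flow \<mu> T) (x $ i) - e \<le> G i (flow \<mu> T) (z $ i)" using i by (intro d(2)) auto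
      then show ?thesis using terminal_cost_edge[OF x i] terminal_cost_edge[OF z(1) zi(1)] by simp
    qed
    then show ?thesis using i d(1) by (intro exI[of _ "min (x $ i) (d)"]) auto
  qed
qed

lemma vertex_running_bounds:
  assumes m: "m \<in> prob_measures_1"
  shows "- C0 \<le> vertex_running L Ls m" "vertex_running L Ls m \<le> L i m 0 0"
proof -
  have "- C0 \<le> L i m 0 0" for i using coercive[OF m order_refl, of 0 i] p by simp
  then show "- C0 \<le> vertex_running L Ls m" using Ls_ge[OF m] by (simp add: vertex_running_def)
  show "vertex_running L Ls m \<le> L i m 0 0" by (simp add: vertex_running_def min.coboundedI2)
qed

sublocale control flow_L flow_L0 final_cost p T C0
proof
  show "\<exists>b. \<forall>a. flow_L i s 0 0 + b * a \<le> flow_L i s 0 a" for i s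
    using strictly_convex_above_tangent[OF convex[OF clamp_flow] C1_on_half_plane(3)[OF flow_L_C1[OF clamp_flow]]]
    unfolding flow_L_def max.idem by blast
  show "flow_L0 s \<le> flow_L i s 0 0" "- C0 \<le> flow_L0 s" for i s
    by (simp_all add: flow_L_def flow_L0_def vertex_running_bounds)
  show "C0 * (\<bar>a\<bar> powr p - 1) \<le> flow_L i s x a" for i s x a by (rule flow_L_coercive)
  show "\<exists>K. \<forall>i s. \<forall>x\<in>{0..r}. \<bar>flow_L i s x 0\<bar> \<le> K" for r by (rule flow_L_bounded)
qed (rule T p C0 flow_L_continuous flow_L0_continuous flow_L0_bounded flow_L_lipschitz flow_L_time
    final_cost_bounded final_cost_lsc; assumption)+

text \<open>Continuity at the vertex forces all edge costs to share the value there. Points on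
  different edges are then compared through the vertex, where \<open>l1_dist\<close> is the sum of
  the two distances.\<close>

lemma final_cost_locally_lipschitz:
  assumes G: "\<And>i. C1_on {0..} (G i (flow \<mu> T))" and c: "continuous_on junction final_cost"
  shows g_locally_lipschitz
  unfolding g_locally_lipschitz_def
proof (intro allI impI)
  let ?G = "\<lambda>i. G i (flow \<mu> T)"
  fix r :: real assume r: "0 < r"
  have "\<exists>B\<ge>0. \<forall>x\<in>{0..r}. \<forall>z\<in>{0..r}. \<bar>?G i x - ?G i z\<bar> \<le> B * \<bar>x - z\<bar>" for i
    using C1_on_half_line_lipschitz[OF G, of r] by metis
  then obtain B where B: "\<And>i. 0 \<le> B i" "\<And>i x z. x \<in> {0..r} \<Longrightarrow> z \<in> {0..r} \<Longrightarrow> \<bar>?G i x - ?G i z\<bar> \<le> B i * \<bar>x - z\<bar>"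
    by metis
  define k where "k = sum B UNIV"
  have k: "0 \<le> k" using B(1) by (simp add: k_def sum_nonneg)
  have Bk: "\<bar>?G i x - ?G i z\<bar> \<le> k * \<bar>x - z\<bar>" if "x \<in> {0..r}" "z \<in> {0..r}" for i x z
  proof -
    have "B i \<le> k" unfolding k_def by (rule member_le_sum) (use B(1) in auto)
    then show ?thesis using B(2)[OF that, of i] by (meson abs_ge_zero mult_right_mono order_trans)
  qed
  have zero: "final_cost 0 = ?G i 0" for i
  proof (rule tendsto_unique[of "at_right 0"])
    have "continuous_on {0..} (\<lambda>s. final_cost (s *\<^sub>R axis i 1))"
      by (rule continuous_on_compose2[OF c]) (auto intro!: continuous_intros axis_junction)
    then have "((\<lambda>s. final_cost (s *\<^sub>R axis i 1)) \<longlongrightarrow> final_cost (0 *\<^sub>R axis i 1)) (at 0 within {0..})"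
      unfolding continuous_on_def by force
    then have "((\<lambda>s. final_cost (s *\<^sub>R axis i 1)) \<longlongrightarrow> final_cost 0) (at_right 0)"
      unfolding scale_zero_left by (rule tendsto_within_subset) auto
    then show "(?G i \<longlongrightarrow> final_cost 0) (at_right 0)"
    proof (rule Lim_transform_eventually)
      have "final_cost (s *\<^sub>R axis i 1) = ?G i s" if "0 < s" for s
        using terminal_cost_edge[OF axis_junction[of s i], of i] that by (simp add: axis_def)
      then show "\<forall>\<^sub>F s in at_right 0. final_cost (s *\<^sub>R axis i 1) = ?G i s"
        by (auto simp: eventually_at_filter)
    qed
    have "continuous_on {0..} (?G i)"
      using G_Cb[of i] T_flow unfolding Cb_into_Cb_def by blast
    then have "(?G i \<longlongrightarrow> ?G i 0) (at 0 within {0..})" unfolding continuous_on_def by force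
    then show "(?G i \<longlongrightarrow> ?G i 0) (at_right 0)"
      by (rule tendsto_within_subset) auto
  qed simp
  have edge: "final_cost x = ?G i (x $ i)" if x: "x \<in> edge i" for x i
  proof (cases "x = 0")
    case False
    then have "0 < x $ i" using x norm_edge[OF x] by (metis zero_less_norm_iff)
    then show ?thesis by (rule terminal_cost_edge[OF edge_junction[OF x]])
  qed (use zero[of i] in \<open>simp del: terminal_cost_zero\<close>)
  have "\<bar>final_cost x - final_cost z\<bar> \<le> k * l1_dist x z"
    if x: "x \<in> junction" "norm x \<le> r" and z: "z \<in> junction" "norm z \<le> r" for x z
  proof -
    obtain i j where ij: "x \<in> edge i" "z \<in> edge j" using x z unfolding junction_def by auto
    have xr: "x $ i \<in> {0..r}" "z $ j \<in> {0..r}"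
      using norm_edge[OF ij(1)] norm_edge[OF ij(2)] x z junction_nonneg by auto
    show ?thesis
    proof (cases "i = j")
      case True
      then show ?thesis using Bk[of "x $ i" "z $ i" i] xr edge[OF ij(1)] edge[OF ij(2)] l1_dist_same_edge[of x i z] ij by simp
    next
      case False
      have "\<bar>final_cost x - final_cost 0\<bar> \<le> k * \<bar>x $ i - 0\<bar>"
        unfolding edge[OF ij(1)] zero[of i] by (rule Bk) (use xr r in auto)
      moreover have "\<bar>final_cost z - final_cost 0\<bar> \<le> k * \<bar>z $ j - 0\<bar>"
        unfolding edge[OF ij(2)] zero[of j] by (rule Bk) (use xr r in auto)
      moreover have "l1_dist x z = x $ i + z $ j"
        using l1_dist_different_edges[OF ij False] norm_edge[OF ij(1)] norm_edge[OF ij(2)] by simp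
      ultimately show ?thesis using xr by (simp add: algebra_simps del: terminal_cost_zero)
    qed
  qed
  then show "\<exists>k\<ge>0. \<forall>x\<in>junction. \<forall>z\<in>junction. norm x \<le> r \<longrightarrow> norm z \<le> r \<longrightarrow> \<bar>final_cost x - final_cost z\<bar> \<le> k * l1_dist x z"
    using k by blast
qed

end

section \<open>The mild solution as a value function\<close>

context mean_field_control
begin

lemma running_cost_eq_running:
  "s \<in> {0..T} \<Longrightarrow> running_cost L Ls (flow \<mu> s) x b = running s x b"
  by (simp add: running_cost_def running_def flow_L_def flow_L0_def)

text \<open>Identifies the two families of numbers whose infima are \<open>u\<close> and
  \<open>val\<close>; paths and trajectories correspond through \<open>trajectory_controlled\<close>
  and \<open>controlled_trajectory\<close>.\<close>

lemma total_costs_eq_payoffs: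
  assumes t: "t \<in> {0..T}"
  shows "total_cost L Ls G Gs T (flow \<mu>) t ` trajectories p T t x = payoffs x t"
proof (intro equalityI subsetI)
  fix c assume "c \<in> total_cost L Ls G Gs T (flow \<mu>) t ` trajectories p T t x"
  then obtain y where y: "y \<in> trajectories p T t x" "c = total_cost L Ls G Gs T (flow \<mu>) t y" by blast
  have "t \<le> T" using t by simp
  then obtain a where a: "controlled p t T y a" "y t = x" using trajectory_controlled[OF y(1) p] by blast
  have "integrated_cost L Ls (flow \<mu>) t T y = cost t T y a"
    by (rule integrated_cost_eq_cost[OF a(1)]) (use t in \<open>auto intro: running_cost_eq_running\<close>)
  then show "c \<in> payoffs x t" using a y(2) unfolding payoffs_def total_cost_def by auto
next
  fix c assume "c \<in> payoffs x t"
  then obtain y a where y: "controlled p t T y a" "y t = x" "c = cost t T y a + final_cost (y T)"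
    unfolding payoffs_def by blast
  let ?y = "restrict y {t..T}"
  have "integrated_cost L Ls (flow \<mu>) t T ?y = cost t T y a"
    by (rule integrated_cost_eq_cost[OF y(1)]) (use t in \<open>auto intro: running_cost_eq_running\<close>)
  then have "c = total_cost L Ls G Gs T (flow \<mu>) t ?y" using t y(3) by (simp add: total_cost_def)
  moreover have "?y \<in> trajectories p T t x" using controlled_trajectory[OF y(1) p] y(2) by simp
  ultimately show "c \<in> total_cost L Ls G Gs T (flow \<mu>) t ` trajectories p T t x" by blast
qed

lemma trajectories_until_costs:
  assumes t: "0 \<le> t" "t \<le> t'" "t' \<le> T" and m: "\<And>s. s \<in> {0..T} \<Longrightarrow> m s = flow \<mu> s"
    and u: "\<And>z. z \<in> junction \<Longrightarrow> u z t' = val z t'"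
  shows "(\<lambda>y. u (y t') t' + integrated_cost L Ls m t t' y) ` trajectories_until p T t t' x =
    {cost t t' y a + val (y t') t' | y a. controlled p t t' y a \<and> y t = x}" (is "?l = ?r")
proof -
  have rc: "running_cost L Ls (m s) z b = running s z b" if "s \<in> {t..t'}" for s z b
    using running_cost_eq_running[of s] m[of s] that t by simp
  show ?thesis
  proof (intro equalityI subsetI)
    fix c assume "c \<in> ?l"
    then obtain y where y: "y \<in> trajectories p T t x"
      "c = u (restrict y {t..t'} t') t' + integrated_cost L Ls m t t' (restrict y {t..t'})"
      by (auto simp: trajectories_until_def)
    have "t \<le> T" using t by simp
    then obtain a where "controlled p t T y a" "y t = x" using trajectory_controlled[OF y(1) p] by blast
    then have a: "controlled p t t' y a" "y t = x" using controlled_subset t by blast+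
    have "integrated_cost L Ls m t t' (restrict y {t..t'}) = cost t t' y a"
      by (rule integrated_cost_eq_cost[OF a(1) _ rc]) auto
    moreover have "u (y t') t' = val (y t') t'" by (rule u[OF controlledD(2)[OF a(1)]]) (use t in simp)
    ultimately have "c = cost t t' y a + val (y t') t'" using y(2) t by simp
    then show "c \<in> ?r" using a by blast
  next
    fix c assume "c \<in> ?r"
    then obtain y a where y: "controlled p t t' y a" "y t = x" "c = cost t t' y a + val (y t') t'" by blast
    have yj: "y t' \<in> junction" by (rule controlledD(2)[OF y(1)]) (use t in simp)
    \<comment> \<open>Restrictions are taken from trajectories on the whole interval, so a path
      ending at \<open>t'\<close> is extended by resting at its endpoint.\<close>
    define z where "z s = (if s \<le> t' then y s else y t')" for s
    have "controlled p t T z (\<lambda>s. if s \<le> t' then a s else 0)"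
      unfolding z_def[abs_def] by (rule controlled_join[OF y(1) controlled_const[OF yj t(3)]]) simp
    then have "restrict z {t..T} \<in> trajectories p T t (z t)" by (rule controlled_trajectory[OF _ p])
    then have z: "restrict z {t..T} \<in> trajectories p T t x" using y(2) t by (simp add: z_def)
    let ?y = "restrict (restrict z {t..T}) {t..t'}"
    have eq: "?y s = y s" if "s \<in> {t..t'}" for s using that t by (simp add: z_def)
    have "integrated_cost L Ls m t t' ?y = cost t t' y a"
      by (rule integrated_cost_eq_cost[OF y(1) eq rc])
    moreover have "u (?y t') t' = val (y t') t'" using u[OF yj] eq[of t'] t by simp
    ultimately have "c = u (?y t') t' + integrated_cost L Ls m t t' ?y" using y(3) by simp
    moreover have "?y \<in> trajectories_until p T t t' x" unfolding trajectories_until_def using z by (rule imageI)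
    ultimately show "c \<in> ?l" by blast
  qed
qed

section \<open>Hamiltonians and the viscosity equation for the value function\<close>

text \<open>A real supremum is meaningful only for bounded sets; here the linear term is dominated
  by the coercive one beyond the speed \<open>l\<close>.\<close>

lemma hamiltonian_bdd_above:
  assumes x: "0 \<le> x"
  shows "bdd_above ((\<lambda>\<zeta>. - q * \<zeta> - flow_L i t x \<zeta>) ` A)"
proof -
  have p1: "0 < p - 1" using p by simp
  obtain l where l: "1 \<le> l" "\<bar>q\<bar> / C0 < l powr (p - 1)" using exists_powr_gt[OF p1] by metis
  have "- q * \<zeta> - flow_L i t x \<zeta> \<le> \<bar>q\<bar> * l + C0" for \<zeta>
  proof -
    have "- q * \<zeta> \<le> \<bar>q\<bar> * \<bar>\<zeta>\<bar>" by (metis abs_ge_self abs_minus_cancel abs_mult)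
    also have "\<dots> \<le> \<bar>q\<bar> * l + C0 * \<bar>\<zeta>\<bar> powr p"
    proof (cases "\<bar>\<zeta>\<bar> \<le> l")
      case True
      then have "\<bar>q\<bar> * \<bar>\<zeta>\<bar> \<le> \<bar>q\<bar> * l" by (intro mult_left_mono) auto
      moreover have "0 \<le> C0 * \<bar>\<zeta>\<bar> powr p" using C0 by simp
      ultimately show ?thesis by simp
    next
      case False
      then have "l powr (p - 1) \<le> \<bar>\<zeta>\<bar> powr (p - 1)" using l(1) p by (intro powr_mono2) auto
      then have "\<bar>q\<bar> \<le> C0 * \<bar>\<zeta>\<bar> powr (p - 1)" using l(2) C0 by (simp add: divide_less_eq mult.commute) (smt (verit) mult_left_mono)
      then have "\<bar>q\<bar> * \<bar>\<zeta>\<bar> \<le> C0 * \<bar>\<zeta>\<bar> powr (p - 1) * \<bar>\<zeta>\<bar>" by (intro mult_right_mono) auto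
      also have "\<dots> = C0 * \<bar>\<zeta>\<bar> powr p" using False l(1) by (simp add: powr_diff)
      finally show ?thesis using l(1) by (simp add: add_increasing)
    qed
    finally show ?thesis using flow_L_coercive[of \<zeta> i t x] by (simp add: algebra_simps)
  qed
  then show ?thesis by (intro bdd_aboveI2) 
qed

lemma hamiltonian_eq:
  assumes "t \<in> {0..T}" "0 \<le> x" "m t = flow \<mu> t"
  shows "hamiltonian L m i x q t = (SUP \<zeta>. - q * \<zeta> - flow_L i t x \<zeta>)"
    "hamiltonian_down L m i x q t = (SUP \<zeta>\<in>{0..}. - q * \<zeta> - flow_L i t x \<zeta>)"
    "vertex_running L Ls (m t) = flow_L0 t"
  using assms by (simp_all add: hamiltonian_def hamiltonian_down_def flow_L_def flow_L0_def)

lemma val_viscosity_subsolution: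
  assumes m: "\<And>s. s \<in> {0..T} \<Longrightarrow> m s = flow \<mu> s"
  shows "viscosity_subsolution T (hamiltonian L m) (vertex_hamiltonian L Ls m) val"
  unfolding viscosity_subsolution_def
proof (intro conjI allI impI)
  show "continuous_on (junction \<times> {0<..<T}) (\<lambda>(x, t). val x t)"
    by (rule continuous_on_subset[OF val_continuous]) auto
  fix \<phi> x t
  assume *: "C1_junction T \<phi> \<and> x \<in> junction \<and> t \<in> {0<..<T} \<and> touches_from_above T \<phi> val x t"
  then have \<phi>: "C1_junction T \<phi>" and t: "t \<in> {0<..<T}" "t \<in> {0..T}" by auto
  {
    fix i assume x: "x \<in> edge i - {0}"
    then have xr: "x = norm x *\<^sub>R axis i 1" "0 < norm x" using edge_eq_axis norm_edge by force+
    have touch: "touches_from_above T \<phi> val (norm x *\<^sub>R axis i 1) t" using * xr(1) by simp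
    have "hamiltonian L m i (norm x) (edge_derivative \<phi> i (norm x) t) t \<le> deriv (\<phi> x) t"
      unfolding hamiltonian_eq[where m = m, OF t(2) norm_ge_zero m[OF t(2)]]
    proof (rule cSUP_least)
      show "- edge_derivative \<phi> i (norm x) t * \<zeta> - flow_L i t (norm x) \<zeta> \<le> deriv (\<phi> x) t" for \<zeta>
        using subsolution_direction[OF \<phi> norm_ge_zero t(1) touch, of \<zeta>] xr by simp
    qed simp
    then show "- deriv (\<phi> x) t + hamiltonian L m i (norm x) (edge_derivative \<phi> i (norm x) t) t \<le> 0" by simp
  next
    assume x: "x = 0"
    then have touch: "touches_from_above T \<phi> val 0 t" using * by simp
    have wait: "- flow_L0 t \<le> deriv (\<phi> 0) t" using subsolution_vertex_wait[OF \<phi> t(1) touch] by simp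
    have "hamiltonian_down L m i 0 (vertex_gradient \<phi> t $ i) t \<le> deriv (\<phi> 0) t" for i
      unfolding hamiltonian_eq[where m = m, OF t(2) order_refl m[OF t(2)]]
    proof (rule cSUP_least)
      fix \<zeta> :: real assume z: "\<zeta> \<in> {0..}"
      show "- (vertex_gradient \<phi> t $ i) * \<zeta> - flow_L i t 0 \<zeta> \<le> deriv (\<phi> 0) t"
      \<comment> \<open>Velocity \<open>0\<close> at the vertex is not covered by
        \<open>subsolution_direction\<close>; it follows from waiting, because the vertex cost is at
        most the edge cost at rest.\<close>
      proof (cases "\<zeta> = 0")
        case True then show ?thesis using wait L0_le[of t i] by simp
      next
        case False
        then show ?thesis
          using subsolution_direction[OF \<phi> order_refl t(1), of i \<zeta>] touch z by (simp add: vertex_gradient_def)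
      qed
    qed simp
    then have "vertex_hamiltonian L Ls m (vertex_gradient \<phi> t) t \<le> deriv (\<phi> 0) t"
      using wait by (simp add: vertex_hamiltonian_def hamiltonian_eq(3)[where m = m, OF t(2) order_refl m[OF t(2)]])
    then show "- deriv (\<phi> 0) t + vertex_hamiltonian L Ls m (vertex_gradient \<phi> t) t \<le> 0" by simp
  }
qed

lemma val_viscosity_supersolution:
  assumes m: "\<And>s. s \<in> {0..T} \<Longrightarrow> m s = flow \<mu> s"
  shows "viscosity_supersolution T (hamiltonian L m) (vertex_hamiltonian L Ls m) val"
  unfolding viscosity_supersolution_def
proof (intro conjI allI impI)
  show "continuous_on (junction \<times> {0<..<T}) (\<lambda>(x, t). val x t)"
    by (rule continuous_on_subset[OF val_continuous]) auto
  fix \<phi> x t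
  assume *: "C1_junction T \<phi> \<and> x \<in> junction \<and> t \<in> {0<..<T} \<and> touches_from_below T \<phi> val x t"
  then have \<phi>: "C1_junction T \<phi>" and t: "t \<in> {0<..<T}" "t \<in> {0..T}" by auto
  {
    fix i assume x: "x \<in> edge i - {0}"
    then have xr: "x = norm x *\<^sub>R axis i 1" "0 < norm x" using edge_eq_axis norm_edge by force+
    have touch: "touches_from_below T \<phi> val (norm x *\<^sub>R axis i 1) t" using * xr(1) by simp
    have "deriv (\<phi> (norm x *\<^sub>R axis i 1)) t \<le> hamiltonian L m i (norm x) (edge_derivative \<phi> i (norm x) t) t"
      unfolding hamiltonian_eq[where m = m, OF t(2) norm_ge_zero m[OF t(2)]]
      by (rule supersolution_edge[OF \<phi> xr(2) t(1) touch]) (rule cSUP_upper[OF UNIV_I hamiltonian_bdd_above], simp)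
    then show "0 \<le> - deriv (\<phi> x) t + hamiltonian L m i (norm x) (edge_derivative \<phi> i (norm x) t) t" using xr(1) by simp
  next
    assume x: "x = 0"
    then have touch: "touches_from_below T \<phi> val 0 t" using * by simp
    have "deriv (\<phi> 0) t \<le> vertex_hamiltonian L Ls m (vertex_gradient \<phi> t) t"
    proof (rule supersolution_vertex[OF \<phi> t(1) touch])
      show "- flow_L0 t \<le> vertex_hamiltonian L Ls m (vertex_gradient \<phi> t) t"
        by (simp add: vertex_hamiltonian_def hamiltonian_eq(3)[where m = m, OF t(2) order_refl m[OF t(2)]])
      fix i and \<zeta> :: real assume z: "0 \<le> \<zeta>"
      have "- edge_derivative \<phi> i 0 t * \<zeta> - flow_L i t 0 \<zeta> \<le> hamiltonian_down L m i 0 (vertex_gradient \<phi> t $ i) t"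
        unfolding hamiltonian_eq[where m = m, OF t(2) order_refl m[OF t(2)]] vertex_gradient_def vec_lambda_beta
        by (rule cSUP_upper[OF _ hamiltonian_bdd_above]) (use z in simp_all)
      also have "\<dots> \<le> vertex_hamiltonian L Ls m (vertex_gradient \<phi> t) t"
        unfolding vertex_hamiltonian_def by (intro max.coboundedI2 Max_ge) auto
      finally show "- edge_derivative \<phi> i 0 t * \<zeta> - flow_L i t 0 \<zeta> \<le> vertex_hamiltonian L Ls m (vertex_gradient \<phi> t) t" .
    qed
    then show "0 \<le> - deriv (\<phi> 0) t + vertex_hamiltonian L Ls m (vertex_gradient \<phi> t) t" by simp
  }
qed

end

lemma touches_cong:
  assumes "\<And>y s. y \<in> junction \<Longrightarrow> s \<in> {0<..<T} \<Longrightarrow> u y s = w y s" and "x \<in> junction" "t \<in> {0<..<T}"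
  shows "touches_from_above T \<phi> u x t \<longleftrightarrow> touches_from_above T \<phi> w x t"
    "touches_from_below T \<phi> u x t \<longleftrightarrow> touches_from_below T \<phi> w x t"
  using assms unfolding touches_from_above_def touches_from_below_def eventually_at_filter
  by (auto elim!: eventually_mono)

lemma viscosity_solution_cong:
  assumes eq: "\<And>y s. y \<in> junction \<Longrightarrow> s \<in> {0<..<T} \<Longrightarrow> u y s = w y s"
    and w: "viscosity_solution T H H0 w"
  shows "viscosity_solution T H H0 u"
proof -
  have "continuous_on (junction \<times> {0<..<T}) (\<lambda>(x, t). u x t) \<longleftrightarrow> continuous_on (junction \<times> {0<..<T}) (\<lambda>(x, t). w x t)"
    by (rule continuous_on_cong) (auto intro: eq)
  then show ?thesis
    using w touches_cong[of T u w, OF eq]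
    unfolding viscosity_solution_def viscosity_subsolution_def viscosity_supersolution_def by blast
qed

lemma locally_lipschitz_junction_cong:
  assumes "\<And>y s. y \<in> junction \<Longrightarrow> s \<in> I \<Longrightarrow> u y s = w y s" "locally_lipschitz_junction I w"
  shows "locally_lipschitz_junction I u"
  using assms(2) unfolding locally_lipschitz_junction_def by (simp add: assms(1) cong: ball_cong)

theorem proposition3p5:
  fixes L :: "'n::finite \<Rightarrow> (real ^ 'n) measure \<Rightarrow> real \<Rightarrow> real \<Rightarrow> real"
    and G :: "'n \<Rightarrow> (real ^ 'n) measure \<Rightarrow> real \<Rightarrow> real"
    and Ls Gs :: "(real ^ 'n) measure \<Rightarrow> real"
    and p T C :: real
    and m0 :: "(real ^ 'n) measure"
    and \<mu> :: "(real \<Rightarrow> real ^ 'n) measure"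
    and u :: "real ^ 'n \<Rightarrow> real \<Rightarrow> real"
    and m :: "real \<Rightarrow> (real ^ 'n) measure"
  assumes N: "CARD('n) > 1" and T: "T > 0" and p: "p > 1"
    and L_C1: "\<forall>i. continuous_into_C1 (L i)"
    and G_Cb: "\<forall>i. Cb_into_Cb (G i)"
    and Ls_Cb: "Cb_real Ls" and Gs_Cb: "Cb_real Gs"
    and coercive: "\<exists>C0>0. \<forall>m'\<in>prob_measures_1.
          (\<forall>i. \<forall>x\<ge>0. \<forall>a. L i m' x a \<ge> C0 * (\<bar>a\<bar> powr p - 1)) \<and> Ls m' \<ge> - C0"
    and modulus: "\<forall>r>0. \<exists>\<omega>. modulus_of_continuity \<omega> \<and>
          (\<forall>i. \<forall>m1\<in>prob_measures_1. \<forall>m2\<in>prob_measures_1. \<forall>x\<in>{0..r}. \<forall>a.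
             \<bar>L i m1 x a - L i m2 x a\<bar> \<le> (1 + \<bar>a\<bar> powr p) * \<omega> (KR_dist m1 m2))"
    and growth: "\<forall>r>0. \<exists>c\<ge>0. \<forall>i. \<forall>m'\<in>prob_measures_1. \<forall>x\<in>{0..r}. \<forall>a.
          \<bar>partial_x (L i m') x a\<bar> \<le> c * (\<bar>a\<bar> powr p + 1) \<and>
          \<bar>partial_a (L i m') x a\<bar> \<le> c * (\<bar>a\<bar> powr (p - 1) + 1)"
    and convex: "\<forall>i. \<forall>m'\<in>prob_measures_1. \<forall>x\<ge>0. strictly_convex (L i m' x)"
    and m0: "m0 \<in> prob_measures (top_of_set junction)"
      "bounded (measure_support (top_of_set junction) m0)"
    and C: "C > 0"
    and equilibrium: "relaxed_equilibrium L Ls G Gs p T C m0 \<mu>"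
    and mild: "mild_solution L Ls G Gs p T \<mu> u m"
  shows "(\<forall>t t' x. 0 \<le> t \<and> t \<le> t' \<and> t' \<le> T \<and> x \<in> junction \<longrightarrow>
            u x t = (INF y\<in>trajectories_until p T t t' x.
                       u (y t') t' + integrated_cost L Ls m t t' y)) \<and>
         continuous_on (junction \<times> {0..<T}) (\<lambda>(x, t). u x t) \<and>
         (\<forall>x\<in>junction. continuous_on {0..T} (u x) \<and> u x T = terminal_cost G Gs (m T) x) \<and>
         viscosity_solution T (hamiltonian L m) (vertex_hamiltonian L Ls m) u \<and>
         ((\<forall>i. \<forall>m'\<in>prob_measures_1. C1_on {0..} (G i m')) \<longrightarrow>
            locally_lipschitz_junction {0..<T} u \<and>
            ((\<forall>m'\<in>prob_measures_1. continuous_on junction (terminal_cost G Gs m')) \<longrightarrow>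
               locally_lipschitz_junction {0..T} u))"
proof -
  obtain C0 where C0: "0 < C0" "\<forall>m'\<in>prob_measures_1. (\<forall>i. \<forall>x\<ge>0. \<forall>a. L i m' x a \<ge> C0 * (\<bar>a\<bar> powr p - 1)) \<and> Ls m' \<ge> - C0"
    using coercive by blast
  interpret mean_field_control p T C \<mu> L Ls G Gs C0
  proof
    show "\<mu> \<in> prob_measures (trajectory_topology p T C)"
      using equilibrium by (simp add: relaxed_equilibrium_def prob_measures_starting_def)
    show "C0 * (\<bar>a\<bar> powr p - 1) \<le> L i m' x a" if "m' \<in> prob_measures_1" "0 \<le> x" for m' i x a
      using C0(2) that by blast
    show "- C0 \<le> Ls m'" if "m' \<in> prob_measures_1" for m' using C0(2) that by blast
    show "strictly_convex (L i m' x)" if "m' \<in> prob_measures_1" "0 \<le> x" for i m' x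
      using convex that by blast
  qed (rule T p C0(1) L_C1[rule_format] G_Cb[rule_format] Ls_Cb Gs_Cb modulus[THEN spec, THEN mp] growth[THEN spec, THEN mp]; assumption?)+
  have m: "m s = flow \<mu> s" if "s \<in> {0..T}" for s using mild that by (simp add: mild_solution_def)
  \<comment> \<open>\<open>u\<close> is determined only on the junction and on
    \<open>{0..T}\<close>, so the properties of \<open>val\<close> are transferred by congruence on
    these sets.\<close>
  have u: "u x t = val x t" if "x \<in> junction" "t \<in> {0..T}" for x t
    using mild that total_costs_eq_payoffs[OF that(2), of x] by (simp add: mild_solution_def val_def)
  have "u x t = (INF y\<in>trajectories_until p T t t' x. u (y t') t' + integrated_cost L Ls m t t' y)"
    if t: "0 \<le> t" "t \<le> t'" "t' \<le> T" and x: "x \<in> junction" for t t' x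
  proof -
    have "(\<lambda>y. u (y t') t' + integrated_cost L Ls m t t' y) ` trajectories_until p T t t' x =
        {cost t t' y a + val (y t') t' | y a. controlled p t t' y a \<and> y t = x}"
      by (rule trajectories_until_costs[OF t m]) (use t u in auto)
    then show ?thesis using dynamic_programming[OF x t(2,3)] u[OF x, of t] t by simp
  qed
  moreover have "continuous_on (junction \<times> {0..<T}) (\<lambda>(x, t). u x t)"
    by (rule continuous_on_eq[OF val_continuous]) (auto simp: u)
  moreover have "continuous_on {0..T} (u x) \<and> u x T = terminal_cost G Gs (m T) x" if x: "x \<in> junction" for x
  proof
    show "continuous_on {0..T} (u x)" by (rule continuous_on_eq[OF val_time_continuous[OF x]]) (simp add: u x)
    show "u x T = terminal_cost G Gs (m T) x" using u[OF x, of T] m[of T] val_terminal[OF x] T by simp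
  qed
  moreover have "viscosity_solution T (hamiltonian L m) (vertex_hamiltonian L Ls m) u"
  proof (rule viscosity_solution_cong)
    show "viscosity_solution T (hamiltonian L m) (vertex_hamiltonian L Ls m) val"
      unfolding viscosity_solution_def using val_viscosity_subsolution val_viscosity_supersolution m by blast
  qed (auto intro: u)
  moreover have "locally_lipschitz_junction {0..<T} u"
    by (rule locally_lipschitz_junction_cong[OF _ val_locally_lipschitz]) (auto intro: u)
  moreover have "locally_lipschitz_junction {0..T} u"
    if "\<forall>i. \<forall>m'\<in>prob_measures_1. C1_on {0..} (G i m')" "\<forall>m'\<in>prob_measures_1. continuous_on junction (terminal_cost G Gs m')"
  proof (rule locally_lipschitz_junction_cong[OF _ val_locally_lipschitz_closed])
    show g_locally_lipschitz by (rule final_cost_locally_lipschitz) (use that in auto)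
  qed (auto intro: u)
  ultimately show ?thesis by blast
qed

end
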